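(* Assume that $(\mathcal X,\sim)$, $d$, $m$ and $R$ satisfy the standing assumptions listed in the context. Then: (1) Although $G$ is not Markov in general, for every $x,y\in\mathcal X$ its bridge $G^{xy}$ is Markov. (2) For every $x,y\in\mathcal X$, the jump kernel of the Markov measure $G^{xy}$ is given by $$J^{G,y}_{t,z}=\sum_{w\in\{z\to\cdot\}^y}\frac{g^y_t(w)}{g^y_t(z)}\,J_{t,z}(w)\,\delta_w,\qquad 0\le t<1,\ z\in\Gamma^{xy}([0,1]),$$ where $\{z\to\cdot\}^y:=\{w\in\Gamma^{zy}([0,1]): z\to w\}$ is the set of all successors of $z$ in the directed tree $(\Gamma^{zy}([0,1]),\to)$ and $$g^y_t(z):=E_R\Big[\exp\Big(\int_t^1J_{s,X_s}(\mathcal X)\,ds\Big)\mathbf 1_{\Gamma(t,z;1,y)}\ \Big|\ X_t=z\Big],$$ with $$\Gamma(t,z;1,y):=\{\omega\in\Omega:\ \omega_{|[t,1]}=\gamma_{|[t,1]}\text{ for some }\gamma\in\Gamma,\ \omega_t=z,\ \omega_1=y\},$$ the set of all geodesics from $z$ to $y$ on the time interval $[t,1]$.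
   Context: **Graph and paths.** $\mathcal X$ is a countable set (discrete topology) with an undirected graph structure $\sim$ which is irreducible (connected), has no loop and is locally finite. $\Omega$ is the set of all right-continuous, left-limited, piecewise constant paths $\omega:[0,1]\to\mathcal X$ with finitely many jumps, left-continuous at $t=1$, such that $\omega_{t^-}\ne\omega_t$ implies $\omega_{t^-}\sim\omega_t$, with the $\sigma$-field generated by the canonical process $X_t(\omega)=\omega_t$. $\mathrm M_+(Y)$ denotes the positive measures on $Y$. For $Q\in\mathrm M_+(\Omega)$, the $xy$-bridge is $Q^{xy}=Q(\cdot\mid X_0=x,X_1=y)$. The jump kernel $j$ of a Markov measure is the kernel such that the generator is $L_tu(x)=\sum_y[u(y)-u(x)]j_{t,x}(y)$ for finitely supported $u$. **Standing assumptions.** - $d$ is a distance on $\mathcal X$ with $d(x,y)\ge1$ for $x\ne y$ and $d(x,y)=\inf\{\ell(\omega):\omega\in\Omega,\omega_0=x,\omega_1=y\}$, where $\ell(\omega)=\sum_{0<t<1}d(\omega_{t^-},\omega_t)$. - $R\in\mathrm M_+(\Omega)$ is Markov with initial measure $R_0=m\in\mathrm M_+(\mathcal X)$, $m_x>0$ for all $x$, and forward jump kernel $J_{t,x}=\sum_{y\sim x}J_{t,x}(y)\delta_y$, where $J_{t,x}(y)>0$ for all $t\in[0,1]$ if and only if $x\sim y$ (and $J_{t,x}(y)=0$ for non-neighbours), and $\sup_{t,x}J_{t,x}(\mathcal X)<\infty$. **Geodesics.** $\Gamma^{xy}=\{\omega\in\Omega:\omega_0=x,\omega_1=y,\ell(\omega)=d(x,y)\}$,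 $\Gamma=\bigcup_{x,y}\Gamma^{xy}$, and $G=\mathbf 1_\Gamma\exp\big(\int_0^1J_{t,X_t}(\mathcal X)\,dt\big)R\in\mathrm M_+(\Omega)$. $\Gamma^{xy}([0,1])\subset\mathcal X$ is the set of all states visited by elements of $\Gamma^{xy}$. It is given a directed graph structure (called directed tree: no directed circuit): $z\to z'$ in $\Gamma^{xy}([0,1])$ if $z\sim z'$ and there are $\gamma\in\Gamma^{xy}$ and $0\le t<t'\le1$ with $\gamma_t=z$, $\gamma_{t'}=z'$. *)

theory Defs
  imports "HOL-Probability.Probability"
begin

text \<open>
  The countable state space is a type of class \<open>countable\<close>; the graph is its edge relation
  \<open>E\<close>. All topological notions on states refer to the discrete topology, so that convergence
  means being eventually constant.
\<close>

definition irreducible_graph :: "('a \<Rightarrow> 'a \<Rightarrow> bool) \<Rightarrow> bool" where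
  "irreducible_graph E \<longleftrightarrow>
     symp E \<and> irreflp E \<and> (\<forall>x. finite {y. E x y}) \<and> (\<forall>x y. E\<^sup>*\<^sup>* x y)"

definition left_lim :: "(real \<Rightarrow> 'a) \<Rightarrow> real \<Rightarrow> 'a" where
  "left_lim \<omega> t = (THE z. \<forall>\<^sub>F s in at_left t. \<omega> s = z)"

definition jump_times :: "(real \<Rightarrow> 'a) \<Rightarrow> real set" where
  "jump_times \<omega> = {t \<in> {0<..<1}. left_lim \<omega> t \<noteq> \<omega> t}"

text \<open>
  A path is a function on \<open>[0,1]\<close>, hence \<open>extensional\<close>. Piecewise constancy is
  right-continuity and existence of left limits for the discrete topology, together with
  finiteness of the set of jump times.
\<close>

definition paths :: "('a \<Rightarrow> 'a \<Rightarrow> bool) \<Rightarrow> (real \<Rightarrow> 'a) set" where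
  "paths E = {\<omega> \<in> extensional {0..1}.
     (\<forall>t\<in>{0..<1}. \<forall>\<^sub>F s in at_right t. \<omega> s = \<omega> t) \<and>
     (\<forall>t\<in>{0<..1}. \<exists>z. \<forall>\<^sub>F s in at_left t. \<omega> s = z) \<and>
     finite (jump_times \<omega>) \<and>
     left_lim \<omega> 1 = \<omega> 1 \<and>
     (\<forall>t\<in>{0<..1}. left_lim \<omega> t \<noteq> \<omega> t \<longrightarrow> E (left_lim \<omega> t) (\<omega> t))}"

definition path_sigma :: "('a \<Rightarrow> 'a \<Rightarrow> bool) \<Rightarrow> real set \<Rightarrow> (real \<Rightarrow> 'a) measure" where
  "path_sigma E I = sigma (paths E) {{\<omega> \<in> paths E. \<omega> s \<in> A} | s A. s \<in> I}"

definition path_measure :: "('a \<Rightarrow> 'a \<Rightarrow> bool) \<Rightarrow> (real \<Rightarrow> 'a) measure \<Rightarrow> bool" where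
  "path_measure E Q \<longleftrightarrow> sets Q = sets (path_sigma E {0..1})"

definition marginal :: "(real \<Rightarrow> 'a) measure \<Rightarrow> real \<Rightarrow> 'a measure" where
  "marginal Q t = distr Q (count_space UNIV) (\<lambda>\<omega>. \<omega> t)"

definition bridge :: "(real \<Rightarrow> 'a) measure \<Rightarrow> 'a \<Rightarrow> 'a \<Rightarrow> (real \<Rightarrow> 'a) measure" where
  "bridge Q x y = uniform_measure Q {\<omega> \<in> space Q. \<omega> 0 = x \<and> \<omega> 1 = y}"

text \<open>
  Path measures may have infinite mass. Conditioning on \<open>X\<^sub>t\<close> and on \<open>X\<^bsub>[0,t]\<^esub>\<close> makes sense
  because all time marginals of a Markov measure are required to be \<open>\<sigma>\<close>-finite.
\<close>

definition markov_measure :: "('a \<Rightarrow> 'a \<Rightarrow> bool) \<Rightarrow> (real \<Rightarrow> 'a) measure \<Rightarrow> bool" where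
  "markov_measure E Q \<longleftrightarrow>
     path_measure E Q \<and>
     (\<forall>t\<in>{0..1}. sigma_finite_measure (marginal Q t)) \<and>
     (\<forall>t\<in>{0..1}. \<forall>B \<in> sets (path_sigma E {t..1}).
        AE \<omega> in Q. nn_cond_exp Q (path_sigma E {0..t}) (indicator B) \<omega> =
                   nn_cond_exp Q (path_sigma E {t}) (indicator B) \<omega>)"

definition path_martingale ::
    "('a \<Rightarrow> 'a \<Rightarrow> bool) \<Rightarrow> (real \<Rightarrow> 'a) measure \<Rightarrow> (real \<Rightarrow> (real \<Rightarrow> 'a) \<Rightarrow> real) \<Rightarrow> bool" where
  "path_martingale E Q M \<longleftrightarrow>
     (\<forall>t\<in>{0..<1}. M t \<in> borel_measurable (path_sigma E {0..t}) \<and> integrable Q (M t)) \<and>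
     (\<forall>s t. 0 \<le> s \<and> s \<le> t \<and> t < 1 \<longrightarrow>
        (AE \<omega> in Q. real_cond_exp Q (path_sigma E {0..s}) (M t) \<omega> = M s \<omega>))"

text \<open>
  A kernel carried by neighbours is given by its point masses: \<open>j t x y\<close> is the mass at \<open>y\<close>
  of the measure \<open>j\<^bsub>t,x\<^esub>\<close>.
\<close>

definition generator ::
    "('a \<Rightarrow> 'a \<Rightarrow> bool) \<Rightarrow> (real \<Rightarrow> 'a \<Rightarrow> 'a \<Rightarrow> real) \<Rightarrow> real \<Rightarrow> ('a \<Rightarrow> real) \<Rightarrow> 'a \<Rightarrow> real" where
  "generator E j t u x = (\<Sum>y | E x y. (u y - u x) * j t x y)"

definition total_rate ::
    "('a \<Rightarrow> 'a \<Rightarrow> bool) \<Rightarrow> (real \<Rightarrow> 'a \<Rightarrow> 'a \<Rightarrow> real) \<Rightarrow> real \<Rightarrow> 'a \<Rightarrow> real" where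
  "total_rate E j t x = (\<Sum>y | E x y. j t x y)"

text \<open>
  The kernel \<open>j\<^bsub>t,x\<^esub>\<close>, \<open>0 \<le> t < 1\<close>, \<open>x \<in> S\<close>, is a jump kernel of the measure \<open>Q\<close>, which does not
  leave the set \<open>S\<close> of states. That \<open>generator E j\<close> is the generator of \<open>Q\<close> is understood in
  the sense of the martingale problem, because \<open>j\<close> is only assumed to be measurable in time.
  The time \<open>1\<close> is left out since the rates of a bridge may explode there; nothing
  is lost because paths are left-continuous at \<open>1\<close>. The integrability clause excludes the
  default value of a Bochner integral that does not exist.
\<close>

definition has_jump_kernel ::
    "('a \<Rightarrow> 'a \<Rightarrow> bool) \<Rightarrow> 'a set \<Rightarrow> (real \<Rightarrow> 'a) measure \<Rightarrow> (real \<Rightarrow> 'a \<Rightarrow> 'a \<Rightarrow> real) \<Rightarrow> bool" where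
  "has_jump_kernel E S Q j \<longleftrightarrow>
     (AE \<omega> in Q. \<forall>t\<in>{0..1}. \<omega> t \<in> S) \<and>
     (\<forall>t\<in>{0..<1}. \<forall>x\<in>S. \<forall>y. 0 \<le> j t x y \<and> (\<not> E x y \<longrightarrow> j t x y = 0)) \<and>
     (\<forall>x\<in>S. \<forall>y. (\<lambda>t. j t x y) \<in> borel_measurable (restrict_space borel {0..<1})) \<and>
     (\<forall>u. finite {x. u x \<noteq> 0} \<longrightarrow>
        (\<forall>t\<in>{0..<1}. AE \<omega> in Q.
           set_integrable lborel {0..t} (\<lambda>s. generator E j s u (\<omega> s))) \<and>
        path_martingale E Q
          (\<lambda>t \<omega>. u (\<omega> t) - u (\<omega> 0) - (LBINT s:{0..t}. generator E j s u (\<omega> s))))"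

definition path_length :: "('a \<Rightarrow> 'a \<Rightarrow> real) \<Rightarrow> (real \<Rightarrow> 'a) \<Rightarrow> real" where
  "path_length d \<omega> = (\<Sum>t\<in>jump_times \<omega>. d (left_lim \<omega> t) (\<omega> t))"

definition graph_distance :: "('a \<Rightarrow> 'a \<Rightarrow> bool) \<Rightarrow> ('a \<Rightarrow> 'a \<Rightarrow> real) \<Rightarrow> bool" where
  "graph_distance E d \<longleftrightarrow>
     Metric_space UNIV d \<and>
     (\<forall>x y. x \<noteq> y \<longrightarrow> 1 \<le> d x y) \<and>
     (\<forall>x y. d x y = Inf (path_length d ` {\<omega> \<in> paths E. \<omega> 0 = x \<and> \<omega> 1 = y}))"

definition reference_walk ::
    "('a \<Rightarrow> 'a \<Rightarrow> bool) \<Rightarrow> 'a measure \<Rightarrow> (real \<Rightarrow> 'a) measure \<Rightarrow> (real \<Rightarrow> 'a \<Rightarrow> 'a \<Rightarrow> real) \<Rightarrow> bool" where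
  "reference_walk E m R J \<longleftrightarrow>
     markov_measure E R \<and>
     marginal R 0 = m \<and> (\<forall>x. 0 < emeasure m {x}) \<and>
     has_jump_kernel E UNIV R J \<and>
     (\<forall>x y t. t \<in> {0..1} \<longrightarrow> (if E x y then 0 < J t x y else J t x y = 0)) \<and>
     bdd_above {total_rate E J t x | t x. t \<in> {0..1}}"

definition standing_assumptions ::
    "('a \<Rightarrow> 'a \<Rightarrow> bool) \<Rightarrow> ('a \<Rightarrow> 'a \<Rightarrow> real) \<Rightarrow> 'a measure \<Rightarrow> (real \<Rightarrow> 'a) measure \<Rightarrow>
     (real \<Rightarrow> 'a \<Rightarrow> 'a \<Rightarrow> real) \<Rightarrow> bool" where
  "standing_assumptions E d m R J \<longleftrightarrow>
     irreducible_graph E \<and> graph_distance E d \<and> reference_walk E m R J"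

definition geodesics_between ::
    "('a \<Rightarrow> 'a \<Rightarrow> bool) \<Rightarrow> ('a \<Rightarrow> 'a \<Rightarrow> real) \<Rightarrow> 'a \<Rightarrow> 'a \<Rightarrow> (real \<Rightarrow> 'a) set" where
  "geodesics_between E d x y =
     {\<omega> \<in> paths E. \<omega> 0 = x \<and> \<omega> 1 = y \<and> path_length d \<omega> = d x y}"

definition geodesics :: "('a \<Rightarrow> 'a \<Rightarrow> bool) \<Rightarrow> ('a \<Rightarrow> 'a \<Rightarrow> real) \<Rightarrow> (real \<Rightarrow> 'a) set" where
  "geodesics E d = (\<Union>x y. geodesics_between E d x y)"

definition geodesic_measure ::
    "('a \<Rightarrow> 'a \<Rightarrow> bool) \<Rightarrow> ('a \<Rightarrow> 'a \<Rightarrow> real) \<Rightarrow> (real \<Rightarrow> 'a) measure \<Rightarrow>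
     (real \<Rightarrow> 'a \<Rightarrow> 'a \<Rightarrow> real) \<Rightarrow> (real \<Rightarrow> 'a) measure" where
  "geodesic_measure E d R J =
     density R (\<lambda>\<omega>. indicator (geodesics E d) \<omega> *
                     ennreal (exp (LBINT t:{0..1}. total_rate E J t (\<omega> t))))"

definition geodesic_states ::
    "('a \<Rightarrow> 'a \<Rightarrow> bool) \<Rightarrow> ('a \<Rightarrow> 'a \<Rightarrow> real) \<Rightarrow> 'a \<Rightarrow> 'a \<Rightarrow> 'a set" where
  "geodesic_states E d x y = {\<gamma> t | \<gamma> t. \<gamma> \<in> geodesics_between E d x y \<and> t \<in> {0..1}}"

definition geodesic_arrow ::
    "('a \<Rightarrow> 'a \<Rightarrow> bool) \<Rightarrow> ('a \<Rightarrow> 'a \<Rightarrow> real) \<Rightarrow> 'a \<Rightarrow> 'a \<Rightarrow> 'a \<Rightarrow> 'a \<Rightarrow> bool" where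
  "geodesic_arrow E d x y z z' \<longleftrightarrow>
     E z z' \<and> (\<exists>\<gamma>\<in>geodesics_between E d x y. \<exists>t t'. 0 \<le> t \<and> t < t' \<and> t' \<le> 1 \<and> \<gamma> t = z \<and> \<gamma> t' = z')"

definition successors ::
    "('a \<Rightarrow> 'a \<Rightarrow> bool) \<Rightarrow> ('a \<Rightarrow> 'a \<Rightarrow> real) \<Rightarrow> 'a \<Rightarrow> 'a \<Rightarrow> 'a set" where
  "successors E d y z = {w \<in> geodesic_states E d z y. geodesic_arrow E d z y z w}"

definition geodesics_from ::
    "('a \<Rightarrow> 'a \<Rightarrow> bool) \<Rightarrow> ('a \<Rightarrow> 'a \<Rightarrow> real) \<Rightarrow> real \<Rightarrow> 'a \<Rightarrow> 'a \<Rightarrow> (real \<Rightarrow> 'a) set" where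
  "geodesics_from E d t z y =
     {\<omega> \<in> paths E. (\<exists>\<gamma>\<in>geodesics E d. \<forall>s\<in>{t..1}. \<omega> s = \<gamma> s) \<and> \<omega> t = z \<and> \<omega> 1 = y}"

text \<open>
  \<open>g\<^sup>y\<^sub>t(z)\<close>, the conditional expectation given the event \<open>X\<^sub>t = z\<close>, i.e. the expectation under
  the normalised restriction of \<open>R\<close> to this event.
\<close>

definition geodesic_weight ::
    "('a \<Rightarrow> 'a \<Rightarrow> bool) \<Rightarrow> ('a \<Rightarrow> 'a \<Rightarrow> real) \<Rightarrow> (real \<Rightarrow> 'a) measure \<Rightarrow>
     (real \<Rightarrow> 'a \<Rightarrow> 'a \<Rightarrow> real) \<Rightarrow> 'a \<Rightarrow> real \<Rightarrow> 'a \<Rightarrow> real" where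
  "geodesic_weight E d R J y t z =
     (\<integral>\<omega>. exp (LBINT s:{t..1}. total_rate E J s (\<omega> s)) * indicator (geodesics_from E d t z y) \<omega>
        \<partial>(uniform_measure R {\<omega> \<in> space R. \<omega> t = z}))"

definition geodesic_kernel ::
    "('a \<Rightarrow> 'a \<Rightarrow> bool) \<Rightarrow> ('a \<Rightarrow> 'a \<Rightarrow> real) \<Rightarrow> (real \<Rightarrow> 'a) measure \<Rightarrow>
     (real \<Rightarrow> 'a \<Rightarrow> 'a \<Rightarrow> real) \<Rightarrow> 'a \<Rightarrow> real \<Rightarrow> 'a \<Rightarrow> 'a \<Rightarrow> real" where
  "geodesic_kernel E d R J y t z w =
     (if w \<in> successors E d y z
      then geodesic_weight E d R J y t w / geodesic_weight E d R J y t z * J t z w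
      else 0)"

end

theory Submission
  imports Defs
begin

text \<open>
  A path is a geodesic on \<open>[a,b]\<close> iff
  \<open>d(\<omega>\<^sub>a,\<omega>\<^sub>p) + d(\<omega>\<^sub>p,\<omega>\<^sub>q) + d(\<omega>\<^sub>q,\<omega>\<^sub>b) = d(\<omega>\<^sub>a,\<omega>\<^sub>b)\<close>
  for all \<open>a \<le> p \<le> q \<le> b\<close>. Once the end points \<open>x,y\<close> are fixed, being a geodesic therefore splits
  at every time \<open>t\<close> into a condition on the past, a condition on \<open>\<omega>\<^sub>t\<close> and a condition on the future,
  and the density of the bridge with respect to \<open>R\<close> factorises accordingly; the bridge inherits the
  Markov property of \<open>R\<close>. The future factor has conditional expectation \<open>g\<^sup>y\<^sub>t(\<omega>\<^sub>t)\<close>.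
  For the jump kernel, expand the transition on a short interval \<open>[t,t+h]\<close> according to whether
  the path stays, jumps once or jumps at least twice; the last event and all corrections have order
  \<open>h\<^sup>2\<close>, and summing over a fine partition yields the forward equation of the bridge exactly,
  although the rates \<open>J\<close> are merely measurable in time.

  \<open>G\<close> itself is not Markov for the telegraph process on two points: a geodesic jumps at most once,
  so that the past and the future of a path at time \<open>1/2\<close> exclude each other.
\<close>


section \<open>Paths and geodesics\<close>

text \<open>The kernel divides by \<open>g y t z\<close>, whose positivity is not established. The
  proof works with products instead: the bridge probability of a past event with X_t = z is a
  constant times a past weight \<open>rho\<close> times \<open>g y t z\<close>, so in the expected
  flux from z to w the denominator cancels and \<open>rho * J * g y t w\<close> remains. What has to
  be shown is that \<open>g y t z = 0\<close> forces \<open>g y t w = 0\<close> for every successor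
  w; the convention x / 0 = 0 then gives the right flux. Since J is only measurable in time, there
  is no derivative in t to compute. But \<open>rho\<close> and \<open>g\<close> are Lipschitz in
  time on [0,1), so on a cell of length h both can be frozen at a cost of order h^2 while J stays
  under the integral. All constants are built from \<open>K\<close>, the supremum of the total
  rates, and from \<open>exp K\<close>, which bounds both the past and the future weight. If the
  bridge event has mass zero under G, then \<open>bridge\<close> is the zero measure and the
  normalising constant 1 / 0 is 0, so the same formulas apply.\<close>

lemma left_lim_eqI:
  assumes "\<forall>\<^sub>F s in at_left t. \<omega> s = z"
  shows "left_lim \<omega> (t::real) = z"
proof -
  have "y = z" if "\<forall>\<^sub>F s in at_left t. \<omega> s = y" for y
  proof -
    have "\<forall>\<^sub>F s in at_left t. y = z"
      using assms that by eventually_elim simp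
    then show ?thesis by (simp add: trivial_limit_at_left_real)
  qed
  then show ?thesis
    unfolding left_lim_def using assms by (rule the_equality[rotated])
qed

lemma paths_right:
  "\<omega> \<in> paths E \<Longrightarrow> 0 \<le> t \<Longrightarrow> t < 1 \<Longrightarrow> \<forall>\<^sub>F s in at_right t. \<omega> s = \<omega> t"
  by (auto simp: paths_def)

lemma paths_left:
  assumes "\<omega> \<in> paths E" "0 < t" "t \<le> 1"
  shows "\<forall>\<^sub>F s in at_left t. \<omega> s = left_lim \<omega> t"
proof -
  obtain z where z: "\<forall>\<^sub>F s in at_left t. \<omega> s = z"
    using assms by (fastforce simp: paths_def)
  with left_lim_eqI[OF z] show ?thesis by simp
qed

lemma paths_left_one: "\<omega> \<in> paths E \<Longrightarrow> left_lim \<omega> 1 = \<omega> 1"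
  and finite_jump_times: "\<omega> \<in> paths E \<Longrightarrow> finite (jump_times \<omega>)"
  by (auto simp: paths_def)

lemma paths_edge:
  "\<omega> \<in> paths E \<Longrightarrow> 0 < t \<Longrightarrow> t \<le> 1 \<Longrightarrow> left_lim \<omega> t \<noteq> \<omega> t \<Longrightarrow> E (left_lim \<omega> t) (\<omega> t)"
  by (auto simp: paths_def)

text \<open>Away from its jump times a path is continuous for the discrete topology, that is,
  locally constant, and the interval is connected.\<close>

lemma paths_no_jump:
  assumes \<omega>: "\<omega> \<in> paths E" and ab: "0 \<le> a" "a \<le> b" "b \<le> 1"
    and no: "jump_times \<omega> \<inter> {a<..b} = {}"
  shows "\<omega> b = \<omega> a"
proof -
  have "\<omega> constant_on {a..b}"
  proof (rule locally_constant_imp_constant)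
    fix t assume t: "t \<in> {a..b}"
    have "\<forall>\<^sub>F s in at_left t. s \<in> {a..b} \<longrightarrow> \<omega> s = \<omega> t"
    proof (cases "t = a")
      case True
      have "\<forall>\<^sub>F s in at_left t. s < t" by (simp add: eventually_at_left_field lt_ex)
      then show ?thesis by eventually_elim (use True in auto)
    next
      case False
      \<comment> \<open>Below 1 this says that t is no jump time; the time 1, which
        \<open>jump_times\<close> leaves out, is covered by the left-continuity of paths
        there.\<close>
      have "left_lim \<omega> t = \<omega> t"
        using no t False ab paths_left_one[OF \<omega>]
        by (cases "t = 1") (auto simp: jump_times_def disjoint_iff dest: spec[of _ t])
      with paths_left[OF \<omega>, of t] t False ab show ?thesis
        by (auto elim!: eventually_mono)
    qed
    moreover have "\<forall>\<^sub>F s in at_right t. s \<in> {a..b} \<longrightarrow> \<omega> s = \<omega> t"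
    proof (cases "t = b")
      case True
      have "\<forall>\<^sub>F s in at_right t. s > t" by (simp add: eventually_at_right_field gt_ex)
      then show ?thesis by eventually_elim (use True in auto)
    next
      case False
      with paths_right[OF \<omega>, of t] t ab show ?thesis
        by (auto elim!: eventually_mono)
    qed
    ultimately have "\<forall>\<^sub>F s in at t. s \<in> {a..b} \<longrightarrow> \<omega> s = \<omega> t"
      by (simp add: eventually_at_split)
    then obtain S where S: "open S" "t \<in> S" "\<forall>s\<in>S. s \<noteq> t \<longrightarrow> s \<in> {a..b} \<longrightarrow> \<omega> s = \<omega> t"
      unfolding eventually_at_topological by auto
    show "\<exists>T. openin (top_of_set {a..b}) T \<and> t \<in> T \<and> (\<forall>x\<in>T. \<omega> x = \<omega> t)"
      using S t by (intro exI[of _ "{a..b} \<inter> S"]) (auto simp: openin_open)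
  qed simp
  then show ?thesis using ab by (auto simp: constant_on_def)
qed

text \<open>The grid points \<open>up a b n p\<close> approach \<open>p\<close> from the right, so that
  right-continuity turns statements about all times in \<open>[a,b]\<close> into statements about grids.\<close>

definition up :: "real \<Rightarrow> real \<Rightarrow> nat \<Rightarrow> real \<Rightarrow> real" where
  "up a b n p = a + (b - a) * of_int \<lceil>(p - a) / (b - a) * n\<rceil> / n"

definition grid :: "real \<Rightarrow> real \<Rightarrow> nat \<Rightarrow> nat \<Rightarrow> real" where
  "grid a b n i = a + (b - a) * i / n"

lemma up_eq_grid:
  assumes "0 < n" "a \<le> p" "p \<le> b"
  shows "up a b n p = grid a b n (nat \<lceil>(p - a) / (b - a) * n\<rceil>)" "nat \<lceil>(p - a) / (b - a) * n\<rceil> \<le> n"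
proof -
  \<comment> \<open>For a = b the quotient is 0 by convention, and both sides of the first claim
    equal a.\<close>
  have "0 \<le> (p - a) / (b - a) * n" "(p - a) / (b - a) * n \<le> 1 * real n"
    using assms by (intro mult_nonneg_nonneg divide_nonneg_nonneg mult_right_mono; simp add: divide_le_eq_1; linarith)+
  then show "up a b n p = grid a b n (nat \<lceil>(p - a) / (b - a) * n\<rceil>)" "nat \<lceil>(p - a) / (b - a) * n\<rceil> \<le> n"
    unfolding up_def grid_def by (auto simp: nat_le_iff ceiling_le_iff)
qed

lemma grid_mono: "a \<le> b \<Longrightarrow> i \<le> j \<Longrightarrow> grid a b n i \<le> grid a b n j"
  unfolding grid_def by (intro add_left_mono divide_right_mono mult_left_mono) auto

lemma grid_0 [simp]: "grid a b n 0 = a"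
  by (simp add: grid_def)

lemma grid_n [simp]: "0 < n \<Longrightarrow> grid a b n n = b"
  by (simp add: grid_def)

lemma grid_in: "a \<le> b \<Longrightarrow> 0 < n \<Longrightarrow> i \<le> n \<Longrightarrow> grid a b n i \<in> {a..b}"
  using grid_mono[of a b 0 i n] grid_mono[of a b i n n] by auto

lemma up_in: "0 < n \<Longrightarrow> a \<le> p \<Longrightarrow> p \<le> b \<Longrightarrow> up a b n p \<in> {a..b}"
  using up_eq_grid[of n a p b] grid_in[of a b n] by (metis order_trans)

lemma up_bounds:
  assumes "0 < n" "a \<le> p" "p \<le> b"
  shows "p \<le> up a b n p" "up a b n p \<le> p + (b - a) / n"
proof -
  have *: "(b - a) * ((p - a) / (b - a) * n) / n = p - a" if "a \<noteq> b"
    using assms that by (simp add: field_simps)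
  show "p \<le> up a b n p"
  proof (cases "a = b")
    case False
    have "(b - a) * ((p - a) / (b - a) * n) / n \<le> (b - a) * of_int \<lceil>(p - a) / (b - a) * n\<rceil> / n"
      using assms by (intro divide_right_mono mult_left_mono) auto
    with *[OF False] show ?thesis by (simp add: up_def)
  qed (use assms in \<open>simp add: up_def\<close>)
  show "up a b n p \<le> p + (b - a) / n"
  proof (cases "a = b")
    case False
    have "(b - a) * of_int \<lceil>(p - a) / (b - a) * n\<rceil> / n \<le> (b - a) * ((p - a) / (b - a) * n + 1) / n"
      using assms by (intro divide_right_mono mult_left_mono) auto
    also have "\<dots> = (p - a) + (b - a) / n"
      using *[OF False] by (simp add: distrib_left add_divide_distrib)
    finally show ?thesis by (simp add: up_def)
  qed (use assms in \<open>simp add: up_def\<close>)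
qed

text \<open>The ceiling keeps the grid point in the interval from p to p + (b - a) / n, on which the
  path is constant for large n by right-continuity. At p = b, possibly 1, no right-continuity is
  available, but there the grid point is b itself.\<close>

lemma paths_up:
  assumes \<omega>: "\<omega> \<in> paths E" and "0 \<le> a" "a \<le> p" "p \<le> b" "b \<le> 1"
  shows "\<forall>\<^sub>F n in sequentially. \<omega> (up a b n p) = \<omega> p"
proof (cases "p = b")
  case True
  have "\<forall>\<^sub>F n in sequentially. (0::nat) < n" by (rule eventually_gt_at_top)
  then show ?thesis
  proof eventually_elim
    case (elim n)
    from up_bounds(1)[OF elim, of a p b] up_in[OF elim, of a p b] True assms
    show ?case by auto
  qed
next
  case False
  have "\<forall>\<^sub>F s in at_right p. \<omega> s = \<omega> p"
    using False assms by (intro paths_right) auto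
  then obtain c where c: "c > p" "\<And>s. p < s \<Longrightarrow> s < c \<Longrightarrow> \<omega> s = \<omega> p"
    unfolding eventually_at_right_field by auto
  have "(\<lambda>n. (b - a) / real n) \<longlonglongrightarrow> 0" by (rule lim_const_over_n)
  then have "\<forall>\<^sub>F n in sequentially. (b - a) / real n < c - p"
    by (rule order_tendstoD) (use c in simp)
  moreover have "\<forall>\<^sub>F n in sequentially. (0::nat) < n" by (rule eventually_gt_at_top)
  ultimately show ?thesis
  proof eventually_elim
    case (elim n)
    from up_bounds[of n a p b] elim assms c show ?case by (cases "up a b n p = p") auto
  qed
qed

text \<open>Extends the path on [t,1] to a full path by waiting in z. If z differs from the state at
  t, a jump is created at t, so it must follow an edge and must not fall on time 1.\<close>

lemma paths_splice:
  assumes \<omega>: "\<omega> \<in> paths E" and t: "0 \<le> t" "t \<le> 1" and z: "z = \<omega> t \<or> E z (\<omega> t) \<and> t < 1"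
  shows "(\<lambda>s. if 0 \<le> s \<and> s < t then z else \<omega> s) \<in> paths E" (is "?\<gamma> \<in> _")
proof -
  have right: "\<forall>\<^sub>F s in at_right u. ?\<gamma> s = ?\<gamma> u" if u: "0 \<le> u" "u < 1" for u
  proof (cases "u < t")
    case True
    then have "\<forall>\<^sub>F s in at_right u. s < t \<and> u < s" by (auto simp: eventually_at_right_field)
    then show ?thesis by eventually_elim (use u True in auto)
  next
    case False
    then have "\<forall>\<^sub>F s in at_right u. u < s" by (auto simp: eventually_at_right_field intro: gt_ex)
    with paths_right[OF \<omega> u] show ?thesis by eventually_elim (use u False in auto)
  qed
  have left1: "\<forall>\<^sub>F s in at_left u. ?\<gamma> s = z" if u: "0 < u" "u \<le> t" for u
  proof -
    have "\<forall>\<^sub>F s in at_left u. 0 < s \<and> s < u" using u by (auto simp: eventually_at_left_field)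
    then show ?thesis by eventually_elim (use u in auto)
  qed
  have left2: "\<forall>\<^sub>F s in at_left u. ?\<gamma> s = left_lim \<omega> u" if u: "t < u" "u \<le> 1" for u
  proof -
    have "\<forall>\<^sub>F s in at_left u. t < s" using u by (auto simp: eventually_at_left_field)
    moreover have "\<forall>\<^sub>F s in at_left u. \<omega> s = left_lim \<omega> u"
      using u t by (intro paths_left[OF \<omega>]) auto
    ultimately show ?thesis by eventually_elim auto
  qed
  note ll1 = left_lim_eqI[OF left1] and ll2 = left_lim_eqI[OF left2]
  have ex: "?\<gamma> \<in> extensional {0..1}"
    using \<omega> t by (auto simp: paths_def extensional_def)
  have "jump_times ?\<gamma> \<subseteq> insert t (jump_times \<omega>)"
  proof
    fix u assume u: "u \<in> jump_times ?\<gamma>"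
    then show "u \<in> insert t (jump_times \<omega>)"
      using ll1[of u] ll2[of u] by (cases u t rule: linorder_cases) (auto simp: jump_times_def)
  qed
  then have fin: "finite (jump_times ?\<gamma>)"
    using finite_jump_times[OF \<omega>] finite_subset by blast
  have one: "left_lim ?\<gamma> 1 = ?\<gamma> 1"
  proof (cases "t = 1")
    case True with ll1[of 1] z show ?thesis by auto
  next
    case False with ll2[of 1] t paths_left_one[OF \<omega>] show ?thesis by auto
  qed
  have lex: "\<exists>y. \<forall>\<^sub>F s in at_left u. ?\<gamma> s = y" if "0 < u" "u \<le> 1" for u
    using left1[of u] left2[of u] that by (cases "u \<le> t") fastforce+
  have edge: "E (left_lim ?\<gamma> u) (?\<gamma> u)" if u: "0 < u" "u \<le> 1" "left_lim ?\<gamma> u \<noteq> ?\<gamma> u" for u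
    using u ll1[of u] ll2[of u] paths_edge[OF \<omega>, of u] z
    by (cases u t rule: linorder_cases) auto
  show ?thesis
    unfolding paths_def using ex right lex fin one edge
    by (intro CollectI conjI ballI) (auto simp del: split_paired_All)
qed

text \<open>Two intermediate times are used because a single one would admit backtracking: a path
  going to and fro along a geodesic only visits states between its end points.\<close>

definition geo :: "('a \<Rightarrow> 'a \<Rightarrow> real) \<Rightarrow> (real \<Rightarrow> 'a) \<Rightarrow> real \<Rightarrow> real \<Rightarrow> bool" where
  "geo d \<omega> a b \<longleftrightarrow> (\<forall>p q. a \<le> p \<and> p \<le> q \<and> q \<le> b \<longrightarrow>
     d (\<omega> a) (\<omega> p) + d (\<omega> p) (\<omega> q) + d (\<omega> q) (\<omega> b) = d (\<omega> a) (\<omega> b))"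

definition moves :: "(real \<Rightarrow> 'a) \<Rightarrow> real \<Rightarrow> real \<Rightarrow> bool" where
  "moves \<omega> a b \<longleftrightarrow> (\<exists>p. a \<le> p \<and> p \<le> b \<and> \<omega> p \<noteq> \<omega> a)"

text \<open>Expressed by values at three times and not by counting jumps, so that right-continuity
  reduces it to grid points.\<close>

definition moves_twice :: "(real \<Rightarrow> 'a) \<Rightarrow> real \<Rightarrow> real \<Rightarrow> bool" where
  "moves_twice \<omega> a b \<longleftrightarrow>
     (\<exists>p q r. a \<le> p \<and> p \<le> q \<and> q \<le> r \<and> r \<le> b \<and> \<omega> p \<noteq> \<omega> q \<and> \<omega> q \<noteq> \<omega> r)"

lemma geo_cong: "(\<And>s. s \<in> {a..b} \<Longrightarrow> \<omega> s = \<gamma> s) \<Longrightarrow> a \<le> b \<Longrightarrow> geo d \<omega> a b = geo d \<gamma> a b"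
  unfolding geo_def
  by (intro iff_allI imp_cong) (simp_all add: atLeastAtMost_iff)

definition segment_length :: "('a \<Rightarrow> 'a \<Rightarrow> real) \<Rightarrow> (real \<Rightarrow> 'a) \<Rightarrow> real \<Rightarrow> real \<Rightarrow> real" where
  "segment_length d \<omega> a b = (\<Sum>t\<in>jump_times \<omega> \<inter> {a<..b}. d (left_lim \<omega> t) (\<omega> t))"

lemma segment_length_add:
  assumes "\<omega> \<in> paths E" "a \<le> b" "b \<le> c"
  shows "segment_length d \<omega> a c = segment_length d \<omega> a b + segment_length d \<omega> b c"
  unfolding segment_length_def using assms finite_jump_times[OF assms(1)]
  by (subst sum.union_disjoint[symmetric]) (auto intro!: sum.cong)

lemma path_length_eq_segment_length: "path_length d \<omega> = segment_length d \<omega> 0 1"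
  unfolding path_length_def segment_length_def
  by (rule sum.cong) (auto simp: jump_times_def)

section \<open>Metric characterisation of geodesics\<close>

context
  fixes d :: "'a \<Rightarrow> 'a \<Rightarrow> real"
  assumes d: "Metric_space UNIV d"
begin

lemma d_triangle: "d x z \<le> d x y + d y z"
  using Metric_space.triangle[OF d] by simp

lemma d_eq_0 [simp]: "d x y = 0 \<longleftrightarrow> x = y"
  using Metric_space.zero[OF d] by simp

lemma d_self [simp]: "d x x = 0"
  by simp

text \<open>From left to right, the equalities on [a,b] leave no slack in the triangle inequalities
  on the two halves. Conversely the triangle inequality gives one direction for free, and the other
  follows by inserting r, whether p and q lie on the same side of r or on different sides.\<close>

lemma geo_split:
  assumes "a \<le> r" "r \<le> b"
  shows "geo d \<omega> a b \<longleftrightarrow> geo d \<omega> a r \<and> geo d \<omega> r b \<and> d (\<omega> a) (\<omega> r) + d (\<omega> r) (\<omega> b) = d (\<omega> a) (\<omega> b)"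
    (is "?L \<longleftrightarrow> ?R")
proof
  assume L: ?L
  then have *: "d (\<omega> a) (\<omega> p) + d (\<omega> p) (\<omega> q) + d (\<omega> q) (\<omega> b) = d (\<omega> a) (\<omega> b)"
    if "a \<le> p" "p \<le> q" "q \<le> b" for p q
    using that by (auto simp: geo_def)
  have r: "d (\<omega> a) (\<omega> r) + d (\<omega> r) (\<omega> b) = d (\<omega> a) (\<omega> b)"
    using *[of r r] assms by simp
  show ?R
  proof (intro conjI r)
    show "geo d \<omega> a r" unfolding geo_def
    proof (intro allI impI, elim conjE)
      fix p q assume pq: "a \<le> p" "p \<le> q" "q \<le> r"
      show "d (\<omega> a) (\<omega> p) + d (\<omega> p) (\<omega> q) + d (\<omega> q) (\<omega> r) = d (\<omega> a) (\<omega> r)"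
        using *[of p q] *[of q r] r pq assms d_triangle[of "\<omega> q" "\<omega> b" "\<omega> r"]
          d_triangle[of "\<omega> a" "\<omega> b" "\<omega> q"] by simp
    qed
    show "geo d \<omega> r b" unfolding geo_def
    proof (intro allI impI, elim conjE)
      fix p q assume pq: "r \<le> p" "p \<le> q" "q \<le> b"
      show "d (\<omega> r) (\<omega> p) + d (\<omega> p) (\<omega> q) + d (\<omega> q) (\<omega> b) = d (\<omega> r) (\<omega> b)"
        using *[of p q] *[of r p] r pq assms d_triangle[of "\<omega> a" "\<omega> p" "\<omega> r"]
          d_triangle[of "\<omega> a" "\<omega> b" "\<omega> p"] by simp
    qed
  qed
next
  assume R: ?R
  have A1: "d (\<omega> a) (\<omega> p) + d (\<omega> p) (\<omega> q) + d (\<omega> q) (\<omega> r) = d (\<omega> a) (\<omega> r)"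
    if "a \<le> p" "p \<le> q" "q \<le> r" for p q
    using R that by (auto simp: geo_def)
  have A2: "d (\<omega> r) (\<omega> p) + d (\<omega> p) (\<omega> q) + d (\<omega> q) (\<omega> b) = d (\<omega> r) (\<omega> b)"
    if "r \<le> p" "p \<le> q" "q \<le> b" for p q
    using R that by (auto simp: geo_def)
  show ?L unfolding geo_def
  proof (intro allI impI, elim conjE)
    fix p q assume pq: "a \<le> p" "p \<le> q" "q \<le> b"
    have le: "d (\<omega> a) (\<omega> b) \<le> d (\<omega> a) (\<omega> p) + d (\<omega> p) (\<omega> q) + d (\<omega> q) (\<omega> b)"
      using d_triangle[of "\<omega> a" "\<omega> b" "\<omega> p"] d_triangle[of "\<omega> p" "\<omega> b" "\<omega> q"] by linarith
    consider "q \<le> r" | "p \<le> r" "r \<le> q" | "r \<le> p" using pq by linarith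
    then have "d (\<omega> a) (\<omega> p) + d (\<omega> p) (\<omega> q) + d (\<omega> q) (\<omega> b) \<le> d (\<omega> a) (\<omega> b)"
    proof cases
      case 1
      show ?thesis
        using A1[of p q] 1 pq R
          d_triangle[of "\<omega> q" "\<omega> b" "\<omega> r"] by linarith
    next
      case 2
      have "d (\<omega> a) (\<omega> p) + d (\<omega> p) (\<omega> r) = d (\<omega> a) (\<omega> r)" using A1[of p r] 2 pq by simp
      moreover have "d (\<omega> r) (\<omega> q) + d (\<omega> q) (\<omega> b) = d (\<omega> r) (\<omega> b)"
        using A2[of r q] A2[of q q] 2 pq by simp
      ultimately show ?thesis using R d_triangle[of "\<omega> p" "\<omega> q" "\<omega> r"] by linarith
    next
      case 3
      then show ?thesis
        using A2[of p q] pq R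
          d_triangle[of "\<omega> a" "\<omega> p" "\<omega> r"] by linarith
    qed
    with le show "d (\<omega> a) (\<omega> p) + d (\<omega> p) (\<omega> q) + d (\<omega> q) (\<omega> b) = d (\<omega> a) (\<omega> b)" by simp
  qed
qed

text \<open>Induction on the number of jumps, cutting off the last one: on a short interval around a
  single jump, length and distance of the end points coincide, and the rest is the triangle
  inequality or its equality case.\<close>

lemma segment_length:
  assumes \<omega>: "\<omega> \<in> paths E" and ab: "0 \<le> a" "a \<le> b" "b \<le> 1"
  shows "d (\<omega> a) (\<omega> b) \<le> segment_length d \<omega> a b \<and>
    (geo d \<omega> a b \<longrightarrow> d (\<omega> a) (\<omega> b) = segment_length d \<omega> a b)"
  using ab
proof (induction "card (jump_times \<omega> \<inter> {a<..b})" arbitrary: b rule: less_induct)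
  case (less b)
  note fin = finite_jump_times[OF \<omega>]
  show ?case
  proof (cases "jump_times \<omega> \<inter> {a<..b} = {}")
    case True
    then show ?thesis
      using paths_no_jump[OF \<omega> less.prems True] by (simp add: segment_length_def)
  next
    case False
    define t where "t = Max (jump_times \<omega> \<inter> {a<..b})"
    have t: "t \<in> jump_times \<omega>" "a < t" "t \<le> b"
      using Max_in[OF _ False] fin unfolding t_def by auto
    have tmax: "s \<le> t" if "s \<in> jump_times \<omega>" "a < s" "s \<le> b" for s
      using that fin unfolding t_def by (intro Max_ge) auto
    have bt: "\<omega> b = \<omega> t"
      using t less.prems tmax by (intro paths_no_jump[OF \<omega>]) force+
    \<comment> \<open>The cutting time s is so close to the last jump t that the path already has
      its left limit there and every earlier jump lies before s.\<close>
    have "\<forall>\<^sub>F s in at_left t. a < s \<and> s < t" using t by (auto simp: eventually_at_left_field)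
    moreover have "\<forall>\<^sub>F s in at_left t. \<forall>u\<in>jump_times \<omega>. u < t \<longrightarrow> u < s"
      using fin by (intro eventually_ball_finite) (auto simp: eventually_at_left_field lt_ex)
    moreover have "\<forall>\<^sub>F s in at_left t. \<omega> s = left_lim \<omega> t"
      using t less.prems by (intro paths_left[OF \<omega>]) auto
    ultimately have "\<forall>\<^sub>F s in at_left t. a < s \<and> s < t \<and> \<omega> s = left_lim \<omega> t \<and>
        (\<forall>u\<in>jump_times \<omega>. u < t \<longrightarrow> u < s)"
      by eventually_elim auto
    from eventually_happens[OF this] obtain s
      where s: "a < s" "s < t" "\<omega> s = left_lim \<omega> t" "\<And>u. u \<in> jump_times \<omega> \<Longrightarrow> u < t \<Longrightarrow> u < s"
      by (auto simp: trivial_limit_at_left_real)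
    have J: "jump_times \<omega> \<inter> {s<..b} = {t}" using t s tmax by force
    then have len: "segment_length d \<omega> s b = d (\<omega> s) (\<omega> b)"
      by (simp add: segment_length_def s bt)
    have "t \<in> jump_times \<omega> \<inter> {a<..b} - jump_times \<omega> \<inter> {a<..s}" using t s by simp
    moreover have "jump_times \<omega> \<inter> {a<..s} \<subseteq> jump_times \<omega> \<inter> {a<..b}" using t s by auto
    ultimately have "jump_times \<omega> \<inter> {a<..s} \<subset> jump_times \<omega> \<inter> {a<..b}" by blast
    then have "card (jump_times \<omega> \<inter> {a<..s}) < card (jump_times \<omega> \<inter> {a<..b})"
      using fin by (intro psubset_card_mono) auto
    from less.hyps[OF this] less.prems s t
    have IH: "d (\<omega> a) (\<omega> s) \<le> segment_length d \<omega> a s"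
      "geo d \<omega> a s \<Longrightarrow> d (\<omega> a) (\<omega> s) = segment_length d \<omega> a s" by auto
    have add: "segment_length d \<omega> a b = segment_length d \<omega> a s + segment_length d \<omega> s b"
      using s t by (intro segment_length_add[OF \<omega>]) auto
    show ?thesis
      using IH add len d_triangle[of "\<omega> a" "\<omega> b" "\<omega> s"] geo_split[of a s b \<omega>] s t by auto
  qed
qed

text \<open>Length is additive in time and dominates the distance on each piece, so if the total is
  minimal there is no slack on [0,p], [p,q] and [q,1].\<close>

lemma path_length_eq_iff_geo:
  assumes \<omega>: "\<omega> \<in> paths E"
  shows "path_length d \<omega> = d (\<omega> 0) (\<omega> 1) \<longleftrightarrow> geo d \<omega> 0 1"
proof
  assume L: "path_length d \<omega> = d (\<omega> 0) (\<omega> 1)"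
  show "geo d \<omega> 0 1" unfolding geo_def
  proof (intro allI impI, elim conjE)
    fix p q :: real assume pq: "0 \<le> p" "p \<le> q" "q \<le> 1"
    have "d (\<omega> 0) (\<omega> p) + d (\<omega> p) (\<omega> q) + d (\<omega> q) (\<omega> 1) \<le>
      segment_length d \<omega> 0 p + segment_length d \<omega> p q + segment_length d \<omega> q 1"
      using pq by (intro add_mono segment_length[OF \<omega>, THEN conjunct1]) auto
    also have "\<dots> = segment_length d \<omega> 0 1"
      using pq segment_length_add[OF \<omega>, of 0 p 1 d] segment_length_add[OF \<omega>, of p q 1 d] by simp
    finally show "d (\<omega> 0) (\<omega> p) + d (\<omega> p) (\<omega> q) + d (\<omega> q) (\<omega> 1) = d (\<omega> 0) (\<omega> 1)"
      using L d_triangle[of "\<omega> 0" "\<omega> 1" "\<omega> p"] d_triangle[of "\<omega> p" "\<omega> 1" "\<omega> q"]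
      by (simp add: path_length_eq_segment_length)
  qed
next
  assume "geo d \<omega> 0 1"
  then show "path_length d \<omega> = d (\<omega> 0) (\<omega> 1)"
    using segment_length[OF \<omega>, of 0 1] by (simp add: path_length_eq_segment_length)
qed

lemma d_le_path_length: "\<omega> \<in> paths E \<Longrightarrow> d (\<omega> 0) (\<omega> 1) \<le> path_length d \<omega>"
  using segment_length[of \<omega> E 0 1] by (simp add: path_length_eq_segment_length)

lemma geodesics_between_iff:
  "\<omega> \<in> geodesics_between E d x y \<longleftrightarrow> \<omega> \<in> paths E \<and> geo d \<omega> 0 1 \<and> \<omega> 0 = x \<and> \<omega> 1 = y"
  using path_length_eq_iff_geo[of \<omega> E] by (auto simp: geodesics_between_def)

lemma geodesics_iff: "\<omega> \<in> geodesics E d \<longleftrightarrow> \<omega> \<in> paths E \<and> geo d \<omega> 0 1"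
  by (auto simp: geodesics_def geodesics_between_iff)

text \<open>A geodesic on [t,1] becomes one on [0,1] by waiting in its state at time t before t. So
  the extension demanded by the definition always exists.\<close>

lemma geodesics_from_iff:
  assumes t: "0 \<le> t" "t \<le> 1" and \<omega>: "\<omega> \<in> paths E"
  shows "\<omega> \<in> geodesics_from E d t z y \<longleftrightarrow> geo d \<omega> t 1 \<and> \<omega> t = z \<and> \<omega> 1 = y"
proof
  assume "\<omega> \<in> geodesics_from E d t z y"
  then obtain \<gamma> where \<gamma>: "geo d \<gamma> 0 1" "\<forall>s\<in>{t..1}. \<omega> s = \<gamma> s" "\<omega> t = z" "\<omega> 1 = y"
    by (auto simp: geodesics_from_def geodesics_iff)
  then show "geo d \<omega> t 1 \<and> \<omega> t = z \<and> \<omega> 1 = y"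
    using t geo_split[of 0 t 1 \<gamma>] geo_cong[of t 1 \<omega> \<gamma> d] by simp
next
  assume A: "geo d \<omega> t 1 \<and> \<omega> t = z \<and> \<omega> 1 = y"
  define \<gamma> where "\<gamma> = (\<lambda>s. if 0 \<le> s \<and> s < t then \<omega> t else \<omega> s)"
  have p: "\<gamma> \<in> paths E" unfolding \<gamma>_def by (rule paths_splice[OF \<omega> t]) simp
  have eq: "\<gamma> s = \<omega> s" if "t \<le> s" for s using that by (simp add: \<gamma>_def)
  have eq': "\<gamma> s = \<omega> t" if "0 \<le> s" "s \<le> t" for s using that by (auto simp: \<gamma>_def)
  have "geo d \<gamma> t 1" using A geo_cong[of t 1 \<omega> \<gamma> d] eq t by simp
  moreover have "geo d \<gamma> 0 t" unfolding geo_def using eq' t by auto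
  moreover have "d (\<gamma> 0) (\<gamma> t) + d (\<gamma> t) (\<gamma> 1) = d (\<gamma> 0) (\<gamma> 1)" using eq'[of 0] eq'[of t] t by simp
  ultimately have "\<gamma> \<in> geodesics E d" using geo_split[of 0 t 1 \<gamma>] t p by (simp add: geodesics_iff)
  then show "\<omega> \<in> geodesics_from E d t z y"
    using A \<omega> eq by (auto simp: geodesics_from_def intro!: bexI[of _ \<gamma>])
qed

lemma successors_imp:
  assumes "w \<in> successors E d y z"
  shows "E z w" "d z w + d w y = d z y"
proof -
  from assms obtain \<gamma> t t' where g: "E z w" "geo d \<gamma> 0 1" "\<gamma> 0 = z" "\<gamma> 1 = y"
    "0 \<le> t" "t < t'" "t' \<le> 1" "\<gamma> t' = w"
    by (auto simp: successors_def geodesic_arrow_def geodesics_between_iff)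
  then show "E z w" "d z w + d w y = d z y"
    using geo_split[of 0 t' 1 \<gamma>] by auto
qed

text \<open>The witness waits in z before t and jumps to w at t. It needs t > 0 to be in z at all
  and t < 1 because no path jumps at time 1.\<close>

lemma successorsI:
  assumes t: "0 < t" "t < 1" and \<omega>: "\<omega> \<in> paths E" "geo d \<omega> t 1" "\<omega> t = w" "\<omega> 1 = y"
    and z: "E z w" "d z w + d w y = d z y"
  shows "w \<in> successors E d y z"
proof -
  define \<gamma> where "\<gamma> = (\<lambda>s. if 0 \<le> s \<and> s < t then z else \<omega> s)"
  have p: "\<gamma> \<in> paths E" unfolding \<gamma>_def by (rule paths_splice) (use t \<omega> z in auto)
  have eq: "\<gamma> s = \<omega> s" if "t \<le> s" for s using that by (simp add: \<gamma>_def)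
  have eq': "\<gamma> s = z" if "0 \<le> s" "s < t" for s using that by (auto simp: \<gamma>_def)
  have "geo d \<gamma> t 1" using \<omega> geo_cong[of t 1 \<omega> \<gamma> d] eq t by simp
  moreover have "geo d \<gamma> 0 t"
    unfolding geo_def
  proof (intro allI impI, elim conjE)
    fix p q assume "0 \<le> p" "p \<le> q" "q \<le> t"
    then show "d (\<gamma> 0) (\<gamma> p) + d (\<gamma> p) (\<gamma> q) + d (\<gamma> q) (\<gamma> t) = d (\<gamma> 0) (\<gamma> t)"
      using eq'[of 0] eq'[of p] eq'[of q] t by (cases "p < t"; cases "q < t") auto
  qed
  moreover have "d (\<gamma> 0) (\<gamma> t) + d (\<gamma> t) (\<gamma> 1) = d (\<gamma> 0) (\<gamma> 1)"
    using eq'[of 0] eq[of t] eq[of 1] t z \<omega> by simp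
  ultimately have "geo d \<gamma> 0 1" using geo_split[of 0 t 1 \<gamma>] t by simp
  then have g: "\<gamma> \<in> geodesics_between E d z y"
    using p eq'[of 0] eq[of 1] t \<omega> by (simp add: geodesics_between_iff)
  have "geodesic_arrow E d z y z w"
    unfolding geodesic_arrow_def using g eq'[of 0] eq[of t] t \<omega> z
    by (intro conjI bexI[OF _ g] exI[of _ 0] exI[of _ t]) auto
  moreover have "w \<in> geodesic_states E d z y"
    unfolding geodesic_states_def using g eq[of t] t \<omega> by (intro CollectI exI[of _ \<gamma>] exI[of _ t]) auto
  ultimately show ?thesis by (simp add: successors_def)
qed

text \<open>Such a path takes only the two end values, first the one and then the other. Hence it is
  geodesic for every metric, and its change of state is a single jump along an edge.\<close>

lemma not_moves_twice:
  assumes \<omega>: "\<omega> \<in> paths E" and ab: "0 \<le> a" "a \<le> b" "b \<le> 1"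
    and n: "\<not> moves_twice \<omega> a b" "\<omega> a \<noteq> \<omega> b"
  shows "E (\<omega> a) (\<omega> b)" "geo d \<omega> a b"
proof -
  have n': "\<omega> p = \<omega> q \<or> \<omega> q = \<omega> r" if "a \<le> p" "p \<le> q" "q \<le> r" "r \<le> b" for p q r
    using n(1) that by (auto simp: moves_twice_def)
  have step: "(\<omega> p = \<omega> a \<or> \<omega> p = \<omega> b) \<and> (\<omega> q = \<omega> a \<or> \<omega> q = \<omega> b) \<and> (\<omega> p = \<omega> b \<longrightarrow> \<omega> q = \<omega> b)"
    if "a \<le> p" "p \<le> q" "q \<le> b" for p q
    using n'[of a p b] n'[of a q b] n'[of a p q] that n(2) by auto
  show "geo d \<omega> a b" unfolding geo_def
  proof (intro allI impI, elim conjE)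
    fix p q assume "a \<le> p" "p \<le> q" "q \<le> b"
    from step[OF this] show "d (\<omega> a) (\<omega> p) + d (\<omega> p) (\<omega> q) + d (\<omega> q) (\<omega> b) = d (\<omega> a) (\<omega> b)"
      by auto
  qed
  obtain t where t: "t \<in> jump_times \<omega>" "a < t" "t \<le> b"
    using paths_no_jump[OF \<omega> ab] n(2) by (metis IntE disjoint_iff greaterThanAtMost_iff)
  then have t1: "0 < t" "t \<le> 1" "left_lim \<omega> t \<noteq> \<omega> t" by (auto simp: jump_times_def)
  have "\<forall>\<^sub>F s in at_left t. a < s \<and> s < t" using t by (auto simp: eventually_at_left_field)
  with paths_left[OF \<omega> t1(1,2)] have "\<forall>\<^sub>F s in at_left t. a < s \<and> s < t \<and> \<omega> s = left_lim \<omega> t"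
    by eventually_elim auto
  then obtain s where s: "a < s" "s < t" "\<omega> s = left_lim \<omega> t"
    using eventually_happens[of _ "at_left t"] by (auto simp: trivial_limit_at_left_real)
  have "\<omega> s = \<omega> a" "\<omega> t = \<omega> b" using step[of s t] s t t1 by auto
  then show "E (\<omega> a) (\<omega> b)" using paths_edge[OF \<omega> t1] s by simp
qed

end

text \<open>Puts \<open>geo\<close> into a form with countably many conditions, as measurability
  requires. For given p and q one n serves both, since the grid values agree with the path
  eventually.\<close>

lemma geo_grid:
  assumes \<omega>: "\<omega> \<in> paths E" and ab: "0 \<le> a" "a \<le> b" "b \<le> 1"
  shows "geo d \<omega> a b \<longleftrightarrow> (\<forall>n>0. \<forall>i\<le>n. \<forall>j\<le>n. i \<le> j \<longrightarrow>
    d (\<omega> a) (\<omega> (grid a b n i)) + d (\<omega> (grid a b n i)) (\<omega> (grid a b n j)) + d (\<omega> (grid a b n j)) (\<omega> b) = d (\<omega> a) (\<omega> b))"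
    (is "_ \<longleftrightarrow> ?R")
proof
  assume "geo d \<omega> a b"
  then show ?R
    using grid_mono[OF ab(2)] grid_in[OF ab(2)] unfolding geo_def by fastforce
next
  assume R: ?R
  show "geo d \<omega> a b" unfolding geo_def
  proof (intro allI impI, elim conjE)
    fix p q assume pq: "a \<le> p" "p \<le> q" "q \<le> b"
    have "\<forall>\<^sub>F n in sequentially. \<omega> (up a b n p) = \<omega> p"
      by (rule paths_up[OF \<omega>]) (use pq ab in auto)
    moreover have "\<forall>\<^sub>F n in sequentially. \<omega> (up a b n q) = \<omega> q"
      by (rule paths_up[OF \<omega>]) (use pq ab in auto)
    moreover have "\<forall>\<^sub>F n in sequentially. (0::nat) < n" by (rule eventually_gt_at_top)
    ultimately have "\<forall>\<^sub>F n in sequentially. \<omega> (up a b n p) = \<omega> p \<and> \<omega> (up a b n q) = \<omega> q \<and> 0 < n"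
      by eventually_elim auto
    then obtain n where n: "\<omega> (up a b n p) = \<omega> p" "\<omega> (up a b n q) = \<omega> q" "0 < n"
      using eventually_happens[of _ sequentially] by auto
    have "nat \<lceil>(p - a) / (b - a) * n\<rceil> \<le> nat \<lceil>(q - a) / (b - a) * n\<rceil>"
      using pq ab by (intro nat_mono ceiling_mono mult_right_mono divide_right_mono) auto
    moreover have "\<omega> p = \<omega> (grid a b n (nat \<lceil>(p - a) / (b - a) * n\<rceil>))" "nat \<lceil>(p - a) / (b - a) * n\<rceil> \<le> n"
      "\<omega> q = \<omega> (grid a b n (nat \<lceil>(q - a) / (b - a) * n\<rceil>))" "nat \<lceil>(q - a) / (b - a) * n\<rceil> \<le> n"
      using n up_eq_grid[OF n(3), of a p b] up_eq_grid[OF n(3), of a q b] pq by auto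
    ultimately show "d (\<omega> a) (\<omega> p) + d (\<omega> p) (\<omega> q) + d (\<omega> q) (\<omega> b) = d (\<omega> a) (\<omega> b)"
      using R n(3) by metis
  qed
qed


section \<open>Measurability of path functionals\<close>

lemma space_path_sigma [simp]: "space (path_sigma E I) = paths E"
  unfolding path_sigma_def by (rule space_measure_of) auto

lemma sets_path_sigma:
  "sets (path_sigma E I) = sigma_sets (paths E) {{\<omega> \<in> paths E. \<omega> s \<in> A} | s A. s \<in> I}"
  unfolding path_sigma_def by (rule sets_measure_of) auto

lemma coord_measurable:
  assumes "t \<in> I" shows "(\<lambda>\<omega>. \<omega> t) \<in> path_sigma E I \<rightarrow>\<^sub>M count_space UNIV"
proof (rule measurableI)
  fix A
  have "(\<lambda>\<omega>. \<omega> t) -` A \<inter> space (path_sigma E I) = {\<omega> \<in> paths E. \<omega> t \<in> A}" by auto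
  also have "\<dots> \<in> sets (path_sigma E I)"
    unfolding sets_path_sigma using assms by (intro sigma_sets.Basic) auto
  finally show "(\<lambda>\<omega>. \<omega> t) -` A \<inter> space (path_sigma E I) \<in> sets (path_sigma E I)" .
qed simp

lemma measurable_into_path_sigma:
  assumes "\<And>x. x \<in> space M \<Longrightarrow> f x \<in> paths E"
    and "\<And>s. s \<in> I \<Longrightarrow> (\<lambda>x. f x s) \<in> M \<rightarrow>\<^sub>M count_space UNIV"
  shows "f \<in> M \<rightarrow>\<^sub>M path_sigma E I"
  unfolding path_sigma_def
proof (rule measurable_measure_of)
  fix B assume "B \<in> {{\<omega> \<in> paths E. \<omega> s \<in> A} | s A. s \<in> I}"
  then obtain s A where B: "B = {\<omega> \<in> paths E. \<omega> s \<in> A}" "s \<in> I" by auto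
  have "f -` B \<inter> space M = (\<lambda>x. f x s) -` A \<inter> space M" using B assms(1) by auto
  then show "f -` B \<inter> space M \<in> sets M" using assms(2)[OF B(2)] by (simp add: measurable_sets)
qed (use assms(1) in auto)

lemma subalgebra_path_sigma: "I \<subseteq> K \<Longrightarrow> subalgebra (path_sigma E K) (path_sigma E I)"
  unfolding subalgebra_def sets_path_sigma by (intro conjI sigma_sets_mono') auto

lemma path_sigma_mono: "I \<subseteq> K \<Longrightarrow> A \<in> sets (path_sigma E I) \<Longrightarrow> A \<in> sets (path_sigma E K)"
  using subalgebra_path_sigma[of I K E] by (auto simp: subalgebra_def)

lemma measurable_path_sigma_mono:
  "I \<subseteq> K \<Longrightarrow> f \<in> path_sigma E I \<rightarrow>\<^sub>M N \<Longrightarrow> f \<in> path_sigma E K \<rightarrow>\<^sub>M N"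
  by (rule measurable_from_subalg[OF subalgebra_path_sigma])

lemma cyl_sets: "t \<in> I \<Longrightarrow> {\<omega> \<in> paths E. \<omega> t = z} \<in> sets (path_sigma E I)"
  using measurable_sets[OF coord_measurable[of t I E], of "{z}"] by (simp add: vimage_def Int_def conj_commute)

lemma path_sigma_local:
  assumes "A \<in> sets (path_sigma E I)" "\<omega> \<in> paths E" "\<gamma> \<in> paths E" "\<And>s. s \<in> I \<Longrightarrow> \<omega> s = \<gamma> s"
  shows "\<omega> \<in> A \<longleftrightarrow> \<gamma> \<in> A"
  using assms(1) unfolding sets_path_sigma
  by (induction rule: sigma_sets.induct) (use assms(2-4) in auto)

text \<open>Applied with I = {t}: a function measurable with respect to X_t is constant on each
  event X_t = z.\<close>

lemma path_sigma_fun_local: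
  fixes f :: "_ \<Rightarrow> ennreal"
  assumes f: "f \<in> borel_measurable (path_sigma E I)"
    and "\<omega> \<in> paths E" "\<gamma> \<in> paths E" "\<And>s. s \<in> I \<Longrightarrow> \<omega> s = \<gamma> s"
  shows "f \<omega> = f \<gamma>"
proof -
  have "f -` {f \<gamma>} \<inter> space (path_sigma E I) \<in> sets (path_sigma E I)"
    using f by (rule measurable_sets) simp
  from path_sigma_local[OF this assms(2-4)] assms(2,3) show ?thesis by auto
qed

section \<open>Joint measurability in time and path\<close>

lemma coord2_measurable:
  assumes "s \<in> I" "t \<in> I"
  shows "(\<lambda>\<omega>. f (\<omega> s) (\<omega> t :: 'a :: countable)) \<in> path_sigma E I \<rightarrow>\<^sub>M count_space UNIV"
proof (rule measurable_compose_countable[where g = "\<lambda>\<omega>. \<omega> t" and f = "\<lambda>x \<omega>. f (\<omega> s) x"])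
  show "(\<lambda>\<omega>. f (\<omega> s) x) \<in> path_sigma E I \<rightarrow>\<^sub>M count_space UNIV" for x
    by (rule measurable_compose[OF coord_measurable[OF assms(1)]]) simp
qed (rule coord_measurable[OF assms(2)])

text \<open>Evaluation at a clamped time is total on the product of the real line with the path
  space, so joint measurability needs no restricted time space.\<close>

definition clamp1 :: "real \<Rightarrow> real \<Rightarrow> real \<Rightarrow> real" where
  "clamp1 a b s = max a (min b s)"

lemma clamp1 [simp]: "s \<in> {a..b} \<Longrightarrow> clamp1 a b s = s"
  by (auto simp: clamp1_def)

lemma clamp1_in: "a \<le> b \<Longrightarrow> clamp1 a b s \<in> {a..b}"
  by (auto simp: clamp1_def)

text \<open>By right-continuity the state at time s is the eventual value along the grid points
  above s, and each of these is a coordinate selected by a countable-valued function of s.\<close>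

lemma eval_measurable:
  assumes ab: "0 \<le> a" "a \<le> b" "b \<le> 1"
  shows "(\<lambda>p. snd p (clamp1 a b (fst p)) :: 'a :: countable)
    \<in> (borel \<Otimes>\<^sub>M path_sigma E {a..b}) \<rightarrow>\<^sub>M count_space UNIV"
proof -
  let ?N = "borel \<Otimes>\<^sub>M path_sigma E {a..b}"
  \<comment> \<open>\<open>Suc n\<close> avoids the empty grid, and \<open>min\<close> keeps every
    index on the grid, so that each fixed index gives a coordinate in [a,b]; the index that really
    occurs is not changed by it.\<close>
  let ?X = "\<lambda>n p. snd p (grid a b (Suc n) (min (Suc n) (nat \<lceil>(clamp1 a b (fst p) - a) / (b - a) * Suc n\<rceil>)))"
  have X: "?X n \<in> ?N \<rightarrow>\<^sub>M count_space UNIV" for n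
  proof (rule measurable_compose_countable[where f = "\<lambda>k p. snd p (grid a b (Suc n) (min (Suc n) k))"])
    fix k :: nat
    have "grid a b (Suc n) (min (Suc n) k) \<in> {a..b}" by (rule grid_in) (use ab in auto)
    then show "(\<lambda>p. snd p (grid a b (Suc n) (min (Suc n) k)) :: 'a) \<in> ?N \<rightarrow>\<^sub>M count_space UNIV"
      by (rule measurable_compose[OF measurable_snd coord_measurable])
  next
    have "(\<lambda>p. nat \<lceil>(clamp1 a b (fst p) - a) / (b - a) * real (Suc n)\<rceil>) \<in> ?N \<rightarrow>\<^sub>M count_space UNIV"
      unfolding clamp1_def by measurable
    then show "(\<lambda>p. nat \<lceil>(clamp1 a b (fst p) - a) / (b - a) * real (Suc n)\<rceil>) \<in> ?N \<rightarrow>\<^sub>M count_space UNIV" .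
  qed
  have "(\<lambda>p. snd p (clamp1 a b (fst p))) -` {z} \<inter> space ?N =
      {p \<in> space ?N. \<forall>\<^sub>F n in sequentially. ?X n p = z}" for z :: 'a
  proof (intro set_eqI iffI)
    fix p assume "p \<in> (\<lambda>p. snd p (clamp1 a b (fst p))) -` {z} \<inter> space ?N"
    then have p: "p \<in> space ?N" "snd p (clamp1 a b (fst p)) = z" by auto
    then have \<omega>: "snd p \<in> paths E" by (auto simp: space_pair_measure)
    have c: "clamp1 a b (fst p) \<in> {a..b}" by (rule clamp1_in) (rule ab)
    have "\<forall>\<^sub>F n in sequentially. snd p (up a b n (clamp1 a b (fst p))) = z"
      using paths_up[OF \<omega>, of a "clamp1 a b (fst p)" b] c ab p by simp
    then have "\<forall>\<^sub>F n in sequentially. snd p (up a b (Suc n) (clamp1 a b (fst p))) = z"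
      by (subst eventually_sequentially_Suc)
    then have "\<forall>\<^sub>F n in sequentially. ?X n p = z"
      by eventually_elim (use up_eq_grid[of "Suc _" a "clamp1 a b (fst p)" b] c in simp)
    then show "p \<in> {p \<in> space ?N. \<forall>\<^sub>F n in sequentially. ?X n p = z}" using p by simp
  next
    fix p assume "p \<in> {p \<in> space ?N. \<forall>\<^sub>F n in sequentially. ?X n p = z}"
    then have p: "p \<in> space ?N" "\<forall>\<^sub>F n in sequentially. ?X n p = z" by auto
    then have \<omega>: "snd p \<in> paths E" by (auto simp: space_pair_measure)
    have c: "clamp1 a b (fst p) \<in> {a..b}" by (rule clamp1_in) (rule ab)
    have "\<forall>\<^sub>F n in sequentially. snd p (up a b n (clamp1 a b (fst p))) = snd p (clamp1 a b (fst p))"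
      using paths_up[OF \<omega>, of a "clamp1 a b (fst p)" b] c ab by simp
    then have "\<forall>\<^sub>F n in sequentially. snd p (up a b (Suc n) (clamp1 a b (fst p))) = snd p (clamp1 a b (fst p))"
      by (subst eventually_sequentially_Suc)
    with p(2) have "\<forall>\<^sub>F n in sequentially. snd p (clamp1 a b (fst p)) = z"
      by eventually_elim (use up_eq_grid[of "Suc _" a "clamp1 a b (fst p)" b] c in simp)
    then show "p \<in> (\<lambda>p. snd p (clamp1 a b (fst p))) -` {z} \<inter> space ?N" using p by simp
  qed
  moreover have "{p \<in> space ?N. \<forall>\<^sub>F n in sequentially. ?X n p = z} \<in> sets ?N" for z :: 'a
  proof (rule sets_Collect_eventually_sequentially)
    fix n
    show "{p \<in> space ?N. ?X n p = z} \<in> sets ?N"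
      using measurable_sets[OF X[of n], of "{z}"] by (simp add: vimage_def Int_def conj_commute)
  qed
  ultimately show ?thesis by (auto simp: measurable_count_space_eq2_countable)
qed

lemma integrand_measurable:
  fixes h :: "real \<Rightarrow> 'a :: countable \<Rightarrow> real"
  assumes ab: "0 \<le> a" "a \<le> b" "b \<le> 1" and h: "\<And>x. (\<lambda>s. indicator {a..b} s * h s x) \<in> borel_measurable borel"
  shows "(\<lambda>p. indicator {a..b} (fst p) * h (fst p) (snd p (clamp1 a b (fst p))))
    \<in> borel_measurable (borel \<Otimes>\<^sub>M path_sigma E {a..b})"
proof (rule measurable_compose_countable[OF _ eval_measurable[OF ab]])
  show "(\<lambda>p. indicator {a..b} (fst p) * h (fst p) x) \<in> borel_measurable (borel \<Otimes>\<^sub>M path_sigma E {a..b})" for x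
    by (rule measurable_compose[OF measurable_fst h])
qed

lemma path_integral_measurable:
  fixes h :: "real \<Rightarrow> 'a :: countable \<Rightarrow> real"
  assumes ab: "0 \<le> a" "a \<le> b" "b \<le> 1" and h: "\<And>x. (\<lambda>s. indicator {a..b} s * h s x) \<in> borel_measurable borel"
  shows "(\<lambda>\<omega>. LBINT s:{a..b}. h s (\<omega> s)) \<in> borel_measurable (path_sigma E {a..b})"
proof -
  let ?N = "path_sigma E {a..b}"
  have "(\<lambda>p. indicator {a..b} (fst p) * h (fst p) (snd p (clamp1 a b (fst p)))) \<in> borel_measurable (borel \<Otimes>\<^sub>M ?N)"
    by (rule integrand_measurable[OF ab h])
  also have "borel_measurable (borel \<Otimes>\<^sub>M ?N) = borel_measurable (lborel \<Otimes>\<^sub>M ?N)"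
    by (rule measurable_cong_sets) (auto intro: sets_pair_measure_cong)
  finally have 1: "(\<lambda>p. indicator {a..b} (fst p) * h (fst p) (snd p (clamp1 a b (fst p)))) \<in> borel_measurable (lborel \<Otimes>\<^sub>M ?N)" .
  have "(\<lambda>p. indicator {a..b} (snd p) * h (snd p) (fst p (clamp1 a b (snd p)))) \<in> borel_measurable (?N \<Otimes>\<^sub>M lborel)"
    using measurable_compose[OF measurable_pair_swap' 1] by (simp add: case_prod_beta)
  then have 2: "(\<lambda>\<omega>. \<integral>s. indicator {a..b} s * h s (\<omega> (clamp1 a b s)) \<partial>lborel) \<in> borel_measurable ?N"
    by (intro lborel.borel_measurable_lebesgue_integral) (simp add: case_prod_beta')
  have "(LBINT s:{a..b}. h s (\<omega> s)) = (\<integral>s. indicator {a..b} s * h s (\<omega> (clamp1 a b s)) \<partial>lborel)" for \<omega>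
    unfolding set_lebesgue_integral_def by (rule Bochner_Integration.integral_cong) (auto simp: indicator_def)
  with 2 show ?thesis by simp
qed

text \<open>Kernels and weights are measurable on [0,1) only; the point 1 is split off with whatever
  value the function has there.\<close>

lemma indicator_measurable_01:
  fixes f :: "real \<Rightarrow> real"
  assumes "f \<in> borel_measurable (restrict_space borel {0..<1})" "0 \<le> a" "b \<le> 1"
  shows "(\<lambda>s. indicator {a..b} s * f s) \<in> borel_measurable borel"
proof -
  have [measurable]: "(\<lambda>s. indicator {0..<1} s * f s) \<in> borel_measurable borel"
    using assms(1) by (subst (asm) borel_measurable_restrict_space_iff) auto
  have "(\<lambda>s. indicator {a..b} s * f s) =
    (\<lambda>s. indicator {a..b} s * (indicator {0..<1} s * f s) + indicator ({a..b} \<inter> {1}) s * f 1)"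
    using assms(2,3) by (auto simp: indicator_def fun_eq_iff)
  then show ?thesis by simp
qed

lemma geo_measurable:
  fixes E :: "'a :: countable \<Rightarrow> 'a \<Rightarrow> bool"
  assumes ab: "0 \<le> a" "a \<le> b" "b \<le> 1"
  shows "{\<omega> \<in> paths E. geo d \<omega> a b} \<in> sets (path_sigma E {a..b})"
proof -
  let ?P = "\<lambda>n i j \<omega>. d (\<omega> a) (\<omega> (grid a b n i)) + d (\<omega> (grid a b n i)) (\<omega> (grid a b n j)) + d (\<omega> (grid a b n j)) (\<omega> b) = d (\<omega> a) (\<omega> b)"
  have m: "(\<lambda>\<omega>. d (\<omega> s) (\<omega> t)) \<in> borel_measurable (path_sigma E {a..b})"
    if "s \<in> {a..b}" "t \<in> {a..b}" for s t
    using measurable_compose[OF coord2_measurable[OF that, where f = d], of "\<lambda>x. x" borel] by simp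
  have "{\<omega> \<in> paths E. geo d \<omega> a b} =
    {\<omega> \<in> space (path_sigma E {a..b}). \<forall>n i j. 0 < n \<and> i \<le> n \<and> j \<le> n \<and> i \<le> j \<longrightarrow> ?P n i j \<omega>}"
    unfolding space_path_sigma
  proof (intro Collect_cong conj_cong refl)
    fix \<omega> assume "\<omega> \<in> paths E"
    from geo_grid[OF this ab, of d]
    show "geo d \<omega> a b \<longleftrightarrow> (\<forall>n i j. 0 < n \<and> i \<le> n \<and> j \<le> n \<and> i \<le> j \<longrightarrow> ?P n i j \<omega>)"
      by blast
  qed
  also have "\<dots> \<in> sets (path_sigma E {a..b})"
  proof (intro sets.sets_Collect_countable_All)
    fix n i j :: nat
    show "{\<omega> \<in> space (path_sigma E {a..b}). 0 < n \<and> i \<le> n \<and> j \<le> n \<and> i \<le> j \<longrightarrow> ?P n i j \<omega>}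
      \<in> sets (path_sigma E {a..b})"
    proof (cases "0 < n \<and> i \<le> n \<and> j \<le> n \<and> i \<le> j")
      case True
      then have "{\<omega> \<in> space (path_sigma E {a..b}). ?P n i j \<omega>} \<in> sets (path_sigma E {a..b})"
        using grid_in[OF ab(2), of n i] grid_in[OF ab(2), of n j] ab
        by (intro borel_measurable_eq borel_measurable_add m) auto
      then show ?thesis by (simp only: True simp_thms)
    next
      case False
      then show ?thesis using sets.top[of "path_sigma E {a..b}"] by (simp only: False simp_thms) simp
    qed
  qed
  finally show ?thesis .
qed

section \<open>The Markov property as conditional independence\<close>

text \<open>Since the state space is countable, the Markov property is conditional independence of past
  and future given each of the events \<open>X\<^sub>t = z\<close>.\<close>

definition cond_indep :: "('a \<Rightarrow> 'a \<Rightarrow> bool) \<Rightarrow> (real \<Rightarrow> 'a) measure \<Rightarrow> bool" where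
  "cond_indep E Q \<longleftrightarrow> (\<forall>t\<in>{0..1}. \<forall>z. \<forall>A\<in>sets (path_sigma E {0..t}). \<forall>B\<in>sets (path_sigma E {t..1}).
     emeasure Q (A \<inter> B \<inter> {\<omega> \<in> paths E. \<omega> t = z}) * emeasure Q {\<omega> \<in> paths E. \<omega> t = z} =
     emeasure Q (A \<inter> {\<omega> \<in> paths E. \<omega> t = z}) * emeasure Q (B \<inter> {\<omega> \<in> paths E. \<omega> t = z}))"

locale path_space =
  fixes E :: "'a::countable \<Rightarrow> 'a \<Rightarrow> bool" and Q :: "(real \<Rightarrow> 'a) measure"
  assumes path_measure: "path_measure E Q"
begin

lemma sets_Q: "sets Q = sets (path_sigma E {0..1})"
  using path_measure by (simp add: path_measure_def)

lemma space_Q [simp]: "space Q = paths E"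
  using sets_eq_imp_space_eq[OF sets_Q] by simp

lemma measurable_Q: "measurable Q N = measurable (path_sigma E {0..1}) N"
  by (rule measurable_cong_sets[OF sets_Q refl])

lemma subalgebra_Q: "I \<subseteq> {0..1} \<Longrightarrow> subalgebra Q (path_sigma E I)"
  using subalgebra_path_sigma[of I "{0..1}" E] by (simp add: subalgebra_def sets_Q)

lemma measurable_path_sigma_Q: "I \<subseteq> {0..1} \<Longrightarrow> f \<in> path_sigma E I \<rightarrow>\<^sub>M N \<Longrightarrow> f \<in> Q \<rightarrow>\<^sub>M N"
  by (rule measurable_from_subalg[OF subalgebra_Q])

lemma sets_path_sigma_Q: "I \<subseteq> {0..1} \<Longrightarrow> A \<in> sets (path_sigma E I) \<Longrightarrow> A \<in> sets Q"
  using subalgebra_Q[of I] by (auto simp: subalgebra_def)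

lemma cyl_sets_Q: "0 \<le> t \<Longrightarrow> t \<le> 1 \<Longrightarrow> {\<omega> \<in> paths E. \<omega> t = z} \<in> sets Q"
  unfolding sets_Q by (rule cyl_sets) simp

lemma emeasure_marginal:
  assumes "0 \<le> t" "t \<le> 1"
  shows "emeasure (marginal Q t) {z} = emeasure Q {\<omega> \<in> paths E. \<omega> t = z}"
proof -
  have "(\<lambda>\<omega>. \<omega> t) \<in> Q \<rightarrow>\<^sub>M count_space UNIV"
    unfolding measurable_Q by (rule coord_measurable) (use assms in auto)
  then show ?thesis
    unfolding marginal_def by (simp add: emeasure_distr vimage_def Int_def conj_commute)
qed

text \<open>Some member of the countable cover by sets of finite measure contains z.\<close>

lemma emeasure_cyl_finite:
  assumes "sigma_finite_measure (marginal Q t)" "0 \<le> t" "t \<le> 1"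
  shows "emeasure Q {\<omega> \<in> paths E. \<omega> t = z} < \<infinity>"
proof -
  obtain A where A: "countable A" "A \<subseteq> sets (marginal Q t)" "\<Union>A = space (marginal Q t)"
    "\<forall>a\<in>A. emeasure (marginal Q t) a \<noteq> \<infinity>"
    using sigma_finite_measure.sigma_finite_countable[OF assms(1)] by auto
  then obtain a where a: "a \<in> A" "z \<in> a" by (auto simp: marginal_def)
  have "emeasure (marginal Q t) {z} \<le> emeasure (marginal Q t) a"
    using a A(2) by (intro emeasure_mono) auto
  also have "\<dots> < \<infinity>" using A(4) a by (simp add: less_top)
  finally show ?thesis using emeasure_marginal[OF assms(2,3)] by simp
qed

lemma sigma_finite_path_sigma:
  assumes "sigma_finite_measure (marginal Q t)" "0 \<le> t" "t \<le> 1" "t \<in> I" "I \<subseteq> {0..1}"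
  shows "sigma_finite_subalgebra Q (path_sigma E I)"
proof (rule sigma_finite_subalgebra.intro)
  show sub: "subalgebra Q (path_sigma E I)" by (rule subalgebra_Q) fact
  have "sigma_finite_measure (restr_to_subalg Q (path_sigma E I))"
  proof
    let ?A = "range (\<lambda>z. {\<omega> \<in> paths E. \<omega> t = z})"
    have "countable ?A" by simp
    moreover have "?A \<subseteq> sets (restr_to_subalg Q (path_sigma E I))"
      using cyl_sets[OF assms(4)] by (auto simp: sets_restr_to_subalg[OF sub])
    moreover have "\<Union>?A = space (restr_to_subalg Q (path_sigma E I))"
      by (auto simp: space_restr_to_subalg)
    moreover have "\<forall>a\<in>?A. emeasure (restr_to_subalg Q (path_sigma E I)) a \<noteq> \<infinity>"
    proof (rule ballI)
      fix a assume "a \<in> ?A"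
      then obtain z where a: "a = {\<omega> \<in> paths E. \<omega> t = z}" by auto
      show "emeasure (restr_to_subalg Q (path_sigma E I)) a \<noteq> \<infinity>"
        using emeasure_cyl_finite[OF assms(1-3), of z]
        unfolding a emeasure_restr_to_subalg[OF sub cyl_sets[OF assms(4)]] by (simp add: less_top)
    qed
    ultimately show "\<exists>A. countable A \<and> A \<subseteq> sets (restr_to_subalg Q (path_sigma E I)) \<and>
      \<Union>A = space (restr_to_subalg Q (path_sigma E I)) \<and>
      (\<forall>a\<in>A. emeasure (restr_to_subalg Q (path_sigma E I)) a \<noteq> \<infinity>)" by blast
  qed
  then show "sigma_finite_measure (restr_to_subalg Q (path_sigma E I))" .
qed

text \<open>The conditional probability of B given X_t is constant on X_t = z. With value k there,
  every past event C satisfies Q(C, B, X_t = z) = k Q(C, X_t = z); taking C = A and C = everything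
  eliminates k.\<close>

lemma markov_imp_cond_indep:
  assumes markov: "markov_measure E Q"
  shows "cond_indep E Q"
  unfolding cond_indep_def
proof (intro ballI allI)
  fix t :: real and z A B
  assume t: "t \<in> {0..1}" and A: "A \<in> sets (path_sigma E {0..t})" and B: "B \<in> sets (path_sigma E {t..1})"
  have sf: "sigma_finite_measure (marginal Q t)" using markov t by (auto simp: markov_measure_def)
  interpret P: sigma_finite_subalgebra Q "path_sigma E {0..t}"
    by (rule sigma_finite_path_sigma[OF sf]) (use t in auto)
  interpret S: sigma_finite_subalgebra Q "path_sigma E {t}"
    by (rule sigma_finite_path_sigma[OF sf]) (use t in auto)
  let ?Z = "{\<omega> \<in> paths E. \<omega> t = z}"
  let ?c = "nn_cond_exp Q (path_sigma E {t}) (indicator B)"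
  have BQ[measurable]: "B \<in> sets Q" by (rule sets_path_sigma_Q[OF _ B]) (use t in auto)
  have AQ[measurable]: "A \<in> sets Q" by (rule sets_path_sigma_Q[OF _ A]) (use t in auto)
  have ZQ[measurable]: "?Z \<in> sets Q" by (rule cyl_sets_Q) (use t in auto)
  have Z: "?Z \<in> sets (path_sigma E {0..t})" by (rule cyl_sets) (use t in auto)
  have ae: "AE \<omega> in Q. nn_cond_exp Q (path_sigma E {0..t}) (indicator B) \<omega> = ?c \<omega>"
    using markov t B by (auto simp: markov_measure_def)
  obtain k where k: "\<And>\<omega>. \<omega> \<in> ?Z \<Longrightarrow> ?c \<omega> = k"
  proof (cases "?Z = {}")
    case False
    then obtain \<gamma> where \<gamma>: "\<gamma> \<in> ?Z" by blast
    show ?thesis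
    proof (rule that)
      fix \<omega> assume "\<omega> \<in> ?Z"
      then show "?c \<omega> = ?c \<gamma>"
        using \<gamma> by (intro path_sigma_fun_local[OF borel_measurable_nn_cond_exp]) auto
    qed
  qed (use that in auto)
  have main: "emeasure Q (C \<inter> B \<inter> ?Z) = k * emeasure Q (C \<inter> ?Z)" if C: "C \<in> sets (path_sigma E {0..t})" for C
  proof -
    have CQ[measurable]: "C \<in> sets Q" by (rule sets_path_sigma_Q[OF _ C]) (use t in auto)
    have "emeasure Q (C \<inter> B \<inter> ?Z) = (\<integral>\<^sup>+\<omega>. indicator (C \<inter> ?Z) \<omega> * indicator B \<omega> \<partial>Q)"
      by (simp add: Int_ac flip: indicator_inter_arith)
    also have "\<dots> = (\<integral>\<^sup>+\<omega>. indicator (C \<inter> ?Z) \<omega> * nn_cond_exp Q (path_sigma E {0..t}) (indicator B) \<omega> \<partial>Q)"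
      using C Z by (intro P.nn_cond_exp_intg[symmetric]) auto
    also have "\<dots> = (\<integral>\<^sup>+\<omega>. k * indicator (C \<inter> ?Z) \<omega> \<partial>Q)"
      using ae by (intro nn_integral_cong_AE, eventually_elim) (auto simp: k indicator_def)
    also have "\<dots> = k * emeasure Q (C \<inter> ?Z)" by (simp add: nn_integral_cmult)
    finally show ?thesis .
  qed
  have top: "paths E \<inter> X = X" if "X \<in> sets Q" for X using sets.sets_into_space[OF that] by auto
  have "emeasure Q (B \<inter> ?Z) = k * emeasure Q ?Z"
    using main[of "paths E"] sets.top[of "path_sigma E {0..t}"] top[OF BQ] top[OF ZQ] by simp
  then show "emeasure Q (A \<inter> B \<inter> ?Z) * emeasure Q ?Z = emeasure Q (A \<inter> ?Z) * emeasure Q (B \<inter> ?Z)"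
    using main[OF A] by (simp add: mult_ac)
qed

lemma nn_integral_partition:
  assumes [measurable]: "f \<in> borel_measurable Q" and t: "0 \<le> t" "t \<le> 1"
  shows "(\<integral>\<^sup>+\<omega>. f \<omega> \<partial>Q) = (\<integral>\<^sup>+z. (\<integral>\<^sup>+\<omega>. f \<omega> * indicator {\<omega> \<in> paths E. \<omega> t = z} \<omega> \<partial>Q) \<partial>count_space UNIV)"
proof -
  have [measurable]: "{\<omega> \<in> paths E. \<omega> t = z} \<in> sets Q" for z by (rule cyl_sets_Q[OF t])
  have "(\<integral>\<^sup>+\<omega>. f \<omega> \<partial>Q) = (\<integral>\<^sup>+\<omega>. (\<integral>\<^sup>+z. f \<omega> * indicator {\<omega> \<in> paths E. \<omega> t = z} \<omega> \<partial>count_space UNIV) \<partial>Q)"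
  proof (rule nn_integral_cong)
    fix \<omega> assume "\<omega> \<in> space Q"
    then have "(\<integral>\<^sup>+z. f \<omega> * indicator {\<omega> \<in> paths E. \<omega> t = z} \<omega> \<partial>count_space UNIV) =
      (\<integral>\<^sup>+z. f \<omega> * indicator {\<omega> t} z \<partial>count_space UNIV)"
      by (intro nn_integral_cong) (auto simp: indicator_def)
    also have "\<dots> = f \<omega>" by (simp add: nn_integral_cmult_indicator)
    finally show "f \<omega> = (\<integral>\<^sup>+z. f \<omega> * indicator {\<omega> \<in> paths E. \<omega> t = z} \<omega> \<partial>count_space UNIV)" ..
  qed
  also have "\<dots> = (\<integral>\<^sup>+z. (\<integral>\<^sup>+\<omega>. f \<omega> * indicator {\<omega> \<in> paths E. \<omega> t = z} \<omega> \<partial>Q) \<partial>count_space UNIV)"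
    by (rule nn_integral_count_space_nn_integral) auto
  finally show ?thesis .
qed

text \<open>The elementary conditional probability of B given X_t = z, as a function of the state at
  t, is a version of both conditional expectations, because its integrals over past events agree
  with those of B on every piece X_t = z.\<close>

lemma cond_indep_imp_markov:
  assumes "finite_measure Q" "cond_indep E Q"
  shows "markov_measure E Q"
  unfolding markov_measure_def
proof (intro conjI ballI path_measure)
  interpret finite_measure Q by fact
  fix t :: real assume t: "t \<in> {0..1}"
  have "(\<lambda>\<omega>. \<omega> t) \<in> Q \<rightarrow>\<^sub>M count_space UNIV"
    unfolding measurable_Q by (rule coord_measurable) (use t in auto)
  then have "finite_measure (marginal Q t)"
    unfolding marginal_def by (rule finite_measure_distr)
  then show sf: "sigma_finite_measure (marginal Q t)" by (simp add: finite_measure_def)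
  fix B assume B: "B \<in> sets (path_sigma E {t..1})"
  let ?Z = "\<lambda>z. {\<omega> \<in> paths E. \<omega> t = z}"
  define c where "c \<omega> = emeasure Q (B \<inter> ?Z (\<omega> t)) / emeasure Q (?Z (\<omega> t))" for \<omega>
  have c: "c \<in> borel_measurable (path_sigma E {t})"
    unfolding c_def by (rule measurable_compose[OF coord_measurable]) auto
  have BQ[measurable]: "B \<in> sets Q" by (rule sets_path_sigma_Q[OF _ B]) (use t in auto)
  have [measurable]: "?Z z \<in> sets Q" for z by (rule cyl_sets_Q) (use t in auto)
  have cQ[measurable]: "c \<in> borel_measurable Q" by (rule measurable_path_sigma_Q[OF _ c]) (use t in auto)
  have main: "(\<integral>\<^sup>+\<omega>\<in>A. indicator B \<omega> \<partial>Q) = (\<integral>\<^sup>+\<omega>\<in>A. c \<omega> \<partial>Q)" if A: "A \<in> sets (path_sigma E {0..t})" for A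
  proof -
    have AQ[measurable]: "A \<in> sets Q" by (rule sets_path_sigma_Q[OF _ A]) (use t in auto)
    have "(\<integral>\<^sup>+\<omega>. indicator B \<omega> * indicator A \<omega> * indicator (?Z z) \<omega> \<partial>Q) =
        (\<integral>\<^sup>+\<omega>. c \<omega> * indicator A \<omega> * indicator (?Z z) \<omega> \<partial>Q)" for z
    proof -
      have "(\<integral>\<^sup>+\<omega>. indicator B \<omega> * indicator A \<omega> * indicator (?Z z) \<omega> \<partial>Q) = emeasure Q (A \<inter> B \<inter> ?Z z)"
        by (simp add: Int_assoc Int_left_commute flip: indicator_inter_arith)
      also have "\<dots> = emeasure Q (B \<inter> ?Z z) / emeasure Q (?Z z) * emeasure Q (A \<inter> ?Z z)"
      \<comment> \<open>On a null state both sides vanish, the quotient 0 / 0 being 0.\<close>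
      proof (cases "emeasure Q (?Z z) = 0")
        case True
        have "emeasure Q (A \<inter> B \<inter> ?Z z) \<le> emeasure Q (?Z z)" "emeasure Q (A \<inter> ?Z z) \<le> emeasure Q (?Z z)"
          by (auto intro!: emeasure_mono)
        with True show ?thesis by simp
      next
        case False
        have "emeasure Q (A \<inter> B \<inter> ?Z z) * emeasure Q (?Z z) = emeasure Q (A \<inter> ?Z z) * emeasure Q (B \<inter> ?Z z)"
          using assms(2) t A B by (auto simp: cond_indep_def)
        moreover have "emeasure Q (A \<inter> B \<inter> ?Z z) = emeasure Q (A \<inter> B \<inter> ?Z z) * emeasure Q (?Z z) / emeasure Q (?Z z)"
          using False emeasure_finite[of "?Z z"] by (simp add: ennreal_mult_divide_eq)
        ultimately show ?thesis by (simp add: ennreal_times_divide mult.commute)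
      qed
      also have "\<dots> = (\<integral>\<^sup>+\<omega>. emeasure Q (B \<inter> ?Z z) / emeasure Q (?Z z) * indicator (A \<inter> ?Z z) \<omega> \<partial>Q)"
        by (simp add: nn_integral_cmult)
      also have "\<dots> = (\<integral>\<^sup>+\<omega>. c \<omega> * indicator A \<omega> * indicator (?Z z) \<omega> \<partial>Q)"
        by (intro nn_integral_cong) (auto simp: c_def indicator_def)
      finally show ?thesis .
    qed
    moreover have "(\<lambda>\<omega>. indicator B \<omega> * indicator A \<omega> :: ennreal) \<in> borel_measurable Q"
      "(\<lambda>\<omega>. c \<omega> * indicator A \<omega>) \<in> borel_measurable Q" by measurable
    ultimately show ?thesis
      using t nn_integral_partition[of "\<lambda>\<omega>. indicator B \<omega> * indicator A \<omega>" t]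
        nn_integral_partition[of "\<lambda>\<omega>. c \<omega> * indicator A \<omega>" t] by auto
  qed
  interpret P: finite_measure_subalgebra Q "path_sigma E {0..t}"
    by unfold_locales (use subalgebra_Q t in auto)
  interpret S: finite_measure_subalgebra Q "path_sigma E {t}"
    by unfold_locales (use subalgebra_Q t in auto)
  have "AE \<omega> in Q. c \<omega> = nn_cond_exp Q (path_sigma E {0..t}) (indicator B) \<omega>"
    by (rule P.nn_cond_exp_charact[OF main]) (use t c measurable_path_sigma_mono[of "{t}" "{0..t}"] in auto)
  moreover have "AE \<omega> in Q. c \<omega> = nn_cond_exp Q (path_sigma E {t}) (indicator B) \<omega>"
    by (rule S.nn_cond_exp_charact[OF main]) (use t c path_sigma_mono[of "{t}" "{0..t}"] in auto)
  ultimately show "AE \<omega> in Q. nn_cond_exp Q (path_sigma E {0..t}) (indicator B) \<omega> =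
    nn_cond_exp Q (path_sigma E {t}) (indicator B) \<omega>" by eventually_elim simp
qed

text \<open>The monotone class argument, applied to the past and to the future in turn.\<close>

lemma cond_indep_nn_integral1:
  assumes ci: "cond_indep E Q" and t: "0 \<le> t" "t \<le> 1"
    and f: "f \<in> borel_measurable (path_sigma E {0..t})" and B: "B \<in> sets (path_sigma E {t..1})"
  shows "(\<integral>\<^sup>+\<omega>. f \<omega> * indicator (B \<inter> {\<omega> \<in> paths E. \<omega> t = z}) \<omega> \<partial>Q) * emeasure Q {\<omega> \<in> paths E. \<omega> t = z} =
    (\<integral>\<^sup>+\<omega>. f \<omega> * indicator {\<omega> \<in> paths E. \<omega> t = z} \<omega> \<partial>Q) * emeasure Q (B \<inter> {\<omega> \<in> paths E. \<omega> t = z})"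
  using f
proof (induction rule: borel_measurable_induct)
  let ?Z = "{\<omega> \<in> paths E. \<omega> t = z}"
  have [measurable]: "?Z \<in> sets Q" by (rule cyl_sets_Q[OF t])
  have [measurable]: "B \<in> sets Q" by (rule sets_path_sigma_Q[OF _ B]) (use t in auto)
  have fQ: "g \<in> borel_measurable Q" if "g \<in> borel_measurable (path_sigma E {0..t})" for g :: "_ \<Rightarrow> ennreal"
    by (rule measurable_path_sigma_Q[OF _ that]) (use t in auto)
  {
    case (cong f g)
    have "(\<integral>\<^sup>+\<omega>. f \<omega> * indicator X \<omega> \<partial>Q) = (\<integral>\<^sup>+\<omega>. g \<omega> * indicator X \<omega> \<partial>Q)" for X
      by (rule nn_integral_cong) (use cong in auto)
    then show ?case using cong by simp
  next
    case (set A)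
    then have [measurable]: "A \<in> sets Q" by (rule sets_path_sigma_Q[rotated]) (use t in auto)
    have "(\<integral>\<^sup>+\<omega>. indicator A \<omega> * indicator X \<omega> \<partial>Q) = emeasure Q (A \<inter> X)" if "X \<in> sets Q" for X
      using that by (simp flip: indicator_inter_arith)
    then show ?case using ci t set B by (simp add: cond_indep_def Int_assoc)
  next
    case (mult u c)
    note [measurable] = fQ[OF \<open>u \<in> _\<close>]
    show ?case using mult.IH by (simp add: mult.assoc nn_integral_cmult)
  next
    case (add u v)
    note [measurable] = fQ[OF \<open>u \<in> _\<close>] fQ[OF \<open>v \<in> _\<close>]
    show ?case using add.IH by (simp add: distrib_right nn_integral_add)
  next
    case (seq U)
    note [measurable] = fQ[OF seq(1)]
    have S: "(\<integral>\<^sup>+\<omega>. (SUP i. U i) \<omega> * indicator X \<omega> \<partial>Q) = (SUP i. \<integral>\<^sup>+\<omega>. U i \<omega> * indicator X \<omega> \<partial>Q)"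
      if [measurable]: "X \<in> sets Q" for X
    proof -
      have "(\<integral>\<^sup>+\<omega>. (SUP i. U i) \<omega> * indicator X \<omega> \<partial>Q) = (\<integral>\<^sup>+\<omega>. (SUP i. U i \<omega> * indicator X \<omega>) \<partial>Q)"
        by (simp add: SUP_mult_right_ennreal image_comp)
      also have "\<dots> = (SUP i. \<integral>\<^sup>+\<omega>. U i \<omega> * indicator X \<omega> \<partial>Q)"
        using \<open>incseq U\<close> by (intro nn_integral_monotone_convergence_SUP)
          (auto simp: incseq_def le_fun_def intro!: mult_right_mono)
      finally show ?thesis .
    qed
    have "B \<inter> ?Z \<in> sets Q" "?Z \<in> sets Q" by measurable
    then show ?case unfolding S[OF \<open>B \<inter> ?Z \<in> sets Q\<close>] S[OF \<open>?Z \<in> sets Q\<close>]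
      using seq.IH by (simp add: SUP_mult_right_ennreal)
  }
qed

lemma cond_indep_nn_integral:
  assumes ci: "cond_indep E Q" and t: "0 \<le> t" "t \<le> 1"
    and f: "f \<in> borel_measurable (path_sigma E {0..t})" and h: "h \<in> borel_measurable (path_sigma E {t..1})"
  shows "(\<integral>\<^sup>+\<omega>. f \<omega> * h \<omega> * indicator {\<omega> \<in> paths E. \<omega> t = z} \<omega> \<partial>Q) * emeasure Q {\<omega> \<in> paths E. \<omega> t = z} =
    (\<integral>\<^sup>+\<omega>. f \<omega> * indicator {\<omega> \<in> paths E. \<omega> t = z} \<omega> \<partial>Q) * (\<integral>\<^sup>+\<omega>. h \<omega> * indicator {\<omega> \<in> paths E. \<omega> t = z} \<omega> \<partial>Q)"
  using h
proof (induction rule: borel_measurable_induct)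
  let ?Z = "{\<omega> \<in> paths E. \<omega> t = z}"
  have [measurable]: "?Z \<in> sets Q" by (rule cyl_sets_Q[OF t])
  have [measurable]: "f \<in> borel_measurable Q" by (rule measurable_path_sigma_Q[OF _ f]) (use t in auto)
  have hQ: "g \<in> borel_measurable Q" if "g \<in> borel_measurable (path_sigma E {t..1})" for g :: "_ \<Rightarrow> ennreal"
    by (rule measurable_path_sigma_Q[OF _ that]) (use t in auto)
  {
    case (cong h g)
    have "(\<integral>\<^sup>+\<omega>. k \<omega> * h \<omega> * indicator ?Z \<omega> \<partial>Q) = (\<integral>\<^sup>+\<omega>. k \<omega> * g \<omega> * indicator ?Z \<omega> \<partial>Q)" for k
      by (rule nn_integral_cong) (use cong in auto)
    from this[of f] this[of "\<lambda>_. 1"] show ?case using cong by simp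
  next
    case (set B)
    then have [measurable]: "B \<in> sets Q" by (rule sets_path_sigma_Q[rotated]) (use t in auto)
    have i: "indicator B \<omega> * indicator ?Z \<omega> = (indicator (B \<inter> ?Z) \<omega> :: ennreal)" for \<omega>
      by (auto simp: indicator_def)
    show ?case using cond_indep_nn_integral1[OF ci t f set] by (simp add: mult.assoc i)
  next
    case (mult u c)
    note [measurable] = hQ[OF \<open>u \<in> _\<close>]
    have "(\<integral>\<^sup>+\<omega>. f \<omega> * (c * u \<omega>) * indicator ?Z \<omega> \<partial>Q) = c * (\<integral>\<^sup>+\<omega>. f \<omega> * u \<omega> * indicator ?Z \<omega> \<partial>Q)"
      by (subst nn_integral_cmult[symmetric]) (auto simp: mult_ac)
    then show ?case using mult.IH by (simp add: mult_ac nn_integral_cmult)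
  next
    case (add u v)
    note [measurable] = hQ[OF \<open>u \<in> _\<close>] hQ[OF \<open>v \<in> _\<close>]
    show ?case using add.IH by (simp add: distrib_right distrib_left nn_integral_add)
  next
    case (seq U)
    note [measurable] = hQ[OF seq(1)]
    have S: "(\<integral>\<^sup>+\<omega>. k \<omega> * (SUP i. U i) \<omega> * indicator ?Z \<omega> \<partial>Q) = (SUP i. \<integral>\<^sup>+\<omega>. k \<omega> * U i \<omega> * indicator ?Z \<omega> \<partial>Q)"
      if [measurable]: "k \<in> borel_measurable Q" for k
    proof -
      have "(\<integral>\<^sup>+\<omega>. k \<omega> * (SUP i. U i) \<omega> * indicator ?Z \<omega> \<partial>Q) = (\<integral>\<^sup>+\<omega>. (SUP i. k \<omega> * U i \<omega> * indicator ?Z \<omega>) \<partial>Q)"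
        by (simp add: SUP_mult_right_ennreal SUP_mult_left_ennreal image_comp)
      also have "\<dots> = (SUP i. \<integral>\<^sup>+\<omega>. k \<omega> * U i \<omega> * indicator ?Z \<omega> \<partial>Q)"
        using \<open>incseq U\<close> by (intro nn_integral_monotone_convergence_SUP)
          (auto simp: incseq_def le_fun_def intro!: mult_right_mono mult_left_mono)
      finally show ?thesis .
    qed
    have S1: "(\<integral>\<^sup>+\<omega>. (SUP i. U i) \<omega> * indicator ?Z \<omega> \<partial>Q) = (SUP i. \<integral>\<^sup>+\<omega>. U i \<omega> * indicator ?Z \<omega> \<partial>Q)"
      using S[of "\<lambda>_. 1"] unfolding mult_1 by simp
    show ?case unfolding S[OF \<open>f \<in> borel_measurable Q\<close>] S1
      using seq.IH by (simp add: SUP_mult_right_ennreal SUP_mult_left_ennreal)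
  }
qed

end


section \<open>Forward equations and jump kernels\<close>

locale finite_path_space = path_space E Q + finite_measure Q
  for E :: "'a::countable \<Rightarrow> 'a \<Rightarrow> bool" and Q :: "(real \<Rightarrow> 'a) measure"
begin

text \<open>The rate f may be unbounded, as that of a bridge has a weight in its denominator. Only
  its product with the state probability is assumed integrable, and since f is nonnegative this is
  exactly Tonelli's criterion.\<close>

lemma fubini_state:
  assumes f: "f \<in> borel_measurable (restrict_space borel {0..<1})" and f0: "\<And>r. 0 \<le> r \<Longrightarrow> r < 1 \<Longrightarrow> 0 \<le> f r"
    and t: "0 \<le> t" "t < 1"
    and int: "set_integrable lborel {0..t} (\<lambda>r. f r * measure Q {\<omega> \<in> paths E. \<omega> r = z})"
  shows "AE \<omega> in Q. set_integrable lborel {0..t} (\<lambda>r. f r * indicator {z} (\<omega> r))"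
    and "integrable Q (\<lambda>\<omega>. LBINT r:{0..t}. f r * indicator {z} (\<omega> r))"
    and "A \<in> sets Q \<Longrightarrow> set_integrable lborel {0..t} (\<lambda>r. f r * measure Q (A \<inter> {\<omega> \<in> paths E. \<omega> r = z}))"
    and "A \<in> sets Q \<Longrightarrow> (\<integral>\<omega>\<in>A. (LBINT r:{0..t}. f r * indicator {z} (\<omega> r)) \<partial>Q) =
      (LBINT r:{0..t}. f r * measure Q (A \<inter> {\<omega> \<in> paths E. \<omega> r = z}))"
proof -
  define H where "H r \<omega> = indicator {0..t} r * (f r * indicator {z} (\<omega> (clamp1 0 t r)))" for r and \<omega> :: "real \<Rightarrow> 'a"
  interpret P: pair_sigma_finite lborel Q ..
  have cyl[measurable]: "{\<omega> \<in> paths E. \<omega> (clamp1 0 t r) = z} \<in> sets Q" for r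
    using clamp1_in[OF t(1), of r] t by (intro cyl_sets_Q) auto
  have H_eq: "H r \<omega> = indicator {0..t} r *\<^sub>R (f r * indicator {z} (\<omega> r))" for r \<omega>
    by (auto simp: H_def indicator_def)
  have H_cyl: "H r \<omega> = (indicator {0..t} r * f r) * indicator {\<omega> \<in> paths E. \<omega> (clamp1 0 t r) = z} \<omega>"
    if "\<omega> \<in> space Q" for r \<omega>
    using that by (auto simp: H_def indicator_def)
  have int_H: "(\<integral>\<omega>. indicator A \<omega> *\<^sub>R H r \<omega> \<partial>Q) = indicator {0..t} r *\<^sub>R (f r * measure Q (A \<inter> {\<omega> \<in> paths E. \<omega> r = z}))"
    if [measurable]: "A \<in> sets Q" for A r
  proof -
    have "(\<integral>\<omega>. indicator A \<omega> *\<^sub>R H r \<omega> \<partial>Q) =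
      (\<integral>\<omega>. (indicator {0..t} r * f r) * indicator (A \<inter> {\<omega> \<in> paths E. \<omega> (clamp1 0 t r) = z}) \<omega> \<partial>Q)"
      by (rule Bochner_Integration.integral_cong) (auto simp: H_cyl indicator_def)
    also have "\<dots> = indicator {0..t} r * f r * measure Q (A \<inter> {\<omega> \<in> paths E. \<omega> (clamp1 0 t r) = z})"
    proof -
      have "A \<inter> {\<omega> \<in> paths E. \<omega> (clamp1 0 t r) = z} \<in> sets Q" by measurable
      moreover have "A \<inter> {\<omega> \<in> paths E. \<omega> (clamp1 0 t r) = z} \<inter> paths E = A \<inter> {\<omega> \<in> paths E. \<omega> (clamp1 0 t r) = z}"
        by auto
      ultimately show ?thesis by simp
    qed
    finally show ?thesis by (auto simp: indicator_def)
  qed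
  have Hm: "case_prod H \<in> borel_measurable (lborel \<Otimes>\<^sub>M Q)"
  proof -
    have a: "(\<lambda>p. indicator {0..t} (fst p) * (f (fst p) * indicator {z} (snd p (clamp1 0 t (fst p)))))
      \<in> borel_measurable (borel \<Otimes>\<^sub>M path_sigma E {0..t})"
    proof (rule integrand_measurable[where h = "\<lambda>s x. f s * indicator {z} x"])
      show "(\<lambda>s. indicator {0..t} s * (f s * indicator {z} x)) \<in> borel_measurable borel" for x
        using indicator_measurable_01[OF f, of 0 t] t
        by (cases "x = z") (auto simp: indicator_def)
    qed (use t in auto)
    have b: "(\<lambda>p. (fst p, snd p)) \<in> (lborel \<Otimes>\<^sub>M Q) \<rightarrow>\<^sub>M (borel \<Otimes>\<^sub>M path_sigma E {0..t})"
    proof (rule measurable_Pair)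
      show "fst \<in> lborel \<Otimes>\<^sub>M Q \<rightarrow>\<^sub>M borel" by measurable
      have "(\<lambda>\<omega>. \<omega>) \<in> Q \<rightarrow>\<^sub>M path_sigma E {0..t}"
        by (rule measurable_path_sigma_Q[OF _ measurable_ident[unfolded id_def]]) (use t in auto)
      then show "snd \<in> lborel \<Otimes>\<^sub>M Q \<rightarrow>\<^sub>M path_sigma E {0..t}"
        by (rule measurable_compose[OF measurable_snd])
    qed
    from measurable_compose[OF b a] show ?thesis
      by (simp add: H_def case_prod_beta')
  qed
  have Hint: "integrable (lborel \<Otimes>\<^sub>M Q) (case_prod H)"
  proof (rule P.Fubini_integrable[OF Hm])
    have "norm (H r \<omega>) = H r \<omega>" for r \<omega>
      using f0 t by (auto simp: H_def indicator_def)
    then have "(\<lambda>r. \<integral>\<omega>. norm (case_prod H (r, \<omega>)) \<partial>Q) =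
      (\<lambda>r. \<integral>\<omega>. indicator (space Q) \<omega> *\<^sub>R H r \<omega> \<partial>Q)"
      by (intro ext Bochner_Integration.integral_cong) auto
    also have "\<dots> = (\<lambda>r. indicator {0..t} r *\<^sub>R (f r * measure Q {\<omega> \<in> paths E. \<omega> r = z}))"
      unfolding int_H[OF sets.top] by (auto simp: Int_def)
    finally show "integrable lborel (\<lambda>r. \<integral>\<omega>. norm (case_prod H (r, \<omega>)) \<partial>Q)"
      using int by (simp add: set_integrable_def)
    show "AE r in lborel. integrable Q (\<lambda>\<omega>. case_prod H (r, \<omega>))"
    proof (rule AE_I2)
      fix r :: real
      have "integrable Q (\<lambda>\<omega>. (indicator {0..t} r * f r) * indicator {\<omega> \<in> paths E. \<omega> (clamp1 0 t r) = z} \<omega>)"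
        by (intro integrable_mult_right integrable_real_indicator cyl) (simp add: emeasure_eq_measure)
      then show "integrable Q (\<lambda>\<omega>. case_prod H (r, \<omega>))"
        by (rule Bochner_Integration.integrable_cong[THEN iffD1, rotated -1]) (auto simp: H_cyl)
    qed
  qed
  show "AE \<omega> in Q. set_integrable lborel {0..t} (\<lambda>r. f r * indicator {z} (\<omega> r))"
    using P.AE_integrable_snd[OF Hint] unfolding set_integrable_def H_eq .
  show "integrable Q (\<lambda>\<omega>. LBINT r:{0..t}. f r * indicator {z} (\<omega> r))"
    using P.integrable_snd[OF Hint] unfolding set_lebesgue_integral_def H_eq .
  assume A[measurable]: "A \<in> sets Q"
  have HA: "integrable (lborel \<Otimes>\<^sub>M Q) (\<lambda>(r, \<omega>). indicator A \<omega> *\<^sub>R H r \<omega>)"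
  proof -
    have "UNIV \<times> A \<in> sets (lborel \<Otimes>\<^sub>M Q)" by (rule pair_measureI) auto
    from integrable_mult_indicator[OF this Hint] show ?thesis
      by (simp add: case_prod_beta' indicator_times)
  qed
  show "set_integrable lborel {0..t} (\<lambda>r. f r * measure Q (A \<inter> {\<omega> \<in> paths E. \<omega> r = z}))"
    using P.integrable_fst[OF HA] unfolding int_H[OF A] set_integrable_def .
  have "(\<integral>\<omega>\<in>A. (LBINT r:{0..t}. f r * indicator {z} (\<omega> r)) \<partial>Q) = (\<integral>\<omega>. (\<integral>r. indicator A \<omega> *\<^sub>R H r \<omega> \<partial>lborel) \<partial>Q)"
    unfolding set_lebesgue_integral_def H_eq[symmetric] by simp
  also have "\<dots> = (\<integral>r. (\<integral>\<omega>. indicator A \<omega> *\<^sub>R H r \<omega> \<partial>Q) \<partial>lborel)"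
    unfolding P.integral_snd[OF HA] P.integral_fst[OF HA] ..
  finally show "(\<integral>\<omega>\<in>A. (LBINT r:{0..t}. f r * indicator {z} (\<omega> r)) \<partial>Q) =
      (LBINT r:{0..t}. f r * measure Q (A \<inter> {\<omega> \<in> paths E. \<omega> r = z}))"
    unfolding int_H[OF A] set_lebesgue_integral_def .
qed

end

lemma set_integral_split:
  fixes f :: "real \<Rightarrow> real"
  assumes "set_integrable lborel {a..c} f" "a \<le> b" "b \<le> c"
  shows "(LBINT r:{a..c}. f r) = (LBINT r:{a..b}. f r) + (LBINT r:{b..c}. f r)"
proof -
  have "{a..c} = {a..b} \<union> {b..c}" using assms by auto
  moreover have "(LBINT r:{a..b} \<union> {b..c}. f r) = (LBINT r:{a..b}. f r) + (LBINT r:{b..c}. f r)"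
  proof (rule set_integral_Un_AE)
    have "AE r in lborel. r \<noteq> b" by (rule AE_lborel_singleton)
    then show "AE r in lborel. \<not> (r \<in> {a..b} \<and> r \<in> {b..c})" by eventually_elim auto
  qed (use assms in \<open>auto intro: set_integrable_subset[OF assms(1)]\<close>)
  ultimately show ?thesis by simp
qed

lemma set_integrable_sum':
  fixes f :: "'i \<Rightarrow> 'b \<Rightarrow> real"
  assumes "\<And>i. i \<in> I \<Longrightarrow> set_integrable M A (f i)"
  shows "set_integrable M A (\<lambda>x. \<Sum>i\<in>I. f i x)"
  using assms unfolding set_integrable_def by (simp add: sum_distrib_left Bochner_Integration.integrable_sum)

lemma set_integral_sum':
  fixes f :: "'i \<Rightarrow> 'b \<Rightarrow> real"
  assumes "\<And>i. i \<in> I \<Longrightarrow> set_integrable M A (f i)"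
  shows "(LINT x:A|M. (\<Sum>i\<in>I. f i x)) = (\<Sum>i\<in>I. LINT x:A|M. f i x)"
  using assms unfolding set_integrable_def set_lebesgue_integral_def
  by (simp add: sum_distrib_left Bochner_Integration.integral_sum)

context finite_path_space
begin

text \<open>The martingale problem only needs to be checked for \<open>u = 1\<^sub>w\<close>, where it is the forward
  equation for \<open>Q(A \<inter> {X\<^sub>t = w})\<close>.\<close>

lemma has_jump_kernelI:
  fixes \<kappa> :: "real \<Rightarrow> 'a \<Rightarrow> 'a \<Rightarrow> real"
  assumes fin: "\<And>x. finite {y. E x y}" and sym: "symp E"
    and S: "AE \<omega> in Q. \<forall>t\<in>{0..1}. \<omega> t \<in> S"
    and nonneg: "\<And>t x y. 0 \<le> t \<Longrightarrow> t < 1 \<Longrightarrow> 0 \<le> \<kappa> t x y"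
    and edge: "\<And>t x y. 0 \<le> t \<Longrightarrow> t < 1 \<Longrightarrow> \<not> E x y \<Longrightarrow> \<kappa> t x y = 0"
    and meas: "\<And>x y. (\<lambda>t. \<kappa> t x y) \<in> borel_measurable (restrict_space borel {0..<1})"
    and int: "\<And>t z w. 0 \<le> t \<Longrightarrow> t < 1 \<Longrightarrow> E z w \<Longrightarrow>
      set_integrable lborel {0..t} (\<lambda>r. \<kappa> r z w * measure Q {\<omega> \<in> paths E. \<omega> r = z})"
    and fwd: "\<And>A s t w. A \<in> sets (path_sigma E {0..s}) \<Longrightarrow> 0 \<le> s \<Longrightarrow> s \<le> t \<Longrightarrow> t < 1 \<Longrightarrow>
      measure Q (A \<inter> {\<omega> \<in> paths E. \<omega> t = w}) - measure Q (A \<inter> {\<omega> \<in> paths E. \<omega> s = w}) =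
      (\<Sum>z | E w z. (LBINT r:{s..t}. \<kappa> r z w * measure Q (A \<inter> {\<omega> \<in> paths E. \<omega> r = z})) -
        (LBINT r:{s..t}. \<kappa> r w z * measure Q (A \<inter> {\<omega> \<in> paths E. \<omega> r = w})))"
  shows "has_jump_kernel E S Q \<kappa>"
proof -
  have E_sym: "E x y \<longleftrightarrow> E y x" for x y using sym by (auto simp: symp_def)
  let ?C = "\<lambda>r z. {\<omega> \<in> paths E. \<omega> r = z}"
  have cyl[measurable]: "?C r z \<in> sets Q" if "0 \<le> r" "r \<le> 1" for r z
    using that by (rule cyl_sets_Q)
  have main: "(\<forall>t\<in>{0..<1}. AE \<omega> in Q. set_integrable lborel {0..t} (\<lambda>s. generator E \<kappa> s u (\<omega> s))) \<and>
        path_martingale E Q (\<lambda>t \<omega>. u (\<omega> t) - u (\<omega> 0) - (LBINT s:{0..t}. generator E \<kappa> s u (\<omega> s)))"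
    if u: "finite {x. u x \<noteq> 0}" for u :: "'a \<Rightarrow> real"
  proof -
    define U where "U = {x. u x \<noteq> 0}"
    \<comment> \<open>Edges are symmetric, so the generator of u vanishes at every state outside U
      and its neighbours, and only the finitely many edges leaving N matter.\<close>
    define N where "N = U \<union> (\<Union>x\<in>U. {y. E x y})"
    have finU: "finite U" using u by (simp add: U_def)
    have finN: "finite N" using finU fin by (auto simp: N_def)
    define I where "I = Sigma N (\<lambda>z. {v. E z v})"
    have finI: "finite I" using finN fin by (auto simp: I_def)
    have gen0: "generator E \<kappa> r u x = 0" if "x \<notin> N" for r x
    proof -
      have "u x = 0" "\<And>y. E x y \<Longrightarrow> u y = 0" using that E_sym by (auto simp: N_def U_def)
      then show ?thesis by (simp add: generator_def)
    qed
    have gen: "generator E \<kappa> r u x = (\<Sum>(z,v)\<in>I. (u v - u z) * (\<kappa> r z v * indicator {z} x))" for r x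
    proof -
      have "(\<Sum>(z,v)\<in>I. (u v - u z) * (\<kappa> r z v * indicator {z} x)) =
        (\<Sum>z\<in>N. \<Sum>v | E z v. (u v - u z) * (\<kappa> r z v * indicator {z} x))"
        unfolding I_def using finN fin by (subst sum.Sigma) auto
      also have "\<dots> = (\<Sum>z\<in>N. if z = x then generator E \<kappa> r u z else 0)"
        by (intro sum.cong) (auto simp: generator_def indicator_def mult.assoc)
      also have "\<dots> = generator E \<kappa> r u x" using finN gen0[of x r] by auto
      finally show ?thesis ..
    qed
    have F: "AE \<omega> in Q. set_integrable lborel {0..t} (\<lambda>r. \<kappa> r (fst p) (snd p) * indicator {fst p} (\<omega> r))"
      "integrable Q (\<lambda>\<omega>. LBINT r:{0..t}. \<kappa> r (fst p) (snd p) * indicator {fst p} (\<omega> r))"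
      "A \<in> sets Q \<Longrightarrow> set_integrable lborel {0..t} (\<lambda>r. \<kappa> r (fst p) (snd p) * measure Q (A \<inter> ?C r (fst p)))"
      "A \<in> sets Q \<Longrightarrow> (\<integral>\<omega>\<in>A. (LBINT r:{0..t}. \<kappa> r (fst p) (snd p) * indicator {fst p} (\<omega> r)) \<partial>Q) =
        (LBINT r:{0..t}. \<kappa> r (fst p) (snd p) * measure Q (A \<inter> ?C r (fst p)))"
      if p: "p \<in> I" and t: "0 \<le> t" "t < 1" for p t A
    proof -
      have "set_integrable lborel {0..t} (\<lambda>r. \<kappa> r (fst p) (snd p) * measure Q (?C r (fst p)))"
        using p t by (intro int) (auto simp: I_def)
      note F = fubini_state[OF meas nonneg t this]
      show "AE \<omega> in Q. set_integrable lborel {0..t} (\<lambda>r. \<kappa> r (fst p) (snd p) * indicator {fst p} (\<omega> r))"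
        by (rule F(1))
      show "integrable Q (\<lambda>\<omega>. LBINT r:{0..t}. \<kappa> r (fst p) (snd p) * indicator {fst p} (\<omega> r))"
        by (rule F(2))
      show "A \<in> sets Q \<Longrightarrow> set_integrable lborel {0..t} (\<lambda>r. \<kappa> r (fst p) (snd p) * measure Q (A \<inter> ?C r (fst p)))"
        by (rule F(3))
      show "A \<in> sets Q \<Longrightarrow> (\<integral>\<omega>\<in>A. (LBINT r:{0..t}. \<kappa> r (fst p) (snd p) * indicator {fst p} (\<omega> r)) \<partial>Q) =
          (LBINT r:{0..t}. \<kappa> r (fst p) (snd p) * measure Q (A \<inter> ?C r (fst p)))"
        by (rule F(4))
    qed
    have AEint: "AE \<omega> in Q. \<forall>p\<in>I. set_integrable lborel {0..t} (\<lambda>r. \<kappa> r (fst p) (snd p) * indicator {fst p} (\<omega> r))"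
      if "0 \<le> t" "t < 1" for t
      using that finI F(1) by (intro AE_finite_allI) auto
    have 1: "AE \<omega> in Q. set_integrable lborel {0..t} (\<lambda>s. generator E \<kappa> s u (\<omega> s)) \<and>
        (LBINT s:{0..t}. generator E \<kappa> s u (\<omega> s)) =
        (\<Sum>p\<in>I. (u (snd p) - u (fst p)) * (LBINT r:{0..t}. \<kappa> r (fst p) (snd p) * indicator {fst p} (\<omega> r)))"
      if t: "0 \<le> t" "t < 1" for t
      using AEint[OF t]
    proof eventually_elim
      case (elim \<omega>)
      have i: "set_integrable lborel {0..t} (\<lambda>r. (u (snd p) - u (fst p)) * (\<kappa> r (fst p) (snd p) * indicator {fst p} (\<omega> r)))"
        if "p \<in> I" for p
        using elim that by (intro set_integrable_mult_right) auto
      show ?case unfolding gen case_prod_beta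
      proof (intro conjI)
        let ?f = "\<lambda>p r. (u (snd p) - u (fst p)) * (\<kappa> r (fst p) (snd p) * indicator {fst p} (\<omega> r))"
        show "set_integrable lborel {0..t} (\<lambda>r. \<Sum>p\<in>I. ?f p r)"
          by (rule set_integrable_sum'[OF i])
        have "(LBINT r:{0..t}. (\<Sum>p\<in>I. ?f p r)) = (\<Sum>p\<in>I. LBINT r:{0..t}. ?f p r)"
          by (rule set_integral_sum'[OF i])
        then show "(LBINT r:{0..t}. (\<Sum>p\<in>I. ?f p r)) =
          (\<Sum>p\<in>I. (u (snd p) - u (fst p)) * (LBINT r:{0..t}. \<kappa> r (fst p) (snd p) * indicator {fst p} (\<omega> r)))"
          by simp
      qed
    qed
    let ?M = "\<lambda>t \<omega>. u (\<omega> t) - u (\<omega> 0) - (LBINT s:{0..t}. generator E \<kappa> s u (\<omega> s))"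
    have um: "(\<lambda>\<omega>. u (\<omega> r)) \<in> borel_measurable (path_sigma E {0..t})" if "0 \<le> r" "r \<le> t" for r t
      by (rule measurable_compose[OF coord_measurable]) (use that in auto)
    have Lm: "(\<lambda>\<omega>. LBINT s:{0..t}. generator E \<kappa> s u (\<omega> s)) \<in> borel_measurable (path_sigma E {0..t})"
      if t: "0 \<le> t" "t < 1" for t
    proof (rule path_integral_measurable)
      show "(\<lambda>s. indicator {0..t} s * generator E \<kappa> s u x) \<in> borel_measurable borel" for x
        unfolding generator_def
        by (rule indicator_measurable_01) (use t meas in \<open>auto intro!: borel_measurable_sum borel_measurable_times\<close>)
    qed (use t in auto)
    have Mm: "?M t \<in> borel_measurable (path_sigma E {0..t})" if t: "0 \<le> t" "t < 1" for t
      using um[of t t] um[of 0 t] Lm[OF t] t by simp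
    have ui: "integrable Q (\<lambda>\<omega>. u (\<omega> r))" if r: "0 \<le> r" "r \<le> 1" for r
    proof (rule integrable_const_bound)
      show "AE \<omega> in Q. norm (u (\<omega> r)) \<le> Max (insert 0 ((\<lambda>x. \<bar>u x\<bar>) ` U))"
      proof (rule AE_I2)
        fix \<omega>
        have "\<bar>u (\<omega> r)\<bar> \<in> insert 0 ((\<lambda>x. \<bar>u x\<bar>) ` U)" by (auto simp: U_def)
        then show "norm (u (\<omega> r)) \<le> Max (insert 0 ((\<lambda>x. \<bar>u x\<bar>) ` U))"
          using finU by (auto intro!: Max_ge)
      qed
      show "(\<lambda>\<omega>. u (\<omega> r)) \<in> borel_measurable Q"
        by (rule measurable_path_sigma_Q[OF _ um[of r 1]]) (use r in auto)
    qed
    have Li: "integrable Q (\<lambda>\<omega>. LBINT s:{0..t}. generator E \<kappa> s u (\<omega> s))"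
      and LA: "\<And>A. A \<in> sets Q \<Longrightarrow> (\<integral>\<omega>\<in>A. (LBINT s:{0..t}. generator E \<kappa> s u (\<omega> s)) \<partial>Q) =
        (\<Sum>p\<in>I. (u (snd p) - u (fst p)) * (LBINT r:{0..t}. \<kappa> r (fst p) (snd p) * measure Q (A \<inter> ?C r (fst p))))"
      if t: "0 \<le> t" "t < 1" for t
    proof -
      let ?L = "\<lambda>\<omega>. \<Sum>p\<in>I. (u (snd p) - u (fst p)) * (LBINT r:{0..t}. \<kappa> r (fst p) (snd p) * indicator {fst p} (\<omega> r))"
      have ae: "AE \<omega> in Q. (LBINT s:{0..t}. generator E \<kappa> s u (\<omega> s)) = ?L \<omega>"
        using 1[OF t] by eventually_elim simp
      have Lm': "(\<lambda>\<omega>. LBINT s:{0..t}. generator E \<kappa> s u (\<omega> s)) \<in> borel_measurable Q"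
        by (rule measurable_path_sigma_Q[OF _ Lm[OF t]]) (use t in auto)
      have iL: "integrable Q ?L"
        using F(2) t by (intro Bochner_Integration.integrable_sum integrable_mult_right) auto
      show "integrable Q (\<lambda>\<omega>. LBINT s:{0..t}. generator E \<kappa> s u (\<omega> s))"
        by (rule integrable_cong_AE[THEN iffD2, OF Lm' borel_measurable_integrable[OF iL] ae iL])
      fix A assume A[measurable]: "A \<in> sets Q"
      have "(\<integral>\<omega>\<in>A. (LBINT s:{0..t}. generator E \<kappa> s u (\<omega> s)) \<partial>Q) = (\<integral>\<omega>\<in>A. ?L \<omega> \<partial>Q)"
        unfolding set_lebesgue_integral_def[of Q]
        using Lm' iL A ae by (intro integral_cong_AE) auto
      also have "\<dots> = (\<Sum>p\<in>I. (\<integral>\<omega>\<in>A. (u (snd p) - u (fst p)) * (LBINT r:{0..t}. \<kappa> r (fst p) (snd p) * indicator {fst p} (\<omega> r)) \<partial>Q))"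
      proof (rule set_integral_sum')
        fix p assume "p \<in> I"
        then show "set_integrable Q A (\<lambda>\<omega>. (u (snd p) - u (fst p)) * (LBINT r:{0..t}. \<kappa> r (fst p) (snd p) * indicator {fst p} (\<omega> r)))"
          using F(2) t A unfolding set_integrable_def
          by (intro integrable_mult_indicator integrable_mult_right) auto
      qed
      also have "\<dots> = (\<Sum>p\<in>I. (u (snd p) - u (fst p)) * (LBINT r:{0..t}. \<kappa> r (fst p) (snd p) * measure Q (A \<inter> ?C r (fst p))))"
        using F(4)[OF _ t A] by (intro sum.cong) auto
      finally show "(\<integral>\<omega>\<in>A. (LBINT s:{0..t}. generator E \<kappa> s u (\<omega> s)) \<partial>Q) =
        (\<Sum>p\<in>I. (u (snd p) - u (fst p)) * (LBINT r:{0..t}. \<kappa> r (fst p) (snd p) * measure Q (A \<inter> ?C r (fst p))))" .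
    qed
    have Mi: "integrable Q (?M t)" if t: "0 \<le> t" "t < 1" for t
      using ui[of t] ui[of 0] Li[OF t] t by simp
    have uA: "(\<integral>\<omega>\<in>A. u (\<omega> r) \<partial>Q) = (\<Sum>w\<in>U. u w * measure Q (A \<inter> ?C r w))"
      if A[measurable]: "A \<in> sets Q" and r: "0 \<le> r" "r \<le> 1" for A r
    proof -
      have m: "A \<inter> ?C r w \<in> sets Q" for w using A cyl[OF r] by blast
      have i: "A \<inter> ?C r w \<inter> paths E = A \<inter> ?C r w" for w by auto
      have "(\<integral>\<omega>\<in>A. u (\<omega> r) \<partial>Q) = (\<integral>\<omega>. (\<Sum>w\<in>U. u w * indicator (A \<inter> ?C r w) \<omega>) \<partial>Q)"
        unfolding set_lebesgue_integral_def
      proof (rule Bochner_Integration.integral_cong[OF refl])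
        fix \<omega> assume "\<omega> \<in> space Q"
        then have "(\<Sum>w\<in>U. u w * indicator (A \<inter> ?C r w) \<omega>) = (\<Sum>w\<in>U. if w = \<omega> r then indicator A \<omega> * u w else 0)"
          by (intro sum.cong) (auto simp: indicator_def)
        also have "\<dots> = indicator A \<omega> *\<^sub>R u (\<omega> r)" using finU by (auto simp: U_def)
        finally show "indicator A \<omega> *\<^sub>R u (\<omega> r) = (\<Sum>w\<in>U. u w * indicator (A \<inter> ?C r w) \<omega>)" ..
      qed
      also have "\<dots> = (\<Sum>w\<in>U. u w * measure Q (A \<inter> ?C r w))"
        using m by (subst Bochner_Integration.integral_sum) (auto intro!: integrable_mult_right integrable_real_indicator simp: emeasure_eq_measure i)
      finally show ?thesis .
    qed
    have martingale: "(\<integral>\<omega>\<in>A. ?M t \<omega> \<partial>Q) = (\<integral>\<omega>\<in>A. ?M s \<omega> \<partial>Q)"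
      if A: "A \<in> sets (path_sigma E {0..s})" and st: "0 \<le> s" "s \<le> t" "t < 1" for A s t
    proof -
      have AQ[measurable]: "A \<in> sets Q" by (rule sets_path_sigma_Q[OF _ A]) (use st in auto)
      have si: "set_integrable Q A f" if "integrable Q f" for f :: "_ \<Rightarrow> real"
        unfolding set_integrable_def by (rule integrable_mult_indicator[OF AQ that])
      have split: "(\<integral>\<omega>\<in>A. ?M r \<omega> \<partial>Q) = (\<Sum>w\<in>U. u w * measure Q (A \<inter> ?C r w)) - (\<integral>\<omega>\<in>A. u (\<omega> 0) \<partial>Q) -
          (\<Sum>p\<in>I. (u (snd p) - u (fst p)) * (LBINT x:{0..r}. \<kappa> x (fst p) (snd p) * measure Q (A \<inter> ?C x (fst p))))"
        if r: "0 \<le> r" "r < 1" for r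
        using si[OF ui[of r]] si[OF ui[of 0]] si[OF Li[OF r]] r LA[OF r AQ] uA[OF AQ, of r]
        by (simp add: set_integral_diff)
      \<comment> \<open>The expected number of jumps from z to v during [s,t] on the event
        A.\<close>
      let ?q = "\<lambda>z v. LBINT x:{s..t}. \<kappa> x z v * measure Q (A \<inter> ?C x z)"
      have q: "(LBINT x:{0..t}. \<kappa> x z v * measure Q (A \<inter> ?C x z)) -
          (LBINT x:{0..s}. \<kappa> x z v * measure Q (A \<inter> ?C x z)) = ?q z v" if "(z, v) \<in> I" for z v
        using set_integral_split[OF F(3)[OF that _ _ AQ, of t], of s] st by simp
      have "(\<Sum>p\<in>I. (u (snd p) - u (fst p)) * (LBINT x:{0..t}. \<kappa> x (fst p) (snd p) * measure Q (A \<inter> ?C x (fst p)))) -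
          (\<Sum>p\<in>I. (u (snd p) - u (fst p)) * (LBINT x:{0..s}. \<kappa> x (fst p) (snd p) * measure Q (A \<inter> ?C x (fst p)))) =
          (\<Sum>p\<in>I. (u (snd p) - u (fst p)) * ?q (fst p) (snd p))"
        unfolding sum_subtractf[symmetric] right_diff_distrib[symmetric]
        by (intro sum.cong refl arg_cong2[where f = times] q) auto
      also have "\<dots> = (\<Sum>p\<in>I. u (snd p) * ?q (fst p) (snd p)) - (\<Sum>p\<in>I. u (fst p) * ?q (fst p) (snd p))"
        by (simp add: left_diff_distrib sum_subtractf)
      also have "(\<Sum>p\<in>I. u (fst p) * ?q (fst p) (snd p)) = (\<Sum>z\<in>N. \<Sum>v | E z v. u z * ?q z v)"
        unfolding I_def using finN fin by (subst sum.Sigma) (auto simp: case_prod_beta')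
      also have "\<dots> = (\<Sum>z\<in>U. \<Sum>v | E z v. u z * ?q z v)"
        using finN by (intro sum.mono_neutral_right) (auto simp: N_def U_def)
      \<comment> \<open>Regroups the inflow by target state: swapping the ends of an edge gives an
        edge again, and targets outside U carry no weight.\<close>
      also have "(\<Sum>p\<in>I. u (snd p) * ?q (fst p) (snd p)) = (\<Sum>p\<in>Sigma U (\<lambda>w. {z. E w z}). u (fst p) * ?q (snd p) (fst p))"
      proof -
        have "(\<Sum>p\<in>I. u (snd p) * ?q (fst p) (snd p)) = (\<Sum>p\<in>{p\<in>I. snd p \<in> U}. u (snd p) * ?q (fst p) (snd p))"
          using finI by (intro sum.mono_neutral_right) (auto simp: U_def)
        also have "\<dots> = (\<Sum>p\<in>Sigma U (\<lambda>w. {z. E w z}). u (fst p) * ?q (snd p) (fst p))"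
          by (rule sum.reindex_bij_witness[of _ prod.swap prod.swap])
            (auto simp: I_def N_def intro: E_sym[THEN iffD1])
        finally show ?thesis .
      qed
      also have "\<dots> = (\<Sum>w\<in>U. \<Sum>z | E w z. u w * ?q z w)"
        using finU fin by (subst sum.Sigma) (auto simp: case_prod_beta')
      also have "(\<Sum>w\<in>U. \<Sum>z | E w z. u w * ?q z w) - (\<Sum>z\<in>U. \<Sum>v | E z v. u z * ?q z v) =
          (\<Sum>w\<in>U. u w * (\<Sum>z | E w z. ?q z w - ?q w z))"
        by (simp add: sum_subtractf sum_distrib_left right_diff_distrib)
      also have "\<dots> = (\<Sum>w\<in>U. u w * (measure Q (A \<inter> ?C t w) - measure Q (A \<inter> ?C s w)))"
        using fwd[OF A st] by simp
      finally show ?thesis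
        using st by (simp add: split right_diff_distrib sum_subtractf)
    qed
    have "path_martingale E Q ?M"
      unfolding path_martingale_def
    proof (intro conjI ballI allI impI)
      fix t :: real assume "t \<in> {0..<1}"
      then show "?M t \<in> borel_measurable (path_sigma E {0..t})" "integrable Q (?M t)"
        using Mm[of t] Mi[of t] by auto
    next
      fix s t :: real assume st: "0 \<le> s \<and> s \<le> t \<and> t < 1"
      interpret G: finite_measure_subalgebra Q "path_sigma E {0..s}"
        by unfold_locales (use subalgebra_Q st in auto)
      show "AE \<omega> in Q. real_cond_exp Q (path_sigma E {0..s}) (?M t) \<omega> = ?M s \<omega>"
        by (rule G.real_cond_exp_charact[OF martingale]) (use st Mi Mm in auto)
    qed
    moreover have "\<forall>t\<in>{0..<1}. AE \<omega> in Q. set_integrable lborel {0..t} (\<lambda>s. generator E \<kappa> s u (\<omega> s))"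
      using 1 by (auto elim!: eventually_mono)
    ultimately show ?thesis by blast
  qed
  show ?thesis
    unfolding has_jump_kernel_def using S nonneg edge meas main by auto
qed

end


section \<open>Short-time estimates for the reference walk\<close>

lemma path_section_measurable:
  fixes h :: "real \<Rightarrow> 'a :: countable \<Rightarrow> real"
  assumes \<omega>: "\<omega> \<in> paths E" and ab: "0 \<le> a" "a \<le> b" "b \<le> 1"
    and h: "\<And>x. (\<lambda>s. h s x) \<in> borel_measurable (restrict_space borel {0..<1})"
  shows "(\<lambda>s. indicator {a..b} s * h s (\<omega> s)) \<in> borel_measurable borel"
proof -
  have "(\<lambda>p. indicator {a..b} (fst p) * h (fst p) (snd p (clamp1 a b (fst p))))
    \<in> borel_measurable (borel \<Otimes>\<^sub>M path_sigma E {a..b})"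
    by (rule integrand_measurable[OF ab indicator_measurable_01[OF h]]) (use ab in auto)
  moreover have "(\<lambda>s. (s, \<omega>)) \<in> borel \<rightarrow>\<^sub>M borel \<Otimes>\<^sub>M path_sigma E {a..b}"
    using \<omega> by (intro measurable_Pair) auto
  ultimately have "(\<lambda>s. indicator {a..b} (fst (s, \<omega>)) * h (fst (s, \<omega>)) (snd (s, \<omega>) (clamp1 a b (fst (s, \<omega>))))) \<in> borel_measurable borel"
    by (rule measurable_compose[rotated])
  also have "(\<lambda>s. indicator {a..b} (fst (s, \<omega>)) * h (fst (s, \<omega>)) (snd (s, \<omega>) (clamp1 a b (fst (s, \<omega>))))) =
    (\<lambda>s. indicator {a..b} s * h s (\<omega> s))"
    by (auto simp: indicator_def fun_eq_iff)
  finally show ?thesis .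
qed

lemma set_integral_bound:
  fixes f :: "real \<Rightarrow> real"
  assumes "(\<lambda>s. indicator {a..b} s * f s) \<in> borel_measurable borel" "a \<le> b"
    and "\<And>s. s \<in> {a..b} \<Longrightarrow> \<bar>f s\<bar> \<le> c"
  shows "set_integrable lborel {a..b} f" "\<bar>LBINT s:{a..b}. f s\<bar> \<le> c * (b - a)"
proof -
  have const: "set_integrable lborel {a..b} (\<lambda>_. c)"
    unfolding set_integrable_def
    by (intro integrable_scaleR_left integrable_real_indicator) (auto simp: emeasure_lborel_Icc_eq)
  show int: "set_integrable lborel {a..b} f"
    unfolding set_integrable_def
  proof (rule Bochner_Integration.integrable_bound[OF const[unfolded set_integrable_def]])
    show "AE s in lborel. norm (indicator {a..b} s *\<^sub>R f s) \<le> norm (indicator {a..b} s *\<^sub>R c)"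
      using assms(3) by (intro AE_I2) (force simp: indicator_def)
  qed (use assms(1) in simp)
  have "\<bar>LBINT s:{a..b}. f s\<bar> \<le> (LBINT s:{a..b}. \<bar>f s\<bar>)"
    unfolding set_lebesgue_integral_def using integral_abs_bound[of lborel "\<lambda>s. indicator {a..b} s *\<^sub>R f s"]
    by (simp add: abs_mult)
  also have "\<dots> \<le> (LBINT s:{a..b}. c)"
    using set_integrable_abs[OF int] const assms(3) by (rule set_integral_mono)
  also have "\<dots> = c * (b - a)"
    using assms(2) by (simp add: set_lebesgue_integral_def)
  finally show "\<bar>LBINT s:{a..b}. f s\<bar> \<le> c * (b - a)" .
qed

lemma path_integral_bound:
  fixes h :: "real \<Rightarrow> 'a :: countable \<Rightarrow> real"
  assumes "\<omega> \<in> paths E" "0 \<le> a" "a \<le> b" "b \<le> 1"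
    and "\<And>x. (\<lambda>s. h s x) \<in> borel_measurable (restrict_space borel {0..<1})"
    and "\<And>s x. s \<in> {a..b} \<Longrightarrow> \<bar>h s x\<bar> \<le> c"
  shows "set_integrable lborel {a..b} (\<lambda>s. h s (\<omega> s))" "\<bar>LBINT s:{a..b}. h s (\<omega> s)\<bar> \<le> c * (b - a)"
  using set_integral_bound[of a b "\<lambda>s. h s (\<omega> s)" c, OF path_section_measurable[OF assms(1-5)] assms(3)]
    assms(6) by auto

section \<open>Detecting moves on grids\<close>

lemma moves_grid:
  assumes \<omega>: "\<omega> \<in> paths E" and ab: "0 \<le> a" "a \<le> b" "b \<le> 1"
    and "moves \<omega> a b"
  shows "\<forall>\<^sub>F n in sequentially. \<exists>i\<le>n. \<omega> (grid a b n i) \<noteq> \<omega> a"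
proof -
  obtain p where p: "a \<le> p" "p \<le> b" "\<omega> p \<noteq> \<omega> a" using assms(5) by (auto simp: moves_def)
  have "\<forall>\<^sub>F n in sequentially. \<omega> (up a b n p) = \<omega> p"
    by (rule paths_up[OF \<omega>]) (use p ab in auto)
  moreover have "\<forall>\<^sub>F n in sequentially. (0::nat) < n" by (rule eventually_gt_at_top)
  ultimately show ?thesis
  proof eventually_elim
    case (elim n)
    then show ?case using up_eq_grid[OF elim(2) p(1,2)] p(3) by metis
  qed
qed

text \<open>The form is made for the Markov property at the grid time l: having left the start is an
  event of the past, the change over the next cell one of the future. Between the indices of q and r
  some cell shows a change, and by then the state at p or at q has already differed from the
  start.\<close>

lemma moves_twice_grid:
  assumes \<omega>: "\<omega> \<in> paths E" and ab: "0 \<le> a" "a \<le> b" "b \<le> 1"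
    and "moves_twice \<omega> a b"
  shows "\<forall>\<^sub>F n in sequentially. \<exists>l<n. (\<exists>i\<le>l. \<omega> (grid a b n i) \<noteq> \<omega> a) \<and> \<omega> (grid a b n l) \<noteq> \<omega> (grid a b n (Suc l))"
proof -
  obtain p q r where p: "a \<le> p" "p \<le> q" "q \<le> r" "r \<le> b" "\<omega> p \<noteq> \<omega> q" "\<omega> q \<noteq> \<omega> r"
    using assms(5) by (auto simp: moves_twice_def)
  have "\<forall>\<^sub>F n in sequentially. \<omega> (up a b n p) = \<omega> p"
    by (rule paths_up[OF \<omega>]) (use p ab in auto)
  moreover have "\<forall>\<^sub>F n in sequentially. \<omega> (up a b n q) = \<omega> q"
    by (rule paths_up[OF \<omega>]) (use p ab in auto)
  moreover have "\<forall>\<^sub>F n in sequentially. \<omega> (up a b n r) = \<omega> r"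
    by (rule paths_up[OF \<omega>]) (use p ab in auto)
  moreover have "\<forall>\<^sub>F n in sequentially. (0::nat) < n" by (rule eventually_gt_at_top)
  ultimately show ?thesis
  proof eventually_elim
    case (elim n)
    define I where "I p = nat \<lceil>(p - a) / (b - a) * n\<rceil>" for p
    have I_mono: "I p \<le> I q" if "p \<le> q" for p q
      unfolding I_def using that ab by (intro nat_mono ceiling_mono mult_right_mono divide_right_mono) auto
    have I: "up a b n s = grid a b n (I s)" "I s \<le> n" if "a \<le> s" "s \<le> b" for s
      unfolding I_def using up_eq_grid[OF elim(4) that] by auto
    let ?g = "\<lambda>i. \<omega> (grid a b n i)"
    have g: "?g (I p) = \<omega> p" "?g (I q) = \<omega> q" "?g (I r) = \<omega> r"
      using elim I(1)[of p] I(1)[of q] I(1)[of r] p by auto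
    have le: "I p \<le> I q" "I q \<le> I r" "I r \<le> n" using I_mono p I(2)[of r] by auto
    have "\<exists>l. I q \<le> l \<and> l < I r \<and> ?g l \<noteq> ?g (Suc l)"
    proof (rule ccontr)
      assume "\<not> ?thesis"
      then have c: "?g (Suc l) = ?g l" if "I q \<le> l" "l < I r" for l using that by metis
      have "?g k = ?g (I q)" if "I q \<le> k" "k \<le> I r" for k
        using that by (induction k rule: dec_induct) (use c in auto)
      from this[OF le(2) order_refl] have "\<omega> r = \<omega> q" unfolding g .
      with p(6) show False by simp
    qed
    then obtain l where l: "I q \<le> l" "l < I r" "?g l \<noteq> ?g (Suc l)" by auto
    moreover have "\<exists>i\<le>l. ?g i \<noteq> \<omega> a"
    proof (cases "\<omega> p = \<omega> a")
      case True
      then have "?g (I q) \<noteq> \<omega> a" unfolding g(2) using p(5) by simp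
      with l(1) show ?thesis by blast
    next
      case False
      then have "?g (I p) \<noteq> \<omega> a" unfolding g(1) .
      with l(1) le(1) order_trans show ?thesis by blast
    qed
    moreover have "l < n" using l(2) le(3) by simp
    ultimately show ?case by blast
  qed
qed

lemma moves_sets:
  fixes E :: "'a :: countable \<Rightarrow> 'a \<Rightarrow> bool"
  assumes ab: "0 \<le> a" "a \<le> b" "b \<le> 1"
  shows "{\<omega> \<in> paths E. moves \<omega> a b} \<in> sets (path_sigma E {a..b})"
proof -
  let ?N = "path_sigma E {a..b}"
  have "{\<omega> \<in> paths E. moves \<omega> a b} = {\<omega> \<in> space ?N. \<exists>n i. 0 < n \<and> i \<le> n \<and> \<omega> (grid a b n i) \<noteq> \<omega> a}"
  proof (intro set_eqI iffI)
    fix \<omega> assume "\<omega> \<in> {\<omega> \<in> paths E. moves \<omega> a b}"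
    then have "\<omega> \<in> paths E" and ev: "\<forall>\<^sub>F n in sequentially. \<exists>i\<le>n. \<omega> (grid a b n i) \<noteq> \<omega> a"
      using moves_grid[OF _ ab] by auto
    have "\<forall>\<^sub>F n in sequentially. (0::nat) < n" by (rule eventually_gt_at_top)
    with ev have "\<forall>\<^sub>F n in sequentially. \<exists>i. 0 < n \<and> i \<le> n \<and> \<omega> (grid a b n i) \<noteq> \<omega> a"
      by eventually_elim auto
    from eventually_happens[OF this] \<open>\<omega> \<in> paths E\<close>
    show "\<omega> \<in> {\<omega> \<in> space ?N. \<exists>n i. 0 < n \<and> i \<le> n \<and> \<omega> (grid a b n i) \<noteq> \<omega> a}" by auto
  next
    fix \<omega> assume "\<omega> \<in> {\<omega> \<in> space ?N. \<exists>n i. 0 < n \<and> i \<le> n \<and> \<omega> (grid a b n i) \<noteq> \<omega> a}"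
    then obtain n i where n: "\<omega> \<in> paths E" "0 < n" "i \<le> n" "\<omega> (grid a b n i) \<noteq> \<omega> a" by auto
    then have "moves \<omega> a b"
      unfolding moves_def using grid_in[OF ab(2) n(2,3)] by (intro exI[of _ "grid a b n i"]) simp
    with n show "\<omega> \<in> {\<omega> \<in> paths E. moves \<omega> a b}" by simp
  qed
  also have "\<dots> \<in> sets ?N"
  proof (intro sets.sets_Collect_countable_Ex)
    fix n i
    show "{\<omega> \<in> space ?N. 0 < n \<and> i \<le> n \<and> \<omega> (grid a b n i) \<noteq> \<omega> a} \<in> sets ?N"
    proof (cases "0 < n \<and> i \<le> n")
      case True
      then have "(\<lambda>\<omega>. \<omega> (grid a b n i) \<noteq> \<omega> a) \<in> ?N \<rightarrow>\<^sub>M count_space UNIV"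
        using grid_in[OF ab(2), of n i] ab by (intro coord2_measurable) auto
      from measurable_sets[OF this, of "{True}"]
      have "{\<omega> \<in> space ?N. \<omega> (grid a b n i) \<noteq> \<omega> a} \<in> sets ?N"
        by (simp add: vimage_def Int_def conj_commute)
      then show ?thesis by (simp only: True simp_thms)
    next
      case False
      then have "{\<omega> \<in> space ?N. 0 < n \<and> i \<le> n \<and> \<omega> (grid a b n i) \<noteq> \<omega> a} = {}" by blast
      then show ?thesis by (simp only: sets.empty_sets)
    qed
  qed
  finally show ?thesis .
qed

lemma moves_twice_sets:
  fixes E :: "'a :: countable \<Rightarrow> 'a \<Rightarrow> bool"
  assumes ab: "0 \<le> a" "a \<le> b" "b \<le> 1"
  shows "{\<omega> \<in> paths E. moves_twice \<omega> a b} \<in> sets (path_sigma E {a..b})"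
proof -
  let ?N = "path_sigma E {a..b}"
  let ?S = "{\<omega> \<in> space ?N. \<exists>n l i. l < n \<and> i \<le> l \<and> \<omega> (grid a b n i) \<noteq> \<omega> a \<and> \<omega> (grid a b n l) \<noteq> \<omega> (grid a b n (Suc l))}"
  have "{\<omega> \<in> paths E. moves_twice \<omega> a b} = ?S"
  proof (intro set_eqI iffI)
    fix \<omega> assume "\<omega> \<in> {\<omega> \<in> paths E. moves_twice \<omega> a b}"
    then have \<omega>: "\<omega> \<in> paths E" "moves_twice \<omega> a b" by auto
    from eventually_happens[OF moves_twice_grid[OF \<omega>(1) ab \<omega>(2)]] obtain n l i
      where "l < n" "i \<le> l" "\<omega> (grid a b n i) \<noteq> \<omega> a" "\<omega> (grid a b n l) \<noteq> \<omega> (grid a b n (Suc l))" by auto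
    with \<omega>(1) show "\<omega> \<in> ?S" unfolding space_path_sigma by blast
  next
    fix \<omega> assume "\<omega> \<in> ?S"
    then obtain n l i where \<omega>: "\<omega> \<in> paths E" "l < n" "i \<le> l" "\<omega> (grid a b n i) \<noteq> \<omega> a"
      "\<omega> (grid a b n l) \<noteq> \<omega> (grid a b n (Suc l))" by auto
    have m: "grid a b n i \<le> grid a b n l" "grid a b n l \<le> grid a b n (Suc l)"
      "a \<le> grid a b n i" "grid a b n (Suc l) \<le> b"
      using grid_mono[OF ab(2), of i l n] grid_mono[OF ab(2), of l "Suc l" n] \<omega>
        grid_in[OF ab(2), of n i] grid_in[OF ab(2), of n "Suc l"] by auto
    \<comment> \<open>If the path is back at its start at index l, the excursion seen at index i is
      the first move; otherwise the start itself differs from the state at l.\<close>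
    have "\<exists>q. a \<le> q \<and> q \<le> grid a b n l \<and> (\<exists>p. a \<le> p \<and> p \<le> q \<and> \<omega> p \<noteq> \<omega> q) \<and> \<omega> q \<noteq> \<omega> (grid a b n (Suc l))"
    proof (cases "\<omega> (grid a b n l) = \<omega> a")
      case True
      then have "\<omega> (grid a b n i) \<noteq> \<omega> (grid a b n l)" using \<omega> by simp
      with m \<omega> show ?thesis using order_trans by blast
    next
      case False
      then have "\<omega> a \<noteq> \<omega> (grid a b n l)" by simp
      with m \<omega> show ?thesis using order_trans order_refl by blast
    qed
    then obtain p q where "a \<le> p" "p \<le> q" "q \<le> grid a b n l" "\<omega> p \<noteq> \<omega> q" "\<omega> q \<noteq> \<omega> (grid a b n (Suc l))" by blast
    then have "moves_twice \<omega> a b" unfolding moves_twice_def using m order_trans by blast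
    then show "\<omega> \<in> {\<omega> \<in> paths E. moves_twice \<omega> a b}" using \<omega> by simp
  qed
  also have "\<dots> \<in> sets ?N"
  proof (intro sets.sets_Collect_countable_Ex)
    fix n l i
    show "{\<omega> \<in> space ?N. l < n \<and> i \<le> l \<and> \<omega> (grid a b n i) \<noteq> \<omega> a \<and> \<omega> (grid a b n l) \<noteq> \<omega> (grid a b n (Suc l))} \<in> sets ?N"
    proof (cases "l < n \<and> i \<le> l")
      case True
      then have g: "grid a b n i \<in> {a..b}" "grid a b n l \<in> {a..b}" "grid a b n (Suc l) \<in> {a..b}"
        using grid_in[OF ab(2), of n] by auto
      have "(\<lambda>\<omega>. \<omega> (grid a b n i) \<noteq> \<omega> a) \<in> ?N \<rightarrow>\<^sub>M count_space UNIV"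
        "(\<lambda>\<omega>. \<omega> (grid a b n l) \<noteq> \<omega> (grid a b n (Suc l))) \<in> ?N \<rightarrow>\<^sub>M count_space UNIV"
        using g ab by (intro coord2_measurable; auto)+
      from this[THEN measurable_sets, of "{True}"]
      have "{\<omega> \<in> paths E. \<omega> (grid a b n i) \<noteq> \<omega> a} \<in> sets ?N"
        "{\<omega> \<in> paths E. \<omega> (grid a b n l) \<noteq> \<omega> (grid a b n (Suc l))} \<in> sets ?N"
        by (simp_all add: vimage_def Int_def conj_commute)
      from sets.Int[OF this]
      have "{\<omega> \<in> space ?N. \<omega> (grid a b n i) \<noteq> \<omega> a \<and> \<omega> (grid a b n l) \<noteq> \<omega> (grid a b n (Suc l))} \<in> sets ?N"
        by (rule back_subst[of "\<lambda>X. X \<in> sets ?N"]) auto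
      then show ?thesis by (simp only: True simp_thms)
    next
      case False
      then have "{\<omega> \<in> space ?N. l < n \<and> i \<le> l \<and> \<omega> (grid a b n i) \<noteq> \<omega> a \<and> \<omega> (grid a b n l) \<noteq> \<omega> (grid a b n (Suc l))} = {}" by blast
      then show ?thesis by (simp only: sets.empty_sets)
    qed
  qed
  finally show ?thesis .
qed

text \<open>Fatou's lemma for sets: U lies in the increasing union of the tail intersections of the
  S n.\<close>

lemma (in finite_measure) measure_eventually_le:
  assumes S: "\<And>n. S n \<in> sets M" "\<And>n. 0 < n \<Longrightarrow> measure M (S n) \<le> e"
    and U: "\<And>\<omega>. \<omega> \<in> U \<Longrightarrow> \<forall>\<^sub>F n in sequentially. \<omega> \<in> S n"
  shows "measure M U \<le> e"
proof -
  \<comment> \<open>Indices start at \<open>Suc N\<close>, hence are positive, where the bound e is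
    assumed.\<close>
  define T where "T N = (\<Inter>n. S (N + Suc n))" for N
  have T: "T N \<in> sets M" for N unfolding T_def using S(1) by (intro sets.countable_INT) auto
  have "incseq T"
  proof (rule incseq_SucI)
    fix N show "T N \<le> T (Suc N)"
      unfolding T_def by (auto, metis add_Suc_right add_Suc_shift)
  qed
  have "(\<lambda>N. measure M (T N)) \<longlonglongrightarrow> measure M (\<Union>N. T N)"
    using T \<open>incseq T\<close> by (intro finite_Lim_measure_incseq) auto
  moreover have "measure M (T N) \<le> e" for N
  proof -
    have "T N \<subseteq> S (N + Suc 0)" unfolding T_def by (rule INT_lower) simp
    then have "measure M (T N) \<le> measure M (S (N + Suc 0))"
      using S(1) by (intro finite_measure_mono)
    also have "\<dots> \<le> e" by (rule S) simp
    finally show ?thesis .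
  qed
  ultimately have *: "measure M (\<Union>N. T N) \<le> e"
    by (intro LIMSEQ_le_const2) auto
  have "U \<subseteq> (\<Union>N. T N)"
  proof
    fix \<omega> assume "\<omega> \<in> U"
    then obtain N where "\<And>n. N \<le> n \<Longrightarrow> \<omega> \<in> S n" using U by (auto simp: eventually_sequentially)
    then show "\<omega> \<in> (\<Union>N. T N)" by (auto simp: T_def intro!: exI[of _ N])
  qed
  then have "measure M U \<le> measure M (\<Union>N. T N)"
    using T by (intro finite_measure_mono sets.countable_UN) auto
  with * show ?thesis by simp
qed

section \<open>First consequences of the martingale problem for the reference walk\<close>

locale walk =
  fixes E :: "'a::countable \<Rightarrow> 'a \<Rightarrow> bool"
    and d :: "'a \<Rightarrow> 'a \<Rightarrow> real"
    and m :: "'a measure"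
    and R :: "(real \<Rightarrow> 'a) measure"
    and J :: "real \<Rightarrow> 'a \<Rightarrow> 'a \<Rightarrow> real"
  assumes standing: "standing_assumptions E d m R J"
begin

lemma reference: "reference_walk E m R J"
  and graph: "irreducible_graph E"
  and dist: "Metric_space UNIV d"
  using standing by (auto simp: standing_assumptions_def graph_distance_def)

lemma E_sym: "symp E" and E_irrefl: "\<not> E x x" and E_finite: "finite {y. E x y}"
  using graph by (auto simp: irreducible_graph_def irreflp_def)

lemma markov: "markov_measure E R"
  and jump_kernel: "has_jump_kernel E UNIV R J"
  and J_pos: "0 \<le> t \<Longrightarrow> t \<le> 1 \<Longrightarrow> E x y \<Longrightarrow> 0 < J t x y"
  and J_zero: "0 \<le> t \<Longrightarrow> t \<le> 1 \<Longrightarrow> \<not> E x y \<Longrightarrow> J t x y = 0"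
  using reference by (auto simp: reference_walk_def split: if_splits)

lemma J_nonneg: "0 \<le> t \<Longrightarrow> t \<le> 1 \<Longrightarrow> 0 \<le> J t x y"
  using J_pos[of t x y] J_zero[of t x y] by (cases "E x y") auto

lemma J_measurable: "(\<lambda>t. J t x y) \<in> borel_measurable (restrict_space borel {0..<1})"
  using jump_kernel by (auto simp: has_jump_kernel_def)

sublocale path_space E R
  using markov by unfold_locales (auto simp: markov_measure_def)

lemma cond_indep: "cond_indep E R"
  by (rule markov_imp_cond_indep[OF markov])

definition K :: real where
  "K = Sup {total_rate E J t x | t x. t \<in> {0..1}}"

lemma rate_bounds:
  assumes "0 \<le> t" "t \<le> 1"
  shows "0 \<le> total_rate E J t x" "total_rate E J t x \<le> K"
proof -
  show "0 \<le> total_rate E J t x"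
    unfolding total_rate_def using J_nonneg[OF assms] by (intro sum_nonneg) auto
  show "total_rate E J t x \<le> K"
    unfolding K_def using reference assms by (intro cSup_upper) (auto simp: reference_walk_def)
qed

lemma K_nonneg: "0 \<le> K"
  using rate_bounds[of 0 undefined] by simp

lemma J_le: "0 \<le> t \<Longrightarrow> t \<le> 1 \<Longrightarrow> J t x y \<le> K"
proof (cases "E x y")
  case True
  assume t: "0 \<le> t" "t \<le> 1"
  have "J t x y \<le> total_rate E J t x"
    unfolding total_rate_def using J_nonneg[OF t] E_finite True by (intro member_le_sum) auto
  with rate_bounds[OF t, of x] show ?thesis by linarith
qed (simp add: J_zero K_nonneg)

lemma rate_measurable: "(\<lambda>t. total_rate E J t x) \<in> borel_measurable (restrict_space borel {0..<1})"
  unfolding total_rate_def using J_measurable by (intro borel_measurable_sum) auto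

abbreviation C :: "real \<Rightarrow> 'a \<Rightarrow> (real \<Rightarrow> 'a) set" where
  "C t z \<equiv> {\<omega> \<in> paths E. \<omega> t = z}"

lemma R_C_finite: "0 \<le> t \<Longrightarrow> t \<le> 1 \<Longrightarrow> emeasure R (C t z) < \<infinity>"
  by (rule emeasure_cyl_finite) (use markov in \<open>auto simp: markov_measure_def\<close>)

lemma generator_indicator:
  assumes "0 \<le> r" "r \<le> 1"
  shows "generator E J r (indicator {w}) x = (if x = w then - total_rate E J r w else J r x w)"
proof (cases "x = w")
  case True
  have "generator E J r (indicator {w}) x = (\<Sum>y | E x y. - J r x y)"
    unfolding generator_def using True E_irrefl by (intro sum.cong) (auto simp: indicator_def)
  then show ?thesis using True by (simp add: total_rate_def sum_negf)
next
  case False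
  have "generator E J r (indicator {w}) x = (\<Sum>y | E x y. if y = w then J r x w else 0)"
    unfolding generator_def using False by (intro sum.cong) (auto simp: indicator_def)
  also have "\<dots> = J r x w" using E_finite J_zero[OF assms, of x w] by simp
  finally show ?thesis using False by simp
qed

lemma generator_bound:
  assumes "0 \<le> r" "r \<le> 1"
  shows "\<bar>generator E J r (indicator {w}) x\<bar> \<le> K" "- K \<le> generator E J r (indicator {w}) x"
  using generator_indicator[OF assms, of w x] rate_bounds[OF assms, of w] J_nonneg[OF assms, of x w]
    J_le[OF assms, of x w] by auto

lemma generator_measurable:
  "(\<lambda>r. generator E J r u x) \<in> borel_measurable (restrict_space borel {0..<1})"
  unfolding generator_def using J_measurable by (intro borel_measurable_sum borel_measurable_times) auto

text \<open>The martingale belonging to the indicator of w, tested on the event X_a = z, which has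
  finite measure even though R may be infinite.\<close>

lemma forward_R:
  assumes ab: "0 \<le> a" "a \<le> b" "b < 1"
  shows "measure R (C a z \<inter> C b w) - indicator {w} z * measure R (C a z) =
    (\<integral>\<omega>\<in>C a z. (LBINT r:{a..b}. generator E J r (indicator {w}) (\<omega> r)) \<partial>R)"
proof -
  define u :: "'a \<Rightarrow> real" where "u = indicator {w}"
  let ?A = "C a z"
  let ?M = "\<lambda>t \<omega>. u (\<omega> t) - u (\<omega> 0) - (LBINT s:{0..t}. generator E J s u (\<omega> s))"
  have A: "?A \<in> sets (path_sigma E {0..a})" by (rule cyl_sets) (use ab in auto)
  have AR[measurable]: "?A \<in> sets R" and BR[measurable]: "C b w \<in> sets R"
    using ab by (auto intro!: cyl_sets_Q)
  have Afin: "emeasure R ?A < \<infinity>" using ab by (intro R_C_finite) auto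
  have "finite {x. u x \<noteq> 0}" by (auto simp: u_def indicator_def)
  then have mart: "path_martingale E R ?M"
    using jump_kernel by (auto simp: has_jump_kernel_def)
  interpret G: sigma_finite_subalgebra R "path_sigma E {0..a}"
    by (rule sigma_finite_path_sigma[where t = a]) (use ab markov in \<open>auto simp: markov_measure_def\<close>)
  have Mi: "integrable R (?M b)" "integrable R (?M a)"
    using mart ab by (auto simp: path_martingale_def)
  have ae: "AE \<omega> in R. real_cond_exp R (path_sigma E {0..a}) (?M b) \<omega> = ?M a \<omega>"
    using mart ab by (auto simp: path_martingale_def)
  have "(\<integral>\<omega>\<in>?A. ?M b \<omega> \<partial>R) = (\<integral>\<omega>\<in>?A. real_cond_exp R (path_sigma E {0..a}) (?M b) \<omega> \<partial>R)"
    by (rule G.real_cond_exp_intA[OF Mi(1) A])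
  also have "\<dots> = (\<integral>\<omega>\<in>?A. ?M a \<omega> \<partial>R)"
    unfolding set_lebesgue_integral_def[of R] using ae borel_measurable_integrable[OF Mi(2)]
    by (intro integral_cong_AE) (auto elim!: eventually_mono)
  finally have eq: "(\<integral>\<omega>\<in>?A. ?M b \<omega> \<partial>R) = (\<integral>\<omega>\<in>?A. ?M a \<omega> \<partial>R)" .
  have si: "set_integrable R ?A (?M t)" if "integrable R (?M t)" for t
    unfolding set_integrable_def by (rule integrable_mult_indicator[OF AR that])
  have "0 = (\<integral>\<omega>\<in>?A. ?M b \<omega> - ?M a \<omega> \<partial>R)"
    using eq si Mi by (subst set_integral_diff) auto
  also have "\<dots> = (\<integral>\<omega>\<in>?A. u (\<omega> b) - u (\<omega> a) - (LBINT r:{a..b}. generator E J r u (\<omega> r)) \<partial>R)"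
    unfolding set_lebesgue_integral_def[of R]
  proof (rule Bochner_Integration.integral_cong[OF refl])
    fix \<omega> assume "\<omega> \<in> space R"
    then have \<omega>: "\<omega> \<in> paths E" by simp
    have "set_integrable lborel {0..b} (\<lambda>s. generator E J s u (\<omega> s))"
      unfolding u_def
      by (rule path_integral_bound(1)[OF \<omega> _ _ _ generator_measurable, where c = K]) (use ab generator_bound in auto)
    from set_integral_split[OF this ab(1,2)]
    show "indicator ?A \<omega> *\<^sub>R (?M b \<omega> - ?M a \<omega>) =
      indicator ?A \<omega> *\<^sub>R (u (\<omega> b) - u (\<omega> a) - (LBINT r:{a..b}. generator E J r u (\<omega> r)))" by simp
  qed
  also have "\<dots> = (\<integral>\<omega>\<in>?A. u (\<omega> b) - u (\<omega> a) \<partial>R) - (\<integral>\<omega>\<in>?A. (LBINT r:{a..b}. generator E J r u (\<omega> r)) \<partial>R)"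
  proof (rule set_integral_diff)
    have "(\<lambda>\<omega>. u (\<omega> t)) \<in> borel_measurable R" if "0 \<le> t" "t \<le> 1" for t
      by (rule measurable_path_sigma_Q[of "{t}"], use that in simp, rule measurable_compose[OF coord_measurable]) auto
    then have um: "(\<lambda>\<omega>. u (\<omega> b) - u (\<omega> a)) \<in> borel_measurable R" using ab by auto
    have Lm: "(\<lambda>\<omega>. LBINT r:{a..b}. generator E J r u (\<omega> r)) \<in> borel_measurable R"
      by (rule measurable_path_sigma_Q[of "{a..b}"], use ab in simp,
          rule path_integral_measurable[OF _ _ _ indicator_measurable_01[OF generator_measurable]]) (use ab in auto)
    show "set_integrable R ?A (\<lambda>\<omega>. u (\<omega> b) - u (\<omega> a))"
      unfolding set_integrable_def
      by (rule integrableI_bounded_set_indicator[where B = 1, OF AR um Afin]) (auto simp: u_def indicator_def)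
    show "set_integrable R ?A (\<lambda>\<omega>. LBINT r:{a..b}. generator E J r u (\<omega> r))"
      unfolding set_integrable_def
    proof (rule integrableI_bounded_set_indicator[where B = "K * (b - a)", OF AR Lm Afin])
      show "AE \<omega> in R. \<omega> \<in> ?A \<longrightarrow> norm (LBINT r:{a..b}. generator E J r u (\<omega> r)) \<le> K * (b - a)"
      proof (rule AE_I2, rule impI)
        fix \<omega> assume "\<omega> \<in> ?A"
        then have \<omega>: "\<omega> \<in> paths E" by simp
        show "norm (LBINT r:{a..b}. generator E J r u (\<omega> r)) \<le> K * (b - a)"
          unfolding u_def real_norm_def
          by (rule path_integral_bound(2)[OF \<omega> _ _ _ generator_measurable]) (use ab generator_bound in auto)
      qed
    qed
  qed
  also have "(\<integral>\<omega>\<in>?A. u (\<omega> b) - u (\<omega> a) \<partial>R) = (\<integral>\<omega>. indicator (?A \<inter> C b w) \<omega> - indicator {w} z * indicator ?A \<omega> \<partial>R)"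
    unfolding set_lebesgue_integral_def[of R]
    by (rule Bochner_Integration.integral_cong) (auto simp: u_def indicator_def)
  also have "\<dots> = measure R (?A \<inter> C b w) - indicator {w} z * measure R ?A"
  proof -
    have AB: "?A \<inter> C b w \<in> sets R" by measurable
    have "emeasure R (?A \<inter> C b w) < \<infinity>"
      by (rule order.strict_trans1[OF emeasure_mono Afin]) auto
    then have "integrable R (indicator (?A \<inter> C b w) :: _ \<Rightarrow> real)" "integrable R (indicator ?A :: _ \<Rightarrow> real)"
      using AB Afin by (auto intro!: integrable_real_indicator)
    moreover have "?A \<inter> C b w \<inter> space R = ?A \<inter> C b w" "?A \<inter> space R = ?A" by auto
    ultimately show ?thesis by (subst Bochner_Integration.integral_diff) (auto simp del: space_Q)
  qed
  finally show ?thesis by (simp add: u_def)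
qed

text \<open>The generator applied to the indicator of z is at least -K everywhere, so over a time b
  - a at most the fraction K (b - a) of the mass is lost.\<close>

lemma stay_R:
  assumes ab: "0 \<le> a" "a \<le> b" "b < 1"
  shows "measure R (C a z) * (1 - K * (b - a)) \<le> measure R (C a z \<inter> C b z)"
proof -
  have AR[measurable]: "C a z \<in> sets R" and BR[measurable]: "C b z \<in> sets R"
    using ab by (auto intro!: cyl_sets_Q)
  have fin: "emeasure R (C a z) < \<infinity>" "emeasure R (C b z) < \<infinity>" using ab R_C_finite[of a z] R_C_finite[of b z] by auto
  have "- (K * (b - a)) * measure R (C a z) \<le> (\<integral>\<omega>\<in>C a z. (LBINT r:{a..b}. generator E J r (indicator {z}) (\<omega> r)) \<partial>R)"
  proof (cases "integrable R (\<lambda>\<omega>. indicator (C a z) \<omega> *\<^sub>R (LBINT r:{a..b}. generator E J r (indicator {z}) (\<omega> r)))")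
    case True
    have "(\<integral>\<omega>. - (K * (b - a)) * indicator (C a z) \<omega> \<partial>R) \<le>
      (\<integral>\<omega>\<in>C a z. (LBINT r:{a..b}. generator E J r (indicator {z}) (\<omega> r)) \<partial>R)"
      unfolding set_lebesgue_integral_def[of R]
    proof (rule integral_mono[OF _ True])
      show "integrable R (\<lambda>\<omega>. - (K * (b - a)) * indicator (C a z) \<omega>)"
        using fin by (intro integrable_mult_right integrable_real_indicator) auto
      fix \<omega> assume "\<omega> \<in> space R"
      then have \<omega>: "\<omega> \<in> paths E" by simp
      have "\<bar>LBINT r:{a..b}. generator E J r (indicator {z}) (\<omega> r)\<bar> \<le> K * (b - a)"
        by (rule path_integral_bound(2)[OF \<omega> _ _ _ generator_measurable]) (use ab generator_bound in auto)
      then show "- (K * (b - a)) * indicator (C a z) \<omega> \<le>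
        indicator (C a z) \<omega> *\<^sub>R (LBINT r:{a..b}. generator E J r (indicator {z}) (\<omega> r))"
        by (auto simp: indicator_def)
    qed
    moreover have "C a z \<inter> space R = C a z" by auto
    ultimately show ?thesis by (simp del: space_Q)
  next
    \<comment> \<open>Here the Bochner integral takes its default value 0, which lies above the
      nonpositive bound.\<close>
    case False
    then show ?thesis
      using K_nonneg ab by (simp add: set_lebesgue_integral_def not_integrable_integral_eq mult_nonneg_nonneg)
  qed
  also have "\<dots> = measure R (C a z \<inter> C b z) - measure R (C a z)"
    using forward_R[OF ab, of z z] by simp
  finally show ?thesis by (simp add: algebra_simps)
qed

text \<open>Each state is charged at time 0, and by \<open>stay_R\<close> it stays charged across
  steps so short that K times their length is below 1.\<close>

lemma R_C_pos:
  assumes "0 \<le> t" "t < 1"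
  shows "0 < measure R (C t z)"
proof -
  have step: "measure R (C a z) * (1 - K * (b - a)) \<le> measure R (C b z)" if ab: "0 \<le> a" "a \<le> b" "b < 1" for a b
  proof -
    have "C a z \<in> sets R" "C b z \<in> sets R" using ab by (auto intro!: cyl_sets_Q)
    then have "measure R (C a z \<inter> C b z) \<le> measure R (C b z)"
      using R_C_finite[of b z] ab by (intro measure_mono_fmeasurable) (auto simp: fmeasurable_def)
    with stay_R[OF ab, of z] show ?thesis by linarith
  qed
  obtain n :: nat where n: "K * t < n" "0 < n"
    using reals_Archimedean2[of "max (K * t) 0"] by (metis max_less_iff_conj of_nat_0_less_iff)
  have "0 < measure R (C (grid 0 t n i) z)" if "i \<le> n" for i
    using that
  proof (induction i)
    case 0
    have "emeasure R (C 0 z) = emeasure m {z}"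
      using emeasure_marginal[of 0 z] reference by (simp add: reference_walk_def)
    also have "\<dots> > 0" using reference by (simp add: reference_walk_def)
    finally show ?case using R_C_finite[of 0 z] by (simp add: measure_def enn2real_positive_iff)
  next
    case (Suc i)
    have g: "0 \<le> grid 0 t n i" "grid 0 t n i \<le> grid 0 t n (Suc i)" "grid 0 t n (Suc i) < 1"
      using grid_in[of 0 t n i] grid_in[of 0 t n "Suc i"] grid_mono[of 0 t i "Suc i" n] Suc assms n by auto
    have "K * (grid 0 t n (Suc i) - grid 0 t n i) = K * t / n"
      by (simp add: grid_def diff_divide_distrib[symmetric] algebra_simps)
    also have "\<dots> < 1" using n by simp
    finally have "0 < 1 - K * (grid 0 t n (Suc i) - grid 0 t n i)" by simp
    then have "0 < measure R (C (grid 0 t n i) z) * (1 - K * (grid 0 t n (Suc i) - grid 0 t n i))"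
      using Suc by (intro mult_pos_pos) auto
    with step[OF g] show ?case by linarith
  qed
  from this[of n] n show ?thesis by simp
qed

end


text \<open>Takes the place of a vanishing derivative: n cells with error c ((t - s) / n)^2 each add
  up to c (t - s)^2 / n.\<close>

lemma zero_increment:
  fixes F :: "real \<Rightarrow> real"
  assumes "s \<le> t" and F: "\<And>a b. s \<le> a \<Longrightarrow> a \<le> b \<Longrightarrow> b \<le> t \<Longrightarrow> \<bar>F b - F a\<bar> \<le> c * (b - a)\<^sup>2"
  shows "F t = F s"
proof -
  have bound: "\<bar>F t - F s\<bar> \<le> c * (t - s)\<^sup>2 / n" if n: "0 < n" for n :: nat
  proof -
    have "F t - F s = (\<Sum>i<n. F (grid s t n (Suc i)) - F (grid s t n i))"
      using n by (subst sum_lessThan_telescope) simp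
    also have "\<bar>\<dots>\<bar> \<le> (\<Sum>i<n. c * (grid s t n (Suc i) - grid s t n i)\<^sup>2)"
    proof (rule order_trans[OF sum_abs sum_mono])
      fix i assume "i \<in> {..<n}"
      then show "\<bar>F (grid s t n (Suc i)) - F (grid s t n i)\<bar> \<le> c * (grid s t n (Suc i) - grid s t n i)\<^sup>2"
        using grid_in[OF assms(1), of n i] grid_in[OF assms(1), of n "Suc i"] grid_mono[OF assms(1), of i "Suc i" n]
        by (intro F) auto
    qed
    also have "\<dots> = (\<Sum>i<n. c * ((t - s) / n)\<^sup>2)"
      by (intro sum.cong) (auto simp: grid_def diff_divide_distrib[symmetric] algebra_simps)
    also have "\<dots> = c * (t - s)\<^sup>2 / n"
      using n by (simp add: power2_eq_square)
    finally show ?thesis .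
  qed
  have "(\<lambda>n. c * (t - s)\<^sup>2 / real n) \<longlonglongrightarrow> 0" by (rule lim_const_over_n)
  then have "\<bar>F t - F s\<bar> \<le> 0"
    by (rule LIMSEQ_le_const) (use bound in \<open>auto intro!: exI[of _ 1]\<close>)
  then show ?thesis by simp
qed

lemma neq_sets:
  fixes E :: "'a :: countable \<Rightarrow> 'a \<Rightarrow> bool"
  assumes "s \<in> I" "t \<in> I"
  shows "{\<omega> \<in> paths E. \<omega> s \<noteq> \<omega> t} \<in> sets (path_sigma E I)"
  using measurable_sets[OF coord2_measurable[OF assms, where f = "(\<noteq>)"], of "{True}"]
  by (simp add: vimage_def Int_def conj_commute)

lemma exp_diff_bound:
  fixes x y :: real
  assumes "0 \<le> x" "x + y \<le> k"
  shows "0 \<le> exp (x + y) - exp y" "exp (x + y) - exp y \<le> exp k * x"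
proof -
  have "exp (x + y) - exp y = exp (x + y) * (1 - exp (- x))"
    by (simp add: algebra_simps exp_add[symmetric])
  also have "\<dots> \<le> exp k * x"
    using assms exp_ge_add_one_self[of "- x"] by (intro mult_mono) auto
  finally show "exp (x + y) - exp y \<le> exp k * x" .
qed (use assms in simp)

section \<open>Conditional laws of the walk and bounds on its number of moves\<close>

context walk
begin

definition P :: "real \<Rightarrow> 'a \<Rightarrow> (real \<Rightarrow> 'a) measure" where
  "P a z = uniform_measure R (C a z)"

lemma sets_P [measurable_cong]: "sets (P a z) = sets R"
  by (simp add: P_def)

lemma space_P [simp]: "space (P a z) = paths E"
  by (simp add: P_def)

lemma R_C_emeasure:
  assumes "0 \<le> a" "a < 1"
  shows "emeasure R (C a z) \<noteq> 0" "emeasure R (C a z) \<noteq> \<infinity>" "emeasure R (C a z) \<noteq> top" "C a z \<in> sets R"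
proof -
  show "emeasure R (C a z) \<noteq> 0" using R_C_pos[OF assms, of z] by (auto simp: measure_def)
  show "emeasure R (C a z) \<noteq> \<infinity>" "emeasure R (C a z) \<noteq> top" using R_C_finite[of a z] assms by auto
  show "C a z \<in> sets R" using assms by (intro cyl_sets_Q) auto
qed

lemma prob_space_P: "0 \<le> a \<Longrightarrow> a < 1 \<Longrightarrow> prob_space (P a z)"
  unfolding P_def using R_C_emeasure[of a z] by (intro prob_space_uniform_measure) auto

lemma path_space_P: "finite_path_space E (P a z)" if "0 \<le> a" "a < 1"
proof -
  interpret prob_space "P a z" using that by (rule prob_space_P)
  show ?thesis by unfold_locales (simp add: path_measure_def sets_P sets_Q)
qed

lemma measurable_P: "I \<subseteq> {0..1} \<Longrightarrow> f \<in> path_sigma E I \<rightarrow>\<^sub>M N \<Longrightarrow> f \<in> P a z \<rightarrow>\<^sub>M N"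
  using measurable_path_sigma_Q[of I f N] measurable_cong_sets[OF sets_P refl] by blast

lemma sets_path_sigma_P: "I \<subseteq> {0..1} \<Longrightarrow> A \<in> sets (path_sigma E I) \<Longrightarrow> A \<in> sets (P a z)"
  unfolding sets_P by (rule sets_path_sigma_Q)

lemma AE_P_start: "0 \<le> a \<Longrightarrow> a < 1 \<Longrightarrow> AE \<omega> in P a z. \<omega> \<in> C a z"
  unfolding P_def using R_C_emeasure[of a z] by (intro AE_uniform_measureI) auto

lemma measure_P:
  "0 \<le> a \<Longrightarrow> a < 1 \<Longrightarrow> B \<in> sets R \<Longrightarrow> measure (P a z) B = measure R (C a z \<inter> B) / measure R (C a z)"
  unfolding P_def using R_C_emeasure[of a z] by (intro measure_uniform_measure) auto

lemma integral_P:
  fixes f :: "_ \<Rightarrow> real"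
  assumes a: "0 \<le> a" "a < 1" and f: "f \<in> borel_measurable R"
  shows "(\<integral>\<omega>. f \<omega> \<partial>P a z) = (\<integral>\<omega>\<in>C a z. f \<omega> \<partial>R) / measure R (C a z)"
proof -
  note e = R_C_emeasure[OF a, of z] and p = R_C_pos[OF a, of z]
  have "indicator (C a z) \<omega> / emeasure R (C a z) = ennreal (indicator (C a z) \<omega> / measure R (C a z))" for \<omega>
    using p e by (simp add: emeasure_eq_ennreal_measure divide_ennreal ennreal_indicator[symmetric] del: ennreal_indicator)
  then have "P a z = density R (\<lambda>\<omega>. ennreal (indicator (C a z) \<omega> / measure R (C a z)))"
    by (simp add: P_def uniform_measure_def)
  then have "(\<integral>\<omega>. f \<omega> \<partial>P a z) = (\<integral>\<omega>. (indicator (C a z) \<omega> / measure R (C a z)) *\<^sub>R f \<omega> \<partial>R)"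
    using f e p by (simp add: integral_density)
  also have "\<dots> = (\<integral>\<omega>. (indicator (C a z) \<omega> *\<^sub>R f \<omega>) / measure R (C a z) \<partial>R)" by simp
  also have "\<dots> = (\<integral>\<omega>\<in>C a z. f \<omega> \<partial>R) / measure R (C a z)"
    unfolding set_lebesgue_integral_def by (rule integral_divide_zero)
  finally show ?thesis .
qed

text \<open>Conditional independence of R at time b, restated for the conditional laws: on X_b = w
  the future may be integrated out under a walk that is known only to be in w at time b.\<close>

lemma nn_markov:
  assumes t: "0 \<le> c" "c \<le> b" "b < 1"
    and f: "f \<in> borel_measurable (path_sigma E {0..b})" and h: "h \<in> borel_measurable (path_sigma E {b..1})"
  shows "(\<integral>\<^sup>+\<omega>. f \<omega> * h \<omega> * indicator (C b w) \<omega> \<partial>P c z) =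
    (\<integral>\<^sup>+\<omega>. f \<omega> * indicator (C b w) \<omega> \<partial>P c z) * (\<integral>\<^sup>+\<omega>. h \<omega> \<partial>P b w)"
proof -
  have fR[measurable]: "f \<in> borel_measurable R" by (rule measurable_path_sigma_Q[OF _ f]) (use t in auto)
  have hR[measurable]: "h \<in> borel_measurable R" by (rule measurable_path_sigma_Q[OF _ h]) (use t in auto)
  have [measurable]: "C b w \<in> sets R" "C c z \<in> sets R" using t by (auto intro!: cyl_sets_Q)
  \<comment> \<open>Conditioning on the earlier state at time c is absorbed into the past
    factor.\<close>
  define f' where "f' \<omega> = f \<omega> * indicator (C c z) \<omega>" for \<omega>
  have "C c z \<in> sets (path_sigma E {0..b})" using t by (intro cyl_sets) auto
  then have f': "f' \<in> borel_measurable (path_sigma E {0..b})" unfolding f'_def using f by measurable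
  note ci = cond_indep_nn_integral[OF cond_indep _ _ f' h, of w]
  have b: "emeasure R (C b w) \<noteq> 0" "emeasure R (C b w) \<noteq> top" using R_C_emeasure[of b w] t by auto
  have "(\<integral>\<^sup>+\<omega>. f \<omega> * h \<omega> * indicator (C b w) \<omega> \<partial>P c z) =
    (\<integral>\<^sup>+\<omega>. f' \<omega> * h \<omega> * indicator (C b w) \<omega> \<partial>R) / emeasure R (C c z)"
    unfolding P_def f'_def by (subst nn_integral_uniform_measure) (auto simp: mult_ac)
  also have "(\<integral>\<^sup>+\<omega>. f' \<omega> * h \<omega> * indicator (C b w) \<omega> \<partial>R) =
    (\<integral>\<^sup>+\<omega>. f' \<omega> * h \<omega> * indicator (C b w) \<omega> \<partial>R) * emeasure R (C b w) / emeasure R (C b w)"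
    using b by (simp add: ennreal_mult_divide_eq)
  also have "\<dots> = (\<integral>\<^sup>+\<omega>. f' \<omega> * indicator (C b w) \<omega> \<partial>R) * (\<integral>\<^sup>+\<omega>. h \<omega> * indicator (C b w) \<omega> \<partial>R) / emeasure R (C b w)"
    using ci t by simp
  also have "\<dots> / emeasure R (C c z) = ((\<integral>\<^sup>+\<omega>. f' \<omega> * indicator (C b w) \<omega> \<partial>R) / emeasure R (C c z)) *
      ((\<integral>\<^sup>+\<omega>. h \<omega> * indicator (C b w) \<omega> \<partial>R) / emeasure R (C b w))"
    by (simp add: divide_ennreal_def mult_ac)
  also have "(\<integral>\<^sup>+\<omega>. f' \<omega> * indicator (C b w) \<omega> \<partial>R) / emeasure R (C c z) = (\<integral>\<^sup>+\<omega>. f \<omega> * indicator (C b w) \<omega> \<partial>P c z)"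
    unfolding P_def f'_def by (subst nn_integral_uniform_measure) (auto simp: mult_ac)
  also have "(\<integral>\<^sup>+\<omega>. h \<omega> * indicator (C b w) \<omega> \<partial>R) / emeasure R (C b w) = (\<integral>\<^sup>+\<omega>. h \<omega> \<partial>P b w)"
    unfolding P_def by (subst nn_integral_uniform_measure) auto
  finally show ?thesis .
qed

lemma markov_expect:
  fixes f h :: "_ \<Rightarrow> real"
  assumes t: "0 \<le> c" "c \<le> b" "b < 1"
    and f: "f \<in> borel_measurable (path_sigma E {0..b})" "\<And>\<omega>. 0 \<le> f \<omega>"
    and h: "h \<in> borel_measurable (path_sigma E {b..1})" "\<And>\<omega>. 0 \<le> h \<omega>"
  shows "(\<integral>\<omega>. f \<omega> * h \<omega> * indicator (C b w) \<omega> \<partial>P c z) =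
    (\<integral>\<omega>. f \<omega> * indicator (C b w) \<omega> \<partial>P c z) * (\<integral>\<omega>. h \<omega> \<partial>P b w)"
proof -
  have [measurable]: "f \<in> borel_measurable (P c z)" by (rule measurable_P[OF _ f(1)]) (use t in auto)
  have hP[measurable]: "h \<in> borel_measurable (P c z)" "h \<in> borel_measurable (P b w)"
    by (rule measurable_P[OF _ h(1)], use t in auto)+
  have [measurable]: "C b w \<in> sets (P c z)" unfolding sets_P using t by (intro cyl_sets_Q) auto
  have "(\<integral>\<^sup>+\<omega>. ennreal (f \<omega> * h \<omega> * indicator (C b w) \<omega>) \<partial>P c z) =
    (\<integral>\<^sup>+\<omega>. ennreal (f \<omega>) * ennreal (h \<omega>) * indicator (C b w) \<omega> \<partial>P c z)"
    using f h by (intro nn_integral_cong) (auto simp: ennreal_mult indicator_def)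
  also have "\<dots> = (\<integral>\<^sup>+\<omega>. ennreal (f \<omega>) * indicator (C b w) \<omega> \<partial>P c z) * (\<integral>\<^sup>+\<omega>. ennreal (h \<omega>) \<partial>P b w)"
    by (rule nn_markov[OF t]) (use f h in auto)
  also have "(\<integral>\<^sup>+\<omega>. ennreal (f \<omega>) * indicator (C b w) \<omega> \<partial>P c z) = (\<integral>\<^sup>+\<omega>. ennreal (f \<omega> * indicator (C b w) \<omega>) \<partial>P c z)"
    by (intro nn_integral_cong) (auto simp: indicator_def)
  finally show ?thesis
    using f h by (simp add: integral_eq_nn_integral enn2real_mult)
qed

text \<open>Decompose according to the state v at time b; the bound on the future is uniform in v,
  so it factors out of the sum.\<close>

lemma future_bound:
  assumes t: "0 \<le> c" "c \<le> b" "b < 1"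
    and B: "B \<in> sets (path_sigma E {0..b})" and D: "D \<in> sets (path_sigma E {b..1})"
    and e: "\<And>v. measure (P b v) D \<le> e"
  shows "measure (P c z) (B \<inter> D) \<le> e * measure (P c z) B"
proof -
  interpret finite_path_space E "P c z" by (rule path_space_P) (use t in auto)
  have [measurable]: "B \<in> sets (P c z)" by (rule sets_path_sigma_P[OF _ B]) (use t in auto)
  have DP[measurable]: "D \<in> sets (P a v)" for a v by (rule sets_path_sigma_P[OF _ D]) (use t in auto)
  have [measurable]: "C b v \<in> sets (P c z)" for v by (rule sets_path_sigma_P[OF _ cyl_sets[of b "{0..1}"]]) (use t in auto)
  have e0: "0 \<le> e" using e[of undefined] measure_nonneg order_trans by blast
  have "emeasure (P c z) (B \<inter> D) = (\<integral>\<^sup>+\<omega>. indicator B \<omega> * indicator D \<omega> \<partial>P c z)"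
    by (simp flip: indicator_inter_arith)
  also have "\<dots> = (\<integral>\<^sup>+v. (\<integral>\<^sup>+\<omega>. indicator B \<omega> * indicator D \<omega> * indicator (C b v) \<omega> \<partial>P c z) \<partial>count_space UNIV)"
    using t by (intro nn_integral_partition) auto
  also have "\<dots> = (\<integral>\<^sup>+v. (\<integral>\<^sup>+\<omega>. indicator B \<omega> * indicator (C b v) \<omega> \<partial>P c z) * emeasure (P b v) D \<partial>count_space UNIV)"
    using B D DP by (intro nn_integral_cong) (simp add: nn_markov[OF t])
  also have "\<dots> \<le> (\<integral>\<^sup>+v. (\<integral>\<^sup>+\<omega>. indicator B \<omega> * indicator (C b v) \<omega> \<partial>P c z) * ennreal e \<partial>count_space UNIV)"
  proof (intro nn_integral_mono mult_left_mono)
    fix v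
    interpret P': prob_space "P b v" using t by (intro prob_space_P) auto
    show "emeasure (P b v) D \<le> ennreal e"
      using e by (simp add: P'.emeasure_eq_measure ennreal_leI)
  qed auto
  also have "\<dots> = (\<integral>\<^sup>+v. (\<integral>\<^sup>+\<omega>. indicator B \<omega> * indicator (C b v) \<omega> \<partial>P c z) \<partial>count_space UNIV) * ennreal e"
    by (simp add: nn_integral_multc)
  also have "(\<integral>\<^sup>+v. (\<integral>\<^sup>+\<omega>. indicator B \<omega> * indicator (C b v) \<omega> \<partial>P c z) \<partial>count_space UNIV) = (\<integral>\<^sup>+\<omega>. indicator B \<omega> \<partial>P c z)"
    using t by (intro nn_integral_partition[symmetric]) auto
  finally have "ennreal (measure (P c z) (B \<inter> D)) \<le> ennreal (e * measure (P c z) B)"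
    using e0 by (simp add: emeasure_eq_measure ennreal_mult mult.commute)
  then show ?thesis using e0 by (simp add: ennreal_le_iff)
qed

lemma leave_bound:
  assumes ab: "0 \<le> a" "a \<le> b" "b < 1"
  shows "measure (P a z) {\<omega> \<in> paths E. \<omega> a \<noteq> \<omega> b} \<le> K * (b - a)"
proof -
  interpret prob_space "P a z" using ab by (intro prob_space_P) auto
  have S: "C b z \<in> sets R" using ab by (intro cyl_sets_Q) auto
  have D: "{\<omega> \<in> paths E. \<omega> a \<noteq> \<omega> b} \<in> sets (P a z)"
    by (rule sets_path_sigma_P[OF _ neq_sets[of a "{0..1}"]]) (use ab in auto)
  have "1 - K * (b - a) \<le> measure R (C a z \<inter> C b z) / measure R (C a z)"
    using stay_R[OF ab, of z] R_C_pos[of a z] ab by (simp add: field_simps)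
  also have "\<dots> = measure (P a z) (C b z)" using ab S by (simp add: measure_P)
  also have "\<dots> = 1 - measure (P a z) (space (P a z) - C b z)"
    using S by (subst prob_compl) (auto simp: sets_P)
  also have "measure (P a z) (space (P a z) - C b z) = measure (P a z) {\<omega> \<in> paths E. \<omega> a \<noteq> \<omega> b}"
  proof (rule finite_measure_eq_AE)
    show "AE \<omega> in P a z. (\<omega> \<in> space (P a z) - C b z) = (\<omega> \<in> {\<omega> \<in> paths E. \<omega> a \<noteq> \<omega> b})"
      using AE_P_start[OF ab(1) order.strict_trans1[OF ab(2,3)], of z] by eventually_elim auto
    show "space (P a z) - C b z \<in> events" using S by (intro sets.Diff[OF sets.top]) (simp add: sets_P)
  qed (rule D)
  finally show ?thesis by simp
qed

lemma jump_bound: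
  assumes "0 \<le> c" "c \<le> a" "a \<le> b" "b < 1" and "B \<in> sets (path_sigma E {0..a})"
  shows "measure (P c z) (B \<inter> {\<omega> \<in> paths E. \<omega> a \<noteq> \<omega> b}) \<le> K * (b - a) * measure (P c z) B"
proof (rule future_bound[OF assms(1,2) _ assms(5)])
  show "{\<omega> \<in> paths E. \<omega> a \<noteq> \<omega> b} \<in> sets (path_sigma E {a..1})"
    using assms by (intro neq_sets) auto
  show "measure (P a v) {\<omega> \<in> paths E. \<omega> a \<noteq> \<omega> b} \<le> K * (b - a)" for v
    using assms by (intro leave_bound) auto
qed (use assms in auto)

lemma moved_sets:
  assumes "0 \<le> a" "a \<le> b" "j \<le> n" "0 < n"
  shows "{\<omega> \<in> paths E. \<exists>i\<le>j. \<omega> (grid a b n i) \<noteq> \<omega> a} \<in> sets (path_sigma E {0..grid a b n j})"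
proof -
  have "{\<omega> \<in> paths E. \<exists>i\<le>j. \<omega> (grid a b n i) \<noteq> \<omega> a} = (\<Union>i\<in>{..j}. {\<omega> \<in> paths E. \<omega> (grid a b n i) \<noteq> \<omega> a})" by auto
  also have "\<dots> \<in> sets (path_sigma E {0..grid a b n j})"
  proof (intro sets.finite_UN neq_sets)
    fix i assume "i \<in> {..j}"
    then show "grid a b n i \<in> {0..grid a b n j}" "a \<in> {0..grid a b n j}"
      using grid_in[of a b n i] grid_in[of a b n j] grid_mono[of a b i j n] assms by auto
  qed simp
  finally show ?thesis .
qed

text \<open>A union bound over the cells, each contributing K times its length. The total does not
  depend on n, so the limit of fine grids can be taken afterwards.\<close>

lemma moved_bound:
  assumes ab: "0 \<le> a" "a \<le> b" "b < 1" and n: "0 < n" and j: "j \<le> n"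
  shows "measure (P a z) {\<omega> \<in> paths E. \<exists>i\<le>j. \<omega> (grid a b n i) \<noteq> \<omega> a} \<le> K * (grid a b n j - a)"
  using j
proof (induction j)
  case 0
  then show ?case by (simp add: conj_commute)
next
  case (Suc j)
  interpret prob_space "P a z" using ab by (intro prob_space_P) auto
  let ?G = "\<lambda>j. {\<omega> \<in> paths E. \<exists>i\<le>j. \<omega> (grid a b n i) \<noteq> \<omega> a}"
  let ?D = "{\<omega> \<in> paths E. \<omega> (grid a b n j) \<noteq> \<omega> (grid a b n (Suc j))}"
  have g: "0 \<le> grid a b n j" "a \<le> grid a b n j" "grid a b n j \<le> grid a b n (Suc j)" "grid a b n (Suc j) < 1"
    using grid_in[of a b n j] grid_in[of a b n "Suc j"] grid_mono[of a b j "Suc j" n] ab n Suc by auto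
  have G: "?G j \<in> sets (P a z)"
    by (rule sets_path_sigma_P[OF _ moved_sets]) (use ab n Suc g in auto)
  have D: "?D \<in> sets (P a z)"
    by (rule sets_path_sigma_P[OF _ neq_sets[of _ "{0..1}"]]) (use g in auto)
  have "?G (Suc j) \<subseteq> ?G j \<union> ?D" by (auto simp: le_Suc_eq)
  then have "measure (P a z) (?G (Suc j)) \<le> measure (P a z) (?G j \<union> ?D)"
    by (rule finite_measure_mono) (rule sets.Un[OF G D])
  also have "\<dots> \<le> measure (P a z) (?G j) + measure (P a z) ?D"
    by (rule measure_Un_le[OF G D])
  also have "measure (P a z) ?D \<le> K * (grid a b n (Suc j) - grid a b n j)"
    using jump_bound[OF ab(1) g(2-4) sets.top, of z] prob_space by (simp add: Int_absorb1[of ?D "paths E"] subset_eq)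
  also have "measure (P a z) (?G j) \<le> K * (grid a b n j - a)" using Suc by simp
  finally show ?case by (simp add: algebra_simps)
qed

lemma moves_bound_start:
  assumes ab: "0 \<le> a" "a \<le> b" "b < 1"
  shows "measure (P a z) {\<omega> \<in> paths E. moves \<omega> a b} \<le> K * (b - a)"
proof -
  interpret prob_space "P a z" using ab by (intro prob_space_P) auto
  \<comment> \<open>The degenerate grid n = 0 is replaced by the empty set, so that all members of
    the sequence are measurable.\<close>
  let ?S = "\<lambda>n. if n = 0 then {} else {\<omega> \<in> paths E. \<exists>i\<le>n. \<omega> (grid a b n i) \<noteq> \<omega> a}"
  show ?thesis
  proof (rule measure_eventually_le[where S = ?S])
    fix n
    show "?S n \<in> events"
    proof (cases "n = 0")
      case False
      have "{\<omega> \<in> paths E. \<exists>i\<le>n. \<omega> (grid a b n i) \<noteq> \<omega> a} \<in> events"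
        by (rule sets_path_sigma_P[OF _ moved_sets]) (use ab False in auto)
      then show ?thesis by (simp only: False if_False)
    qed simp
    assume n: "0 < n"
    then have "\<not> n = 0" by simp
    then have S: "?S n = {\<omega> \<in> paths E. \<exists>i\<le>n. \<omega> (grid a b n i) \<noteq> \<omega> a}" by (rule if_not_P)
    show "prob (?S n) \<le> K * (b - a)"
      unfolding S using moved_bound[OF ab n order_refl, of z] grid_n[OF n, of a b] by (simp only:)
  next
    fix \<omega> assume \<omega>: "\<omega> \<in> {\<omega> \<in> paths E. moves \<omega> a b}"
    then have "\<forall>\<^sub>F n in sequentially. \<exists>i\<le>n. \<omega> (grid a b n i) \<noteq> \<omega> a"
      using ab by (intro moves_grid) auto
    moreover have "\<forall>\<^sub>F n in sequentially. (0::nat) < n" by (rule eventually_gt_at_top)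
    ultimately show "\<forall>\<^sub>F n in sequentially. \<omega> \<in> ?S n"
    proof eventually_elim
      case (elim n)
      then have "\<not> n = 0" by simp
      then have "?S n = {\<omega> \<in> paths E. \<exists>i\<le>n. \<omega> (grid a b n i) \<noteq> \<omega> a}" by (rule if_not_P)
      then show ?case using elim \<omega> by blast
    qed
  qed
qed

lemma moves_twice_bound_start:
  assumes ab: "0 \<le> a" "a \<le> b" "b < 1"
  shows "measure (P a z) {\<omega> \<in> paths E. moves_twice \<omega> a b} \<le> K\<^sup>2 * (b - a)\<^sup>2"
proof -
  interpret prob_space "P a z" using ab by (intro prob_space_P) auto
  let ?G = "\<lambda>n j. {\<omega> \<in> paths E. \<exists>i\<le>j. \<omega> (grid a b n i) \<noteq> \<omega> a}"
  let ?D = "\<lambda>n j. {\<omega> \<in> paths E. \<omega> (grid a b n j) \<noteq> \<omega> (grid a b n (Suc j))}"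
  let ?S = "\<lambda>n. \<Union>l\<in>{..<n}. ?G n l \<inter> ?D n l"
  have g: "0 \<le> grid a b n j" "a \<le> grid a b n j" "grid a b n j \<le> grid a b n (Suc j)" "grid a b n j \<le> b" "grid a b n (Suc j) < 1"
    "grid a b n (Suc j) \<le> 1" if "j < n" for n j
    using grid_in[of a b n j] grid_in[of a b n "Suc j"] grid_mono[of a b j "Suc j" n] ab that by auto
  have GD: "?G n l \<inter> ?D n l \<in> events" if l: "l < n" for n l
  proof (rule sets.Int)
    show "?G n l \<in> events"
      by (rule sets_path_sigma_P[OF _ moved_sets]) (use ab l g[OF l] in auto)
    show "?D n l \<in> events"
      by (rule sets_path_sigma_P[OF _ neq_sets[of _ "{0..1}"]]) (use g[OF l] in auto)
  qed
  show ?thesis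
  proof (rule measure_eventually_le[where S = ?S])
    fix n
    show "?S n \<in> events" by (rule sets.finite_UN[OF finite_lessThan]) (rule GD, simp)
    assume n: "0 < n"
    have "prob (?S n) \<le> (\<Sum>l<n. prob (?G n l \<inter> ?D n l))"
      by (rule finite_measure_subadditive_finite[OF finite_lessThan image_subsetI]) (rule GD, simp)
    \<comment> \<open>The first factor bounds the probability of a change over the cell given the
      past, the second that of having left the start before it; the n equal terms then give order (b
      - a)^2.\<close>
    also have "\<dots> \<le> (\<Sum>l<n. K * ((b - a) / n) * (K * (b - a)))"
    proof (rule sum_mono)
      fix l assume "l \<in> {..<n}"
      then have l: "l < n" by simp
      have "prob (?G n l \<inter> ?D n l) \<le> K * (grid a b n (Suc l) - grid a b n l) * prob (?G n l)"
        by (rule jump_bound[OF ab(1) g(2)[OF l] g(3)[OF l] g(5)[OF l] moved_sets[OF ab(1,2)]]) (use l in auto)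
      also have "grid a b n (Suc l) - grid a b n l = (b - a) / n"
        by (simp add: grid_def diff_divide_distrib[symmetric] algebra_simps)
      also have "K * ((b - a) / n) * prob (?G n l) \<le> K * ((b - a) / n) * (K * (b - a))"
      proof (rule mult_left_mono)
        have "prob (?G n l) \<le> K * (grid a b n l - a)" by (rule moved_bound[OF ab n]) (use l in simp)
        also have "\<dots> \<le> K * (b - a)" using g[OF l] K_nonneg by (intro mult_left_mono) auto
        finally show "prob (?G n l) \<le> K * (b - a)" .
        show "0 \<le> K * ((b - a) / n)" using K_nonneg ab by simp
      qed
      finally show "prob (?G n l \<inter> ?D n l) \<le> K * ((b - a) / n) * (K * (b - a))" .
    qed
    also have "\<dots> = K\<^sup>2 * (b - a)\<^sup>2" using n by (simp add: power2_eq_square)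
    finally show "prob (?S n) \<le> K\<^sup>2 * (b - a)\<^sup>2" .
  next
    fix \<omega> assume "\<omega> \<in> {\<omega> \<in> paths E. moves_twice \<omega> a b}"
    then have \<omega>: "\<omega> \<in> paths E" "moves_twice \<omega> a b" by auto
    have "\<forall>\<^sub>F n in sequentially. \<exists>l<n. (\<exists>i\<le>l. \<omega> (grid a b n i) \<noteq> \<omega> a) \<and> \<omega> (grid a b n l) \<noteq> \<omega> (grid a b n (Suc l))"
      by (rule moves_twice_grid[OF \<omega>(1) _ _ _ \<omega>(2)]) (use ab in auto)
    then show "\<forall>\<^sub>F n in sequentially. \<omega> \<in> ?S n"
      by eventually_elim (use \<omega> in blast)
  qed
qed

lemma moves_bound:
  assumes "0 \<le> c" "c \<le> a" "a \<le> b" "b < 1" and "B \<in> sets (path_sigma E {0..a})"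
  shows "measure (P c z) (B \<inter> {\<omega> \<in> paths E. moves \<omega> a b}) \<le> K * (b - a) * measure (P c z) B"
proof (rule future_bound[OF assms(1,2) _ assms(5)])
  show "{\<omega> \<in> paths E. moves \<omega> a b} \<in> sets (path_sigma E {a..1})"
    by (rule path_sigma_mono[OF _ moves_sets]) (use assms in auto)
  show "measure (P a v) {\<omega> \<in> paths E. moves \<omega> a b} \<le> K * (b - a)" for v
    using assms by (intro moves_bound_start) auto
qed (use assms in auto)

lemma moves_twice_bound:
  assumes "0 \<le> c" "c \<le> a" "a \<le> b" "b < 1" and "B \<in> sets (path_sigma E {0..a})"
  shows "measure (P c z) (B \<inter> {\<omega> \<in> paths E. moves_twice \<omega> a b}) \<le> K\<^sup>2 * (b - a)\<^sup>2 * measure (P c z) B"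
proof (rule future_bound[OF assms(1,2) _ assms(5)])
  show "{\<omega> \<in> paths E. moves_twice \<omega> a b} \<in> sets (path_sigma E {a..1})"
    by (rule path_sigma_mono[OF _ moves_twice_sets]) (use assms in auto)
  show "measure (P a v) {\<omega> \<in> paths E. moves_twice \<omega> a b} \<le> K\<^sup>2 * (b - a)\<^sup>2" for v
    using assms by (intro moves_twice_bound_start) auto
qed (use assms in auto)

text \<open>On paths that stay in z during [a,b] the integrated generator equals the integral of J
  exactly. The other paths have probability at most K (b - a), and on them each of the two integrals
  is at most K (b - a), whence the factor 2.\<close>

lemma transition_bound:
  assumes ab: "0 \<le> a" "a \<le> b" "b < 1" and zw: "z \<noteq> w"
  shows "\<bar>measure (P a z) (C b w) - (LBINT r:{a..b}. J r z w)\<bar> \<le> 2 * K\<^sup>2 * (b - a)\<^sup>2"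
proof -
  interpret prob_space "P a z" using ab by (intro prob_space_P) auto
  let ?L = "\<lambda>\<omega>. LBINT r:{a..b}. generator E J r (indicator {w}) (\<omega> r)"
  let ?j = "LBINT r:{a..b}. J r z w"
  let ?T = "{\<omega> \<in> paths E. moves \<omega> a b}"
  have LR: "?L \<in> borel_measurable R"
    by (rule measurable_path_sigma_Q[of "{a..b}"], use ab in simp,
        rule path_integral_measurable[OF _ _ _ indicator_measurable_01[OF generator_measurable]]) (use ab in auto)
  then have Lm[measurable]: "?L \<in> borel_measurable (P a z)" by (simp add: measurable_cong_sets[OF sets_P refl])
  have S: "C b w \<in> sets R" using ab by (intro cyl_sets_Q) auto
  have T[measurable]: "?T \<in> events"
    by (rule sets_path_sigma_P[OF _ moves_sets]) (use ab in auto)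
  have Lb: "\<bar>?L \<omega>\<bar> \<le> K * (b - a)" and Li: "set_integrable lborel {a..b} (\<lambda>r. generator E J r (indicator {w}) (\<omega> r))"
    if "\<omega> \<in> paths E" for \<omega>
    using path_integral_bound[where h = "\<lambda>r. generator E J r (indicator {w})", OF that _ _ _ generator_measurable, where a = a and b = b and c = K]
      ab generator_bound by auto
  have jm: "(\<lambda>r. indicator {a..b} r * J r z w) \<in> borel_measurable borel"
    by (rule indicator_measurable_01[OF J_measurable]) (use ab in auto)
  have Lint: "integrable (P a z) ?L"
    using Lb by (intro integrable_const_bound[where B = "K * (b - a)"]) auto
  have "measure (P a z) (C b w) = measure R (C a z \<inter> C b w) / measure R (C a z)"
    using ab S by (intro measure_P) auto
  also have "measure R (C a z \<inter> C b w) = (\<integral>\<omega>\<in>C a z. ?L \<omega> \<partial>R)"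
    using forward_R[OF ab, of z w] zw by simp
  also have "\<dots> / measure R (C a z) = (\<integral>\<omega>. ?L \<omega> \<partial>P a z)"
    using ab LR by (intro integral_P[symmetric]) auto
  finally have "measure (P a z) (C b w) - ?j = (\<integral>\<omega>. ?L \<omega> - ?j \<partial>P a z)"
    using Lint prob_space by simp
  then have "\<bar>measure (P a z) (C b w) - ?j\<bar> = \<bar>\<integral>\<omega>. ?L \<omega> - ?j \<partial>P a z\<bar>" by (rule arg_cong)
  also have "\<dots> \<le> (\<integral>\<omega>. \<bar>?L \<omega> - ?j\<bar> \<partial>P a z)" by (rule integral_abs_bound)
  also have "\<dots> \<le> (\<integral>\<omega>. 2 * K * (b - a) * indicator ?T \<omega> \<partial>P a z)"
  proof (rule integral_mono_AE)
    show "AE \<omega> in P a z. \<bar>?L \<omega> - ?j\<bar> \<le> 2 * K * (b - a) * indicator ?T \<omega>"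
      using AE_P_start[OF ab(1) order.strict_trans1[OF ab(2,3)], of z]
    proof (eventually_elim)
      case (elim \<omega>)
      then have \<omega>: "\<omega> \<in> paths E" "\<omega> a = z" by auto
      show ?case
      proof (cases "\<omega> \<in> ?T")
        case True
        have "\<bar>?j\<bar> \<le> K * (b - a)"
          by (rule set_integral_bound(2)[OF jm ab(2)]) (use J_le J_nonneg ab in auto)
        with Lb[OF \<omega>(1)] True show ?thesis by simp
      next
        case False
        then have st: "\<omega> r = z" if "a \<le> r" "r \<le> b" for r using that \<omega> by (auto simp: moves_def)
        have "?L \<omega> = ?j"
        proof (rule set_lebesgue_integral_cong)
          show "\<forall>r. r \<in> {a..b} \<longrightarrow> generator E J r (indicator {w}) (\<omega> r) = J r z w"
            using st zw ab by (auto simp: generator_indicator)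
        qed simp
        then show ?thesis using False by simp
      qed
    qed
    show "integrable (P a z) (\<lambda>\<omega>. \<bar>?L \<omega> - ?j\<bar>)" using Lint by auto
    show "integrable (P a z) (\<lambda>\<omega>. 2 * K * (b - a) * indicator ?T \<omega>)"
      by (intro integrable_mult_right integrable_real_indicator T) (simp add: emeasure_eq_measure)
  qed
  also have "\<dots> = 2 * K * (b - a) * measure (P a z) ?T"
  proof -
    have "?T \<inter> paths E = ?T" by auto
    then show ?thesis using T by simp
  qed
  also have "\<dots> \<le> 2 * K * (b - a) * (K * (b - a))"
    using moves_bound_start[OF ab, of z] K_nonneg ab by (intro mult_left_mono) auto
  finally show ?thesis by (simp add: power2_eq_square mult_ac)
qed

end


section \<open>The geodesic weight\<close>

context walk
begin

text \<open>The part of the density of G that depends on the path after t only. The state at time t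
  is not prescribed here; in \<open>g\<close> the law \<open>P t z\<close> does that.\<close>

definition xi :: "'a \<Rightarrow> real \<Rightarrow> (real \<Rightarrow> 'a) \<Rightarrow> real" where
  "xi y t \<omega> = exp (LBINT s:{t..1}. total_rate E J s (\<omega> s)) *
     indicator {\<gamma> \<in> paths E. geo d \<gamma> t 1 \<and> \<gamma> 1 = y} \<omega>"

definition g :: "'a \<Rightarrow> real \<Rightarrow> 'a \<Rightarrow> real" where
  "g y t z = (\<integral>\<omega>. xi y t \<omega> \<partial>P t z)"

text \<open>The condition on the intermediate state in \<open>geo_split\<close>, for a path from z
  to y that visits w.\<close>

definition admissible :: "'a \<Rightarrow> 'a \<Rightarrow> 'a \<Rightarrow> real" where
  "admissible y z w = of_bool (d z w + d w y = d z y)"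

lemma admissible_bounds: "0 \<le> admissible y z w" "admissible y z w \<le> 1" "\<bar>admissible y z w\<bar> \<le> 1"
  by (auto simp: admissible_def)

lemma rate_integral:
  assumes \<omega>: "\<omega> \<in> paths E" and ab: "0 \<le> a" "a \<le> b" "b \<le> 1"
  shows "set_integrable lborel {a..b} (\<lambda>s. total_rate E J s (\<omega> s))"
    and "0 \<le> (LBINT s:{a..b}. total_rate E J s (\<omega> s))"
    and "(LBINT s:{a..b}. total_rate E J s (\<omega> s)) \<le> K * (b - a)"
proof -
  have "\<bar>total_rate E J s x\<bar> \<le> K" if "s \<in> {a..b}" for s x
    using rate_bounds[of s x] that ab by auto
  note b = path_integral_bound[where h = "total_rate E J", OF \<omega> ab rate_measurable this]
  from b
  show "set_integrable lborel {a..b} (\<lambda>s. total_rate E J s (\<omega> s))"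
    "(LBINT s:{a..b}. total_rate E J s (\<omega> s)) \<le> K * (b - a)" by auto
  show "0 \<le> (LBINT s:{a..b}. total_rate E J s (\<omega> s))"
    unfolding set_lebesgue_integral_def using rate_bounds ab
    by (intro Bochner_Integration.integral_nonneg) (auto simp: indicator_def)
qed

lemma rate_integral_split:
  assumes "\<omega> \<in> paths E" "0 \<le> a" "a \<le> b" "b \<le> c" "c \<le> 1"
  shows "(LBINT s:{a..c}. total_rate E J s (\<omega> s)) =
    (LBINT s:{a..b}. total_rate E J s (\<omega> s)) + (LBINT s:{b..c}. total_rate E J s (\<omega> s))"
  using assms by (intro set_integral_split rate_integral) auto

lemma rate_integral_measurable:
  assumes "0 \<le> a" "a \<le> b" "b \<le> 1"
  shows "(\<lambda>\<omega>. LBINT s:{a..b}. total_rate E J s (\<omega> s)) \<in> borel_measurable (path_sigma E {a..b})"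
  by (rule path_integral_measurable[OF assms indicator_measurable_01[OF rate_measurable]]) (use assms in auto)

lemma xi_set:
  assumes "0 \<le> t" "t \<le> 1"
  shows "{\<gamma> \<in> paths E. geo d \<gamma> t 1 \<and> \<gamma> 1 = y} \<in> sets (path_sigma E {t..1})"
proof -
  have "{\<gamma> \<in> paths E. geo d \<gamma> t 1} \<inter> C 1 y \<in> sets (path_sigma E {t..1})"
    using assms by (intro sets.Int geo_measurable cyl_sets) auto
  also have "{\<gamma> \<in> paths E. geo d \<gamma> t 1} \<inter> C 1 y = {\<gamma> \<in> paths E. geo d \<gamma> t 1 \<and> \<gamma> 1 = y}" by auto
  finally show ?thesis .
qed

lemma xi_measurable: "0 \<le> t \<Longrightarrow> t \<le> 1 \<Longrightarrow> xi y t \<in> borel_measurable (path_sigma E {t..1})"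
  unfolding xi_def using rate_integral_measurable[of t 1] xi_set[of t y] by measurable

lemma xi_nonneg: "0 \<le> xi y t \<omega>"
  by (simp add: xi_def)

lemma xi_le: "0 \<le> t \<Longrightarrow> t \<le> 1 \<Longrightarrow> xi y t \<omega> \<le> exp K"
proof (cases "\<omega> \<in> paths E")
  case True
  assume t: "0 \<le> t" "t \<le> 1"
  have "K * (1 - t) \<le> K * 1" using t K_nonneg by (intro mult_left_mono) auto
  with rate_integral(3)[OF True t(1,2) order_refl] show ?thesis by (auto simp: xi_def indicator_def)
qed (simp add: xi_def)

lemma integrable_bounded_P:
  fixes f :: "_ \<Rightarrow> real"
  assumes "0 \<le> a" "a < 1" "f \<in> borel_measurable (P a z)" "\<And>\<omega>. \<bar>f \<omega>\<bar> \<le> c"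
  shows "integrable (P a z) f"
proof -
  interpret prob_space "P a z" using assms by (intro prob_space_P)
  show ?thesis using assms by (intro integrable_const_bound[where B = c]) auto
qed

lemma xi_measurable_P: "0 \<le> t \<Longrightarrow> t \<le> 1 \<Longrightarrow> xi y t \<in> borel_measurable (P a z)"
  by (rule measurable_P[OF _ xi_measurable]) auto

lemma g_bounds:
  assumes "0 \<le> t" "t < 1"
  shows "0 \<le> g y t z" "g y t z \<le> exp K"
proof -
  interpret prob_space "P t z" using assms by (intro prob_space_P)
  show "0 \<le> g y t z" unfolding g_def by (intro Bochner_Integration.integral_nonneg xi_nonneg)
  have "integrable (P t z) (xi y t)"
    using assms xi_nonneg xi_le[of t y] by (intro integrable_bounded_P[where c = "exp K"] xi_measurable_P) auto
  then show "g y t z \<le> exp K"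
    unfolding g_def using xi_le[of t y] assms by (intro integral_le_const) auto
qed

lemma geodesic_weight_eq_g:
  assumes t: "0 \<le> t" "t < 1"
  shows "geodesic_weight E d R J y t z = g y t z"
proof -
  let ?G = "{\<gamma> \<in> paths E. geo d \<gamma> t 1 \<and> \<gamma> 1 = y}"
  have G: "?G \<in> sets (P t z)" by (rule sets_path_sigma_P[OF _ xi_set]) (use t in auto)
  have Ct: "C t z \<in> sets (P t z)" unfolding sets_P using t by (intro cyl_sets_Q) auto
  have "geodesics_from E d t z y = ?G \<inter> C t z"
  proof (intro set_eqI)
    fix \<omega>
    show "\<omega> \<in> geodesics_from E d t z y \<longleftrightarrow> \<omega> \<in> ?G \<inter> C t z"
      using geodesics_from_iff[OF dist t(1) less_imp_le[OF t(2)], of \<omega> E z y]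
      by (cases "\<omega> \<in> paths E") (auto simp: geodesics_from_def)
  qed
  then have "geodesic_weight E d R J y t z =
    (\<integral>\<omega>. exp (LBINT s:{t..1}. total_rate E J s (\<omega> s)) * indicator (?G \<inter> C t z) \<omega> \<partial>P t z)"
    by (simp add: geodesic_weight_def P_def)
  also have "\<dots> = g y t z"
    unfolding g_def
  proof (rule integral_cong_AE)
    have "(\<lambda>\<omega>. LBINT s:{t..1}. total_rate E J s (\<omega> s)) \<in> borel_measurable (P t z)"
      by (rule measurable_P[OF _ rate_integral_measurable]) (use t in auto)
    then show "(\<lambda>\<omega>. exp (LBINT s:{t..1}. total_rate E J s (\<omega> s)) * indicator (?G \<inter> C t z) \<omega>) \<in> borel_measurable (P t z)"
      using sets.Int[OF G Ct] by (intro borel_measurable_times borel_measurable_indicator measurable_compose[OF _ borel_measurable_exp])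
    show "xi y t \<in> borel_measurable (P t z)" using t by (intro xi_measurable_P) auto
    show "AE \<omega> in P t z. exp (LBINT s:{t..1}. total_rate E J s (\<omega> s)) * indicator (?G \<inter> C t z) \<omega> = xi y t \<omega>"
      using AE_P_start[OF t, of z] by eventually_elim (auto simp: xi_def indicator_def)
  qed
  finally show ?thesis .
qed

lemma xi_split:
  assumes \<omega>: "\<omega> \<in> paths E" and ab: "0 \<le> a" "a \<le> b" "b \<le> 1" and geo: "geo d \<omega> a b"
  shows "xi y a \<omega> = admissible y (\<omega> a) (\<omega> b) * exp (LBINT s:{a..b}. total_rate E J s (\<omega> s)) * xi y b \<omega>"
  using \<omega> geo geo_split[OF dist ab(2,3), of \<omega>] rate_integral_split[OF \<omega> ab order_refl]
  by (auto simp: xi_def admissible_def exp_add indicator_def)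

text \<open>By \<open>xi_split\<close> the two weights differ by admissibility and by a factor exp x
  with x at most K (b - a). Dropping that factor only lowers the weight, and by at most exp K times
  x.\<close>

lemma xi_close:
  assumes \<omega>: "\<omega> \<in> paths E" and ab: "0 \<le> a" "a \<le> b" "b \<le> 1" and geo: "geo d \<omega> a b"
  shows "admissible y (\<omega> a) (\<omega> b) * xi y b \<omega> \<le> xi y a \<omega>"
    and "\<bar>xi y a \<omega> - admissible y (\<omega> a) (\<omega> b) * xi y b \<omega>\<bar> \<le> exp K * (K * (b - a))"
proof -
  let ?x = "LBINT s:{a..b}. total_rate E J s (\<omega> s)" and ?y = "LBINT s:{b..1}. total_rate E J s (\<omega> s)"
  have x: "0 \<le> ?x" "?x \<le> K * (b - a)" by (rule rate_integral[OF \<omega> ab])+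
  have "?y \<le> K * (1 - b)" using rate_integral[OF \<omega>, of b 1] ab by auto
  with x have "?x + ?y \<le> K * (1 - a)" by (simp add: algebra_simps)
  also have "\<dots> \<le> K * 1" using K_nonneg ab by (intro mult_left_mono) auto
  finally have "?x + ?y \<le> K" by simp
  note e = exp_diff_bound[OF x(1) this]
  have e0: "0 \<le> exp K * (K * (b - a))" using K_nonneg ab by auto
  have "exp (?x + ?y) - exp ?y \<le> exp K * (K * (b - a))"
    using e(2) x(2) by (meson exp_ge_zero mult_left_mono order_trans)
  then show "admissible y (\<omega> a) (\<omega> b) * xi y b \<omega> \<le> xi y a \<omega>"
    "\<bar>xi y a \<omega> - admissible y (\<omega> a) (\<omega> b) * xi y b \<omega>\<bar> \<le> exp K * (K * (b - a))"
    using e(1) e0 unfolding xi_split[OF \<omega> ab geo]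
    by (auto simp: xi_def admissible_def exp_add indicator_def)
qed

lemma not_moves:
  assumes "\<not> moves \<omega> a b" "a \<le> b"
  shows "\<omega> b = \<omega> a" "geo d \<omega> a b"
proof -
  have *: "\<omega> r = \<omega> a" if "a \<le> r" "r \<le> b" for r
    using assms that unfolding moves_def by blast
  show "\<omega> b = \<omega> a" by (rule *) (use assms in auto)
  show "geo d \<omega> a b" unfolding geo_def
  proof (intro allI impI, elim conjE)
    fix p q assume pq: "a \<le> p" "p \<le> q" "q \<le> b"
    have "\<omega> p = \<omega> a" by (rule *) (use pq in auto)
    moreover have "\<omega> q = \<omega> a" by (rule *) (use pq in auto)
    moreover have "\<omega> b = \<omega> a" by (rule *) (use pq in auto)
    ultimately
    show "d (\<omega> a) (\<omega> p) + d (\<omega> p) (\<omega> q) + d (\<omega> q) (\<omega> b) = d (\<omega> a) (\<omega> b)"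
      using d_self[OF dist] by simp
  qed
qed

lemma admissible_self: "admissible y z z = 1"
  using d_self[OF dist] by (simp add: admissible_def)

lemma integral_indicator_P: "A \<in> sets R \<Longrightarrow> (\<integral>\<omega>. indicator A \<omega> \<partial>P a z) = measure (P a z) A"
proof -
  assume "A \<in> sets R"
  then have "A \<inter> paths E = A" using sets.sets_into_space by fastforce
  then show ?thesis using \<open>A \<in> sets R\<close> by simp
qed

lemma integral_cyl_xi:
  assumes "0 \<le> a" "a \<le> b" "b < 1"
  shows "(\<integral>\<omega>. indicator (C b w) \<omega> * xi y b \<omega> \<partial>P a z) = measure (P a z) (C b w) * g y b w"
proof -
  have "(\<integral>\<omega>. 1 * xi y b \<omega> * indicator (C b w) \<omega> \<partial>P a z) = (\<integral>\<omega>. 1 * indicator (C b w) \<omega> \<partial>P a z) * g y b w"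
    unfolding g_def using assms xi_measurable[of b y] xi_nonneg by (intro markov_expect) auto
  moreover have "C b w \<in> sets R" using assms by (intro cyl_sets_Q) auto
  moreover have "C b w \<inter> paths E = C b w" by auto
  ultimately show ?thesis by (simp add: integral_indicator_P mult.commute)
qed

lemma cyl_le:
  assumes ab: "0 \<le> a" "a \<le> b" "b < 1"
  shows "1 - K * (b - a) \<le> measure (P a z) (C b z)"
    and "z \<noteq> w \<Longrightarrow> measure (P a z) (C b w) \<le> K * (b - a)"
proof -
  interpret prob_space "P a z" using ab by (intro prob_space_P) auto
  have S: "C b w \<in> events" for w unfolding sets_P using ab by (intro cyl_sets_Q) auto
  have D: "{\<omega> \<in> paths E. \<omega> a \<noteq> \<omega> b} \<in> events"
    by (rule sets_path_sigma_P[OF _ neq_sets[of a "{0..1}"]]) (use ab in auto)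
  have a1: "a < 1" using ab by simp
  show "1 - K * (b - a) \<le> prob (C b z)"
    using stay_R[OF ab, of z] R_C_pos[OF ab(1) a1, of z] S[of z]
    by (simp add: sets_P measure_P[OF ab(1) a1] field_simps)
  assume "z \<noteq> w"
  have "prob (C b w) \<le> prob {\<omega> \<in> paths E. \<omega> a \<noteq> \<omega> b}"
  proof (rule finite_measure_mono_AE[OF _ D])
    show "AE \<omega> in P a z. \<omega> \<in> C b w \<longrightarrow> \<omega> \<in> {\<omega> \<in> paths E. \<omega> a \<noteq> \<omega> b}"
      using AE_P_start[OF ab(1) a1, of z] by eventually_elim (use \<open>z \<noteq> w\<close> in auto)
  qed
  with leave_bound[OF ab, of z] show "prob (C b w) \<le> K * (b - a)" by simp
qed

text \<open>The constant 3 counts three errors of size K exp K (b - a): the change of the weight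
  along paths that stay in z, the paths that move, and the replacement of the probability of X_b = z
  by 1.\<close>

lemma g_lipschitz:
  assumes ab: "0 \<le> a" "a \<le> b" "b < 1"
  shows "\<bar>g y a z - g y b z\<bar> \<le> 3 * K * exp K * (b - a)"
proof -
  have a1: "a < 1" using ab by simp
  interpret prob_space "P a z" using ab by (intro prob_space_P) auto
  let ?T = "{\<omega> \<in> paths E. moves \<omega> a b}"
  let ?f = "\<lambda>\<omega>. xi y a \<omega> - indicator (C b z) \<omega> * xi y b \<omega>"
  have S[measurable]: "C b z \<in> events" unfolding sets_P using ab by (intro cyl_sets_Q) auto
  have T: "?T \<in> events" by (rule sets_path_sigma_P[OF _ moves_sets]) (use ab in auto)
  have TR: "?T \<in> sets R" using T by (simp add: sets_P)
  have [measurable]: "xi y a \<in> borel_measurable (P a z)" "xi y b \<in> borel_measurable (P a z)"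
    using ab by (auto intro!: xi_measurable_P)
  have xa: "\<bar>xi y a \<omega>\<bar> \<le> exp K" and xb: "\<bar>indicator (C b z) \<omega> * xi y b \<omega>\<bar> \<le> exp K" for \<omega>
    using xi_nonneg xi_le[of a y \<omega>] xi_le[of b y \<omega>] ab by (auto simp: indicator_def)
  have ia: "integrable (P a z) (xi y a)"
    using xa ab by (intro integrable_bounded_P[where c = "exp K"]) auto
  have ib: "integrable (P a z) (\<lambda>\<omega>. indicator (C b z) \<omega> * xi y b \<omega>)"
    by (rule integrable_bounded_P[OF ab(1) a1 _ xb]) measurable
  have "g y a z - prob (C b z) * g y b z = (\<integral>\<omega>. ?f \<omega> \<partial>P a z)"
    using ia ib integral_cyl_xi[OF ab, where w = z and y = y and z = z] by (simp add: g_def)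
  then have "\<bar>g y a z - prob (C b z) * g y b z\<bar> = \<bar>\<integral>\<omega>. ?f \<omega> \<partial>P a z\<bar>" by (rule arg_cong)
  also have "\<dots> \<le> (\<integral>\<omega>. \<bar>?f \<omega>\<bar> \<partial>P a z)" by (rule integral_abs_bound)
  also have "\<dots> \<le> (\<integral>\<omega>. exp K * (K * (b - a)) + exp K * indicator ?T \<omega> \<partial>P a z)"
  proof (rule integral_mono_AE)
    show "integrable (P a z) (\<lambda>\<omega>. \<bar>?f \<omega>\<bar>)" using ia ib by (intro integrable_abs Bochner_Integration.integrable_diff)
    show "integrable (P a z) (\<lambda>\<omega>. exp K * (K * (b - a)) + exp K * indicator ?T \<omega>)"
      using T by (intro Bochner_Integration.integrable_add integrable_mult_right integrable_real_indicator)
        (auto simp: emeasure_eq_measure)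
    show "AE \<omega> in P a z. \<bar>?f \<omega>\<bar> \<le> exp K * (K * (b - a)) + exp K * indicator ?T \<omega>"
      using AE_P_start[OF ab(1) a1, of z]
    proof eventually_elim
      case (elim \<omega>)
      then have \<omega>: "\<omega> \<in> paths E" "\<omega> a = z" by auto
      have e0: "0 \<le> exp K * (K * (b - a))" using K_nonneg ab by auto
      show ?case
      proof (cases "moves \<omega> a b")
        case True
        have "0 \<le> indicator (C b z) \<omega> * xi y b \<omega>" using xi_nonneg by simp
        with xa[of \<omega>] xb[of \<omega>] xi_nonneg[of y a \<omega>] have "\<bar>?f \<omega>\<bar> \<le> exp K" by linarith
        with True \<omega> e0 show ?thesis by simp
      next
        case False
        note nm = not_moves[OF False ab(2)]
        have "\<bar>xi y a \<omega> - xi y b \<omega>\<bar> \<le> exp K * (K * (b - a))"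
          using xi_close(2)[OF \<omega>(1) ab(1,2) _ nm(2), of y] nm ab by (simp add: admissible_self)
        moreover have "\<omega> \<in> C b z" using \<omega> nm by simp
        ultimately show ?thesis using False by simp
      qed
    qed
  qed
  also have "\<dots> = exp K * (K * (b - a)) + exp K * prob ?T"
  proof -
    have "integrable (P a z) (indicator ?T :: _ \<Rightarrow> real)"
      using T by (intro integrable_real_indicator) (auto simp: emeasure_eq_measure)
    then show ?thesis using integral_indicator_P[OF TR, of a z] prob_space
      by (subst Bochner_Integration.integral_add) auto
  qed
  also have "\<dots> \<le> exp K * (K * (b - a)) + exp K * (K * (b - a))"
    using moves_bound_start[OF ab, of z] by (intro add_left_mono mult_left_mono) auto
  finally have 1: "\<bar>g y a z - prob (C b z) * g y b z\<bar> \<le> 2 * K * exp K * (b - a)" by (simp add: mult_ac)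
  have "prob (C b z) * g y b z - g y b z = - ((1 - prob (C b z)) * g y b z)" by (simp add: algebra_simps)
  moreover have "0 \<le> (1 - prob (C b z)) * g y b z"
    using g_bounds[of b y z] ab prob_le_1[of "C b z"] by (intro mult_nonneg_nonneg) auto
  ultimately have "\<bar>prob (C b z) * g y b z - g y b z\<bar> = (1 - prob (C b z)) * g y b z" by simp
  also have "\<dots> \<le> (K * (b - a)) * exp K"
    using g_bounds[of b y z] cyl_le(1)[OF ab, of z] ab K_nonneg by (intro mult_mono) auto
  finally show ?thesis using 1 by (simp add: mult_ac abs_if split: if_splits)
qed

lemma g_measurable: "(\<lambda>t. g y t z) \<in> borel_measurable (restrict_space borel {0..<1})"
proof (rule borel_measurable_continuous_on_restrict)
  have "\<bar>g y s z - g y t z\<bar> \<le> 3 * K * exp K * \<bar>s - t\<bar>" if "s \<in> {0..<1}" "t \<in> {0..<1}" for s t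
    using g_lipschitz[of s t y z] g_lipschitz[of t s y z] that by (cases "s \<le> t") (auto simp: abs_minus_commute)
  then have "(3 * K * exp K)-lipschitz_on {0..<1} (\<lambda>t. g y t z)"
    using K_nonneg by (intro lipschitz_onI) (auto simp: dist_real_def)
  then show "continuous_on {0..<1} (\<lambda>t. g y t z)" by (rule lipschitz_on_continuous_on)
qed

lemma J_integral:
  assumes ab: "0 \<le> a" "a \<le> b" "b \<le> 1"
  shows "set_integrable lborel {a..b} (\<lambda>r. J r z w)" "0 \<le> (LBINT r:{a..b}. J r z w)"
    "(LBINT r:{a..b}. J r z w) \<le> K * (b - a)"
proof -
  have b: "\<bar>J r z w\<bar> \<le> K" if "r \<in> {a..b}" for r using J_le J_nonneg that ab by auto
  have m: "(\<lambda>r. indicator {a..b} r * J r z w) \<in> borel_measurable borel"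
    using ab by (intro indicator_measurable_01 J_measurable) auto
  from set_integral_bound[OF m ab(2) b]
  show "set_integrable lborel {a..b} (\<lambda>r. J r z w)" "(LBINT r:{a..b}. J r z w) \<le> K * (b - a)" by auto
  show "0 \<le> (LBINT r:{a..b}. J r z w)"
    unfolding set_lebesgue_integral_def using J_nonneg ab
    by (intro Bochner_Integration.integral_nonneg) (auto simp: indicator_def)
qed

lemma Jg_integrable:
  assumes ab: "0 \<le> a" "a \<le> b" "b < 1"
  shows "set_integrable lborel {a..b} (\<lambda>r. J r z w * g y r w)"
proof (rule set_integral_bound(1)[OF _ ab(2)])
  show "(\<lambda>r. indicator {a..b} r * (J r z w * g y r w)) \<in> borel_measurable borel"
    using ab by (intro indicator_measurable_01 borel_measurable_times J_measurable g_measurable) auto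
  show "\<bar>J r z w * g y r w\<bar> \<le> K * exp K" if "r \<in> {a..b}" for r
  proof -
    have "0 \<le> J r z w" "J r z w \<le> K" "0 \<le> g y r w" "g y r w \<le> exp K"
      using that ab J_nonneg J_le g_bounds by auto
    then show ?thesis by (simp add: abs_mult mult_mono K_nonneg)
  qed
qed

text \<open>Freezing the weight at the right end of the cell costs its Lipschitz constant 3 K exp K
  times the length, against an integrated rate of at most K times the length.\<close>

lemma Jg_close:
  assumes ab: "0 \<le> a" "a \<le> b" "b < 1"
  shows "\<bar>(LBINT r:{a..b}. J r z w) * g y b w - (LBINT r:{a..b}. J r z w * g y r w)\<bar> \<le> 3 * K\<^sup>2 * exp K * (b - a)\<^sup>2"
proof -
  have Ji: "set_integrable lborel {a..b} (\<lambda>r. J r z w * g y b w)"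
    using J_integral(1)[of a b z w] ab by simp
  have "(LBINT r:{a..b}. J r z w) * g y b w - (LBINT r:{a..b}. J r z w * g y r w) =
    (LBINT r:{a..b}. J r z w * g y b w - J r z w * g y r w)"
    using Ji Jg_integrable[OF ab] by (subst set_integral_diff) auto
  then have "\<bar>(LBINT r:{a..b}. J r z w) * g y b w - (LBINT r:{a..b}. J r z w * g y r w)\<bar> =
    \<bar>LBINT r:{a..b}. J r z w * g y b w - J r z w * g y r w\<bar>" by (rule arg_cong)
  also have "\<dots> \<le> (K * (3 * K * exp K * (b - a))) * (b - a)"
  proof (rule set_integral_bound(2)[OF _ ab(2)])
    have "(\<lambda>r. J r z w * g y b w - J r z w * g y r w) \<in> borel_measurable (restrict_space borel {0..<1})"
      using J_measurable g_measurable by (intro borel_measurable_diff borel_measurable_times) auto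
    then show "(\<lambda>r. indicator {a..b} r * (J r z w * g y b w - J r z w * g y r w)) \<in> borel_measurable borel"
      using ab by (intro indicator_measurable_01) auto
    fix r assume r: "r \<in> {a..b}"
    have J: "0 \<le> J r z w" "J r z w \<le> K" using r ab J_nonneg J_le by auto
    have "\<bar>g y b w - g y r w\<bar> \<le> 3 * K * exp K * (b - r)"
      using g_lipschitz[of r b y w] r ab by (simp add: abs_minus_commute)
    also have "\<dots> \<le> 3 * K * exp K * (b - a)"
      using r K_nonneg by (intro mult_left_mono) auto
    finally have "J r z w * \<bar>g y b w - g y r w\<bar> \<le> K * (3 * K * exp K * (b - a))"
      using J K_nonneg by (intro mult_mono) auto
    then show "\<bar>J r z w * g y b w - J r z w * g y r w\<bar> \<le> K * (3 * K * exp K * (b - a))"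
      using J by (simp add: right_diff_distrib[symmetric] abs_mult)
  qed
  finally show ?thesis by (simp add: power2_eq_square mult_ac)
qed

text \<open>A path from z to w that does not move twice is geodesic on [a,b], so its weight is
  nearly the admissible weight from b on. The constant is 7 = 2 + 2 + 3: two moves together with the
  change of the exponential, then the replacement of the transition probability by the integral of
  J, then the unfreezing of \<open>g\<close>.\<close>

lemma one_step:
  assumes ab: "0 \<le> a" "a \<le> b" "b < 1" and zw: "z \<noteq> w"
  shows "\<bar>(\<integral>\<omega>. indicator (C b w) \<omega> * xi y a \<omega> \<partial>P a z) -
      admissible y z w * (LBINT r:{a..b}. J r z w * g y r w)\<bar> \<le> 7 * K\<^sup>2 * exp K * (b - a)\<^sup>2"
proof -
  have a1: "a < 1" using ab by simp
  interpret prob_space "P a z" using ab by (intro prob_space_P) auto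
  let ?T = "{\<omega> \<in> paths E. moves_twice \<omega> a b}"
  let ?A = "admissible y z w"
  let ?f = "\<lambda>\<omega>. indicator (C b w) \<omega> * xi y a \<omega>" and ?h = "\<lambda>\<omega>. indicator (C b w) \<omega> * xi y b \<omega>"
  let ?D = "\<lambda>\<omega>. exp K * indicator ?T \<omega> + exp K * (K * (b - a)) * indicator (C b w) \<omega>"
  have S[measurable]: "C b w \<in> events" unfolding sets_P using ab by (intro cyl_sets_Q) auto
  have T: "?T \<in> events" by (rule sets_path_sigma_P[OF _ moves_twice_sets]) (use ab in auto)
  have R: "?T \<in> sets R" "C b w \<in> sets R" using T S by (simp_all add: sets_P)
  have [measurable]: "xi y a \<in> borel_measurable (P a z)" "xi y b \<in> borel_measurable (P a z)"
    using ab by (auto intro!: xi_measurable_P)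
  have f: "0 \<le> ?f \<omega>" "?f \<omega> \<le> exp K" and h: "0 \<le> ?h \<omega>" "?h \<omega> \<le> exp K" for \<omega>
    using xi_nonneg xi_le[of a y \<omega>] xi_le[of b y \<omega>] ab by (auto simp: indicator_def)
  have i_f: "integrable (P a z) ?f"
    using f ab by (intro integrable_bounded_P[where c = "exp K"]) auto
  have i_h: "integrable (P a z) ?h"
    using h by (intro integrable_bounded_P[OF ab(1) a1, where c = "exp K"]) auto
  have i_D: "integrable (P a z) ?D"
    using T S by (intro Bochner_Integration.integrable_add integrable_mult_right integrable_real_indicator)
      (auto simp: emeasure_eq_measure)
  have "(\<integral>\<omega>. ?f \<omega> \<partial>P a z) - ?A * (prob (C b w) * g y b w) = (\<integral>\<omega>. ?f \<omega> - ?A * ?h \<omega> \<partial>P a z)"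
    using i_f i_h integral_cyl_xi[OF ab, where w = w and y = y and z = z] by simp
  then have "\<bar>(\<integral>\<omega>. ?f \<omega> \<partial>P a z) - ?A * (prob (C b w) * g y b w)\<bar> = \<bar>\<integral>\<omega>. ?f \<omega> - ?A * ?h \<omega> \<partial>P a z\<bar>"
    by (rule arg_cong)
  also have "\<dots> \<le> (\<integral>\<omega>. \<bar>?f \<omega> - ?A * ?h \<omega>\<bar> \<partial>P a z)" by (rule integral_abs_bound)
  also have "\<dots> \<le> (\<integral>\<omega>. ?D \<omega> \<partial>P a z)"
  proof (rule integral_mono_AE[OF _ i_D])
    show "integrable (P a z) (\<lambda>\<omega>. \<bar>?f \<omega> - ?A * ?h \<omega>\<bar>)"
      using i_f i_h by (intro integrable_abs Bochner_Integration.integrable_diff integrable_mult_right)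
    show "AE \<omega> in P a z. \<bar>?f \<omega> - ?A * ?h \<omega>\<bar> \<le> ?D \<omega>"
      using AE_P_start[OF ab(1) a1, of z]
    proof eventually_elim
      case (elim \<omega>)
      then have \<omega>: "\<omega> \<in> paths E" "\<omega> a = z" by auto
      have e0: "0 \<le> exp K * (K * (b - a))" using K_nonneg ab by auto
      show ?case
      \<comment> \<open>With two moves both weights are merely bounded by exp K; with one move they
        are close, and the small error is incurred only on X_b = w, whose probability is itself of
        order b - a.\<close>
      proof (cases "\<omega> b = w \<and> \<not> moves_twice \<omega> a b")
        case False
        show ?thesis
        proof (cases "\<omega> b = w")
          case True
          with False have m: "moves_twice \<omega> a b" by simp
          have "0 \<le> ?A * ?h \<omega>" by (rule mult_nonneg_nonneg[OF admissible_bounds(1) h(1)])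
          moreover have "?A * ?h \<omega> \<le> 1 * ?h \<omega>" by (rule mult_right_mono[OF admissible_bounds(2) h(1)])
          moreover note f[of \<omega>] h[of \<omega>]
          ultimately have "\<bar>?f \<omega> - ?A * ?h \<omega>\<bar> \<le> exp K" by linarith
          with m \<omega> True e0 show ?thesis by simp
        qed (use e0 in \<open>simp add: indicator_def\<close>)
      next
        case True
        then have n: "\<not> moves_twice \<omega> a b" "\<omega> a \<noteq> \<omega> b" using \<omega> zw by auto
        have geo: "geo d \<omega> a b"
          by (rule not_moves_twice(2)[OF dist \<omega>(1) ab(1,2) _ n]) (use ab in simp)
        have "\<bar>xi y a \<omega> - ?A * xi y b \<omega>\<bar> \<le> exp K * (K * (b - a))"
          using xi_close(2)[OF \<omega>(1) ab(1,2) _ geo, of y] ab \<omega> True by simp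
        then show ?thesis using True \<omega> by simp
      qed
    qed
  qed
  also have "\<dots> = exp K * prob ?T + exp K * (K * (b - a)) * prob (C b w)"
  proof -
    have "integrable (P a z) (indicator ?T :: _ \<Rightarrow> real)" "integrable (P a z) (indicator (C b w) :: _ \<Rightarrow> real)"
      using T S by (auto intro!: integrable_real_indicator simp: emeasure_eq_measure)
    then show ?thesis using integral_indicator_P[OF R(1), of a z] integral_indicator_P[OF R(2), of a z]
      by (subst Bochner_Integration.integral_add) auto
  qed
  also have "\<dots> \<le> exp K * (K\<^sup>2 * (b - a)\<^sup>2) + exp K * (K * (b - a)) * (K * (b - a))"
    using moves_twice_bound_start[OF ab, of z] cyl_le(2)[OF ab zw] K_nonneg ab
    by (intro add_mono mult_left_mono) auto
  finally have 1: "\<bar>(\<integral>\<omega>. ?f \<omega> \<partial>P a z) - ?A * (prob (C b w) * g y b w)\<bar> \<le> 2 * K\<^sup>2 * exp K * (b - a)\<^sup>2"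
    by (simp add: power2_eq_square mult_ac)
  let ?j = "LBINT r:{a..b}. J r z w" and ?q = "LBINT r:{a..b}. J r z w * g y r w"
  have gb: "0 \<le> g y b w" "g y b w \<le> exp K" using g_bounds[of b y w] ab by auto
  have "\<bar>prob (C b w) * g y b w - ?j * g y b w\<bar> = \<bar>prob (C b w) - ?j\<bar> * g y b w"
    using gb by (simp add: left_diff_distrib[symmetric] abs_mult)
  also have "\<dots> \<le> (2 * K\<^sup>2 * (b - a)\<^sup>2) * exp K"
    using transition_bound[OF ab zw] gb by (intro mult_mono) auto
  finally have 2: "\<bar>prob (C b w) * g y b w - ?j * g y b w\<bar> \<le> 2 * K\<^sup>2 * exp K * (b - a)\<^sup>2" by (simp add: mult_ac)
  have "\<bar>?j * g y b w - ?q\<bar> \<le> 3 * K\<^sup>2 * exp K * (b - a)\<^sup>2" by (rule Jg_close[OF ab])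
  with 2 have "\<bar>prob (C b w) * g y b w - ?q\<bar> \<le> 5 * K\<^sup>2 * exp K * (b - a)\<^sup>2" by linarith
  then have "?A * \<bar>prob (C b w) * g y b w - ?q\<bar> \<le> 1 * (5 * K\<^sup>2 * exp K * (b - a)\<^sup>2)"
    using admissible_bounds[of y z w] by (intro mult_mono) auto
  then have "\<bar>?A * (prob (C b w) * g y b w) - ?A * ?q\<bar> \<le> 5 * K\<^sup>2 * exp K * (b - a)\<^sup>2"
    using admissible_bounds[of y z w] by (simp add: right_diff_distrib[symmetric] abs_mult)
  with 1 show ?thesis by linarith
qed

end


section \<open>Bridges of the geodesic measure\<close>

context walk
begin

text \<open>If no weight leaves z at time s, none leaves it shortly afterwards, because the walk may
  wait in z. Then the weighted flux from z to w is zero as well, although its density is J times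
  \<open>g y r w\<close> with J positive; so \<open>g y s w\<close> cannot be positive. This makes
  the division by \<open>g y t z\<close> in the kernel harmless.\<close>

lemma weight_propagates:
  assumes s: "0 \<le> s" "s < 1" and zw: "E z w" "admissible y z w = 1" and gz: "g y s z = 0"
  shows "g y s w = 0"
proof (rule ccontr)
  assume "g y s w \<noteq> 0"
  define c where "c = g y s w"
  have c: "0 < c" using \<open>g y s w \<noteq> 0\<close> g_bounds(1)[OF s, of y w] by (simp add: c_def)
  define L where "L = 3 * K * exp K"
  have L: "0 \<le> L" using K_nonneg by (simp add: L_def)
  \<comment> \<open>The three bounds ensure s + e < 1, a positive probability of waiting during
    [s,s+e], and that \<open>g y r w\<close> stays above c / 2 there by its Lipschitz bound.\<close>
  define e where "e = min ((1 - s) / 2) (min (1 / (2 * (K + 1))) (c / (4 * (L + 1))))"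
  have e: "0 < e" "s + e < 1" using s c L K_nonneg by (auto simp: e_def min_def field_simps)
  have Ke: "K * e < 1"
  proof -
    have "K * e \<le> K * (1 / (2 * (K + 1)))" using K_nonneg by (intro mult_left_mono) (auto simp: e_def)
    also have "\<dots> < 1" using K_nonneg by (simp add: field_simps)
    finally show ?thesis .
  qed
  have Le: "L * e \<le> c / 2"
  proof -
    have "L * e \<le> L * (c / (4 * (L + 1)))" using L by (intro mult_left_mono) (auto simp: e_def)
    also have "\<dots> \<le> c / 2" using L c by (simp add: field_simps)
    finally show ?thesis .
  qed
  have ne: "z \<noteq> w" using zw E_irrefl by auto
  \<comment> \<open>The paths that wait in z during [s,a] have positive probability, and for them
    the weight from s on is at least the weight from a on. Hence \<open>g y s z\<close> dominates a
    positive multiple of \<open>g y a z\<close>.\<close>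
  have gaz: "g y a z = 0" if a: "s \<le> a" "a \<le> s + e" for a
  proof -
    have a1: "a < 1" "0 \<le> a" using a e s by auto
    interpret prob_space "P s z" using s by (intro prob_space_P)
    let ?T = "{\<omega> \<in> paths E. moves \<omega> s a}"
    let ?N = "space (P s z) - ?T"
    have TF: "?T \<in> sets (path_sigma E {0..a})"
      by (rule path_sigma_mono[OF _ moves_sets]) (use s a a1 in auto)
    have NF: "?N \<in> sets (path_sigma E {0..a})" using sets.Diff[OF sets.top TF] by simp
    have T: "?T \<in> events" by (rule sets_path_sigma_P[OF _ TF]) (use a1 in auto)
    have S: "C a z \<in> events" unfolding sets_P using a1 by (intro cyl_sets_Q) auto
    have NR: "?N \<in> sets R" using sets.compl_sets[OF T] by (simp add: sets_P)
    have [measurable]: "?N \<in> events" using T by (rule sets.compl_sets)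
    have [measurable]: "xi y s \<in> borel_measurable (P s z)" "xi y a \<in> borel_measurable (P s z)"
      using s a1 by (auto intro!: xi_measurable_P)
    have "(\<integral>\<omega>. indicator ?N \<omega> * xi y a \<omega> * indicator (C a z) \<omega> \<partial>P s z) =
      (\<integral>\<omega>. indicator ?N \<omega> * indicator (C a z) \<omega> \<partial>P s z) * g y a z"
      unfolding g_def
    proof (rule markov_expect[OF s(1) a(1) a1(1)])
      show "indicator ?N \<in> borel_measurable (path_sigma E {0..a})" using NF by simp
      show "xi y a \<in> borel_measurable (path_sigma E {a..1})" using a1 by (intro xi_measurable) auto
    qed (auto simp: xi_nonneg)
    moreover have "(\<integral>\<omega>. indicator ?N \<omega> * xi y a \<omega> * indicator (C a z) \<omega> \<partial>P s z) \<le> (\<integral>\<omega>. xi y s \<omega> \<partial>P s z)"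
    proof (rule integral_mono_AE)
      show "integrable (P s z) (xi y s)"
        using s xi_nonneg xi_le[of s y] by (intro integrable_bounded_P[where c = "exp K"]) auto
      have b: "\<bar>indicator ?N \<omega> * xi y a \<omega> * indicator (C a z) \<omega>\<bar> \<le> exp K" for \<omega>
        using xi_nonneg[of y a \<omega>] xi_le[of a y \<omega>] a1 by (auto simp: indicator_def)
      have m: "(\<lambda>\<omega>. indicator ?N \<omega> * xi y a \<omega> * indicator (C a z) \<omega>) \<in> borel_measurable (P s z)"
        using S by (intro borel_measurable_times borel_measurable_indicator \<open>?N \<in> events\<close> \<open>xi y a \<in> _\<close>)
      show "integrable (P s z) (\<lambda>\<omega>. indicator ?N \<omega> * xi y a \<omega> * indicator (C a z) \<omega>)"
        by (rule integrable_bounded_P[OF s m b])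
      show "AE \<omega> in P s z. indicator ?N \<omega> * xi y a \<omega> * indicator (C a z) \<omega> \<le> xi y s \<omega>"
        using AE_P_start[OF s, of z]
      proof eventually_elim
        case (elim \<omega>)
        then have \<omega>: "\<omega> \<in> paths E" "\<omega> s = z" by auto
        show ?case
        proof (cases "moves \<omega> s a")
          case False
          note nm = not_moves[OF False a(1)]
          have "xi y a \<omega> \<le> xi y s \<omega>"
            using xi_close(1)[OF \<omega>(1) s(1) a(1) _ nm(2), of y] nm a1 by (simp add: admissible_self)
          then show ?thesis using xi_nonneg[of y s \<omega>] by (auto simp: indicator_def)
        qed (use \<omega> xi_nonneg in \<open>simp add: indicator_def\<close>)
      qed
    qed
    moreover have "(\<integral>\<omega>. xi y s \<omega> \<partial>P s z) = 0" using gz by (simp add: g_def)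
    moreover have "0 < (\<integral>\<omega>. (indicator ?N \<omega> :: real) * indicator (C a z) \<omega> \<partial>P s z)"
    proof -
      have "(\<integral>\<omega>. (indicator ?N \<omega> :: real) * indicator (C a z) \<omega> \<partial>P s z) = (\<integral>\<omega>. indicator ?N \<omega> \<partial>P s z)"
      proof (rule integral_cong_AE)
        show "AE \<omega> in P s z. indicator ?N \<omega> * indicator (C a z) \<omega> = (indicator ?N \<omega> :: real)"
          using AE_P_start[OF s, of z] by eventually_elim (use not_moves(1)[OF _ a(1)] in \<open>auto simp: indicator_def\<close>)
      qed (use S in measurable)
      also have "\<dots> = 1 - prob ?T" using integral_indicator_P[OF NR, of s z] prob_compl[OF T] by simp
      finally have I: "(\<integral>\<omega>. (indicator ?N \<omega> :: real) * indicator (C a z) \<omega> \<partial>P s z) = 1 - prob ?T" .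
      have "prob ?T \<le> K * (a - s)" using s a a1 by (intro moves_bound_start) auto
      also have "K * (a - s) \<le> K * e" using a K_nonneg by (intro mult_left_mono) auto
      finally show ?thesis unfolding I using Ke by linarith
    qed
    moreover have "0 \<le> g y a z" using g_bounds a1 by simp
    ultimately have "(\<integral>\<omega>. (indicator ?N \<omega> :: real) * indicator (C a z) \<omega> \<partial>P s z) * g y a z \<le> 0"
      "0 < (\<integral>\<omega>. (indicator ?N \<omega> :: real) * indicator (C a z) \<omega> \<partial>P s z)" "0 \<le> g y a z" by linarith+
    moreover have "i * v \<le> 0 \<Longrightarrow> 0 < i \<Longrightarrow> 0 \<le> v \<Longrightarrow> v = 0" for i v :: real
      by (auto simp: mult_le_0_iff)
    ultimately show ?thesis by blast
  qed
  define F where "F t = (LBINT r:{s..t}. J r z w * g y r w)" for t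
  have Fd: "F b - F a = (LBINT r:{a..b}. J r z w * g y r w)" if "s \<le> a" "a \<le> b" "b \<le> s + e" for a b
    unfolding F_def using that e s set_integral_split[OF Jg_integrable[of s b z w y] that(1,2)] by simp
  \<comment> \<open>As no weight leaves z, the expectation in \<open>one_step\<close> vanishes on
    every cell, and only its error of order (b - a)^2 remains.\<close>
  have "F (s + e) = F s"
  proof (rule zero_increment[where F = F and c = "7 * K\<^sup>2 * exp K"])
    fix a b assume ab: "s \<le> a" "a \<le> b" "b \<le> s + e"
    then have ab': "0 \<le> a" "a < 1" "b < 1" using s e by auto
    interpret prob_space "P a z" using ab' by (intro prob_space_P)
    have S: "C b w \<in> events" unfolding sets_P using ab ab' by (intro cyl_sets_Q) auto
    have xm: "xi y a \<in> borel_measurable (P a z)" using ab' by (intro xi_measurable_P) auto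
    have xb: "\<bar>xi y a \<omega>\<bar> \<le> exp K" "\<bar>indicator (C b w) \<omega> * xi y a \<omega>\<bar> \<le> exp K" for \<omega>
      using xi_nonneg[of y a \<omega>] xi_le[of a y \<omega>] ab' by (auto simp: indicator_def)
    have "(\<integral>\<omega>. indicator (C b w) \<omega> * xi y a \<omega> \<partial>P a z) \<le> (\<integral>\<omega>. xi y a \<omega> \<partial>P a z)"
      using ab' xm S xb xi_nonneg
      by (intro integral_mono integrable_bounded_P[where c = "exp K"] borel_measurable_times borel_measurable_indicator)
        (auto simp: indicator_def)
    moreover have "0 \<le> (\<integral>\<omega>. indicator (C b w) \<omega> * xi y a \<omega> \<partial>P a z)"
      using xi_nonneg by (intro Bochner_Integration.integral_nonneg) auto
    ultimately have "(\<integral>\<omega>. indicator (C b w) \<omega> * xi y a \<omega> \<partial>P a z) = 0"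
      using gaz[OF ab(1)] ab by (simp add: g_def)
    then show "\<bar>F b - F a\<bar> \<le> 7 * K\<^sup>2 * exp K * (b - a)\<^sup>2"
      using one_step[OF ab'(1) ab(2) ab'(3) ne, of y] zw(2) by (simp add: Fd[OF ab])
  qed (use e in auto)
  then have "(LBINT r:{s..s+e}. J r z w * g y r w) = 0" using Fd[of s "s + e"] e by simp
  moreover have "(LBINT r:{s..s+e}. J r z w * (c / 2)) \<le> (LBINT r:{s..s+e}. J r z w * g y r w)"
  proof (rule set_integral_mono)
    show "set_integrable lborel {s..s + e} (\<lambda>r. J r z w * (c / 2))"
      using J_integral(1)[of s "s + e" z w] s e by (intro set_integrable_mult_left) auto
    show "set_integrable lborel {s..s + e} (\<lambda>r. J r z w * g y r w)" using s e by (intro Jg_integrable) auto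
    fix r assume r: "r \<in> {s..s + e}"
    have "L * (r - s) \<le> L * e" using r L by (intro mult_left_mono) auto
    moreover have "\<bar>g y s w - g y r w\<bar> \<le> L * (r - s)"
      using g_lipschitz[of s r y w] r s e by (simp add: L_def)
    ultimately have "c / 2 \<le> g y r w" using Le unfolding c_def by linarith
    then show "J r z w * (c / 2) \<le> J r z w * g y r w" using J_nonneg r s e by (intro mult_left_mono) auto
  qed
  ultimately have "(LBINT r:{s..s+e}. J r z w) * (c / 2) \<le> 0" by simp
  then have J0: "(LBINT r:{s..s+e}. J r z w) = 0"
    using c J_integral(2)[of s "s + e" z w] s e by (simp add: mult_le_0_iff)
  \<comment> \<open>A nonnegative function with integral 0 vanishes almost everywhere, whereas J is
    positive at every time; so an interval of length e would be a null set.\<close>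
  have "AE r in lborel. indicator {s..s+e} r *\<^sub>R J r z w = 0"
  proof (rule integral_nonneg_eq_0_iff_AE[THEN iffD1])
    show "integrable lborel (\<lambda>r. indicator {s..s+e} r *\<^sub>R J r z w)"
      using J_integral(1)[of s "s + e" z w] s e by (simp add: set_integrable_def)
    show "AE r in lborel. 0 \<le> indicator {s..s+e} r *\<^sub>R J r z w"
      using J_nonneg s e by (auto simp: indicator_def)
    show "(LBINT r. indicator {s..s+e} r *\<^sub>R J r z w) = 0" using J0 by (simp add: set_lebesgue_integral_def)
  qed
  then have "AE r in lborel. r \<notin> {s..s+e}"
  proof eventually_elim
    case (elim r)
    then show ?case using J_pos[of r z w] zw(1) s e by (auto simp: indicator_def)
  qed
  then have "emeasure lborel {r \<in> space lborel. r \<in> {s..s+e}} = 0"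
    by (intro emeasure_eq_0_AE) simp
  then have "emeasure lborel {s..s+e} = 0" by (simp add: atLeastAtMost_def atLeast_def atMost_def Int_def)
  then show False using e by simp
qed

text \<open>A single path of nonzero weight starting in w at time t would, preceded by z, make w a
  successor of z.\<close>

lemma weight_zero:
  assumes t: "0 < t" "t < 1" and zw: "E z w" "d z w + d w y = d z y" and w: "w \<notin> successors E d y z"
  shows "g y t w = 0"
proof -
  have t0: "0 \<le> t" using t by simp
  have "(\<integral>\<omega>. xi y t \<omega> \<partial>P t w) = (\<integral>\<omega>. 0 \<partial>P t w)"
  proof (rule integral_cong_AE)
    show "AE \<omega> in P t w. xi y t \<omega> = 0"
      using AE_P_start[OF t0 t(2), of w]
    proof eventually_elim
      case (elim \<omega>)
      then show ?case
        using successorsI[OF dist t, of \<omega> E w y z] zw w by (auto simp: xi_def indicator_def)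
    qed
  qed (use t in \<open>auto intro!: xi_measurable_P\<close>)
  then show ?thesis by (simp add: g_def)
qed

text \<open>Multiplication by \<open>g y t z\<close> removes the denominator of the kernel, also
  where it vanishes: there the left side is 0 and \<open>weight_propagates\<close> makes the right
  side 0. It is in this product form that the kernel enters the forward equation. Time 0 is left out
  because \<open>successorsI\<close> needs a moment before the jump.\<close>

lemma geodesic_kernel_eq:
  assumes t: "0 < t" "t < 1"
  shows "geodesic_kernel E d R J y t z w * g y t z = admissible y z w * J t z w * g y t w"
proof (cases "w \<in> successors E d y z")
  case True
  note s = successors_imp[OF dist True]
  have adm: "admissible y z w = 1" using s by (simp add: admissible_def)
  have "g y t w = 0" if "g y t z = 0"
    using weight_propagates[OF _ t(2) s(1) adm that] t by simp
  then show ?thesis using True t adm by (auto simp: geodesic_kernel_def geodesic_weight_eq_g)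
next
  case False
  have "E z w \<Longrightarrow> d z w + d w y = d z y \<Longrightarrow> g y t w = 0" by (rule weight_zero[OF t _ _ False])
  then have "admissible y z w * J t z w * g y t w = 0"
    using J_zero[of t z w] t by (cases "E z w") (auto simp: admissible_def)
  then show ?thesis using False by (simp add: geodesic_kernel_def)
qed

text \<open>The past factor of the density of the bridge, complementary to \<open>xi\<close>. The
  target y enters only through the state at time t.\<close>

definition W :: "'a \<Rightarrow> 'a \<Rightarrow> real \<Rightarrow> (real \<Rightarrow> 'a) \<Rightarrow> real" where
  "W x y t \<omega> = indicator {\<gamma> \<in> paths E. geo d \<gamma> 0 t \<and> \<gamma> 0 = x} \<omega> * admissible y x (\<omega> t) *
     exp (LBINT s:{0..t}. total_rate E J s (\<omega> s))"

lemma W_nonneg: "0 \<le> W x y t \<omega>"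
  using admissible_bounds by (simp add: W_def)

lemma W_le: "0 \<le> t \<Longrightarrow> t \<le> 1 \<Longrightarrow> W x y t \<omega> \<le> exp K"
proof (cases "\<omega> \<in> paths E")
  case True
  assume t: "0 \<le> t" "t \<le> 1"
  have "K * (t - 0) \<le> K * 1" using t K_nonneg by (intro mult_left_mono) auto
  with rate_integral(3)[OF True order_refl t] show ?thesis by (auto simp: W_def indicator_def admissible_def)
qed (simp add: W_def)

lemma W_measurable:
  assumes t: "0 \<le> t" "t \<le> 1"
  shows "W x y t \<in> borel_measurable (path_sigma E {0..t})"
proof -
  have "{\<gamma> \<in> paths E. geo d \<gamma> 0 t} \<inter> C 0 x \<in> sets (path_sigma E {0..t})"
    using t by (intro sets.Int geo_measurable cyl_sets) auto
  also have "{\<gamma> \<in> paths E. geo d \<gamma> 0 t} \<inter> C 0 x = {\<gamma> \<in> paths E. geo d \<gamma> 0 t \<and> \<gamma> 0 = x}" by auto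
  finally have [measurable]: "{\<gamma> \<in> paths E. geo d \<gamma> 0 t \<and> \<gamma> 0 = x} \<in> sets (path_sigma E {0..t})" .
  have [measurable]: "(\<lambda>\<omega>. admissible y x (\<omega> t)) \<in> borel_measurable (path_sigma E {0..t})"
    by (rule measurable_compose[OF coord_measurable]) (use t in auto)
  have [measurable]: "(\<lambda>\<omega>. LBINT s:{0..t}. total_rate E J s (\<omega> s)) \<in> borel_measurable (path_sigma E {0..t})"
    using t by (intro rate_integral_measurable) auto
  show ?thesis unfolding W_def by measurable
qed

lemma xi_eq_W:
  assumes \<omega>: "\<omega> \<in> paths E" "\<omega> 0 = x" and t: "0 \<le> t" "t \<le> 1"
  shows "xi y 0 \<omega> = W x y t \<omega> * xi y t \<omega>"
proof (cases "geo d \<omega> 0 t")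
  case True
  from xi_split[OF \<omega>(1) order_refl t True, of y] show ?thesis
    using \<omega> True by (simp add: W_def)
next
  case False
  with geo_split[OF dist t, of \<omega>] show ?thesis by (simp add: xi_def W_def)
qed

text \<open>The bridge event has G-mass \<open>g y 0 x\<close> times R(X_0 = x). If it is zero, the
  value 1 / 0 = 0 agrees with \<open>uniform_measure\<close>, which is then the zero
  measure.\<close>

definition norm_const :: "'a \<Rightarrow> 'a \<Rightarrow> real" where
  "norm_const x y = 1 / g y 0 x"

lemma norm_const_nonneg: "0 \<le> norm_const x y"
  using g_bounds(1)[of 0 y x] by (simp add: norm_const_def)

abbreviation B :: "'a \<Rightarrow> 'a \<Rightarrow> (real \<Rightarrow> 'a) measure" where
  "B x y \<equiv> bridge (geodesic_measure E d R J) x y"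

lemma sets_B: "sets (B x y) = sets R"
  by (simp add: bridge_def geodesic_measure_def)

lemma space_B [simp]: "space (B x y) = paths E"
  by (simp add: bridge_def geodesic_measure_def)

lemma integral_xi_indicator:
  assumes A: "A \<in> sets R"
  shows "0 \<le> (\<integral>\<omega>. xi y 0 \<omega> * indicator A \<omega> \<partial>P 0 x)" "(\<integral>\<omega>. xi y 0 \<omega> * indicator A \<omega> \<partial>P 0 x) \<le> g y 0 x"
    "integrable (P 0 x) (\<lambda>\<omega>. xi y 0 \<omega> * indicator A \<omega>)"
proof -
  have m[measurable]: "xi y 0 \<in> borel_measurable (P 0 x)" by (intro xi_measurable_P) auto
  have [measurable]: "A \<in> sets (P 0 x)" using A by (simp add: sets_P)
  have b: "\<bar>xi y 0 \<omega> * indicator A \<omega>\<bar> \<le> exp K" "\<bar>xi y 0 \<omega>\<bar> \<le> exp K" for \<omega>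
    using xi_nonneg[of y 0 \<omega>] xi_le[of 0 y \<omega>] by (auto simp: indicator_def)
  show i: "integrable (P 0 x) (\<lambda>\<omega>. xi y 0 \<omega> * indicator A \<omega>)"
    by (rule integrable_bounded_P[OF _ _ _ b(1)]) auto
  have i0: "integrable (P 0 x) (xi y 0)"
    by (rule integrable_bounded_P[OF _ _ _ b(2)]) auto
  show "0 \<le> (\<integral>\<omega>. xi y 0 \<omega> * indicator A \<omega> \<partial>P 0 x)"
    using xi_nonneg by (intro Bochner_Integration.integral_nonneg) auto
  show "(\<integral>\<omega>. xi y 0 \<omega> * indicator A \<omega> \<partial>P 0 x) \<le> g y 0 x"
    unfolding g_def using xi_nonneg by (intro integral_mono i i0) (auto simp: indicator_def)
qed

text \<open>On X_0 = x and X_1 = y the density of G is \<open>xi y 0\<close>; the mass R(X_0 = x)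
  cancels between numerator and denominator.\<close>

lemma emeasure_bridge:
  assumes A: "A \<in> sets R"
  shows "emeasure (B x y) A = ennreal (norm_const x y * (\<integral>\<omega>. xi y 0 \<omega> * indicator A \<omega> \<partial>P 0 x))"
proof -
  let ?G = "geodesic_measure E d R J" and ?r = "measure R (C 0 x)"
  let ?X = "{\<omega> \<in> space ?G. \<omega> 0 = x \<and> \<omega> 1 = y}"
  let ?D = "\<lambda>\<omega>. indicator (geodesics E d) \<omega> * ennreal (exp (LBINT t:{0..1}. total_rate E J t (\<omega> t)))"
  have X: "?X = C 0 x \<inter> C 1 y" by (auto simp: geodesic_measure_def)
  have c0: "C 0 x \<in> sets R" "C 1 y \<in> sets R" by (auto intro!: cyl_sets_Q)
  then have XR: "?X \<in> sets R" unfolding X by (rule sets.Int)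
  have "geodesics E d = {\<omega> \<in> paths E. geo d \<omega> 0 1}"
    using geodesics_iff[OF dist] by blast
  also have "\<dots> \<in> sets R" unfolding sets_Q by (rule geo_measurable) auto
  finally have gm: "geodesics E d \<in> sets R" .
  have "(\<lambda>\<omega>. LBINT t:{0..1}. total_rate E J t (\<omega> t)) \<in> borel_measurable R"
    by (rule measurable_path_sigma_Q[OF _ rate_integral_measurable]) auto
  then have Dm: "?D \<in> borel_measurable R" using gm by measurable
  have xm: "xi y 0 \<in> borel_measurable R"
    by (rule measurable_path_sigma_Q[OF _ xi_measurable]) auto
  have G: "emeasure ?G (?X \<inter> S) = ennreal (?r * (\<integral>\<omega>. xi y 0 \<omega> * indicator S \<omega> \<partial>P 0 x))" if S: "S \<in> sets R" for S
  proof -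
    note [measurable] = S c0
    have "emeasure ?G (?X \<inter> S) = (\<integral>\<^sup>+\<omega>. ?D \<omega> * indicator (?X \<inter> S) \<omega> \<partial>R)"
      unfolding geodesic_measure_def by (rule emeasure_density[OF Dm]) (rule sets.Int[OF XR[unfolded geodesic_measure_def] S])
    also have "\<dots> = (\<integral>\<^sup>+\<omega>. ennreal (xi y 0 \<omega> * indicator S \<omega>) * indicator (C 0 x) \<omega> \<partial>R)"
      unfolding X using geodesics_iff[OF dist]
      by (intro nn_integral_cong) (auto simp: xi_def indicator_def)
    also have "\<dots> = (\<integral>\<^sup>+\<omega>. ennreal (xi y 0 \<omega> * indicator S \<omega>) \<partial>P 0 x) * emeasure R (C 0 x)"
      unfolding P_def using xm R_C_emeasure[of 0 x]
      by (subst nn_integral_uniform_measure) (auto simp: ennreal_divide_times ennreal_divide_self less_top)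
    also have "(\<integral>\<^sup>+\<omega>. ennreal (xi y 0 \<omega> * indicator S \<omega>) \<partial>P 0 x) = ennreal (\<integral>\<omega>. xi y 0 \<omega> * indicator S \<omega> \<partial>P 0 x)"
      using xi_nonneg by (intro nn_integral_eq_integral integral_xi_indicator S) auto
    also have "emeasure R (C 0 x) = ennreal ?r"
      using R_C_emeasure[of 0 x] by (intro emeasure_eq_ennreal_measure) auto
    finally show ?thesis
      using integral_xi_indicator(1)[OF S] by (simp add: ennreal_mult[symmetric] mult.commute)
  qed
  have "(\<integral>\<omega>. xi y 0 \<omega> * indicator (space R) \<omega> \<partial>P 0 x) = g y 0 x"
    unfolding g_def by (intro Bochner_Integration.integral_cong) auto
  then have GX: "emeasure ?G ?X = ennreal (?r * g y 0 x)"
    using G[OF sets.top] sets.sets_into_space[OF XR] by (simp add: Int_absorb2)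
  have "emeasure (B x y) A = emeasure ?G (?X \<inter> A) / emeasure ?G ?X"
    unfolding bridge_def using XR A by (intro emeasure_uniform_measure) (auto simp: geodesic_measure_def)
  also have "\<dots> = ennreal (norm_const x y * (\<integral>\<omega>. xi y 0 \<omega> * indicator A \<omega> \<partial>P 0 x))"
  proof (cases "g y 0 x = 0")
    case True
    then show ?thesis
      using integral_xi_indicator(1,2)[OF A, where x = x and y = y]
      by (simp add: G[OF A] GX norm_const_def del: mem_Collect_eq)
  next
    case False
    then have "0 < g y 0 x" using g_bounds(1)[of 0 y x] by simp
    moreover have "0 < ?r" using R_C_pos[of 0 x] by simp
    ultimately show ?thesis
      unfolding G[OF A] GX using integral_xi_indicator(1)[OF A, where x = x and y = y]
      by (subst divide_ennreal) (auto simp: norm_const_def)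
  qed
  finally show ?thesis .
qed

lemma measure_bridge:
  assumes "A \<in> sets R"
  shows "measure (B x y) A = norm_const x y * (\<integral>\<omega>. xi y 0 \<omega> * indicator A \<omega> \<partial>P 0 x)"
  using emeasure_bridge[OF assms] integral_xi_indicator(1)[OF assms] norm_const_nonneg
  by (simp add: measure_def)

lemma finite_path_space_bridge: "finite_path_space E (B x y)"
proof -
  interpret finite_measure "B x y"
    by (rule finite_measureI) (simp add: emeasure_bridge[OF sets.top, simplified])
  show ?thesis by unfold_locales (simp add: path_measure_def sets_B sets_Q)
qed

lemma emeasure_bridge_split:
  assumes A: "A \<in> sets R" "A \<subseteq> C t z" and t: "0 \<le> t" "t \<le> 1"
  shows "emeasure (B x y) A = ennreal (norm_const x y) *
    ((\<integral>\<^sup>+\<omega>. ennreal (W x y t \<omega>) * ennreal (xi y t \<omega>) * indicator A \<omega> \<partial>R) / emeasure R (C 0 x))"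
proof -
  have m[measurable]: "xi y 0 \<in> borel_measurable R" "xi y t \<in> borel_measurable R" "W x y t \<in> borel_measurable R"
    using t by (auto intro!: measurable_path_sigma_Q[OF _ xi_measurable] measurable_path_sigma_Q[OF _ W_measurable])
  note [measurable] = A(1)
  have [measurable]: "C 0 x \<in> sets R" by (intro cyl_sets_Q) auto
  have "emeasure (B x y) A = ennreal (norm_const x y) * ennreal (\<integral>\<omega>. xi y 0 \<omega> * indicator A \<omega> \<partial>P 0 x)"
    using emeasure_bridge[OF A(1)] norm_const_nonneg integral_xi_indicator(1)[OF A(1)] by (simp add: ennreal_mult)
  also have "ennreal (\<integral>\<omega>. xi y 0 \<omega> * indicator A \<omega> \<partial>P 0 x) = (\<integral>\<^sup>+\<omega>. ennreal (xi y 0 \<omega> * indicator A \<omega>) \<partial>P 0 x)"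
    using xi_nonneg by (intro nn_integral_eq_integral[symmetric] integral_xi_indicator A) auto
  also have "\<dots> = (\<integral>\<^sup>+\<omega>. ennreal (xi y 0 \<omega> * indicator A \<omega>) * indicator (C 0 x) \<omega> \<partial>R) / emeasure R (C 0 x)"
    unfolding P_def by (rule nn_integral_uniform_measure) measurable
  also have "(\<integral>\<^sup>+\<omega>. ennreal (xi y 0 \<omega> * indicator A \<omega>) * indicator (C 0 x) \<omega> \<partial>R) =
    (\<integral>\<^sup>+\<omega>. ennreal (W x y t \<omega>) * ennreal (xi y t \<omega>) * indicator A \<omega> \<partial>R)"
  proof (rule nn_integral_cong)
    fix \<omega> assume "\<omega> \<in> space R"
    then have "\<omega> \<in> paths E" by simp
    then show "ennreal (xi y 0 \<omega> * indicator A \<omega>) * indicator (C 0 x) \<omega> =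
      ennreal (W x y t \<omega>) * ennreal (xi y t \<omega>) * indicator A \<omega>"
    proof (cases "\<omega> 0 = x")
      case True
      then show ?thesis
        using xi_eq_W[OF \<open>\<omega> \<in> paths E\<close> True t, of y] \<open>\<omega> \<in> paths E\<close> W_nonneg xi_nonneg
        by (simp add: indicator_def ennreal_mult)
    next
      case False
      then show ?thesis by (simp add: W_def)
    qed
  qed
  finally show ?thesis .
qed

text \<open>On X_t = z the density is a function of the past times a function of the future, and R
  makes the two conditionally independent. Thus all four masses in \<open>cond_indep\<close> are
  products of a past and a future integral, and both sides contain the same factors.\<close>

lemma markov_bridge: "markov_measure E (B x y)"
proof -
  interpret Q: finite_path_space E "B x y" by (rule finite_path_space_bridge)
  have "cond_indep E (B x y)"
    unfolding cond_indep_def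
  proof (intro ballI allI)
    fix t :: real and z A D
    assume t: "t \<in> {0..1}" and A: "A \<in> sets (path_sigma E {0..t})" and D: "D \<in> sets (path_sigma E {t..1})"
    let ?Z = "C t z"
    have t': "0 \<le> t" "t \<le> 1" using t by auto
    have AR: "A \<in> sets R" and DR: "D \<in> sets R" and ZR: "?Z \<in> sets R"
      using t' by (auto intro!: sets_path_sigma_Q[OF _ A] sets_path_sigma_Q[OF _ D] cyl_sets_Q)
    define N where "N f h = (\<integral>\<^sup>+\<omega>. f \<omega> * h \<omega> * indicator ?Z \<omega> \<partial>R)" for f h :: "_ \<Rightarrow> ennreal"
    define \<rho> where "\<rho> = emeasure R ?Z"
    let ?W = "\<lambda>\<omega>. ennreal (W x y t \<omega>)" and ?X = "\<lambda>\<omega>. ennreal (xi y t \<omega>)"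
    let ?WA = "\<lambda>\<omega>. ?W \<omega> * indicator A \<omega>" and ?XD = "\<lambda>\<omega>. ?X \<omega> * indicator D \<omega>"
    let ?k = "ennreal (norm_const x y)" and ?r = "emeasure R (C 0 x)"
    have fm: "?W \<in> borel_measurable (path_sigma E {0..t})" "?WA \<in> borel_measurable (path_sigma E {0..t})"
      and hm: "?X \<in> borel_measurable (path_sigma E {t..1})" "?XD \<in> borel_measurable (path_sigma E {t..1})"
      using W_measurable[OF t'] xi_measurable[OF t'] A D by measurable
    have N: "N f h * \<rho> = N f (\<lambda>_. 1) * N (\<lambda>_. 1) h"
      if "f \<in> borel_measurable (path_sigma E {0..t})" "h \<in> borel_measurable (path_sigma E {t..1})" for f h
      using cond_indep_nn_integral[OF cond_indep t' that, of z] by (simp add: N_def \<rho>_def)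
    have e: "emeasure (B x y) (S \<inter> ?Z) = ?k * (N f h / ?r)"
      if "S \<in> sets R" "\<And>\<omega>. f \<omega> * h \<omega> = ?W \<omega> * ?X \<omega> * indicator S \<omega>" for S f h
    proof -
      have "emeasure (B x y) (S \<inter> ?Z) =
        ?k * ((\<integral>\<^sup>+\<omega>. ?W \<omega> * ?X \<omega> * indicator (S \<inter> ?Z) \<omega> \<partial>R) / ?r)"
        using that ZR t' by (intro emeasure_bridge_split[where z = z]) auto
      also have "(\<integral>\<^sup>+\<omega>. ?W \<omega> * ?X \<omega> * indicator (S \<inter> ?Z) \<omega> \<partial>R) = N f h"
        unfolding N_def that(2) by (intro nn_integral_cong) (auto simp: indicator_def)
      finally show ?thesis .
    qed
    have Zs: "space R \<inter> ?Z = ?Z" by auto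
    have e1: "emeasure (B x y) (A \<inter> D \<inter> ?Z) = ?k * (N ?WA ?XD / ?r)"
      using AR DR by (intro e) (auto simp: indicator_def)
    have e2: "emeasure (B x y) (A \<inter> ?Z) = ?k * (N ?WA ?X / ?r)"
      using AR by (intro e) (auto simp: indicator_def)
    have e3: "emeasure (B x y) (D \<inter> ?Z) = ?k * (N ?W ?XD / ?r)"
      using DR by (intro e) (auto simp: mult.assoc)
    have e4: "emeasure (B x y) ?Z = ?k * (N ?W ?X / ?r)"
    proof -
      have "emeasure (B x y) ?Z = emeasure (B x y) (?Z \<inter> ?Z)" by simp
      also have "\<dots> = ?k * ((\<integral>\<^sup>+\<omega>. ?W \<omega> * ?X \<omega> * indicator (?Z \<inter> ?Z) \<omega> \<partial>R) / ?r)"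
        using ZR t' by (intro emeasure_bridge_split[where z = z]) auto
      finally show ?thesis by (simp add: N_def)
    qed
    show "emeasure (B x y) (A \<inter> D \<inter> ?Z) * emeasure (B x y) ?Z = emeasure (B x y) (A \<inter> ?Z) * emeasure (B x y) (D \<inter> ?Z)"
    \<comment> \<open>The factorised integrals are obtained by dividing by the R-mass of X_t = z; if
      it is zero, the bridge does not charge this state either.\<close>
    proof (cases "\<rho> = 0")
      case True
      have "emeasure (B x y) S = 0" if S: "S \<in> sets R" "S \<subseteq> ?Z" for S
      proof -
        have "emeasure R S = 0"
          using emeasure_mono[OF S(2) ZR] True by (simp add: \<rho>_def)
        then have "S \<in> null_sets R" using S by (auto simp: null_sets_def)
        then have "(\<integral>\<^sup>+\<omega>. ?W \<omega> * ?X \<omega> * indicator S \<omega> \<partial>R) = 0"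
          by (rule nn_integral_null_set)
        then show ?thesis using emeasure_bridge_split[OF S t', of x y] by simp
      qed
      then show ?thesis using AR DR ZR by simp
    next
      case False
      have "\<rho> < \<infinity>" unfolding \<rho>_def using t' by (rule R_C_finite)
      then have NN: "N f h = N f (\<lambda>_. 1) * N (\<lambda>_. 1) h / \<rho>"
        if "f \<in> borel_measurable (path_sigma E {0..t})" "h \<in> borel_measurable (path_sigma E {t..1})" for f h
        using False N[OF that] ennreal_mult_divide_eq[of \<rho> "N f h"] by simp
      show ?thesis
        unfolding e1 e2 e3 e4 NN[OF fm(1) hm(1)] NN[OF fm(2) hm(1)] NN[OF fm(1) hm(2)] NN[OF fm(2) hm(2)]
        by (simp add: divide_ennreal_def mult_ac)
    qed
  qed
  then show ?thesis by (intro Q.cond_indep_imp_markov) (rule Q.finite_measure_axioms)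
qed

lemma bridge_states: "AE \<omega> in B x y. \<forall>t\<in>{0..1}. \<omega> t \<in> geodesic_states E d x y"
proof -
  let ?S = "{\<omega> \<in> paths E. geo d \<omega> 0 1 \<and> \<omega> 1 = y} \<inter> C 0 x"
  have S: "?S \<in> sets R" unfolding sets_Q by (intro sets.Int xi_set cyl_sets) auto
  then have N: "space R - ?S \<in> sets R" by (rule sets.compl_sets)
  have "(\<integral>\<omega>. xi y 0 \<omega> * indicator (space R - ?S) \<omega> \<partial>P 0 x) = (\<integral>\<omega>. 0 \<partial>P 0 x)"
  proof (rule integral_cong_AE)
    show "AE \<omega> in P 0 x. xi y 0 \<omega> * indicator (space R - ?S) \<omega> = 0"
      using AE_P_start[OF order_refl zero_less_one, of x] by eventually_elim (auto simp: xi_def indicator_def)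
    show "(\<lambda>\<omega>. xi y 0 \<omega> * indicator (space R - ?S) \<omega>) \<in> borel_measurable (P 0 x)"
      using integral_xi_indicator(3)[OF N] by (rule borel_measurable_integrable)
  qed simp
  then have "emeasure (B x y) (space R - ?S) = 0" using emeasure_bridge[OF N, of x y] by simp
  then have "space R - ?S \<in> null_sets (B x y)" using N by (auto simp: null_sets_def sets_B)
  moreover have "{\<omega> \<in> space (B x y). \<not> (\<forall>t\<in>{0..1}. \<omega> t \<in> geodesic_states E d x y)} \<subseteq> space R - ?S"
  proof
    fix \<omega> assume "\<omega> \<in> {\<omega> \<in> space (B x y). \<not> (\<forall>t\<in>{0..1}. \<omega> t \<in> geodesic_states E d x y)}"
    then have \<omega>: "\<omega> \<in> paths E" "\<not> (\<forall>t\<in>{0..1}. \<omega> t \<in> geodesic_states E d x y)" by auto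
    then have "\<omega> \<notin> geodesics_between E d x y" by (auto simp: geodesic_states_def)
    then show "\<omega> \<in> space R - ?S" using \<omega> geodesics_between_iff[OF dist, of \<omega> E x y] by auto
  qed
  ultimately show ?thesis by (rule AE_I')
qed

end


lemma (in finite_measure) measure_sum_approx:
  assumes X: "X \<in> sets M" and T: "T \<in> sets M" and I: "finite I" "\<And>i. i \<in> I \<Longrightarrow> D i \<in> sets M" "disjoint_family_on D I"
    and sub: "\<And>i. i \<in> I \<Longrightarrow> D i \<subseteq> X" "X \<subseteq> (\<Union>i\<in>I. D i) \<union> T"
  shows "\<bar>measure M X - (\<Sum>i\<in>I. measure M (D i))\<bar> \<le> measure M T"
proof -
  have U: "(\<Union>i\<in>I. D i) \<in> sets M" using I by auto
  have eq: "measure M (\<Union>i\<in>I. D i) = (\<Sum>i\<in>I. measure M (D i))"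
    using I by (intro finite_measure_finite_Union) auto
  have "measure M (\<Union>i\<in>I. D i) \<le> measure M X" using X sub by (intro finite_measure_mono) auto
  moreover have "measure M X \<le> measure M ((\<Union>i\<in>I. D i) \<union> T)" using U T sub by (intro finite_measure_mono) auto
  moreover have "\<dots> \<le> measure M (\<Union>i\<in>I. D i) + measure M T" by (rule measure_Un_le[OF U T])
  ultimately show ?thesis unfolding eq by linarith
qed

text \<open>The identity for the kernel is available for positive times only; as Lebesgue measure
  does not charge a point, this suffices.\<close>

lemma set_integral_cong_0:
  fixes f h :: "real \<Rightarrow> real"
  assumes "0 \<le> a" "\<And>r. 0 < r \<Longrightarrow> r \<in> {a..b} \<Longrightarrow> f r = h r"
  shows "(LBINT r:{a..b}. f r) = (LBINT r:{a..b}. h r)" "set_integrable lborel {a..b} f \<longleftrightarrow> set_integrable lborel {a..b} h"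
proof -
  have eq: "indicator {a..b} r *\<^sub>R f r = indicator {a..b} r *\<^sub>R h r" if "r \<notin> {0}" for r
    using assms that by (cases "r \<in> {a..b}") auto
  show "(LBINT r:{a..b}. f r) = (LBINT r:{a..b}. h r)"
    unfolding set_lebesgue_integral_def
    by (rule integral_discrete_difference[where X = "{0}"]) (simp, simp, simp, rule eq)
  show "set_integrable lborel {a..b} f \<longleftrightarrow> set_integrable lborel {a..b} h"
    unfolding set_integrable_def
    by (rule integrable_discrete_difference[where X = "{0}"]) (simp, simp, simp, rule eq)
qed

section \<open>Flux between states under the bridge\<close>

context walk
begin

text \<open>The expected past weight arriving in z at time r. For a past event A the bridge
  probability of A with X_r = z is \<open>norm_const x y\<close> times this times
  \<open>g y r z\<close>, see \<open>bridge_state\<close>.\<close>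

definition rho :: "'a \<Rightarrow> 'a \<Rightarrow> (real \<Rightarrow> 'a) set \<Rightarrow> real \<Rightarrow> 'a \<Rightarrow> real" where
  "rho x y A r z = (\<integral>\<omega>. indicator A \<omega> * W x y r \<omega> * indicator (C r z) \<omega> \<partial>P 0 x)"

lemma W_measurable_P: "0 \<le> t \<Longrightarrow> t \<le> 1 \<Longrightarrow> W x y t \<in> borel_measurable (P a z)"
  by (rule measurable_P[OF _ W_measurable]) auto

lemma rho_integrand:
  assumes A: "A \<in> sets R" and r: "0 \<le> r" "r \<le> 1"
  shows "0 \<le> indicator A \<omega> * W x y r \<omega> * indicator (C r z) \<omega>"
    "indicator A \<omega> * W x y r \<omega> * indicator (C r z) \<omega> \<le> exp K"
    "integrable (P 0 x) (\<lambda>\<omega>. indicator A \<omega> * W x y r \<omega> * indicator (C r z) \<omega>)"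
proof -
  have b: "0 \<le> indicator A \<omega> * W x y r \<omega> * indicator (C r z) \<omega>"
    "indicator A \<omega> * W x y r \<omega> * indicator (C r z) \<omega> \<le> exp K" for \<omega>
    using W_nonneg W_le[OF r, of x y \<omega>] by (auto simp: indicator_def)
  then show "0 \<le> indicator A \<omega> * W x y r \<omega> * indicator (C r z) \<omega>"
    "indicator A \<omega> * W x y r \<omega> * indicator (C r z) \<omega> \<le> exp K" by auto
  have "C r z \<in> sets R" using r by (rule cyl_sets_Q)
  then show "integrable (P 0 x) (\<lambda>\<omega>. indicator A \<omega> * W x y r \<omega> * indicator (C r z) \<omega>)"
    using A W_measurable_P[OF r] b
    by (intro integrable_bounded_P[where c = "exp K"] borel_measurable_times borel_measurable_indicator)
      (auto simp: sets_P)
qed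

lemma rho_bounds:
  assumes A: "A \<in> sets R" and r: "0 \<le> r" "r \<le> 1"
  shows "0 \<le> rho x y A r z" "rho x y A r z \<le> exp K"
proof -
  interpret prob_space "P 0 x" by (intro prob_space_P) auto
  show "0 \<le> rho x y A r z" unfolding rho_def by (intro Bochner_Integration.integral_nonneg rho_integrand[OF A r])
  show "rho x y A r z \<le> exp K" unfolding rho_def
    using rho_integrand(2)[OF A r] by (intro integral_le_const rho_integrand[OF A r]) auto
qed

lemma bridge_future:
  assumes a: "0 \<le> a" "a < 1" and A: "A \<in> sets (path_sigma E {0..a})" and D: "D \<in> sets (path_sigma E {a..1})"
  shows "measure (B x y) (A \<inter> C a z \<inter> D) = norm_const x y * (rho x y A a z * (\<integral>\<omega>. indicator D \<omega> * xi y a \<omega> \<partial>P a z))"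
proof -
  have AR: "A \<in> sets R" and DR: "D \<in> sets R" and CR: "C a z \<in> sets R"
    using a by (auto intro!: sets_path_sigma_Q[OF _ A] sets_path_sigma_Q[OF _ D] cyl_sets_Q)
  have S: "A \<inter> C a z \<inter> D \<in> sets R" using AR DR CR by blast
  have "(\<integral>\<omega>. xi y 0 \<omega> * indicator (A \<inter> C a z \<inter> D) \<omega> \<partial>P 0 x) =
    (\<integral>\<omega>. (indicator A \<omega> * W x y a \<omega>) * (indicator D \<omega> * xi y a \<omega>) * indicator (C a z) \<omega> \<partial>P 0 x)"
  proof (rule integral_cong_AE)
    show "(\<lambda>\<omega>. xi y 0 \<omega> * indicator (A \<inter> C a z \<inter> D) \<omega>) \<in> borel_measurable (P 0 x)"
      using integral_xi_indicator(3)[OF S] by (rule borel_measurable_integrable)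
    show "(\<lambda>\<omega>. (indicator A \<omega> * W x y a \<omega>) * (indicator D \<omega> * xi y a \<omega>) * indicator (C a z) \<omega>) \<in> borel_measurable (P 0 x)"
      using AR DR CR a
      by (intro borel_measurable_times borel_measurable_indicator W_measurable_P xi_measurable_P) (auto simp: sets_P)
    show "AE \<omega> in P 0 x. xi y 0 \<omega> * indicator (A \<inter> C a z \<inter> D) \<omega> =
      (indicator A \<omega> * W x y a \<omega>) * (indicator D \<omega> * xi y a \<omega>) * indicator (C a z) \<omega>"
      using AE_P_start[OF order_refl zero_less_one, of x]
    proof eventually_elim
      case (elim \<omega>)
      then have "xi y 0 \<omega> = W x y a \<omega> * xi y a \<omega>" using a by (intro xi_eq_W) auto
      then show ?case by (simp add: indicator_inter_arith)
    qed
  qed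
  also have "\<dots> = (\<integral>\<omega>. indicator A \<omega> * W x y a \<omega> * indicator (C a z) \<omega> \<partial>P 0 x) * (\<integral>\<omega>. indicator D \<omega> * xi y a \<omega> \<partial>P a z)"
    using A D a W_measurable[of a x y] xi_measurable[of a y] W_nonneg xi_nonneg
    by (intro markov_expect) auto
  finally show ?thesis unfolding rho_def measure_bridge[OF S] by simp
qed

lemma bridge_state:
  assumes a: "0 \<le> a" "a < 1" and A: "A \<in> sets (path_sigma E {0..a})"
  shows "measure (B x y) (A \<inter> C a z) = norm_const x y * (rho x y A a z * g y a z)"
proof -
  have "A \<inter> C a z \<inter> space (path_sigma E {a..1}) = A \<inter> C a z" by auto
  moreover have "(\<integral>\<omega>. indicator (space (path_sigma E {a..1})) \<omega> * xi y a \<omega> \<partial>P a z) = g y a z"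
    unfolding g_def by (rule Bochner_Integration.integral_cong) auto
  ultimately show ?thesis
    using bridge_future[OF a A sets.top, of x y z] by (simp only:)
qed

lemma W_stay:
  assumes \<omega>: "\<omega> \<in> paths E" and ab: "0 \<le> a" "a \<le> b" "b \<le> 1" and nm: "\<not> moves \<omega> a b"
  shows "\<bar>W x y a \<omega> - W x y b \<omega>\<bar> \<le> exp K * (K * (b - a))"
proof -
  let ?x = "LBINT s:{a..b}. total_rate E J s (\<omega> s)" and ?y = "LBINT s:{0..a}. total_rate E J s (\<omega> s)"
  have x: "0 \<le> ?x" "?x \<le> K * (b - a)" by (rule rate_integral[OF \<omega> ab])+
  have "?y \<le> K * (a - 0)" using ab by (intro rate_integral[OF \<omega>]) auto
  with x have "?x + ?y \<le> K * b" by (simp add: algebra_simps)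
  also have "\<dots> \<le> K * 1" using K_nonneg ab by (intro mult_left_mono) auto
  finally have "?x + ?y \<le> K" by simp
  note e = exp_diff_bound[OF x(1) this]
  have e0: "0 \<le> exp K * (K * (b - a))" using K_nonneg ab by auto
  have e2: "exp (?x + ?y) - exp ?y \<le> exp K * (K * (b - a))"
    using e(2) x(2) by (meson exp_ge_zero mult_left_mono order_trans)
  have split: "(LBINT s:{0..b}. total_rate E J s (\<omega> s)) = ?x + ?y"
    using rate_integral_split[OF \<omega> order_refl ab] by simp
  have st: "\<omega> b = \<omega> a" "geo d \<omega> a b" by (rule not_moves[OF nm ab(2)])+
  have "geo d \<omega> 0 b \<longleftrightarrow> geo d \<omega> 0 a"
    using geo_split[OF dist ab(1,2), of \<omega>] st d_self[OF dist] by simp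
  then show ?thesis
    using e(1) e2 e0 by (auto simp: W_def split st admissible_def indicator_def)
qed

text \<open>Paths that do not move keep their state and change their past weight by at most exp K K
  (b - a); the paths that move have probability at most K (b - a) and weight at most exp K. This
  gives the factor 2.\<close>

lemma rho_lipschitz:
  assumes A: "A \<in> sets R" and ab: "0 \<le> a" "a \<le> b" "b < 1"
  shows "\<bar>rho x y A a z - rho x y A b z\<bar> \<le> 2 * K * exp K * (b - a)"
proof -
  interpret prob_space "P 0 x" by (intro prob_space_P) auto
  let ?T = "{\<omega> \<in> paths E. moves \<omega> a b}"
  let ?f = "\<lambda>r \<omega>. indicator A \<omega> * W x y r \<omega> * indicator (C r z) \<omega>"
  have T: "?T \<in> events" by (rule sets_path_sigma_P[OF _ moves_sets]) (use ab in auto)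
  have TR: "?T \<in> sets R" using T by (simp add: sets_P)
  have f: "0 \<le> ?f r \<omega>" "?f r \<omega> \<le> exp K" "integrable (P 0 x) (?f r)" if "r \<in> {a, b}" for r \<omega>
    using that ab rho_integrand[OF A, of r] by auto
  have "rho x y A a z - rho x y A b z = (\<integral>\<omega>. ?f a \<omega> - ?f b \<omega> \<partial>P 0 x)"
    unfolding rho_def using f(3) by (subst Bochner_Integration.integral_diff) auto
  then have "\<bar>rho x y A a z - rho x y A b z\<bar> = \<bar>\<integral>\<omega>. ?f a \<omega> - ?f b \<omega> \<partial>P 0 x\<bar>" by (rule arg_cong)
  also have "\<dots> \<le> (\<integral>\<omega>. \<bar>?f a \<omega> - ?f b \<omega>\<bar> \<partial>P 0 x)" by (rule integral_abs_bound)
  also have "\<dots> \<le> (\<integral>\<omega>. exp K * (K * (b - a)) + exp K * indicator ?T \<omega> \<partial>P 0 x)"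
  proof (rule integral_mono)
    show "integrable (P 0 x) (\<lambda>\<omega>. \<bar>?f a \<omega> - ?f b \<omega>\<bar>)"
      by (intro integrable_abs Bochner_Integration.integrable_diff f(3)) auto
    show "integrable (P 0 x) (\<lambda>\<omega>. exp K * (K * (b - a)) + exp K * indicator ?T \<omega>)"
      using T by (intro Bochner_Integration.integrable_add integrable_mult_right integrable_real_indicator)
        (auto simp: emeasure_eq_measure)
    fix \<omega> assume "\<omega> \<in> space (P 0 x)"
    then have \<omega>: "\<omega> \<in> paths E" by simp
    have e0: "0 \<le> exp K * (K * (b - a))" using K_nonneg ab by auto
    show "\<bar>?f a \<omega> - ?f b \<omega>\<bar> \<le> exp K * (K * (b - a)) + exp K * indicator ?T \<omega>"
    proof (cases "moves \<omega> a b")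
      case True
      have "\<bar>?f a \<omega> - ?f b \<omega>\<bar> \<le> exp K" using f(1,2)[of a \<omega>] f(1,2)[of b \<omega>] by simp
      with True \<omega> e0 show ?thesis by simp
    next
      case False
      have "\<omega> b = \<omega> a" by (rule not_moves[OF False ab(2)])
      then have "\<bar>?f a \<omega> - ?f b \<omega>\<bar> \<le> \<bar>W x y a \<omega> - W x y b \<omega>\<bar>" by (auto simp: indicator_def)
      also have "\<dots> \<le> exp K * (K * (b - a))" using ab by (intro W_stay[OF \<omega> _ _ _ False]) auto
      finally show ?thesis using False by simp
    qed
  qed
  also have "\<dots> = exp K * (K * (b - a)) + exp K * prob ?T"
  proof -
    have "integrable (P 0 x) (indicator ?T :: _ \<Rightarrow> real)"
      using T by (intro integrable_real_indicator) (auto simp: emeasure_eq_measure)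
    then show ?thesis using integral_indicator_P[OF TR, of 0 x] prob_space
      by (subst Bochner_Integration.integral_add) auto
  qed
  also have "prob ?T \<le> K * (b - a)"
  proof -
    have "space (path_sigma E {0..a}) \<inter> ?T = ?T" by auto
    moreover have "prob (space (path_sigma E {0..a})) = 1" using prob_space by simp
    ultimately show ?thesis
      using moves_bound[OF order_refl ab sets.top, of x] by (simp only: mult_1_right)
  qed
  finally show ?thesis by (simp add: mult_ac)
qed

text \<open>The rate at time r of bridge mass going from z to w on the event A: the kernel times the
  probability of A and X_r = z, after cancellation of \<open>g y r z\<close>.\<close>

definition psi :: "'a \<Rightarrow> 'a \<Rightarrow> (real \<Rightarrow> 'a) set \<Rightarrow> 'a \<Rightarrow> 'a \<Rightarrow> real \<Rightarrow> real" where
  "psi x y A z w r = norm_const x y * admissible y z w * (rho x y A r z * (J r z w * g y r w))"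

lemma rho_measurable:
  assumes A: "A \<in> sets R"
  shows "(\<lambda>r. rho x y A r z) \<in> borel_measurable (restrict_space borel {0..<1})"
proof (rule borel_measurable_continuous_on_restrict)
  have "\<bar>rho x y A s z - rho x y A t z\<bar> \<le> 2 * K * exp K * \<bar>s - t\<bar>" if "s \<in> {0..<1}" "t \<in> {0..<1}" for s t
    using rho_lipschitz[OF A, of s t x y z] rho_lipschitz[OF A, of t s x y z] that
    by (cases "s \<le> t") (auto simp: abs_minus_commute)
  then have "(2 * K * exp K)-lipschitz_on {0..<1} (\<lambda>t. rho x y A t z)"
    using K_nonneg by (intro lipschitz_onI) (auto simp: dist_real_def)
  then show "continuous_on {0..<1} (\<lambda>t. rho x y A t z)" by (rule lipschitz_on_continuous_on)
qed

lemma Jg_bounds: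
  assumes "0 \<le> r" "r < 1"
  shows "0 \<le> J r z w * g y r w" "J r z w * g y r w \<le> K * exp K"
  using assms J_nonneg[of r z w] J_le[of r z w] g_bounds[of r y w] K_nonneg by (auto intro!: mult_mono)

lemma psi_integrable:
  assumes A: "A \<in> sets R" and ab: "0 \<le> a" "a \<le> b" "b < 1"
  shows "set_integrable lborel {a..b} (psi x y A z w)"
proof -
  have "set_integrable lborel {a..b} (\<lambda>r. rho x y A r z * (J r z w * g y r w))"
  proof (rule set_integral_bound(1)[OF _ ab(2)])
    show "(\<lambda>r. indicator {a..b} r * (rho x y A r z * (J r z w * g y r w))) \<in> borel_measurable borel"
      using ab A by (intro indicator_measurable_01 borel_measurable_times J_measurable g_measurable rho_measurable) auto
    show "\<bar>rho x y A r z * (J r z w * g y r w)\<bar> \<le> exp K * (K * exp K)" if "r \<in> {a..b}" for r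
      using that ab rho_bounds[OF A, of r x y z] Jg_bounds[of r z w y]
      by (subst abs_of_nonneg) (auto intro!: mult_mono mult_nonneg_nonneg)
  qed
  then show ?thesis unfolding psi_def by (intro set_integrable_mult_right)
qed

text \<open>The constant is 9 = 7 + 2: the error of \<open>one_step\<close> multiplied by the bound
  exp K of \<open>rho\<close>, and the unfreezing of \<open>rho\<close>, whose Lipschitz constant is
  2 K exp K, against a density of at most K exp K.\<close>

lemma flow:
  assumes A: "A \<in> sets (path_sigma E {0..a})" and ab: "0 \<le> a" "a \<le> b" "b < 1" and zw: "z \<noteq> w"
  shows "\<bar>measure (B x y) (A \<inter> C a z \<inter> C b w) - (LBINT r:{a..b}. psi x y A z w r)\<bar> \<le>
    norm_const x y * (9 * K\<^sup>2 * (exp K)\<^sup>2) * (b - a)\<^sup>2"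
proof -
  let ?n = "norm_const x y" and ?S = "admissible y z w" and ?e = "\<integral>\<omega>. indicator (C b w) \<omega> * xi y a \<omega> \<partial>P a z"
  let ?q = "LBINT r:{a..b}. J r z w * g y r w" and ?rho = "\<lambda>r. rho x y A r z"
  have a1: "a < 1" using ab by simp
  have AR: "A \<in> sets R" using ab by (intro sets_path_sigma_Q[OF _ A]) auto
  have Cb: "C b w \<in> sets (path_sigma E {a..1})" using ab by (intro cyl_sets) auto
  have rb: "0 \<le> ?rho a" "?rho a \<le> exp K" using rho_bounds[OF AR] ab by auto
  have "?rho a * \<bar>?e - ?S * ?q\<bar> \<le> exp K * (7 * K\<^sup>2 * exp K * (b - a)\<^sup>2)"
    using rb one_step[OF ab zw, of y] by (intro mult_mono) auto
  then have 1: "\<bar>?rho a * ?e - ?rho a * (?S * ?q)\<bar> \<le> exp K * (7 * K\<^sup>2 * exp K * (b - a)\<^sup>2)"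
    using rb by (simp add: right_diff_distrib[symmetric] abs_mult)
  let ?h = "\<lambda>r. ?rho r * (J r z w * g y r w)"
  have hm: "(\<lambda>r. ?rho r * (J r z w * g y r w)) \<in> borel_measurable (restrict_space borel {0..<1})"
    by (intro borel_measurable_times J_measurable g_measurable rho_measurable AR)
  have hi: "set_integrable lborel {a..b} ?h"
  proof (rule set_integral_bound(1)[OF _ ab(2)])
    show "(\<lambda>r. indicator {a..b} r * ?h r) \<in> borel_measurable borel"
      using ab by (intro indicator_measurable_01 hm) auto
    show "\<bar>?h r\<bar> \<le> exp K * (K * exp K)" if "r \<in> {a..b}" for r
      using that ab rho_bounds[OF AR, of r x y z] Jg_bounds[of r z w y]
      by (subst abs_of_nonneg) (auto intro!: mult_mono mult_nonneg_nonneg)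
  qed
  have qi: "set_integrable lborel {a..b} (\<lambda>r. ?rho a * (J r z w * g y r w))"
    using Jg_integrable[OF ab] by (intro set_integrable_mult_right) auto
  have "?rho a * ?q - (LBINT r:{a..b}. ?h r) = (LBINT r:{a..b}. ?rho a * (J r z w * g y r w) - ?h r)"
    using hi qi by (subst set_integral_diff) auto
  then have "\<bar>?rho a * ?q - (LBINT r:{a..b}. ?h r)\<bar> = \<bar>LBINT r:{a..b}. ?rho a * (J r z w * g y r w) - ?h r\<bar>"
    by (rule arg_cong)
  also have "\<dots> \<le> (2 * K * exp K * (b - a) * (K * exp K)) * (b - a)"
  proof (rule set_integral_bound(2)[OF _ ab(2)])
    have "(\<lambda>r. ?rho a * (J r z w * g y r w) - ?h r) \<in> borel_measurable (restrict_space borel {0..<1})"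
      by (intro borel_measurable_diff borel_measurable_times borel_measurable_const J_measurable g_measurable rho_measurable AR)
    then show "(\<lambda>r. indicator {a..b} r * (?rho a * (J r z w * g y r w) - ?h r)) \<in> borel_measurable borel"
      using ab by (intro indicator_measurable_01) auto
    fix r assume r: "r \<in> {a..b}"
    have "\<bar>?rho a - ?rho r\<bar> \<le> 2 * K * exp K * (r - a)"
      using r ab by (intro rho_lipschitz[OF AR]) auto
    also have "\<dots> \<le> 2 * K * exp K * (b - a)" using r K_nonneg by (intro mult_left_mono) auto
    finally have "\<bar>?rho a - ?rho r\<bar> * (J r z w * g y r w) \<le> 2 * K * exp K * (b - a) * (K * exp K)"
      by (rule mult_mono) (use Jg_bounds[of r z w y] r ab K_nonneg in auto)
    moreover have "\<bar>?rho a * (J r z w * g y r w) - ?h r\<bar> = \<bar>(?rho a - ?rho r) * (J r z w * g y r w)\<bar>"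
      by (simp only: left_diff_distrib)
    moreover have "\<dots> = \<bar>?rho a - ?rho r\<bar> * \<bar>J r z w * g y r w\<bar>" by (rule abs_mult)
    moreover have "\<bar>J r z w * g y r w\<bar> = J r z w * g y r w"
      by (rule abs_of_nonneg) (use Jg_bounds(1)[of r z w y] r ab in auto)
    ultimately show "\<bar>?rho a * (J r z w * g y r w) - ?h r\<bar> \<le> 2 * K * exp K * (b - a) * (K * exp K)" by simp
  qed
  finally have "\<bar>?rho a * ?q - (LBINT r:{a..b}. ?h r)\<bar> \<le> 2 * K\<^sup>2 * (exp K)\<^sup>2 * (b - a)\<^sup>2"
    by (simp add: power2_eq_square mult_ac)
  then have "?S * \<bar>?rho a * ?q - (LBINT r:{a..b}. ?h r)\<bar> \<le> 1 * (2 * K\<^sup>2 * (exp K)\<^sup>2 * (b - a)\<^sup>2)"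
    using admissible_bounds[of y z w] by (intro mult_mono) auto
  then have 2: "\<bar>?rho a * (?S * ?q) - ?S * (LBINT r:{a..b}. ?h r)\<bar> \<le> 2 * K\<^sup>2 * (exp K)\<^sup>2 * (b - a)\<^sup>2"
    using admissible_bounds[of y z w] by (simp add: right_diff_distrib[symmetric] abs_mult mult.left_commute[of _ ?S])
  have "\<bar>?rho a * ?e - ?S * (LBINT r:{a..b}. ?h r)\<bar> \<le> 9 * K\<^sup>2 * (exp K)\<^sup>2 * (b - a)\<^sup>2"
  proof -
    have "exp K * (7 * K\<^sup>2 * exp K * (b - a)\<^sup>2) = 7 * K\<^sup>2 * (exp K)\<^sup>2 * (b - a)\<^sup>2"
      by (simp add: power2_eq_square mult_ac)
    with 1 2 show ?thesis by linarith
  qed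
  then have "?n * \<bar>?rho a * ?e - ?S * (LBINT r:{a..b}. ?h r)\<bar> \<le> ?n * (9 * K\<^sup>2 * (exp K)\<^sup>2 * (b - a)\<^sup>2)"
    using norm_const_nonneg by (intro mult_left_mono) auto
  then have "\<bar>?n * (?rho a * ?e) - ?n * (?S * (LBINT r:{a..b}. ?h r))\<bar> \<le> ?n * (9 * K\<^sup>2 * (exp K)\<^sup>2 * (b - a)\<^sup>2)"
    using norm_const_nonneg[of x y] by (simp add: right_diff_distrib[symmetric] abs_mult)
  moreover have "(LBINT r:{a..b}. psi x y A z w r) = ?n * (?S * (LBINT r:{a..b}. ?h r))"
    unfolding psi_def by (simp add: mult.assoc)
  ultimately show ?thesis
    unfolding bridge_future[OF ab(1) a1 A Cb] by (simp add: mult.assoc)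
qed

lemma bridge_moves_twice:
  assumes ab: "0 \<le> a" "a \<le> b" "b < 1"
  shows "measure (B x y) {\<omega> \<in> paths E. moves_twice \<omega> a b} \<le> norm_const x y * (exp K * K\<^sup>2) * (b - a)\<^sup>2"
proof -
  interpret prob_space "P 0 x" by (intro prob_space_P) auto
  let ?T = "{\<omega> \<in> paths E. moves_twice \<omega> a b}"
  have T: "?T \<in> sets R" by (rule sets_path_sigma_Q[OF _ moves_twice_sets]) (use ab in auto)
  have "(\<integral>\<omega>. xi y 0 \<omega> * indicator ?T \<omega> \<partial>P 0 x) \<le> (\<integral>\<omega>. exp K * indicator ?T \<omega> \<partial>P 0 x)"
  proof (rule integral_mono[OF integral_xi_indicator(3)[OF T]])
    show "integrable (P 0 x) (\<lambda>\<omega>. exp K * indicator ?T \<omega>)"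
      using T by (intro integrable_mult_right integrable_real_indicator) (auto simp: emeasure_eq_measure sets_P)
    show "xi y 0 \<omega> * indicator ?T \<omega> \<le> exp K * indicator ?T \<omega>" for \<omega>
      using xi_le[of 0 y \<omega>] by (intro mult_right_mono) auto
  qed
  also have "\<dots> = exp K * prob ?T" using integral_indicator_P[OF T, of 0 x] by simp
  also have "prob ?T \<le> K\<^sup>2 * (b - a)\<^sup>2"
  proof -
    have "space (path_sigma E {0..a}) \<inter> ?T = ?T" by auto
    moreover have "prob (space (path_sigma E {0..a})) = 1" using prob_space by simp
    ultimately show ?thesis
      using moves_twice_bound[OF order_refl ab sets.top, of x] by (simp only: mult_1_right)
  qed
  finally have "(\<integral>\<omega>. xi y 0 \<omega> * indicator ?T \<omega> \<partial>P 0 x) \<le> exp K * (K\<^sup>2 * (b - a)\<^sup>2)" by simp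
  then have "norm_const x y * (\<integral>\<omega>. xi y 0 \<omega> * indicator ?T \<omega> \<partial>P 0 x) \<le> norm_const x y * (exp K * (K\<^sup>2 * (b - a)\<^sup>2))"
    using norm_const_nonneg by (rule mult_left_mono)
  then show ?thesis unfolding measure_bridge[OF T] by (simp add: mult.assoc)
qed

lemma E_sym': "E z w \<Longrightarrow> E w z"
  using E_sym by (auto simp: symp_def)

text \<open>The change of probability of w over a cell is arrivals minus departures. Up to paths
  moving twice, both decompose over the neighbours of w into the flows already estimated;
  \<open>zero_increment\<close> then removes the error.\<close>

lemma bridge_forward:
  assumes A: "A \<in> sets (path_sigma E {0..s})" and st: "0 \<le> s" "s \<le> t" "t < 1"
  shows "measure (B x y) (A \<inter> C t w) - measure (B x y) (A \<inter> C s w) =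
    (\<Sum>z | E w z. (LBINT r:{s..t}. psi x y A z w r) - (LBINT r:{s..t}. psi x y A w z r))"
proof -
  interpret Q: finite_path_space E "B x y" by (rule finite_path_space_bridge)
  let ?Q = "\<lambda>X. measure (B x y) X" and ?N = "{z. E w z}"
  let ?p = "\<lambda>r. ?Q (A \<inter> C r w)"
  define \<Psi> where "\<Psi> a b = (\<Sum>z\<in>?N. (LBINT r:{a..b}. psi x y A z w r) - (LBINT r:{a..b}. psi x y A w z r))" for a b
  define c1 where "c1 = norm_const x y * (9 * K\<^sup>2 * (exp K)\<^sup>2)"
  define c2 where "c2 = norm_const x y * (exp K * K\<^sup>2)"
  have AR: "A \<in> sets R" using st by (intro sets_path_sigma_Q[OF _ A]) auto
  \<comment> \<open>\<open>2 * c2\<close> pays for arrivals and departures with two moves, and each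
    neighbour pays \<open>2 * c1\<close> for its two flows.\<close>
  have step: "\<bar>?p b - ?p a - \<Psi> a b\<bar> \<le> (2 * c2 + card ?N * (2 * c1)) * (b - a)\<^sup>2"
    if ab: "s \<le> a" "a \<le> b" "b \<le> t" for a b
  proof -
    have ab': "0 \<le> a" "a < 1" "b < 1" "0 \<le> b" "a \<le> 1" "b \<le> 1" using ab st by auto
    have Aa: "A \<in> sets (path_sigma E {0..a})" using path_sigma_mono[OF _ A, of "{0..a}"] ab by auto
    let ?T = "{\<omega> \<in> paths E. moves_twice \<omega> a b}"
    have T: "?T \<in> sets (B x y)" unfolding sets_B by (rule sets_path_sigma_Q[OF _ moves_twice_sets]) (use ab' ab in auto)
    have Cs: "A \<inter> C a z \<in> sets (B x y)" "A \<inter> C b z \<in> sets (B x y)" "A \<inter> C a z \<inter> C b v \<in> sets (B x y)" for z v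
      unfolding sets_B using AR cyl_sets_Q[of a] cyl_sets_Q[of b] ab' by auto
    have T2: "?Q ?T \<le> c2 * (b - a)\<^sup>2"
      unfolding c2_def by (rule bridge_moves_twice[OF ab'(1) ab(2) ab'(3)])
    have fl: "\<bar>?Q (A \<inter> C a z \<inter> C b v) - (LBINT r:{a..b}. psi x y A z v r)\<bar> \<le> c1 * (b - a)\<^sup>2" if "z \<noteq> v" for z v
      unfolding c1_def by (rule flow[OF Aa ab'(1) ab(2) ab'(3) that])
    have ne: "z \<noteq> w" "w \<noteq> z" if "z \<in> ?N" for z using that E_irrefl by auto
    let ?X = "A \<inter> C b w - A \<inter> C a w" and ?Y = "A \<inter> C a w - A \<inter> C b w"
    \<comment> \<open>A change of state between non-neighbours cannot be made by one jump.\<close>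
    have tw: "moves_twice \<omega> a b" if "\<omega> \<in> paths E" "\<omega> a \<noteq> \<omega> b" "\<not> E (\<omega> a) (\<omega> b)" for \<omega>
      using not_moves_twice(1)[OF dist that(1) ab'(1) ab(2) ab'(6) _ that(2)] that(3) by blast
    have X: "\<bar>?Q ?X - (\<Sum>z\<in>?N. ?Q (A \<inter> C a z \<inter> C b w))\<bar> \<le> ?Q ?T"
    proof (rule Q.measure_sum_approx)
      show "A \<inter> C a z \<inter> C b w \<subseteq> ?X" if "z \<in> ?N" for z using ne[OF that] by auto
      show "?X \<subseteq> (\<Union>z\<in>?N. A \<inter> C a z \<inter> C b w) \<union> ?T"
      proof
        fix \<omega> assume "\<omega> \<in> ?X"
        then have \<omega>: "\<omega> \<in> A" "\<omega> \<in> paths E" "\<omega> b = w" "\<omega> a \<noteq> \<omega> b" by auto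
        then show "\<omega> \<in> (\<Union>z\<in>?N. A \<inter> C a z \<inter> C b w) \<union> ?T"
          using tw[OF \<omega>(2,4)] E_sym'[of "\<omega> a" "\<omega> b"] by blast
      qed
    qed (use Cs T E_finite in \<open>auto simp: disjoint_family_on_def\<close>)
    have Y: "\<bar>?Q ?Y - (\<Sum>z\<in>?N. ?Q (A \<inter> C a w \<inter> C b z))\<bar> \<le> ?Q ?T"
    proof (rule Q.measure_sum_approx)
      show "A \<inter> C a w \<inter> C b z \<subseteq> ?Y" if "z \<in> ?N" for z using ne[OF that] by auto
      show "?Y \<subseteq> (\<Union>z\<in>?N. A \<inter> C a w \<inter> C b z) \<union> ?T"
      proof
        fix \<omega> assume "\<omega> \<in> ?Y"
        then have \<omega>: "\<omega> \<in> A" "\<omega> \<in> paths E" "\<omega> a = w" "\<omega> a \<noteq> \<omega> b" by auto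
        then show "\<omega> \<in> (\<Union>z\<in>?N. A \<inter> C a w \<inter> C b z) \<union> ?T"
          using tw[OF \<omega>(2,4)] by blast
      qed
    qed (use Cs T E_finite in \<open>auto simp: disjoint_family_on_def\<close>)
    have "?p b - ?p a = ?Q ?X - ?Q ?Y"
    proof -
      have "?Q ?X = ?p b - ?Q (A \<inter> C b w \<inter> (A \<inter> C a w))" by (rule Q.finite_measure_Diff') (rule Cs)+
      moreover have "?Q ?Y = ?p a - ?Q (A \<inter> C a w \<inter> (A \<inter> C b w))" by (rule Q.finite_measure_Diff') (rule Cs)+
      moreover have "A \<inter> C b w \<inter> (A \<inter> C a w) = A \<inter> C a w \<inter> (A \<inter> C b w)" by blast
      ultimately show ?thesis by simp
    qed
    then have 1: "\<bar>?p b - ?p a - (\<Sum>z\<in>?N. ?Q (A \<inter> C a z \<inter> C b w) - ?Q (A \<inter> C a w \<inter> C b z))\<bar> \<le> 2 * ?Q ?T"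
      using X Y unfolding sum_subtractf by linarith
    have "\<bar>(\<Sum>z\<in>?N. ?Q (A \<inter> C a z \<inter> C b w) - ?Q (A \<inter> C a w \<inter> C b z)) - \<Psi> a b\<bar> \<le> (\<Sum>z\<in>?N. 2 * (c1 * (b - a)\<^sup>2))"
      unfolding \<Psi>_def sum_subtractf[symmetric]
    proof (rule order_trans[OF sum_abs sum_mono])
      fix z assume z: "z \<in> ?N"
      show "\<bar>?Q (A \<inter> C a z \<inter> C b w) - ?Q (A \<inter> C a w \<inter> C b z) -
        ((LBINT r:{a..b}. psi x y A z w r) - (LBINT r:{a..b}. psi x y A w z r))\<bar> \<le> 2 * (c1 * (b - a)\<^sup>2)"
        using fl[OF ne(1)[OF z]] fl[OF ne(2)[OF z]] by linarith
    qed
    also have "\<dots> = card ?N * (2 * c1) * (b - a)\<^sup>2" by simp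
    finally have "\<bar>?p b - ?p a - \<Psi> a b\<bar> \<le> 2 * (c2 * (b - a)\<^sup>2) + card ?N * (2 * c1) * (b - a)\<^sup>2"
      using 1 T2 by linarith
    then show ?thesis by (simp add: algebra_simps)
  qed
  have \<Psi>_split: "\<Psi> s b - \<Psi> s a = \<Psi> a b" if ab: "s \<le> a" "a \<le> b" "b \<le> t" for a b
  proof -
    have "(LBINT r:{s..b}. psi x y A z v r) = (LBINT r:{s..a}. psi x y A z v r) + (LBINT r:{a..b}. psi x y A z v r)" for z v
      using ab st by (intro set_integral_split psi_integrable[OF AR]) auto
    then show ?thesis unfolding \<Psi>_def by (simp add: sum_subtractf sum.distrib)
  qed
  define F where "F r = ?p r - \<Psi> s r" for r
  have "F t = F s"
  proof (rule zero_increment[where F = F, OF st(2)])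
    fix a b assume ab: "s \<le> a" "a \<le> b" "b \<le> t"
    have "F b - F a = ?p b - ?p a - \<Psi> a b" using \<Psi>_split[OF ab] by (simp add: F_def)
    with step[OF ab] show "\<bar>F b - F a\<bar> \<le> (2 * c2 + card ?N * (2 * c1)) * (b - a)\<^sup>2" by simp
  qed
  moreover have "\<Psi> s s = 0" using \<Psi>_split[of s s] st by simp
  ultimately show ?thesis unfolding F_def \<Psi>_def by simp
qed

lemma bridge_jump_kernel:
  "has_jump_kernel E (geodesic_states E d x y) (B x y) (geodesic_kernel E d R J y)"
proof -
  interpret Q: finite_path_space E "B x y" by (rule finite_path_space_bridge)
  let ?k = "geodesic_kernel E d R J y"
  have k: "?k r z w * measure (B x y) (A \<inter> C r z) = psi x y A z w r"
    if "A \<in> sets (path_sigma E {0..s})" "0 < r" "s \<le> r" "r < 1" for A s r z w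
  proof -
    have A: "A \<in> sets (path_sigma E {0..r})" using path_sigma_mono[OF _ that(1), of "{0..r}"] that by auto
    have "?k r z w * measure (B x y) (A \<inter> C r z) = norm_const x y * rho x y A r z * (?k r z w * g y r z)"
      using that by (subst bridge_state[OF _ _ A]) auto
    also have "\<dots> = psi x y A z w r"
      using geodesic_kernel_eq[OF that(2,4), of y z w] by (simp add: psi_def mult_ac)
    finally show ?thesis .
  qed
  show ?thesis
  proof (rule Q.has_jump_kernelI)
    show "finite {y. E x y}" for x by (rule E_finite)
    show "symp E" by (rule E_sym)
    show "AE \<omega> in B x y. \<forall>t\<in>{0..1}. \<omega> t \<in> geodesic_states E d x y" by (rule bridge_states)
    show "0 \<le> ?k t z w" if "0 \<le> t" "t < 1" for t z w
      using that g_bounds[of t y] J_nonneg[of t z w] by (auto simp: geodesic_kernel_def geodesic_weight_eq_g)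
    show "?k t z w = 0" if "\<not> E z w" for t z w
      using that successors_imp(1)[OF dist, of w E y z] by (auto simp: geodesic_kernel_def)
    show "(\<lambda>t. ?k t z w) \<in> borel_measurable (restrict_space borel {0..<1})" for z w
    proof (cases "w \<in> successors E d y z")
      case True
      have "(\<lambda>t. g y t w / g y t z * J t z w) \<in> borel_measurable (restrict_space borel {0..<1})"
        by (intro borel_measurable_times borel_measurable_divide g_measurable J_measurable)
      also have "?this \<longleftrightarrow> ?thesis"
        using True by (intro measurable_cong) (auto simp: geodesic_kernel_def geodesic_weight_eq_g space_restrict_space)
      finally show ?thesis .
    qed (simp add: geodesic_kernel_def)
    show "set_integrable lborel {0..t} (\<lambda>r. ?k r z w * measure (B x y) (C r z))" if t: "0 \<le> t" "t < 1" for t z w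
    proof -
      have "paths E \<inter> C r z = C r z" for r by auto
      then have "?k r z w * measure (B x y) (C r z) = psi x y (paths E) z w r" if "0 < r" "r \<in> {0..t}" for r
        using k[of "paths E" 0 r z w] sets.top[of "path_sigma E {0..0}"] that t by simp
      from set_integral_cong_0(2)[OF order_refl this] show ?thesis
        using psi_integrable[OF sets.top, of 0 t x y z w] t by simp
    qed
    fix A s t w assume A: "A \<in> sets (path_sigma E {0..s})" and st: "0 \<le> s" "s \<le> t" "t < (1::real)"
    have "(LBINT r:{s..t}. ?k r z v * measure (B x y) (A \<inter> C r z)) = (LBINT r:{s..t}. psi x y A z v r)" for z v
      using k[OF A] st by (intro set_integral_cong_0(1)) auto
    then show "measure (B x y) (A \<inter> C t w) - measure (B x y) (A \<inter> C s w) =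
      (\<Sum>z | E w z. (LBINT r:{s..t}. ?k r z w * measure (B x y) (A \<inter> C r z)) -
        (LBINT r:{s..t}. ?k r w z * measure (B x y) (A \<inter> C r w)))"
      using bridge_forward[OF A st] by simp
  qed
qed

end


section \<open>A geodesic measure that is not Markov\<close>

text \<open>On the two-point graph the geodesics are the paths with at most one jump. The reference walk
  is the telegraph process: it jumps at the points of a Poisson process, realised as a Poisson
  number of independent uniform points, which makes the joint law of the signs explicit.\<close>

definition differ :: "bool \<Rightarrow> bool \<Rightarrow> bool" where
  "differ a b \<longleftrightarrow> a \<noteq> b"

definition unit_uniform :: "real measure" where
  "unit_uniform = uniform_measure lborel {0<..<1}"

text \<open>An infinite independent sequence of which the Poisson number selects an initial part, so
  that the sample space does not depend on the number of points.\<close>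

abbreviation points :: "(nat \<Rightarrow> real) measure" where
  "points \<equiv> PiM UNIV (\<lambda>_. unit_uniform)"

abbreviation counts :: "nat measure" where
  "counts \<equiv> measure_pmf (poisson_pmf 1)"

abbreviation start :: "bool measure" where
  "start \<equiv> measure_pmf (bernoulli_pmf (1 / 2))"

lemma prob_space_unit_uniform: "prob_space unit_uniform"
  unfolding unit_uniform_def by (rule prob_space_uniform_measure) auto

lemma sets_unit_uniform [measurable_cong, simp]: "sets unit_uniform = sets borel"
  by (simp add: unit_uniform_def)

lemma space_unit_uniform [simp]: "space unit_uniform = UNIV"
  by (simp add: unit_uniform_def)

interpretation unit_uniform: prob_space unit_uniform
  by (rule prob_space_unit_uniform)

interpretation points: product_prob_space "\<lambda>_ :: nat. unit_uniform" UNIV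
  by unfold_locales

interpretation counts_points: pair_prob_space counts points
  by unfold_locales

interpretation start_counts_points: pair_prob_space start "counts \<Otimes>\<^sub>M points"
  by unfold_locales

lemma integral_points_prod:
  fixes \<phi> :: "real \<Rightarrow> real"
  assumes \<phi>: "\<phi> \<in> borel_measurable borel" "\<And>v. \<bar>\<phi> v\<bar> \<le> 1"
  shows "(\<integral>u. (\<Prod>i<n. \<phi> (u i)) \<partial>points) = (\<integral>v. \<phi> v \<partial>unit_uniform) ^ n"
proof -
  let ?J = "{..<n}"
  have [measurable]: "\<phi> \<in> borel_measurable unit_uniform" using \<phi> by simp
  have "(\<integral>v. \<phi> v \<partial>unit_uniform) ^ n = (\<Prod>i\<in>?J. \<integral>v. \<phi> v \<partial>unit_uniform)" by simp
  also have "\<dots> = (\<integral>u. (\<Prod>i\<in>?J. \<phi> (u i)) \<partial>PiM ?J (\<lambda>_. unit_uniform))"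
    using \<phi> by (intro points.product_integral_prod[symmetric] unit_uniform.integrable_const_bound[where B = 1]) auto
  also have "\<dots> = (\<integral>u. (\<Prod>i\<in>?J. \<phi> (u i)) \<partial>distr points (PiM ?J (\<lambda>_. unit_uniform)) (\<lambda>x. restrict x ?J))"
    by (subst points.distr_PiM_restrict_finite) auto
  also have "\<dots> = (\<integral>u. (\<Prod>i\<in>?J. \<phi> (restrict u ?J i)) \<partial>points)"
  proof (rule integral_distr)
    show "(\<lambda>x. restrict x ?J) \<in> points \<rightarrow>\<^sub>M PiM ?J (\<lambda>_. unit_uniform)"
      by (rule measurable_restrict_subset) simp
    show "(\<lambda>u. \<Prod>i<n. \<phi> (u i)) \<in> borel_measurable (PiM ?J (\<lambda>_. unit_uniform))"
      by (intro borel_measurable_prod measurable_compose[OF measurable_component_singleton]) auto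
  qed
  also have "\<dots> = (\<integral>u. (\<Prod>i\<in>?J. \<phi> (u i)) \<partial>points)"
    by (intro Bochner_Integration.integral_cong prod.cong) auto
  finally show ?thesis by simp
qed

text \<open>The probability generating function of the Poisson law with parameter 1.\<close>

lemma integral_counts_power:
  fixes c :: real
  assumes "\<bar>c\<bar> \<le> 1"
  shows "(\<integral>n. c ^ n \<partial>counts) = exp (c - 1)"
proof -
  have s: "(\<lambda>n. c ^ n / fact n) sums exp c"
    using exp_converges[of c] by (simp add: divide_inverse mult.commute scaleR_conv_of_real)
  then have s1: "(\<lambda>n. pmf (poisson_pmf 1) n * c ^ n) sums (exp (- 1) * exp c)"
    using sums_mult[OF s, of "exp (- 1)"] by (simp add: field_simps)
  have "integrable counts (\<lambda>n. c ^ n)"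
    using assms by (intro measure_pmf.integrable_const_bound[where B = 1]) (auto simp: power_abs power_le_one)
  then have i: "integrable (count_space UNIV) (\<lambda>n. pmf (poisson_pmf 1) n * c ^ n)"
    unfolding measure_pmf_eq_density by (subst (asm) integrable_density) (auto intro: measurable_count_space_eq1[THEN iffD2])
  have "(\<integral>n. c ^ n \<partial>counts) = (\<integral>n. pmf (poisson_pmf 1) n * c ^ n \<partial>count_space UNIV)"
    unfolding measure_pmf_eq_density by (subst integral_density) auto
  also have "\<dots> = (\<Sum>n. pmf (poisson_pmf 1) n * c ^ n)" by (rule integral_count_space_nat[OF i])
  also have "\<dots> = exp (- 1) * exp c" using s1 by (rule sums_unique[symmetric])
  finally show ?thesis by (simp add: exp_add[symmetric])
qed

text \<open>Given n points, independence turns the product into a power c^n; averaging over the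
  Poisson number gives exp (c - 1), the usual formula for a multiplicative functional of a Poisson
  process.\<close>

lemma integral_telegraph:
  fixes \<phi> :: "real \<Rightarrow> real" and k :: "bool \<Rightarrow> real"
  assumes \<phi>: "\<phi> \<in> borel_measurable borel" "\<And>v. \<bar>\<phi> v\<bar> \<le> 1"
  shows "(\<integral>x. k (fst x) * (\<Prod>i<fst (snd x). \<phi> (snd (snd x) i)) \<partial>(start \<Otimes>\<^sub>M (counts \<Otimes>\<^sub>M points))) =
    (k True + k False) / 2 * exp ((\<integral>v. \<phi> v \<partial>unit_uniform) - 1)"
proof -
  let ?c = "\<integral>v. \<phi> v \<partial>unit_uniform"
  have "\<bar>?c\<bar> \<le> (\<integral>v. \<bar>\<phi> v\<bar> \<partial>unit_uniform)" by (rule integral_abs_bound)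
  also have "\<dots> \<le> 1"
    using \<phi> by (intro unit_uniform.integral_le_const unit_uniform.integrable_const_bound[where B = 1]) auto
  finally have c: "\<bar>?c\<bar> \<le> 1" .
  have P: "\<bar>\<Prod>i<n. \<phi> (u i)\<bar> \<le> 1" for n and u :: "nat \<Rightarrow> real"
    unfolding abs_prod using \<phi>(2) by (intro prod_le_1) auto
  have m1: "(\<lambda>q. \<Prod>i<fst q. \<phi> (snd q i)) \<in> borel_measurable (counts \<Otimes>\<^sub>M points)"
  proof (rule measurable_compose_countable[where f = "\<lambda>n q. \<Prod>i<n. \<phi> (snd q i)" and g = fst])
    show "(\<lambda>q. \<Prod>i<n. \<phi> (snd q i)) \<in> borel_measurable (counts \<Otimes>\<^sub>M points)" for n
    proof (rule borel_measurable_prod)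
      fix i
      have "(\<lambda>q. snd q i) \<in> (counts \<Otimes>\<^sub>M points) \<rightarrow>\<^sub>M unit_uniform" by measurable
      then show "(\<lambda>q. \<phi> (snd q i)) \<in> borel_measurable (counts \<Otimes>\<^sub>M points)"
        by (rule measurable_compose) (use \<phi> in simp)
    qed
    show "fst \<in> (counts \<Otimes>\<^sub>M points) \<rightarrow>\<^sub>M count_space UNIV" by measurable
  qed
  have i1: "integrable (counts \<Otimes>\<^sub>M points) (\<lambda>q. \<Prod>i<fst q. \<phi> (snd q i))"
    using m1 P by (intro counts_points.P.integrable_const_bound[where B = 1]) auto
  have "(\<integral>q. (\<Prod>i<fst q. \<phi> (snd q i)) \<partial>(counts \<Otimes>\<^sub>M points)) = (\<integral>n. (\<integral>u. (\<Prod>i<n. \<phi> (u i)) \<partial>points) \<partial>counts)"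
    using counts_points.integral_fst'[OF i1] by simp
  also have "\<dots> = exp (?c - 1)" unfolding integral_points_prod[OF \<phi>] by (rule integral_counts_power[OF c])
  finally have inner: "(\<integral>q. (\<Prod>i<fst q. \<phi> (snd q i)) \<partial>(counts \<Otimes>\<^sub>M points)) = exp (?c - 1)" .
  have m2: "(\<lambda>x. k (fst x) * (\<Prod>i<fst (snd x). \<phi> (snd (snd x) i))) \<in> borel_measurable (start \<Otimes>\<^sub>M (counts \<Otimes>\<^sub>M points))"
    using measurable_compose[OF measurable_snd m1] by (intro borel_measurable_times measurable_compose[OF measurable_fst]) auto
  have i2: "integrable (start \<Otimes>\<^sub>M (counts \<Otimes>\<^sub>M points)) (\<lambda>x. k (fst x) * (\<Prod>i<fst (snd x). \<phi> (snd (snd x) i)))"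
  proof (rule start_counts_points.P.integrable_const_bound[OF _ m2])
    have "\<bar>k b * (\<Prod>i<n. \<phi> (u i))\<bar> \<le> (\<bar>k True\<bar> + \<bar>k False\<bar>) * 1" for b n and u :: "nat \<Rightarrow> real"
      unfolding abs_mult using P[of u n] by (intro mult_mono) (cases b, auto)
    then show "AE x in start \<Otimes>\<^sub>M (counts \<Otimes>\<^sub>M points). norm (k (fst x) * (\<Prod>i<fst (snd x). \<phi> (snd (snd x) i))) \<le> (\<bar>k True\<bar> + \<bar>k False\<bar>) * 1"
      by (intro AE_I2) simp
  qed
  show ?thesis
    unfolding start_counts_points.integral_fst'[OF i2, symmetric] fst_conv snd_conv
    by (simp add: inner)
qed

text \<open>The parity of the points up to time t. Those outside the open unit interval are ignored:
  they have probability zero, but the trajectory has to be a path for every sample, in particular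
  without a jump at time 1.\<close>

primrec flip :: "nat \<Rightarrow> (nat \<Rightarrow> real) \<Rightarrow> real \<Rightarrow> bool" where
  "flip 0 u t = False"
| "flip (Suc n) u t = differ (flip n u t) (0 < u n \<and> u n < 1 \<and> u n \<le> t)"

definition telegraph_path :: "bool \<times> nat \<times> (nat \<Rightarrow> real) \<Rightarrow> real \<Rightarrow> bool" where
  "telegraph_path x t = (if t \<in> {0..1} then differ (fst x) (flip (fst (snd x)) (snd (snd x)) t) else undefined)"

definition telegraph :: "(real \<Rightarrow> bool) measure" where
  "telegraph = distr (start \<Otimes>\<^sub>M (counts \<Otimes>\<^sub>M points)) (path_sigma differ {0..1}) telegraph_path"

lemma flip_cong:
  "(\<And>i. i < n \<Longrightarrow> 0 < u i \<Longrightarrow> u i < 1 \<Longrightarrow> u i \<le> s \<longleftrightarrow> u i \<le> t) \<Longrightarrow> flip n u s = flip n u t"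
proof (induction n)
  case (Suc n)
  then have "flip n u s = flip n u t" by simp
  with Suc.prems[of n] show ?case by (auto simp: differ_def)
qed simp

lemma telegraph_path_in_paths: "telegraph_path x \<in> paths differ"
proof -
  obtain b n u where x: "x = (b, n, u)" by (cases x)
  have T: "telegraph_path x t = differ b (flip n u t)" if "t \<in> {0..1}" for t
    using that by (simp add: telegraph_path_def x)
  have right: "\<forall>\<^sub>F s in at_right t. telegraph_path x s = telegraph_path x t" if t: "0 \<le> t" "t < 1" for t
  proof -
    \<comment> \<open>Just to the right of t there is no further point, so the parity does not
      change.\<close>
    have "\<forall>\<^sub>F s in at_right t. \<forall>i\<in>{..<n}. t < u i \<longrightarrow> s < u i"
      by (intro eventually_ball_finite) (auto simp: eventually_at_right_field gt_ex)
    moreover have "\<forall>\<^sub>F s in at_right t. t < s \<and> s < 1"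
      using t by (auto simp: eventually_at_right_field)
    ultimately show ?thesis
    proof eventually_elim
      case (elim s)
      then have "flip n u s = flip n u t" by (intro flip_cong) force
      then show ?case using elim t by (simp add: T)
    qed
  qed
  have left: "\<forall>\<^sub>F s in at_left t. 0 < s \<and> s < t \<and> (\<forall>i<n. u i < t \<longrightarrow> u i \<le> s)" if t: "0 < t" for t
  proof -
    have "\<forall>\<^sub>F s in at_left t. \<forall>i\<in>{..<n}. u i < t \<longrightarrow> u i \<le> s"
      by (intro eventually_ball_finite) (auto simp: eventually_at_left_field intro: less_imp_le lt_ex)
    moreover have "\<forall>\<^sub>F s in at_left t. 0 < s \<and> s < t"
      using t by (auto simp: eventually_at_left_field)
    ultimately show ?thesis by eventually_elim auto
  qed
  have left_ex: "\<exists>z. \<forall>\<^sub>F s in at_left t. telegraph_path x s = z" if t: "0 < t" "t \<le> 1" for t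
  proof -
    obtain s0 where s0: "0 < s0" "s0 < t" "\<And>i. i < n \<Longrightarrow> u i < t \<Longrightarrow> u i \<le> s0"
      using eventually_happens[OF left[OF t(1)]] by (auto simp: trivial_limit_at_left_real)
    have "\<forall>\<^sub>F s in at_left t. telegraph_path x s = telegraph_path x s0"
      using left[OF t(1)]
    proof eventually_elim
      case (elim s)
      have "flip n u s = flip n u s0"
      proof (rule flip_cong)
        fix i assume i: "i < n"
        show "u i \<le> s \<longleftrightarrow> u i \<le> s0"
        proof (cases "u i < t")
          case True then show ?thesis using elim s0 i by simp
        next
          case False then show ?thesis using elim s0 by simp
        qed
      qed
      then show ?case using elim s0 t by (simp add: T)
    qed
    then show ?thesis ..
  qed
  have no_jump: "left_lim (telegraph_path x) t = telegraph_path x t"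
    if t: "0 < t" "t \<le> 1" "t \<notin> u ` {..<n} \<or> t = 1" for t
  proof (rule left_lim_eqI)
    show "\<forall>\<^sub>F s in at_left t. telegraph_path x s = telegraph_path x t"
      using left[OF t(1)]
    proof eventually_elim
      case (elim s)
      have "flip n u s = flip n u t"
      proof (rule flip_cong)
        fix i assume i: "i < n" "u i < 1"
        then have "u i \<noteq> t" using t(3) by auto
        then show "u i \<le> s \<longleftrightarrow> u i \<le> t" using elim i by (cases "u i < t") auto
      qed
      then show ?case using elim t by (simp add: T)
    qed
  qed
  have "jump_times (telegraph_path x) \<subseteq> u ` {..<n}"
  proof
    fix t assume "t \<in> jump_times (telegraph_path x)"
    then have "0 < t" "t < 1" "left_lim (telegraph_path x) t \<noteq> telegraph_path x t" by (auto simp: jump_times_def)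
    then show "t \<in> u ` {..<n}" using no_jump[of t] by auto
  qed
  then have "finite (jump_times (telegraph_path x))" by (rule finite_subset) simp
  moreover have "telegraph_path x \<in> extensional {0..1}" by (auto simp: telegraph_path_def extensional_def)
  ultimately show ?thesis
    unfolding paths_def using right left_ex no_jump[of 1] by (auto simp: differ_def)
qed

lemma flip_measurable: "(\<lambda>u. flip n u t) \<in> points \<rightarrow>\<^sub>M count_space UNIV"
proof (induction n)
  case (Suc n)
  have "(\<lambda>u. u n) \<in> points \<rightarrow>\<^sub>M unit_uniform" by measurable
  then have [measurable]: "(\<lambda>u. u n) \<in> borel_measurable points" by (simp cong: measurable_cong_sets)
  have [measurable]: "(\<lambda>u. flip n u t) \<in> points \<rightarrow>\<^sub>M count_space UNIV" by (rule Suc)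
  show ?case unfolding flip.simps differ_def by measurable
qed simp

lemma telegraph_path_measurable:
  "telegraph_path \<in> (start \<Otimes>\<^sub>M (counts \<Otimes>\<^sub>M points)) \<rightarrow>\<^sub>M path_sigma differ {0..1}"
proof (rule measurable_into_path_sigma)
  fix t :: real assume t: "t \<in> {0..1}"
  let ?M = "start \<Otimes>\<^sub>M (counts \<Otimes>\<^sub>M points)"
  have f: "(\<lambda>x. flip (fst (snd x)) (snd (snd x)) t) \<in> ?M \<rightarrow>\<^sub>M count_space UNIV"
  proof (rule measurable_compose_countable[where f = "\<lambda>n x. flip n (snd (snd x)) t" and g = "\<lambda>x. fst (snd x)"])
    show "(\<lambda>x. flip n (snd (snd x)) t) \<in> ?M \<rightarrow>\<^sub>M count_space UNIV" for n
      by (rule measurable_compose[OF _ flip_measurable]) measurable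
    show "(\<lambda>x. fst (snd x)) \<in> ?M \<rightarrow>\<^sub>M count_space UNIV" by measurable
  qed
  have [measurable]: "fst \<in> ?M \<rightarrow>\<^sub>M count_space UNIV" by measurable
  note [measurable] = f
  have "(\<lambda>x. differ (fst x) (flip (fst (snd x)) (snd (snd x)) t)) \<in> ?M \<rightarrow>\<^sub>M count_space UNIV" by measurable
  then show "(\<lambda>x. telegraph_path x t) \<in> ?M \<rightarrow>\<^sub>M count_space UNIV"
    using t by (simp add: telegraph_path_def)
qed (rule telegraph_path_in_paths)

interpretation telegraph: prob_space telegraph
  unfolding telegraph_def by (rule start_counts_points.P.prob_space_distr[OF telegraph_path_measurable])

interpretation telegraph: finite_path_space "differ" telegraph
  by unfold_locales (simp add: path_measure_def telegraph_def)

section \<open>Spins of the telegraph process and their joint moments\<close>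

definition spin :: "bool \<Rightarrow> real" where
  "spin b = (if b then - 1 else 1)"

text \<open>The factor by which a single point v multiplies the spin at time t.\<close>

definition jump_sign :: "real \<Rightarrow> real \<Rightarrow> real" where
  "jump_sign t v = (if 0 < v \<and> v < 1 \<and> v \<le> t then - 1 else 1)"

lemma spin_differ: "spin (differ a b) = spin a * spin b"
  by (simp add: spin_def differ_def)

lemma spin_sq: "spin b * spin b = 1"
  by (simp add: spin_def)

lemma spin_flip: "spin (flip n u t) = (\<Prod>i<n. jump_sign t (u i))"
  by (induction n) (auto simp: spin_differ, auto simp: spin_def jump_sign_def)

lemma jump_sign_measurable [measurable]: "jump_sign t \<in> borel_measurable borel"
  unfolding jump_sign_def by measurable

lemma abs_jump_sign [simp]: "\<bar>jump_sign t v\<bar> = 1"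
  by (simp add: jump_sign_def)

text \<open>The symmetric initial spin occurs \<open>card X\<close> times in the first product and
  twice in every factor of the second, so its mean is the parity of \<open>card X\<close>. The rest
  is a product over the points and falls under \<open>integral_telegraph\<close>.\<close>

lemma telegraph_char:
  assumes X: "X \<subseteq> {0..1}" and Y: "Y \<subseteq> {0..1}" and t: "t \<in> {0..1}"
  shows "(\<integral>\<omega>. (\<Prod>r\<in>X. spin (\<omega> r)) * (\<Prod>r\<in>Y. spin (differ (\<omega> r) (\<omega> t))) \<partial>telegraph) =
    of_bool (even (card X)) *
    exp ((\<integral>v. (\<Prod>r\<in>X. jump_sign r v) * (\<Prod>r\<in>Y. jump_sign r v * jump_sign t v) \<partial>unit_uniform) - 1)"
proof -
  let ?M = "start \<Otimes>\<^sub>M (counts \<Otimes>\<^sub>M points)"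
  let ?\<phi> = "\<lambda>v. (\<Prod>r\<in>X. jump_sign r v) * (\<Prod>r\<in>Y. jump_sign r v * jump_sign t v)"
  have m: "(\<lambda>\<omega>. (\<Prod>r\<in>X. spin (\<omega> r)) * (\<Prod>r\<in>Y. spin (differ (\<omega> r) (\<omega> t)))) \<in> borel_measurable (path_sigma differ {0..1})"
  proof (intro borel_measurable_times borel_measurable_prod)
    show "(\<lambda>\<omega>. spin (\<omega> r)) \<in> borel_measurable (path_sigma differ {0..1})" if "r \<in> X" for r
      by (rule measurable_compose[OF coord_measurable]) (use that X in auto)
    show "(\<lambda>\<omega>. spin (differ (\<omega> r) (\<omega> t))) \<in> borel_measurable (path_sigma differ {0..1})" if "r \<in> Y" for r
    proof -
      have "r \<in> {0..1}" using that Y by auto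
      from measurable_compose[OF coord2_measurable[OF this t, where f = "\<lambda>x y. spin (differ x y)"], of "\<lambda>x. x" borel]
      show ?thesis by simp
    qed
  qed
  have "(\<integral>\<omega>. (\<Prod>r\<in>X. spin (\<omega> r)) * (\<Prod>r\<in>Y. spin (differ (\<omega> r) (\<omega> t))) \<partial>telegraph) =
    (\<integral>x. (\<Prod>r\<in>X. spin (telegraph_path x r)) * (\<Prod>r\<in>Y. spin (differ (telegraph_path x r) (telegraph_path x t))) \<partial>?M)"
    unfolding telegraph_def by (rule integral_distr[OF telegraph_path_measurable m])
  also have "\<dots> = (\<integral>x. spin (fst x) ^ card X * (\<Prod>i<fst (snd x). ?\<phi> (snd (snd x) i)) \<partial>?M)"
  proof (rule Bochner_Integration.integral_cong[OF refl])
    fix x :: "bool \<times> nat \<times> (nat \<Rightarrow> real)"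
    obtain b n u where x: "x = (b, n, u)" by (cases x)
    have s: "spin (telegraph_path x r) = spin b * (\<Prod>i<n. jump_sign r (u i))" if "r \<in> {0..1}" for r
      using that by (simp add: telegraph_path_def x spin_differ spin_flip)
    have "(\<Prod>r\<in>X. spin (telegraph_path x r)) = (\<Prod>r\<in>X. spin b * (\<Prod>i<n. jump_sign r (u i)))"
      using X by (intro prod.cong refl s) auto
    also have "\<dots> = spin b ^ card X * (\<Prod>i<n. \<Prod>r\<in>X. jump_sign r (u i))"
      by (simp add: prod.distrib prod.swap[of _ "{..<n}"])
    finally have 1: "(\<Prod>r\<in>X. spin (telegraph_path x r)) = spin b ^ card X * (\<Prod>i<n. \<Prod>r\<in>X. jump_sign r (u i))" .
    have "(\<Prod>r\<in>Y. spin (differ (telegraph_path x r) (telegraph_path x t))) = (\<Prod>r\<in>Y. \<Prod>i<n. jump_sign r (u i) * jump_sign t (u i))"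
    proof (rule prod.cong[OF refl])
      fix r assume "r \<in> Y"
      then have "spin (differ (telegraph_path x r) (telegraph_path x t)) =
        (spin b * spin b) * ((\<Prod>i<n. jump_sign r (u i)) * (\<Prod>i<n. jump_sign t (u i)))"
        using Y t by (subst spin_differ) (simp add: s subset_eq mult_ac)
      then show "spin (differ (telegraph_path x r) (telegraph_path x t)) = (\<Prod>i<n. jump_sign r (u i) * jump_sign t (u i))"
        by (simp add: spin_sq prod.distrib)
    qed
    also have "\<dots> = (\<Prod>i<n. \<Prod>r\<in>Y. jump_sign r (u i) * jump_sign t (u i))" by (rule prod.swap)
    finally show "(\<Prod>r\<in>X. spin (telegraph_path x r)) * (\<Prod>r\<in>Y. spin (differ (telegraph_path x r) (telegraph_path x t))) =
      spin (fst x) ^ card X * (\<Prod>i<fst (snd x). ?\<phi> (snd (snd x) i))"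
      using 1 by (simp add: x prod.distrib mult_ac)
  qed
  also have "\<dots> = (spin True ^ card X + spin False ^ card X) / 2 * exp ((\<integral>v. ?\<phi> v \<partial>unit_uniform) - 1)"
  proof (rule integral_telegraph)
    show "?\<phi> \<in> borel_measurable borel" by measurable
    show "\<bar>?\<phi> v\<bar> \<le> 1" for v by (simp add: abs_mult abs_prod)
  qed
  also have "(spin True ^ card X + spin False ^ card X) / 2 = (of_bool (even (card X)) :: real)"
    by (simp add: spin_def)
  finally show ?thesis .
qed

lemma telegraph_bounded:
  fixes f :: "bool \<Rightarrow> bool \<Rightarrow> real"
  assumes "r \<in> {0..1}" "t \<in> {0..1}"
  shows "(\<lambda>\<omega>. f (\<omega> r) (\<omega> t)) \<in> borel_measurable telegraph"
  unfolding telegraph.measurable_Q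
  using measurable_compose[OF coord2_measurable[OF assms, where f = f], of "\<lambda>x. x" borel] by simp

text \<open>Every function of a spin is affine in it, so independence follows from the product formula
  for products of signs.\<close>

lemma telegraph_indep:
  fixes f h :: "real \<Rightarrow> bool \<Rightarrow> real"
  assumes t: "0 \<le> t" "t \<le> 1" and D: "finite D" "D \<subseteq> {0..t}" and D': "finite D'" "D' \<subseteq> {t..1}"
  shows "(\<integral>\<omega>. (\<Prod>r\<in>D. f r (\<omega> r)) * (\<Prod>r\<in>D'. h r (differ (\<omega> r) (\<omega> t))) \<partial>telegraph) =
    (\<integral>\<omega>. (\<Prod>r\<in>D. f r (\<omega> r)) \<partial>telegraph) * (\<integral>\<omega>. (\<Prod>r\<in>D'. h r (differ (\<omega> r) (\<omega> t))) \<partial>telegraph)"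
proof -
  define ch where "ch X \<omega> = (\<Prod>r\<in>X. spin (\<omega> r))" for X and \<omega> :: "real \<Rightarrow> bool"
  define ch' where "ch' X \<omega> = (\<Prod>r\<in>X. spin (differ (\<omega> r) (\<omega> t)))" for X and \<omega> :: "real \<Rightarrow> bool"
  define c where "c f X Y = (\<Prod>r\<in>X. (f r False + f r True) / 2) * (\<Prod>r\<in>Y - X. (f r False - f r True) / 2)"
    for f :: "real \<Rightarrow> bool \<Rightarrow> real" and X Y
  have affine: "f r x = (f r False + f r True) / 2 + (f r False - f r True) / 2 * spin x" for f :: "real \<Rightarrow> bool \<Rightarrow> real" and r x
    by (cases x) (auto simp: spin_def field_simps)
  \<comment> \<open>The product of affine functions is multiplied out; in each term X collects the
    times at which the constant part is chosen.\<close>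
  have expand: "(\<Prod>r\<in>Y. f r (s r)) = (\<Sum>X\<in>Pow Y. c f X Y * (\<Prod>r\<in>Y - X. spin (s r)))"
    if "finite Y" for f :: "real \<Rightarrow> bool \<Rightarrow> real" and Y s
  proof -
    have "(\<Prod>r\<in>Y. f r (s r)) = (\<Prod>r\<in>Y. (f r False + f r True) / 2 + (f r False - f r True) / 2 * spin (s r))"
      by (rule prod.cong[OF refl affine])
    also have "\<dots> = (\<Sum>X\<in>Pow Y. (\<Prod>r\<in>X. (f r False + f r True) / 2) * (\<Prod>r\<in>Y - X. (f r False - f r True) / 2 * spin (s r)))"
      by (rule prod_add[OF that])
    also have "\<dots> = (\<Sum>X\<in>Pow Y. c f X Y * (\<Prod>r\<in>Y - X. spin (s r)))"
      by (simp only: c_def prod.distrib mult.assoc)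
    finally show ?thesis .
  qed
  have int: "integrable telegraph (\<lambda>\<omega>. ch X \<omega> * ch' Y \<omega>)" if "X \<subseteq> {0..1}" "Y \<subseteq> {0..1}" for X Y
  proof (rule telegraph.integrable_const_bound[where B = 1])
    show "(\<lambda>\<omega>. ch X \<omega> * ch' Y \<omega>) \<in> borel_measurable telegraph"
      unfolding ch_def ch'_def using that t
      by (intro borel_measurable_times borel_measurable_prod telegraph_bounded[where f = "\<lambda>x y. spin x"]
          telegraph_bounded[where f = "\<lambda>x y. spin (differ x y)"]) auto
    have "\<bar>ch X \<omega>\<bar> \<le> 1" "\<bar>ch' Y \<omega>\<bar> \<le> 1" for \<omega>
      unfolding ch_def ch'_def abs_prod by (intro prod_le_1; simp add: spin_def)+
    then show "AE \<omega> in telegraph. norm (ch X \<omega> * ch' Y \<omega>) \<le> 1"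
      by (intro AE_I2) (simp add: abs_mult mult_le_one)
  qed
  have prod: "(\<integral>\<omega>. ch X \<omega> * ch' Y \<omega> \<partial>telegraph) = (\<integral>\<omega>. ch X \<omega> \<partial>telegraph) * (\<integral>\<omega>. ch' Y \<omega> \<partial>telegraph)"
    if X: "X \<subseteq> {0..t}" and Y: "Y \<subseteq> {t..1}" for X Y
  proof -
    let ?P = "\<lambda>v. \<Prod>r\<in>X. jump_sign r v" and ?Q = "\<lambda>v. \<Prod>r\<in>Y. jump_sign r v * jump_sign t v"
    have XY: "X \<subseteq> {0..1}" "Y \<subseteq> {0..1}" "t \<in> {0..1}" using X Y t by auto
    have iP: "integrable unit_uniform ?P" "integrable unit_uniform ?Q"
      by (rule unit_uniform.integrable_const_bound[where B = 1]; simp add: abs_prod abs_mult)+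
    \<comment> \<open>A point up to t cancels from every increment after t, and a later point has no
      effect on the spins before t. One of the factors is therefore 1, the exponents add up, and the
      moments factorise.\<close>
    have "?P v * ?Q v = ?P v + ?Q v - 1" for v
    proof (cases "v \<le> t")
      case True
      then have "?Q v = 1" using Y by (intro prod.neutral) (auto simp: jump_sign_def)
      then show ?thesis by simp
    next
      case False
      then have "?P v = 1" using X by (intro prod.neutral) (auto simp: jump_sign_def)
      then show ?thesis by simp
    qed
    then have "(\<integral>v. ?P v * ?Q v \<partial>unit_uniform) = (\<integral>v. ?P v + ?Q v - 1 \<partial>unit_uniform)" by simp
    also have "\<dots> = (\<integral>v. ?P v \<partial>unit_uniform) + (\<integral>v. ?Q v \<partial>unit_uniform) - 1"
      using iP unit_uniform.prob_space by simp
    finally have I: "(\<integral>v. ?P v * ?Q v \<partial>unit_uniform) - 1 = ((\<integral>v. ?P v \<partial>unit_uniform) - 1) + ((\<integral>v. ?Q v \<partial>unit_uniform) - 1)" by simp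
    show ?thesis
      using telegraph_char[OF XY] telegraph_char[OF XY(1) empty_subsetI XY(3)] telegraph_char[OF empty_subsetI XY(2,3)]
      unfolding ch_def ch'_def I exp_add by simp
  qed
  have e1: "(\<integral>\<omega>. (\<Prod>r\<in>D. f r (\<omega> r)) \<partial>telegraph) = (\<Sum>X\<in>Pow D. c f X D * (\<integral>\<omega>. ch (D - X) \<omega> \<partial>telegraph))"
  proof -
    have "(\<integral>\<omega>. (\<Prod>r\<in>D. f r (\<omega> r)) \<partial>telegraph) = (\<integral>\<omega>. (\<Sum>X\<in>Pow D. c f X D * ch (D - X) \<omega>) \<partial>telegraph)"
      unfolding ch_def by (simp add: expand[OF D(1)])
    also have "\<dots> = (\<Sum>X\<in>Pow D. c f X D * (\<integral>\<omega>. ch (D - X) \<omega> \<partial>telegraph))"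
    proof (subst Bochner_Integration.integral_sum)
      fix X
      have "D - X \<subseteq> {0..1}" using D t by force
      from int[OF this, of "{}"] have "integrable telegraph (ch (D - X))" by (simp add: ch'_def)
      then show "integrable telegraph (\<lambda>\<omega>. c f X D * ch (D - X) \<omega>)" by (rule integrable_mult_right)
    qed simp
    finally show ?thesis .
  qed
  have e2: "(\<integral>\<omega>. (\<Prod>r\<in>D'. h r (differ (\<omega> r) (\<omega> t))) \<partial>telegraph) = (\<Sum>Y\<in>Pow D'. c h Y D' * (\<integral>\<omega>. ch' (D' - Y) \<omega> \<partial>telegraph))"
  proof -
    have "(\<integral>\<omega>. (\<Prod>r\<in>D'. h r (differ (\<omega> r) (\<omega> t))) \<partial>telegraph) = (\<integral>\<omega>. (\<Sum>Y\<in>Pow D'. c h Y D' * ch' (D' - Y) \<omega>) \<partial>telegraph)"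
      unfolding ch'_def by (intro Bochner_Integration.integral_cong refl expand[OF D'(1)])
    also have "\<dots> = (\<Sum>Y\<in>Pow D'. c h Y D' * (\<integral>\<omega>. ch' (D' - Y) \<omega> \<partial>telegraph))"
    proof (subst Bochner_Integration.integral_sum)
      fix Y
      have "D' - Y \<subseteq> {0..1}" using D' t by force
      from int[OF _ this, of "{}"] have "integrable telegraph (ch' (D' - Y))" by (simp add: ch_def)
      then show "integrable telegraph (\<lambda>\<omega>. c h Y D' * ch' (D' - Y) \<omega>)" by (rule integrable_mult_right)
    qed simp
    finally show ?thesis .
  qed
  have "(\<integral>\<omega>. (\<Prod>r\<in>D. f r (\<omega> r)) * (\<Prod>r\<in>D'. h r (differ (\<omega> r) (\<omega> t))) \<partial>telegraph) =
    (\<integral>\<omega>. (\<Sum>X\<in>Pow D. \<Sum>Y\<in>Pow D'. (c f X D * c h Y D') * (ch (D - X) \<omega> * ch' (D' - Y) \<omega>)) \<partial>telegraph)"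
    unfolding ch_def ch'_def
  proof (rule Bochner_Integration.integral_cong[OF refl])
    fix \<omega> :: "real \<Rightarrow> bool"
    show "(\<Prod>r\<in>D. f r (\<omega> r)) * (\<Prod>r\<in>D'. h r (differ (\<omega> r) (\<omega> t))) =
      (\<Sum>X\<in>Pow D. \<Sum>Y\<in>Pow D'. (c f X D * c h Y D') * ((\<Prod>r\<in>D - X. spin (\<omega> r)) * (\<Prod>r\<in>D' - Y. spin (differ (\<omega> r) (\<omega> t)))))"
      unfolding expand[OF D(1), of f \<omega>] expand[OF D'(1), of h "\<lambda>r. differ (\<omega> r) (\<omega> t)"] sum_product
      by (intro sum.cong refl) (simp only: mult.assoc mult.left_commute)
  qed
  also have "\<dots> = (\<Sum>X\<in>Pow D. \<Sum>Y\<in>Pow D'. (c f X D * c h Y D') * (\<integral>\<omega>. ch (D - X) \<omega> * ch' (D' - Y) \<omega> \<partial>telegraph))"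
  proof -
    have i: "integrable telegraph (\<lambda>\<omega>. (c f X D * c h Y D') * (ch (D - X) \<omega> * ch' (D' - Y) \<omega>))" for X Y
    proof -
      have "D - X \<subseteq> {0..1}" "D' - Y \<subseteq> {0..1}" using D D' t by force+
      then show ?thesis by (intro integrable_mult_right int)
    qed
    show ?thesis
      using i by (simp add: Bochner_Integration.integral_sum Bochner_Integration.integrable_sum)
  qed
  also have "\<dots> = (\<Sum>X\<in>Pow D. \<Sum>Y\<in>Pow D'. (c f X D * c h Y D') *
      ((\<integral>\<omega>. ch (D - X) \<omega> \<partial>telegraph) * (\<integral>\<omega>. ch' (D' - Y) \<omega> \<partial>telegraph)))"
    using D D' by (intro sum.cong refl arg_cong2[where f = times] prod) auto
  also have "\<dots> = (\<integral>\<omega>. (\<Prod>r\<in>D. f r (\<omega> r)) \<partial>telegraph) * (\<integral>\<omega>. (\<Prod>r\<in>D'. h r (differ (\<omega> r) (\<omega> t))) \<partial>telegraph)"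
    unfolding e1 e2 sum_product by (intro sum.cong refl) (simp add: mult_ac)
  finally show ?thesis .
qed

lemma telegraph_start: "telegraph.expectation (\<lambda>\<omega>. spin (\<omega> t)) = 0" if "t \<in> {0..1}"
  using telegraph_char[of "{t}" "{}" t] that by simp

section \<open>Conditional independence for the telegraph process\<close>

definition cylinder :: "real set \<Rightarrow> (real \<Rightarrow> bool set) \<Rightarrow> (real \<Rightarrow> bool) set" where
  "cylinder D F = {\<omega> \<in> paths differ. \<forall>r\<in>D. \<omega> r \<in> F r}"

lemma cylinder_sets:
  assumes "finite D" "D \<subseteq> I"
  shows "cylinder D F \<in> sets (path_sigma differ I)"
proof -
  have "{\<omega> \<in> space (path_sigma differ I). \<forall>r\<in>D. \<omega> r \<in> F r} \<in> sets (path_sigma differ I)"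
  proof (rule sets.sets_Collect_finite_All[OF _ assms(1)])
    fix r assume "r \<in> D"
    then have "r \<in> I" using assms(2) by auto
    from measurable_sets[OF coord_measurable[OF this, of "differ"], of "F r"]
    show "{\<omega> \<in> space (path_sigma differ I). \<omega> r \<in> F r} \<in> sets (path_sigma differ I)"
      by (simp add: vimage_def Int_def conj_commute)
  qed
  then show ?thesis by (simp add: cylinder_def)
qed

lemma Int_stable_cylinder: "Int_stable {cylinder D F | D F. finite D \<and> D \<subseteq> I}"
proof (rule Int_stableI)
  fix A B assume "A \<in> {cylinder D F | D F. finite D \<and> D \<subseteq> I}" "B \<in> {cylinder D F | D F. finite D \<and> D \<subseteq> I}"
  then obtain D F D' F' where A: "A = cylinder D F" "finite D" "D \<subseteq> I" and B: "B = cylinder D' F'" "finite D'" "D' \<subseteq> I"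
    by blast
  have "A \<inter> B = cylinder (D \<union> D') (\<lambda>r. (if r \<in> D then F r else UNIV) \<inter> (if r \<in> D' then F' r else UNIV))"
    unfolding A B cylinder_def by (auto split: if_splits)
  then show "A \<inter> B \<in> {cylinder D F | D F. finite D \<and> D \<subseteq> I}" using A B by blast
qed

lemma sets_path_sigma_cylinder:
  "sets (path_sigma differ (I :: real set)) = sigma_sets (paths differ) {cylinder D F | D F. finite D \<and> D \<subseteq> I}"
proof
  show "sets (path_sigma differ I) \<subseteq> sigma_sets (paths differ) {cylinder D F | D F. finite D \<and> D \<subseteq> I}"
    unfolding sets_path_sigma
  proof (rule sigma_sets_mono')
    show "{{\<omega> \<in> paths differ. \<omega> s \<in> A} | s A. s \<in> I} \<subseteq> {cylinder D F | D F. finite D \<and> D \<subseteq> I}"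
    proof
      fix S assume "S \<in> {{\<omega> \<in> paths differ. \<omega> s \<in> A} | s A. s \<in> I}"
      then obtain s A where "S = {\<omega> \<in> paths differ. \<omega> s \<in> A}" "s \<in> I" by blast
      then have "S = cylinder {s} (\<lambda>_. A)" "{s} \<subseteq> I" by (auto simp: cylinder_def)
      then show "S \<in> {cylinder D F | D F. finite D \<and> D \<subseteq> I}" by blast
    qed
  qed
  have "sigma_sets (space (path_sigma differ I)) {cylinder D F | D F. finite D \<and> D \<subseteq> I} \<subseteq> sets (path_sigma differ I)"
    by (rule sets.sigma_sets_subset) (auto intro: cylinder_sets)
  then show "sigma_sets (paths differ) {cylinder D F | D F. finite D \<and> D \<subseteq> I} \<subseteq> sets (path_sigma differ I)" by simp
qed

text \<open>On X_t = z the later states are recovered from their increments relative to time t, so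
  the future event can be written in terms of increments, which are independent of the past.\<close>

lemma telegraph_cylinder:
  assumes t: "0 \<le> t" "t \<le> 1" and D: "finite D" "D \<subseteq> {0..t}" and D': "finite D'" "D' \<subseteq> {t..1}"
  shows "telegraph.prob (cylinder D F \<inter> cylinder D' G \<inter> {\<omega> \<in> paths differ. \<omega> t = z}) =
    telegraph.prob (cylinder D F \<inter> {\<omega> \<in> paths differ. \<omega> t = z}) *
    telegraph.expectation (\<lambda>\<omega>. \<Prod>r\<in>D'. of_bool ((differ (differ (\<omega> r) (\<omega> t)) z) \<in> G r))"
proof -
  let ?Z = "{\<omega> \<in> paths differ. \<omega> t = z}"
  \<comment> \<open>The condition X_t = z is made one of the factors of the past by adding t to its
    set of times.\<close>
  define f :: "real \<Rightarrow> bool \<Rightarrow> real" where "f r x = of_bool ((r \<in> D \<longrightarrow> x \<in> F r) \<and> (r = t \<longrightarrow> x = z))" for r x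
  define h :: "real \<Rightarrow> bool \<Rightarrow> real" where "h r x = of_bool (differ x z \<in> G r)" for r x
  have t': "finite (insert t D)" "insert t D \<subseteq> {0..t}" using D t by auto
  have I: "D \<subseteq> {0..1}" "D' \<subseteq> {0..1}" using D D' t by force+
  have S: "cylinder D F \<inter> cylinder D' G \<inter> ?Z \<in> telegraph.events" "cylinder D F \<inter> ?Z \<in> telegraph.events"
    using cylinder_sets[OF D(1) I(1)] cylinder_sets[OF D'(1) I(2)] telegraph.cyl_sets_Q[OF t, of z]
    unfolding telegraph.sets_Q by blast+
  have prod_bool: "(\<Prod>r\<in>Y. of_bool (p r)) = (of_bool (\<forall>r\<in>Y. p r) :: real)" if "finite Y" for Y and p :: "real \<Rightarrow> bool"
    using that by (induction Y) auto
  have ind: "telegraph.prob X = telegraph.expectation g"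
    if "X \<in> telegraph.events" "\<And>\<omega>. \<omega> \<in> paths differ \<Longrightarrow> g \<omega> = indicator X \<omega>" for X g
  proof -
    have "telegraph.expectation g = telegraph.expectation (indicator X)"
      using that(2) by (intro Bochner_Integration.integral_cong) auto
    moreover have "X \<inter> paths differ = X" using sets.sets_into_space[OF that(1)] by auto
    ultimately show ?thesis using that(1) by simp
  qed
  have f: "(\<Prod>r\<in>insert t D. f r (\<omega> r)) = indicator (cylinder D F \<inter> ?Z) \<omega>" if "\<omega> \<in> paths differ" for \<omega>
    using that t' unfolding f_def by (subst prod_bool) (auto simp: indicator_def cylinder_def)
  have h: "(\<Prod>r\<in>D'. h r (differ (\<omega> r) (\<omega> t))) = of_bool (\<forall>r\<in>D'. (differ (differ (\<omega> r) (\<omega> t)) z) \<in> G r)" for \<omega>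
    unfolding h_def by (rule prod_bool[OF D'(1)])
  have "telegraph.prob (cylinder D F \<inter> cylinder D' G \<inter> ?Z) =
    telegraph.expectation (\<lambda>\<omega>. (\<Prod>r\<in>insert t D. f r (\<omega> r)) * (\<Prod>r\<in>D'. h r (differ (\<omega> r) (\<omega> t))))"
  proof (rule ind[OF S(1)])
    fix \<omega> :: "real \<Rightarrow> bool" assume \<omega>: "\<omega> \<in> paths differ"
    have "differ (differ (\<omega> r) z) z = \<omega> r" for r by (auto simp: differ_def)
    then show "(\<Prod>r\<in>insert t D. f r (\<omega> r)) * (\<Prod>r\<in>D'. h r (differ (\<omega> r) (\<omega> t))) =
      indicator (cylinder D F \<inter> cylinder D' G \<inter> ?Z) \<omega>"
      unfolding f[OF \<omega>] h using \<omega> by (cases "\<omega> t = z") (auto simp: indicator_def cylinder_def)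
  qed
  also have "\<dots> = telegraph.expectation (\<lambda>\<omega>. \<Prod>r\<in>insert t D. f r (\<omega> r)) * telegraph.expectation (\<lambda>\<omega>. \<Prod>r\<in>D'. h r (differ (\<omega> r) (\<omega> t)))"
    by (rule telegraph_indep[OF t t' D'])
  also have "telegraph.expectation (\<lambda>\<omega>. \<Prod>r\<in>insert t D. f r (\<omega> r)) = telegraph.prob (cylinder D F \<inter> ?Z)"
    by (rule ind[OF S(2) f, symmetric])
  finally show ?thesis by (simp add: h_def)
qed

text \<open>Under the law conditioned on X_t = z the cylinders of past and future are independent;
  both families are closed under intersection and generate the two sigma-algebras.\<close>

lemma telegraph_cond_indep: "cond_indep differ telegraph"
  unfolding cond_indep_def
proof (intro ballI allI)
  fix t :: real and z A B
  assume t: "t \<in> {0..1}" and A: "A \<in> sets (path_sigma differ {0..t})" and B: "B \<in> sets (path_sigma differ {t..1})"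
  let ?Z = "{\<omega> \<in> paths differ. \<omega> t = z}"
  have t': "0 \<le> t" "t \<le> 1" using t by auto
  have Z: "?Z \<in> telegraph.events" by (rule telegraph.cyl_sets_Q[OF t'])
  have AB: "A \<in> telegraph.events" "B \<in> telegraph.events"
    using t' by (auto intro: telegraph.sets_path_sigma_Q[OF _ A] telegraph.sets_path_sigma_Q[OF _ B])
  show "emeasure telegraph (A \<inter> B \<inter> ?Z) * emeasure telegraph ?Z = emeasure telegraph (A \<inter> ?Z) * emeasure telegraph (B \<inter> ?Z)"
  proof (cases "telegraph.prob ?Z = 0")
    case True
    have "telegraph.prob (X \<inter> ?Z) = 0" for X
      using True telegraph.finite_measure_mono[OF Int_lower2 Z, of X] measure_nonneg[of telegraph "X \<inter> ?Z"] by linarith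
    then show ?thesis using True by (simp add: telegraph.emeasure_eq_measure)
  next
    case False
    let ?P = "uniform_measure telegraph ?Z"
    have Z0: "emeasure telegraph ?Z \<noteq> 0" "emeasure telegraph ?Z \<noteq> \<infinity>"
      using False by (auto simp: telegraph.emeasure_eq_measure)
    interpret P: prob_space ?P by (rule prob_space_uniform_measure[OF Z0])
    have P: "P.prob X = telegraph.prob (X \<inter> ?Z) / telegraph.prob ?Z" if "X \<in> telegraph.events" for X
      using measure_uniform_measure[OF Z0 that] by (simp add: Int_commute)
    let ?GA = "{cylinder D F | D F. finite D \<and> D \<subseteq> {0..t}}" and ?GB = "{cylinder D F | D F. finite D \<and> D \<subseteq> {t..1}}"
    have "P.indep_set ?GA ?GB"
    proof (rule P.indep_setI)
      have ev: "{cylinder D F | D F. finite D \<and> D \<subseteq> I} \<subseteq> telegraph.events" if "I \<subseteq> {0..1}" for I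
      proof
        fix X assume "X \<in> {cylinder D F | D F. finite D \<and> D \<subseteq> I}"
        then obtain D F where X: "X = cylinder D F" "finite D" "D \<subseteq> I" by blast
        show "X \<in> telegraph.events"
          unfolding telegraph.sets_Q X(1) by (rule cylinder_sets[OF X(2) subset_trans[OF X(3) that]])
      qed
      show "?GA \<subseteq> P.events" "?GB \<subseteq> P.events"
        unfolding sets_uniform_measure by (rule ev; use t' in auto)+
    next
      fix X Y assume "X \<in> ?GA" "Y \<in> ?GB"
      then obtain D F D' G where X: "X = cylinder D F" "finite D" "D \<subseteq> {0..t}" and Y: "Y = cylinder D' G" "finite D'" "D' \<subseteq> {t..1}"
        by blast
      have I: "D \<subseteq> {0..1}" "D' \<subseteq> {0..1}" using X Y t' by force+
      have ev: "X \<in> telegraph.events" "Y \<in> telegraph.events"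
        unfolding X(1) Y(1) telegraph.sets_Q by (rule cylinder_sets[OF X(2) I(1)], rule cylinder_sets[OF Y(2) I(2)])
      let ?e = "telegraph.expectation (\<lambda>\<omega>. \<Prod>r\<in>D'. of_bool ((differ (differ (\<omega> r) (\<omega> t)) z) \<in> G r))"
      have 1: "telegraph.prob (X \<inter> Y \<inter> ?Z) = telegraph.prob (X \<inter> ?Z) * ?e"
        unfolding X(1) Y(1) by (rule telegraph_cylinder[OF t' X(2,3) Y(2,3)])
      \<comment> \<open>With an empty set of times the past cylinder is the whole space, which
        identifies the future factor with the conditional probability of Y.\<close>
      have "cylinder {} F \<inter> Y = Y" "cylinder {} F \<inter> ?Z = ?Z" unfolding Y cylinder_def by auto
      then have 2: "telegraph.prob (Y \<inter> ?Z) = telegraph.prob ?Z * ?e"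
        using telegraph_cylinder[OF t' finite.emptyI empty_subsetI Y(2,3), of F G z] unfolding Y(1) by simp
      show "P.prob (X \<inter> Y) = P.prob X * P.prob Y"
        using False 1 2 ev by (simp add: P)
    qed
    then have "P.indep_set (sigma_sets (space ?P) ?GA) (sigma_sets (space ?P) ?GB)"
      by (rule P.indep_set_sigma_sets[OF _ Int_stable_cylinder Int_stable_cylinder])
    moreover have "space ?P = paths differ" by simp
    ultimately have "P.indep_set (sets (path_sigma differ {0..t})) (sets (path_sigma differ {t..1}))"
      by (simp add: sets_path_sigma_cylinder)
    from P.indep_setD[OF this A B] have "telegraph.prob (A \<inter> B \<inter> ?Z) * telegraph.prob ?Z =
      telegraph.prob (A \<inter> ?Z) * telegraph.prob (B \<inter> ?Z)"
      using False AB by (simp add: P field_simps)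
    then show ?thesis by (simp add: telegraph.emeasure_eq_measure ennreal_mult[symmetric])
  qed
qed

section \<open>Transition probabilities and jump kernel of the telegraph process\<close>

lemma telegraph_half: "telegraph.prob {\<omega> \<in> paths differ. \<omega> t = z} = 1 / 2" if t: "t \<in> {0..1}"
proof -
  let ?Z = "{\<omega> \<in> paths differ. \<omega> t = z}"
  have Z: "?Z \<in> telegraph.events" using t by (intro telegraph.cyl_sets_Q) auto
  have Zi: "?Z \<inter> paths differ = ?Z" by auto
  have i: "integrable telegraph (\<lambda>\<omega>. spin (\<omega> t))"
    using telegraph_bounded[OF t t, of "\<lambda>x y. spin x"]
    by (intro telegraph.integrable_const_bound[where B = 1]) (auto simp: spin_def)
  have "telegraph.prob ?Z = telegraph.expectation (indicator ?Z)" using Z Zi by simp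
  also have "\<dots> = telegraph.expectation (\<lambda>\<omega>. (1 + spin z * spin (\<omega> t)) / 2)"
    by (intro Bochner_Integration.integral_cong) (auto simp: spin_def indicator_def)
  also have "\<dots> = 1 / 2"
    using i telegraph_start[OF t] telegraph.prob_space by simp
  finally show ?thesis .
qed

text \<open>The spins at s and r differ by one sign for each point in (s,r]; a single point has mean
  sign 1 - 2 (r - s), so the mean product of the spins is exp (- 2 (r - s)).\<close>

lemma telegraph_pair:
  assumes st: "0 \<le> s" "s \<le> r" "r < 1"
  shows "telegraph.prob ({\<omega> \<in> paths differ. \<omega> r = w} \<inter> {\<omega> \<in> paths differ. \<omega> s = z}) =
    (1 + spin (differ w z) * exp (- 2 * (r - s))) / 4"
proof -
  let ?Z = "{\<omega> \<in> paths differ. \<omega> s = z}" and ?W = "{\<omega> \<in> paths differ. \<omega> r = w}"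
  have s1: "s \<in> {0..1}" "r \<in> {0..1}" using st by auto
  have i: "integrable telegraph (\<lambda>\<omega>. spin (differ (\<omega> r) (\<omega> s)))"
    using telegraph_bounded[OF s1(2,1), of "\<lambda>x y. spin (differ x y)"]
    by (intro telegraph.integrable_const_bound[where B = 1]) (auto simp: spin_def)
  have "jump_sign r v * jump_sign s v = 1 - 2 * indicator {s<..r} v" for v
    using st by (auto simp: jump_sign_def indicator_def)
  moreover have "measure unit_uniform {s<..r} = r - s"
  proof -
    have "{0<..<1} \<inter> {s<..r} = {s<..r}" using st by auto
    then have "emeasure unit_uniform {s<..r} = ennreal (r - s)"
      unfolding unit_uniform_def using st by (subst emeasure_uniform_measure) (auto simp: divide_ennreal_def)
    then show ?thesis using st by (simp add: measure_def)
  qed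
  ultimately have "(\<integral>v. jump_sign r v * jump_sign s v \<partial>unit_uniform) = 1 - 2 * (r - s)"
    using unit_uniform.prob_space by (simp add: unit_uniform.emeasure_eq_measure)
  then have e: "telegraph.expectation (\<lambda>\<omega>. spin (differ (\<omega> r) (\<omega> s))) = exp (- 2 * (r - s))"
    using telegraph_char[of "{}" "{r}" s] s1 by simp
  have "cylinder {} (\<lambda>_. {}) \<inter> cylinder {r} (\<lambda>_. {w}) = ?W" "cylinder {} (\<lambda>_. {}) \<inter> ?Z = ?Z"
    by (auto simp: cylinder_def)
  then have "telegraph.prob (?W \<inter> ?Z) = telegraph.prob ?Z *
      telegraph.expectation (\<lambda>\<omega>. of_bool ((differ (differ (\<omega> r) (\<omega> s)) z) \<in> {w}))"
    using telegraph_cylinder[of s "{}" "{r}" "\<lambda>_. {}" "\<lambda>_. {w}" z] st by simp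
  also have "(\<lambda>\<omega>. of_bool ((differ (differ (\<omega> r) (\<omega> s)) z) \<in> {w})) = (\<lambda>\<omega>. (1 + spin (differ w z) * spin (differ (\<omega> r) (\<omega> s))) / 2)"
    by (auto simp: spin_def fun_eq_iff differ_def)
  also have "telegraph.expectation \<dots> = (1 + spin (differ w z) * exp (- 2 * (r - s))) / 2"
    using i e telegraph.prob_space by simp
  finally show ?thesis unfolding telegraph_half[OF s1(1)] by (simp add: field_simps)
qed


lemma telegraph_markov: "markov_measure differ telegraph"
  by (rule telegraph.cond_indep_imp_markov[OF telegraph.finite_measure_axioms telegraph_cond_indep])

text \<open>The two state probabilities on A relax towards their common mean, and their difference
  decays at rate 2.\<close>

lemma telegraph_step:
  assumes st: "0 \<le> s" "s \<le> r" "r < 1" and A: "A \<in> sets (path_sigma differ {0..s})"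
  shows "telegraph.prob (A \<inter> {\<omega> \<in> paths differ. \<omega> r = w}) =
    (telegraph.prob (A \<inter> {\<omega> \<in> paths differ. \<omega> s = w}) + telegraph.prob (A \<inter> {\<omega> \<in> paths differ. \<omega> s = (\<not> w)})) / 2 +
    (telegraph.prob (A \<inter> {\<omega> \<in> paths differ. \<omega> s = w}) - telegraph.prob (A \<inter> {\<omega> \<in> paths differ. \<omega> s = (\<not> w)})) / 2 *
      exp (- 2 * (r - s))"
proof -
  let ?C = "\<lambda>t z. {\<omega> \<in> paths differ. \<omega> t = z}" and ?e = "exp (- 2 * (r - s))"
  have s1: "0 \<le> s" "s \<le> 1" "0 \<le> r" "r \<le> 1" using st by auto
  have Q: "A \<in> telegraph.events" using s1 by (intro telegraph.sets_path_sigma_Q[OF _ A]) auto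
  note cyl = telegraph.cyl_sets_Q[OF s1(1,2)] telegraph.cyl_sets_Q[OF s1(3,4)]
  have pair: "telegraph.prob (A \<inter> ?C r w \<inter> ?C s z) = telegraph.prob (A \<inter> ?C s z) * (1 + spin (differ w z) * ?e) / 2" for z
  proof -
    have "?C r w \<in> sets (path_sigma differ {s..1})" using st by (intro cyl_sets) auto
    then have "emeasure telegraph (A \<inter> ?C r w \<inter> ?C s z) * emeasure telegraph (?C s z) =
      emeasure telegraph (A \<inter> ?C s z) * emeasure telegraph (?C r w \<inter> ?C s z)"
      using telegraph_cond_indep A s1 unfolding cond_indep_def by auto
    then have "telegraph.prob (A \<inter> ?C r w \<inter> ?C s z) * telegraph.prob (?C s z) =
      telegraph.prob (A \<inter> ?C s z) * telegraph.prob (?C r w \<inter> ?C s z)"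
      by (simp add: telegraph.emeasure_eq_measure ennreal_mult[symmetric])
    moreover have "telegraph.prob (?C s z) = 1 / 2" by (rule telegraph_half) (use s1 in auto)
    ultimately show ?thesis unfolding telegraph_pair[OF st] by (simp add: field_simps)
  qed
  have "A \<inter> ?C r w = (A \<inter> ?C r w \<inter> ?C s w) \<union> (A \<inter> ?C r w \<inter> ?C s (\<not> w))" by auto
  then have "telegraph.prob (A \<inter> ?C r w) = telegraph.prob ((A \<inter> ?C r w \<inter> ?C s w) \<union> (A \<inter> ?C r w \<inter> ?C s (\<not> w)))"
    by (rule arg_cong)
  also have "\<dots> = telegraph.prob (A \<inter> ?C r w \<inter> ?C s w) + telegraph.prob (A \<inter> ?C r w \<inter> ?C s (\<not> w))"
    using Q cyl by (intro telegraph.finite_measure_Union sets.Int) auto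
  also have "\<dots> = telegraph.prob (A \<inter> ?C s w) * (1 + ?e) / 2 + telegraph.prob (A \<inter> ?C s (\<not> w)) * (1 - ?e) / 2"
    unfolding pair by (simp add: spin_def differ_def)
  finally show ?thesis by (simp add: field_simps)
qed

lemma set_integral_exp:
  fixes p q s t :: real
  assumes "s \<le> t"
  shows "(LBINT r:{s..t}. p + q * exp (- 2 * (r - s))) = p * (t - s) + q * (1 - exp (- 2 * (t - s))) / 2"
proof -
  have "(LBINT r:{s..t}. p + q * exp (- 2 * (r - s))) = (\<integral>r. (p + q * exp (- 2 * (r - s))) * indicator {s..t} r \<partial>lborel)"
    by (simp add: set_lebesgue_integral_def mult.commute)
  also have "\<dots> = (p * t - q * exp (- 2 * (t - s)) / 2) - (p * s - q * exp (- 2 * (s - s)) / 2)"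
    by (rule integral_FTC_Icc_real[OF assms]) (auto intro!: derivative_eq_intros continuous_intros)
  finally show ?thesis by (simp add: field_simps)
qed

definition unit_rate :: "real \<Rightarrow> bool \<Rightarrow> bool \<Rightarrow> real" where
  "unit_rate t x y = of_bool (differ x y)"

text \<open>Every state has a single neighbour, so the forward equation only involves the difference
  of the two state probabilities, whose explicit exponential form can be integrated.\<close>

lemma telegraph_jump_kernel: "has_jump_kernel differ UNIV telegraph unit_rate"
proof (rule telegraph.has_jump_kernelI)
  show "symp differ" by (auto simp: symp_def differ_def)
  fix t :: real and z w :: bool assume t: "0 \<le> t" "t < 1"
  have "set_integrable lborel {0..t} (\<lambda>r. unit_rate r z w * telegraph.prob {\<omega> \<in> paths differ. \<omega> r = z}) =
    set_integrable lborel {0..t} (\<lambda>r. of_bool (differ z w) * (1 / 2) :: real)"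
    by (rule set_integrable_cong) (use t in \<open>auto simp: unit_rate_def telegraph_half\<close>)
  then show "set_integrable lborel {0..t} (\<lambda>r. unit_rate r z w * telegraph.prob {\<omega> \<in> paths differ. \<omega> r = z})"
    using borel_integrable_atLeastAtMost'[of 0 t "\<lambda>r. of_bool (differ z w) * (1 / 2) :: real"] by simp
next
  fix A s t w assume A: "A \<in> sets (path_sigma differ {0..s})" and st: "0 \<le> s" "s \<le> t" "t < (1::real)"
  let ?P = "\<lambda>r z. telegraph.prob (A \<inter> {\<omega> \<in> paths differ. \<omega> r = z})"
  have int: "(LBINT r:{s..t}. ?P r z) = (?P s z + ?P s (\<not> z)) / 2 * (t - s) + (?P s z - ?P s (\<not> z)) / 2 * (1 - exp (- 2 * (t - s))) / 2" for z
  proof -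
    have "(LBINT r:{s..t}. ?P r z) = (LBINT r:{s..t}. (?P s z + ?P s (\<not> z)) / 2 + (?P s z - ?P s (\<not> z)) / 2 * exp (- 2 * (r - s)))"
    proof (rule set_lebesgue_integral_cong, simp, intro allI impI)
      fix r assume "r \<in> {s..t}"
      then show "?P r z = (?P s z + ?P s (\<not> z)) / 2 + (?P s z - ?P s (\<not> z)) / 2 * exp (- 2 * (r - s))"
        using st by (intro telegraph_step A) auto
    qed
    then show ?thesis unfolding set_integral_exp[OF st(2)] .
  qed
  have nbr: "{z. differ w z} = {\<not> w}" by (auto simp: differ_def)
  have d: "differ (\<not> w) w" "differ w (\<not> w)" by (auto simp: differ_def)
  have "?P t w - ?P s w = (LBINT r:{s..t}. ?P r (\<not> w)) - (LBINT r:{s..t}. ?P r w)"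
    unfolding int telegraph_step[OF st A] by (simp add: field_simps)
  then show "?P t w - ?P s w = (\<Sum>z | differ w z. (LBINT r:{s..t}. unit_rate r z w * ?P r z) - (LBINT r:{s..t}. unit_rate r w z * ?P r w))"
    unfolding nbr unit_rate_def by (simp only: sum.insert sum.empty finite.emptyI empty_iff not_False_eq_True d of_bool_eq(2) mult_1 add_0_right)
qed (auto simp: unit_rate_def)

section \<open>The standing assumptions on the two-point graph\<close>

definition unit_distance :: "bool \<Rightarrow> bool \<Rightarrow> real" where
  "unit_distance x y = of_bool (differ x y)"

lemma unit_distance_metric: "Metric_space UNIV unit_distance"
  by unfold_locales (auto simp: unit_distance_def differ_def)

lemma flip_le_one:
  assumes "n \<le> 1"
  shows "flip n u t \<longleftrightarrow> n = 1 \<and> 0 < u 0 \<and> u 0 < 1 \<and> u 0 \<le> t"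
  using assms by (cases n) (auto simp: differ_def)

text \<open>With at most one point the parity is monotone in time, so the path changes its state at
  most once.\<close>

lemma telegraph_path_geodesic:
  assumes "n \<le> 1"
  shows "telegraph_path (b, n, u) \<in> geodesics differ unit_distance"
proof -
  define j where "j t \<longleftrightarrow> n = 1 \<and> 0 < u 0 \<and> u 0 < 1 \<and> u 0 \<le> t" for t
  have T: "telegraph_path (b, n, u) t = differ b (j t)" if "0 \<le> t" "t \<le> 1" for t
    using that by (simp add: telegraph_path_def flip_le_one[OF assms] j_def)
  have "geo unit_distance (telegraph_path (b, n, u)) 0 1"
    unfolding geo_def
  proof (intro allI impI, elim conjE)
    fix p q :: real assume pq: "0 \<le> p" "p \<le> q" "q \<le> 1"
    have "j 0 \<longrightarrow> j p" "j p \<longrightarrow> j q" "j q \<longrightarrow> j 1" unfolding j_def using pq by auto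
    moreover have "telegraph_path (b, n, u) 0 = differ b (j 0)" "telegraph_path (b, n, u) p = differ b (j p)"
      "telegraph_path (b, n, u) q = differ b (j q)" "telegraph_path (b, n, u) 1 = differ b (j 1)"
      using pq by (auto intro!: T)
    ultimately show "unit_distance (telegraph_path (b, n, u) 0) (telegraph_path (b, n, u) p) +
      unit_distance (telegraph_path (b, n, u) p) (telegraph_path (b, n, u) q) +
      unit_distance (telegraph_path (b, n, u) q) (telegraph_path (b, n, u) 1) =
      unit_distance (telegraph_path (b, n, u) 0) (telegraph_path (b, n, u) 1)"
      by (cases b; cases "j 0"; cases "j p"; cases "j q"; cases "j 1") (simp_all add: unit_distance_def differ_def)
  qed
  then show ?thesis by (simp add: geodesics_iff[OF unit_distance_metric] telegraph_path_in_paths)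
qed

lemma unit_distance_graph: "graph_distance differ unit_distance"
  unfolding graph_distance_def
proof (intro conjI allI impI unit_distance_metric)
  fix x y
  show "1 \<le> unit_distance x y" if "x \<noteq> y" using that by (simp add: unit_distance_def differ_def)
  \<comment> \<open>Minimal path: one jump at time 1/2 if the end points differ, and no jump
    otherwise.\<close>
  define \<gamma> where "\<gamma> = telegraph_path (x, of_bool (differ x y), \<lambda>_. 1 / 2)"
  have \<gamma>: "\<gamma> \<in> paths differ" "geo unit_distance \<gamma> 0 1"
    using telegraph_path_geodesic[of "of_bool (differ x y)" x "\<lambda>_. 1 / 2"]
    unfolding geodesics_iff[OF unit_distance_metric] \<gamma>_def by auto
  have e: "\<gamma> 0 = x" "\<gamma> 1 = y"
    unfolding \<gamma>_def telegraph_path_def by (cases "differ x y"; simp add: differ_def)+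
  have "Inf (path_length unit_distance ` {\<omega> \<in> paths differ. \<omega> 0 = x \<and> \<omega> 1 = y}) = unit_distance x y"
  proof (rule cInf_eq_minimum)
    show "unit_distance x y \<in> path_length unit_distance ` {\<omega> \<in> paths differ. \<omega> 0 = x \<and> \<omega> 1 = y}"
      using \<gamma> e path_length_eq_iff_geo[OF unit_distance_metric \<gamma>(1)] by (intro image_eqI[of _ _ \<gamma>]) auto
    show "unit_distance x y \<le> l" if "l \<in> path_length unit_distance ` {\<omega> \<in> paths differ. \<omega> 0 = x \<and> \<omega> 1 = y}" for l
      using that d_le_path_length[OF unit_distance_metric] by auto
  qed
  then show "unit_distance x y = Inf (path_length unit_distance ` {\<omega> \<in> paths differ. \<omega> 0 = x \<and> \<omega> 1 = y})" by simp
qed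

lemma telegraph_standing:
  "standing_assumptions differ unit_distance (marginal telegraph 0) telegraph unit_rate"
  unfolding standing_assumptions_def
proof (intro conjI unit_distance_graph)
  have "differ\<^sup>*\<^sup>* x y" for x y
    by (cases "x = y") (auto simp: differ_def intro: r_into_rtranclp)
  then show "irreducible_graph differ"
    by (auto simp: irreducible_graph_def symp_def irreflp_def differ_def)
  have pos: "0 < emeasure (marginal telegraph 0) {x}" for x
    using telegraph_half[of 0 x] by (simp add: telegraph.emeasure_marginal telegraph.emeasure_eq_measure)
  have nbr: "{y. differ x y} = {\<not> x}" for x by (auto simp: differ_def)
  have "total_rate differ unit_rate t x = 1" for t x
    unfolding total_rate_def nbr unit_rate_def by (simp add: differ_def)
  then have "bdd_above {total_rate differ unit_rate t x | t x. t \<in> {0..1}}"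
    by (intro bdd_aboveI[of _ 1]) auto
  then show "reference_walk differ (marginal telegraph 0) telegraph unit_rate"
    unfolding reference_walk_def using telegraph_markov telegraph_jump_kernel pos
    by (auto simp: unit_rate_def)
qed

text \<open>The samples with initial state b, exactly one point and this point in (a,c) have
  positive probability: the product of the initial probability, the Poisson weight of 1 and the
  length c - a.\<close>

lemma telegraph_one_jump:
  assumes a: "0 \<le> a" "a < c" "c \<le> 1" and S: "S \<in> telegraph.events"
    and sub: "\<And>u. a < u 0 \<Longrightarrow> u 0 < c \<Longrightarrow> telegraph_path (b, 1, u) \<in> S"
  shows "0 < emeasure telegraph S"
proof -
  let ?M = "start \<Otimes>\<^sub>M (counts \<Otimes>\<^sub>M points)"
  let ?U = "{u \<in> space points. u 0 \<in> {a<..<c}}"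
  have U: "?U \<in> sets points" by measurable
  have "{0<..<1} \<inter> {a<..<c} = {a<..<c}" using a by auto
  then have "emeasure unit_uniform {a<..<c} = ennreal (c - a)"
    unfolding unit_uniform_def using a by (subst emeasure_uniform_measure) (auto simp: divide_ennreal_def)
  then have "emeasure points ?U = ennreal (c - a)"
    by (subst points.emeasure_PiM_Collect_single) auto
  then have "emeasure ?M ({b} \<times> {1} \<times> ?U) = ennreal (pmf (bernoulli_pmf (1 / 2)) b) * (ennreal (pmf (poisson_pmf 1) 1) * ennreal (c - a))"
    using U by (simp add: counts_points.P.emeasure_pair_measure_Times points.P.emeasure_pair_measure_Times emeasure_pmf_single)
  also have "\<dots> > 0"
  proof -
    have "0 < pmf (bernoulli_pmf (1 / 2)) b" by (cases b) simp_all
    moreover have "0 < pmf (poisson_pmf 1) 1" by simp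
    ultimately show ?thesis using a by (simp only: ennreal_zero_less_mult_iff ennreal_less_zero_iff diff_gt_0_iff_gt)
  qed
  also have "emeasure ?M ({b} \<times> {1} \<times> ?U) \<le> emeasure ?M (telegraph_path -` S \<inter> space ?M)"
  proof (rule emeasure_mono)
    show "{b} \<times> {1} \<times> ?U \<subseteq> telegraph_path -` S \<inter> space ?M"
      using sub by (auto simp: space_pair_measure)
    show "telegraph_path -` S \<inter> space ?M \<in> sets ?M"
      using S telegraph_path_measurable by (intro measurable_sets) (auto simp: telegraph.sets_Q)
  qed
  also have "\<dots> = emeasure telegraph S"
    unfolding telegraph_def
    by (rule emeasure_distr[symmetric, OF telegraph_path_measurable]) (use S in \<open>simp add: telegraph.sets_Q\<close>)
  finally show ?thesis .
qed

lemma telegraph_geodesic_not_markov: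
  "\<not> markov_measure differ (geodesic_measure differ unit_distance telegraph unit_rate)"
proof
  let ?G = "geodesic_measure differ unit_distance telegraph unit_rate"
  let ?C = "\<lambda>t z. {\<omega> \<in> paths differ. \<omega> t = z}"
  let ?D = "\<lambda>\<omega>. indicator (geodesics differ unit_distance) \<omega> *
    ennreal (exp (LBINT t:{0..1}. total_rate differ unit_rate t (\<omega> t)))"
  assume markov_G: "markov_measure differ ?G"
  interpret walk differ unit_distance "marginal telegraph 0" telegraph unit_rate
    by unfold_locales (rule telegraph_standing)
  interpret G: path_space differ ?G
    by (rule path_space.intro) (use markov_G in \<open>simp add: markov_measure_def\<close>)
  have geodesics: "geodesics differ unit_distance = {\<omega> \<in> paths differ. geo unit_distance \<omega> 0 1}"
    using geodesics_iff[OF unit_distance_metric, of _ differ] by auto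
  have geo_sets: "geodesics differ unit_distance \<in> telegraph.events"
    unfolding geodesics telegraph.sets_Q by (rule geo_measurable) auto
  have D: "?D \<in> borel_measurable telegraph"
    using geo_sets rate_integral_measurable[of 0 1] unfolding telegraph.measurable_Q telegraph.sets_Q by measurable
  have cyl: "?C t z \<in> telegraph.events" if "0 \<le> t" "t \<le> 1" for t z using that by (rule telegraph.cyl_sets_Q)
  have pos: "emeasure ?G S \<noteq> 0"
    if S: "S \<in> telegraph.events" and a: "0 \<le> a" "a < c" "c \<le> 1"
      and sub: "\<And>u. a < u 0 \<Longrightarrow> u 0 < c \<Longrightarrow> telegraph_path (b, 1, u) \<in> S" for S a b c
  proof
    assume "emeasure ?G S = 0"
    then have "S \<in> null_sets (density telegraph ?D)" using S by (auto simp: null_sets_def geodesic_measure_def)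
    then have "AE \<omega> in telegraph. \<omega> \<in> S \<longrightarrow> ?D \<omega> = 0" by (simp only: null_sets_density_iff[OF D])
    then have "AE \<omega> in telegraph. \<omega> \<notin> S \<inter> geodesics differ unit_distance"
      by eventually_elim (auto simp: ennreal_eq_0_iff not_le)
    then have "emeasure telegraph (S \<inter> geodesics differ unit_distance) = 0"
      using S geo_sets sets.sets_into_space[OF S] by (intro AE_iff_measurable[THEN iffD1]) auto
    moreover have "0 < emeasure telegraph (S \<inter> geodesics differ unit_distance)"
      using S geo_sets sub telegraph_path_geodesic[of 1] by (intro telegraph_one_jump[OF a]) auto
    ultimately show False by simp
  qed
  have "?C 0 False \<in> sets (path_sigma differ {0..1 / 2})" "?C 1 False \<in> sets (path_sigma differ {1 / 2..1})"
    by (intro cyl_sets; simp)+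
  moreover have "(1 / 2 :: real) \<in> {0..1}" by simp
  \<comment> \<open>Start in False, state True at time 1/2, end in False: past and future each have
    positive mass together with the present, but jointly they require two jumps, so that one side is
    0 and the other is not.\<close>
  ultimately have "emeasure ?G (?C 0 False \<inter> ?C 1 False \<inter> ?C (1 / 2) True) * emeasure ?G (?C (1 / 2) True) =
    emeasure ?G (?C 0 False \<inter> ?C (1 / 2) True) * emeasure ?G (?C 1 False \<inter> ?C (1 / 2) True)"
    using G.markov_imp_cond_indep[OF markov_G] unfolding cond_indep_def by blast
  moreover have "emeasure ?G (?C 0 False \<inter> ?C (1 / 2) True) \<noteq> 0"
  proof (rule pos[where a = 0 and c = "1 / 2" and b = False])
    show "?C 0 False \<inter> ?C (1 / 2) True \<in> telegraph.events" by (intro sets.Int cyl) auto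
  qed (auto simp: telegraph_path_in_paths telegraph_path_def differ_def)
  moreover have "emeasure ?G (?C 1 False \<inter> ?C (1 / 2) True) \<noteq> 0"
  proof (rule pos[where a = "1 / 2" and c = 1 and b = True])
    show "?C 1 False \<inter> ?C (1 / 2) True \<in> telegraph.events" by (intro sets.Int cyl) auto
  qed (auto simp: telegraph_path_in_paths telegraph_path_def differ_def)
  moreover have "emeasure ?G (?C 0 False \<inter> ?C 1 False \<inter> ?C (1 / 2) True) = 0"
  proof -
    have "\<not> geo unit_distance \<omega> 0 1" if "\<omega> \<in> ?C 0 False \<inter> ?C 1 False \<inter> ?C (1 / 2) True" for \<omega>
    proof
      assume "geo unit_distance \<omega> 0 1"
      then have "unit_distance (\<omega> 0) (\<omega> (1 / 2)) + unit_distance (\<omega> (1 / 2)) (\<omega> (1 / 2)) + unit_distance (\<omega> (1 / 2)) (\<omega> 1) =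
        unit_distance (\<omega> 0) (\<omega> 1)"
        unfolding geo_def by (elim allE[where x = "1 / 2"]) simp
      with that show False by (simp add: unit_distance_def differ_def)
    qed
    then have "?C 0 False \<inter> ?C 1 False \<inter> ?C (1 / 2) True \<in> null_sets (density telegraph ?D)"
      unfolding null_sets_density_iff[OF D] unfolding geodesics
      by (intro conjI sets.Int cyl AE_I2) auto
    then show ?thesis by (auto simp: geodesic_measure_def null_sets_def)
  qed
  ultimately show False by simp
qed

text \<open>That G is not Markov in general is rendered by an instance satisfying the standing
  assumptions, on the two-point state space \<open>bool\<close>.\<close>

theorem theorem2p10:
  fixes E :: "'a::countable \<Rightarrow> 'a \<Rightarrow> bool"
    and d :: "'a \<Rightarrow> 'a \<Rightarrow> real"
    and m :: "'a measure"
    and R :: "(real \<Rightarrow> 'a) measure"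
    and J :: "real \<Rightarrow> 'a \<Rightarrow> 'a \<Rightarrow> real"
  assumes "standing_assumptions E d m R J"
  shows "(\<exists>(E' :: bool \<Rightarrow> bool \<Rightarrow> bool) d' m' R' J'.
            standing_assumptions E' d' m' R' J' \<and>
            \<not> markov_measure E' (geodesic_measure E' d' R' J')) \<and>
         (\<forall>x y. markov_measure E (bridge (geodesic_measure E d R J) x y)) \<and>
         (\<forall>x y. has_jump_kernel E (geodesic_states E d x y)
                  (bridge (geodesic_measure E d R J) x y)
                  (geodesic_kernel E d R J y))"
proof -
  interpret walk E d m R J by unfold_locales (rule assms)
  show ?thesis
    using telegraph_standing telegraph_geodesic_not_markov markov_bridge bridge_jump_kernel by blast
qed

end
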